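(* Let $d\ge 1$ be an integer and $\lambda\ge 0$ a constant. Let $(\rho_0,u_0)$ satisfy $\rho_0>0$ in $\mathbb R^d$ and $(\rho_0,u_0)\in H^{s}(\mathbb R^d)\times H^{s+1}(\mathbb R^d;\mathbb R^d)$ for some $s>\frac d2+1$. For each $\varepsilon\in(0,1]$ let $f_0^\varepsilon:\mathbb R^d\times\mathbb R^d\to\mathbb R$ satisfy $f_0^\varepsilon\ge 0$, $f_0^\varepsilon\in L^1\cap L^\infty(\mathbb R^{2d})$, $|v|^2f_0^\varepsilon\in L^1(\mathbb R^{2d})$, and set $\rho_0^\varepsilon=\int_{\mathbb R^d}f_0^\varepsilon\,dv$, $u_0^\varepsilon=\frac1{\rho_0^\varepsilon}\int_{\mathbb R^d}vf_0^\varepsilon\,dv$. Assume that (A1) $\int_{\mathbb R^d}\Big(\int_{\mathbb R^d}\frac{|v|^2}{2}f_0^\varepsilon\,dv-\rho_0\frac{|u_0|^2}{2}\Big)dx=\mathcal O(\sqrt\varepsilon)$; (A2) $\rho_0^\varepsilon-\rho_0=\mathcal O(\sqrt\varepsilon)$ in $L^\infty(\mathbb R^d)$; (A3) $u_0^\varepsilon-u_0=\mathcal O(\sqrt\varepsilon)$ in $L^\infty(\mathbb R^d)$. For each $\varepsilon$, let $f^\varepsilon\ge0$ be a weak solution (in the sense defined in the context) of $$\partial_tf^\varepsilon+v\cdot\nabla_xf^\varepsilon-\lambda\nabla_v\cdot(vf^\varepsilon)+\frac1\varepsilon\nabla_v\cdot\big((u^\varepsilon-v)f^\varepsilon\big)=0,\qquad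 f^\varepsilon|_{t=0}=f_0^\varepsilon,$$ which conserves mass, $\|f^\varepsilon(t)\|_{L^1(\mathbb R^{2d})}=\|f^\varepsilon_0\|_{L^1(\mathbb R^{2d})}$ for all $t>0$, and satisfies the entropy inequality, for $t>0$, $$\int_{\mathbb R^{2d}}\frac{|v|^2}2f^\varepsilon(t)\,dv\,dx+\frac1\varepsilon\int_0^t\int_{\mathbb R^{2d}}f^\varepsilon|u^\varepsilon-v|^2\,dx\,dv\,ds+\lambda\int_0^t\int_{\mathbb R^{2d}}|v|^2f^\varepsilon\,dv\,dx\,ds\le\int_{\mathbb R^{2d}}\frac{|v|^2}2f^\varepsilon_0\,dv\,dx,$$ where $\rho^\varepsilon=\int_{\mathbb R^d}f^\varepsilon\,dv$ and $\rho^\varepsilon u^\varepsilon=\int_{\mathbb R^d}vf^\varepsilon\,dv$. Let $(\rho,u)$ be the classical solution on $[0,T_*]$, $T_*>0$ (in the class $\mathcal X$ defined in the context), of $$\partial_t\rho+\nabla\cdot(\rho u)=0,\qquad \partial_t(\rho u)+\nabla\cdot(\rho u\otimes u)=-\lambda\rho u,\qquad \rho|_{t=0}=\rho_0,\quad u|_{t=0}=u_0.$$ Then there is a constant $C(T_* )$, depending on $T_*$ but not on $\varepsilon$, such that $$\int_{\mathbb R^d}\rho^\varepsilon(t)\,|(u^\varepsilon-u)(t)|^2\,dx\le C(T_* )\sqrt\varepsilon,\qquad t\le T_*.$$ Moreover, as $\varepsilon\to0$, the following convergences hold weakly in $\mathcal M([0,T_*]\times\mathbb R^d)$: $$\rho^\varepsilon\rightharpoonup\rho,\qquad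 \rho^\varepsilon u^\varepsilon\rightharpoonup\rho u,\qquad \rho^\varepsilon u^\varepsilon\otimes u^\varepsilon\rightharpoonup\rho u\otimes u,\qquad \int_{\mathbb R^d}f^\varepsilon|v|^2\,dv\rightharpoonup\rho|u|^2,$$ and, for any $\psi\in C^1(\mathbb R^d)$ with $\nabla\psi\in L^\infty(\mathbb R^d)$, $$\int_{\mathbb R^d}f^\varepsilon\psi(v)\,dv\rightharpoonup\rho\,\psi(u)\quad\text{weakly in }\mathcal M([0,T_*]\times\mathbb R^d).$$
   Context: Notation: $f^\varepsilon=f^\varepsilon(t,x,v)$ with $t\ge0$, $x,v\in\mathbb R^d$. The average velocity is $u^\varepsilon=\frac{\int_{\mathbb R^d} vf^\varepsilon dv}{\int_{\mathbb R^d} f^\varepsilon dv}$ (set to $0$ where $\rho^\varepsilon=0$, so that $\rho^\varepsilon u^\varepsilon=\int vf^\varepsilon dv$ always). $\mathcal O(\sqrt\varepsilon)$ denotes a quantity bounded (in the indicated norm) by $C\sqrt\varepsilon$ with $C$ independent of $\varepsilon$. Constants may depend on $d,\lambda$, the data, and the fixed solution $(\rho,u)$, but never on $\varepsilon$. Weak solution: $f^\varepsilon$ is a weak solution of the kinetic equation if for any $T>0$, $f^\varepsilon\in C(0,T;L^1(\mathbb R^{2d}))\cap L^\infty((0,T)\times\mathbb R^{2d})$, $|v|^2f^\varepsilon\in L^\infty(0,T;L^1(\mathbb R^{2d}))$ (with continuity in time up to $t=0$), and for every $\psi\in C_c^\infty([0,T)\times\mathbb R^{2d})$, $$\int_0^T\int_{\mathbb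 R^{2d}}f^\varepsilon\Big[\partial_t\psi+v\cdot\nabla_x\psi-\lambda v\cdot\nabla_v\psi+\frac1\varepsilon(u^\varepsilon-v)\cdot\nabla_v\psi\Big]dv\,dx\,ds+\int_{\mathbb R^{2d}}f_0^\varepsilon\,\psi(0,\cdot)\,dv\,dx=0.$$ Classical solution: for data $\rho_0>0$, $(\rho_0,u_0)\in H^s\times H^{s+1}$, $s>\frac d2+1$, it is known that there are $T_*>0$ and a unique classical solution on $[0,T_*]$ in $$\mathcal X=\{(\rho,u):\rho\in C^0([0,T_*];H^s)\cap C^1([0,T_*];H^{s-1}),\ u\in C^0([0,T_*];H^{s+1})\cap C^1([0,T_*];H^s)\};$$ in particular $(\rho,u)\in C^1(\mathbb R^d\times[0,T_*])$. This solution and $T_*$ are those in the claim. $\mathcal M([0,T_*]\times\mathbb R^d)$ is the space of (nonnegative) Radon measures on $[0,T_*]\times\mathbb R^d$, and weak convergence in it is weak-$*$ convergence, i.e. convergence of integrals against every compactly supported continuous test function on $[0,T_*]\times\mathbb R^d$; for signed, vector- or matrix-valued quantities it is understood componentwise in the same sense. Functions are identified with the measures having them as densities with respect to $dx\,dt$. *)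

theory Defs
  imports "HOL-Analysis.Analysis"
begin

fun Ck :: "nat \<Rightarrow> ('a::euclidean_space \<Rightarrow> 'b::real_normed_vector) \<Rightarrow> bool" where
  "Ck 0 f \<longleftrightarrow> continuous_on UNIV f"
| "Ck (Suc k) f \<longleftrightarrow> (\<forall>x. f differentiable (at x)) \<and>
     (\<forall>b\<in>Basis. Ck k (\<lambda>x. frechet_derivative f (at x) b))"

definition smooth :: "('a::euclidean_space \<Rightarrow> 'b::real_normed_vector) \<Rightarrow> bool" where
  "smooth f \<longleftrightarrow> (\<forall>k. Ck k f)"

text \<open>Continuously differentiable on \<open>S\<close>, with derivatives taken within \<open>S\<close>
  (so one-sided at boundary points).\<close>

definition C1_on :: "'a::real_normed_vector set \<Rightarrow> ('a \<Rightarrow> 'b::real_normed_vector) \<Rightarrow> bool" where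
  "C1_on S f \<longleftrightarrow> (\<exists>f' :: 'a \<Rightarrow> ('a \<Rightarrow>\<^sub>L 'b). continuous_on S f' \<and>
     (\<forall>p\<in>S. (f has_derivative blinfun_apply (f' p)) (at p within S)))"

definition divergence :: "(real^'d \<Rightarrow> real^'d) \<Rightarrow> real^'d \<Rightarrow> real" where
  "divergence F x = (\<Sum>i\<in>UNIV. frechet_derivative F (at x) (axis i 1) $ i)"

definition test_fun :: "'a::euclidean_space set \<Rightarrow> ('a \<Rightarrow> real) \<Rightarrow> bool" where
  "test_fun U \<phi> \<longleftrightarrow> smooth \<phi> \<and> (\<exists>K. compact K \<and> K \<subseteq> U \<and> (\<forall>x. x \<notin> K \<longrightarrow> \<phi> x = 0))"

text \<open>Fourier convention: \<open>\<hat>f(\<xi>) = \<integral> exp(-i x\<cdot>\<xi>) f(x) dx\<close>; below is the inverse transform.\<close>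

definition inv_fourier :: "(real^'d \<Rightarrow> real) \<Rightarrow> real^'d \<Rightarrow> complex" where
  "inv_fourier \<phi> \<xi> =
     (LINT x|lborel. cis (x \<bullet> \<xi>) * complex_of_real (\<phi> x)) / (2 * complex_of_real pi) ^ CARD('d)"

text \<open>\<open>g\<close> is the Fourier transform of \<open>f \<in> L\<^sup>2\<close>: as distributions, \<open>f\<close> is the inverse transform
  of \<open>g\<close>, i.e. pairing \<open>f\<close> with \<open>\<phi>\<close> is pairing \<open>g\<close> with the inverse transform of \<open>\<phi>\<close>. By Plancherel
  such a \<open>g\<close> exists for every \<open>f \<in> L\<^sup>2\<close> and is unique almost everywhere.\<close>

definition is_fourier_transform :: "(real^'d \<Rightarrow> real) \<Rightarrow> (real^'d \<Rightarrow> complex) \<Rightarrow> bool" where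
  "is_fourier_transform f g \<longleftrightarrow>
     f \<in> borel_measurable borel \<and> integrable lborel (\<lambda>x. (f x)\<^sup>2) \<and>
     g \<in> borel_measurable borel \<and> integrable lborel (\<lambda>\<xi>. (cmod (g \<xi>))\<^sup>2) \<and>
     (\<forall>\<phi>. test_fun UNIV \<phi> \<longrightarrow>
        complex_of_real (LINT x|lborel. f x * \<phi> x) = (LINT \<xi>|lborel. g \<xi> * inv_fourier \<phi> \<xi>))"

definition fourier :: "(real^'d \<Rightarrow> real) \<Rightarrow> real^'d \<Rightarrow> complex" where
  "fourier f = (SOME g. is_fourier_transform f g)"

text \<open>\<open>H\<^sup>s\<close> for \<open>s \<ge> 0\<close> (only nonnegative orders are used).\<close>

definition sobolev :: "real \<Rightarrow> (real^'d \<Rightarrow> real) set" where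
  "sobolev s = {f. is_fourier_transform f (fourier f) \<and>
     integrable lborel (\<lambda>\<xi>. (1 + (norm \<xi>)\<^sup>2) powr s * (cmod (fourier f \<xi>))\<^sup>2)}"

definition sobolev_norm :: "real \<Rightarrow> (real^'d \<Rightarrow> real) \<Rightarrow> real" where
  "sobolev_norm s f = sqrt (LINT \<xi>|lborel. (1 + (norm \<xi>)\<^sup>2) powr s * (cmod (fourier f \<xi>))\<^sup>2)"

definition sobolev_tendsto ::
  "real \<Rightarrow> ('a \<Rightarrow> real^'d \<Rightarrow> real) \<Rightarrow> (real^'d \<Rightarrow> real) \<Rightarrow> 'a filter \<Rightarrow> bool" where
  "sobolev_tendsto s F g A \<longleftrightarrow>
     (\<forall>\<^sub>F a in A. (\<lambda>x. F a x - g x) \<in> sobolev s) \<and>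
     ((\<lambda>a. sobolev_norm s (\<lambda>x. F a x - g x)) \<longlongrightarrow> 0) A"

definition C0_sobolev :: "real \<Rightarrow> real \<Rightarrow> (real \<Rightarrow> real^'d \<Rightarrow> real) \<Rightarrow> bool" where
  "C0_sobolev T s F \<longleftrightarrow>
     (\<forall>t\<in>{0..T}. F t \<in> sobolev s \<and> sobolev_tendsto s F (F t) (at t within {0..T}))"

definition C1_sobolev :: "real \<Rightarrow> real \<Rightarrow> (real \<Rightarrow> real^'d \<Rightarrow> real) \<Rightarrow> bool" where
  "C1_sobolev T s F \<longleftrightarrow> C0_sobolev T s F \<and>
     (\<exists>F'. C0_sobolev T s F' \<and>
       (\<forall>t\<in>{0..T}. sobolev_tendsto s (\<lambda>\<tau> x. (F \<tau> x - F t x) / (\<tau> - t)) (F' t)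
          (at t within {0..T})))"

text \<open>Pressureless Euler system with damping. The \<open>C1_on\<close> conditions follow from the Sobolev
  regularity for \<open>s > d/2 + 1\<close> up to modification on null sets; they select the continuously
  differentiable representatives.
  The \<open>i\<close>-th component of the divergence of \<open>\<rho> u \<otimes> u\<close> is the divergence of \<open>\<rho> u\<^sub>i u\<close>.\<close>

definition classical_solution ::
  "real \<Rightarrow> real \<Rightarrow> real \<Rightarrow> (real^'d \<Rightarrow> real) \<Rightarrow> (real^'d \<Rightarrow> real^'d) \<Rightarrow>
   (real \<Rightarrow> real^'d \<Rightarrow> real) \<Rightarrow> (real \<Rightarrow> real^'d \<Rightarrow> real^'d) \<Rightarrow> bool" where
  "classical_solution lam s T \<rho>0 u0 \<rho> u \<longleftrightarrow>
     C0_sobolev T s \<rho> \<and> C1_sobolev T (s - 1) \<rho> \<and>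
     (\<forall>i. C0_sobolev T (s + 1) (\<lambda>t x. u t x $ i) \<and> C1_sobolev T s (\<lambda>t x. u t x $ i)) \<and>
     C1_on ({0..T} \<times> UNIV) (\<lambda>(t, x). \<rho> t x) \<and> C1_on ({0..T} \<times> UNIV) (\<lambda>(t, x). u t x) \<and>
     (\<forall>t\<in>{0..T}. \<forall>x.
        ((\<lambda>\<tau>. \<rho> \<tau> x) has_real_derivative - divergence (\<lambda>y. \<rho> t y *\<^sub>R u t y) x)
          (at t within {0..T})) \<and>
     (\<forall>t\<in>{0..T}. \<forall>x i.
        ((\<lambda>\<tau>. \<rho> \<tau> x * u \<tau> x $ i) has_real_derivative
           - divergence (\<lambda>y. (\<rho> t y * u t y $ i) *\<^sub>R u t y) x - lam * (\<rho> t x * u t x $ i))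
          (at t within {0..T})) \<and>
     (\<forall>x. \<rho> 0 x = \<rho>0 x \<and> u 0 x = u0 x)"

definition mass_density :: "((real^'d) \<times> (real^'d) \<Rightarrow> real) \<Rightarrow> real^'d \<Rightarrow> real" where
  "mass_density g x = (LINT v|lborel. g (x, v))"

text \<open>Since \<open>1 / 0 = 0\<close>, this is \<open>0\<close> where the density vanishes.\<close>

definition mean_velocity :: "((real^'d) \<times> (real^'d) \<Rightarrow> real) \<Rightarrow> real^'d \<Rightarrow> real^'d" where
  "mean_velocity g x = (1 / mass_density g x) *\<^sub>R (LINT v|lborel. g (x, v) *\<^sub>R v)"

text \<open>Test functions on \<open>[0,T) \<times> \<real>\<^sup>2\<^sup>d\<close>, smooth up to \<open>t = 0\<close>, are the restrictions of test
  functions on \<open>(-\<infinity>,T) \<times> \<real>\<^sup>2\<^sup>d\<close>. Directional derivatives are written as values of the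
  total derivative: \<open>D (0, w, 0) = w \<cdot> \<nabla>\<^sub>x \<psi>\<close> and \<open>D (0, 0, w) = w \<cdot> \<nabla>\<^sub>v \<psi>\<close>.\<close>

definition weak_solution ::
  "real \<Rightarrow> real \<Rightarrow> ((real^'d) \<times> (real^'d) \<Rightarrow> real) \<Rightarrow>
   (real \<Rightarrow> (real^'d) \<times> (real^'d) \<Rightarrow> real) \<Rightarrow> bool" where
  "weak_solution lam \<epsilon> f0 f \<longleftrightarrow> (\<forall>T>0.
     (\<forall>t\<in>{0..<T}. integrable lborel (f t) \<and>
        ((\<lambda>\<tau>. LINT z|lborel. \<bar>f \<tau> z - f t z\<bar>) \<longlongrightarrow> 0) (at t within {0..<T})) \<and>
     set_borel_measurable borel ({0..<T} \<times> UNIV) (\<lambda>(t, z). f t z) \<and>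
     (\<exists>K. AE (t, z) in lborel. t \<in> {0<..<T} \<longrightarrow> \<bar>f t z\<bar> \<le> K) \<and>
     (\<exists>K. AE t in lborel. t \<in> {0<..<T} \<longrightarrow>
        integrable lborel (\<lambda>(x, v). (norm v)\<^sup>2 * f t (x, v)) \<and>
        (LINT (x, v)|lborel. \<bar>(norm v)\<^sup>2 * f t (x, v)\<bar>) \<le> K) \<and>
     (\<forall>\<psi>. test_fun ({..<T} \<times> UNIV) \<psi> \<longrightarrow>
        (LINT (t, x, v) : {0..<T} \<times> UNIV | lborel.
           let D = frechet_derivative \<psi> (at (t, x, v)) in
           f t (x, v) *
             (D (1, 0, 0) + D (0, v, 0) - lam * D (0, 0, v)
              + (1 / \<epsilon>) * D (0, 0, mean_velocity (f t) x - v)))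
        + (LINT z|lborel. f0 z * \<psi> (0, z)) = 0))"

definition conserves_mass ::
  "((real^'d) \<times> (real^'d) \<Rightarrow> real) \<Rightarrow> (real \<Rightarrow> (real^'d) \<times> (real^'d) \<Rightarrow> real) \<Rightarrow> bool" where
  "conserves_mass f0 f \<longleftrightarrow>
     (\<forall>t>0. (LINT z|lborel. \<bar>f t z\<bar>) = (LINT z|lborel. \<bar>f0 z\<bar>))"

text \<open>All integrands are nonnegative, so the integrals are taken in \<open>[0,\<infinity>]\<close>.\<close>

definition entropy_inequality ::
  "real \<Rightarrow> real \<Rightarrow> ((real^'d) \<times> (real^'d) \<Rightarrow> real) \<Rightarrow>
   (real \<Rightarrow> (real^'d) \<times> (real^'d) \<Rightarrow> real) \<Rightarrow> bool" where
  "entropy_inequality lam \<epsilon> f0 f \<longleftrightarrow> (\<forall>t>0.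
     (\<integral>\<^sup>+(x, v). ennreal ((norm v)\<^sup>2 / 2 * f t (x, v)) \<partial>lborel)
     + ennreal (1 / \<epsilon>) *
         (\<integral>\<^sup>+\<tau>\<in>{0..t}. (\<integral>\<^sup>+(x, v). ennreal (f \<tau> (x, v) * (norm (mean_velocity (f \<tau>) x - v))\<^sup>2)
            \<partial>lborel) \<partial>lborel)
     + ennreal lam *
         (\<integral>\<^sup>+\<tau>\<in>{0..t}. (\<integral>\<^sup>+(x, v). ennreal ((norm v)\<^sup>2 * f \<tau> (x, v)) \<partial>lborel) \<partial>lborel)
     \<le> (\<integral>\<^sup>+(x, v). ennreal ((norm v)\<^sup>2 / 2 * f0 (x, v)) \<partial>lborel))"

definition loc_integrable :: "real \<Rightarrow> (real \<Rightarrow> real^'d \<Rightarrow> real) \<Rightarrow> bool" where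
  "loc_integrable T g \<longleftrightarrow>
     (\<forall>K. compact K \<and> K \<subseteq> {0..T} \<times> UNIV \<longrightarrow> set_integrable lborel K (\<lambda>(t, x). g t x))"

text \<open>Local integrability is what makes \<open>g \<epsilon>\<close> and \<open>h\<close> densities of (signed) Radon measures on
  \<open>[0,T] \<times> \<real>\<^sup>d\<close>; the limit is \<open>\<epsilon> \<rightarrow> 0\<close> from the right.\<close>

definition weakly_converges ::
  "real \<Rightarrow> (real \<Rightarrow> real \<Rightarrow> real^'d \<Rightarrow> real) \<Rightarrow> (real \<Rightarrow> real^'d \<Rightarrow> real) \<Rightarrow> bool" where
  "weakly_converges T g h \<longleftrightarrow>
     (\<forall>\<epsilon>\<in>{0<..1}. loc_integrable T (g \<epsilon>)) \<and> loc_integrable T h \<and>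
     (\<forall>\<phi> :: real \<times> (real^'d) \<Rightarrow> real.
        continuous_on ({0..T} \<times> UNIV) \<phi> \<and>
        (\<exists>K. compact K \<and> (\<forall>p \<in> {0..T} \<times> UNIV - K. \<phi> p = 0)) \<longrightarrow>
        ((\<lambda>\<epsilon>. LINT (t, x) : {0..T} \<times> UNIV | lborel. \<phi> (t, x) * g \<epsilon> t x) \<longlongrightarrow>
           (LINT (t, x) : {0..T} \<times> UNIV | lborel. \<phi> (t, x) * h t x)) (at_right 0))"

end

theory Submission
  imports Defs "HOL-Computational_Algebra.Polynomial"
begin

text \<open>Relative entropy method: \<open>H t = \<integral> f |v - u|\<^sup>2\<close> satisfies a Gronwall inequality. It is obtained by
  testing the weak formulation with \<open>|u|\<^sup>2 / 2 - v \<bullet> u\<close>, adding the entropy inequality, and using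
  \<open>\<partial>\<^sub>t u + u \<bullet> \<nabla> u = - \<lambda> u\<close>; the stiff term drops out since \<open>\<rho>\<^sup>\<epsilon> u\<^sup>\<epsilon>\<close> is the exact momentum. The total mass
  need not be bounded uniformly in \<open>\<epsilon>\<close>, but a mass with polynomially decaying weight is. The densities
  converge because a test function transported along the explicit characteristics of the damped flow turns the
  difference of the two continuity equations into an error controlled by \<open>\<integral> f |v - u|\<close>. The
  remaining limits compare every moment with the density times its value at \<open>u\<close>.\<close>

section \<open>Differentiability classes and bump functions\<close>

text \<open>The test function \<open>|u|^2 / 2 - v \<bullet> u\<close> is only C^1, lives on a
  closed time interval and grows linearly in \<open>v\<close>, while the weak formulation admits
  smooth compactly supported functions. The admissible class is therefore enlarged in stages, ending
  with \<open>weak_general\<close>. The weight \<open>1 + |v|^2 + |U|^2\<close>, whose moment is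
  finite by the entropy inequality, dominates every integrand there. The constants of that step
  contain \<open>1 / \<epsilon>\<close> and the total mass; this is harmless, since they only
  justify an identity. Uniformity in \<open>\<epsilon>\<close> enters through the initial relative
  energy, of order \<open>sqrt \<epsilon>\<close>, and through the weighted mass, bounded because
  the initial densities are uniformly bounded. Young's inequality between the two makes the weighted
  first moment of \<open>|v - u|\<close> of order \<open>\<epsilon>\<close> to the power 1/4, the
  origin of \<open>sqrt (sqrt \<epsilon>)\<close>. On the Euler side, Sobolev regularity acts
  through uniform bounds on the solution and on the gradient of \<open>u\<close>, and positivity of
  the density has to be propagated in time before the momentum equation can be divided by
  it.\<close>

lemma Ck_imp_continuous_on: "Ck k f \<Longrightarrow> continuous_on UNIV f"
  by (cases k) (auto simp: continuous_on_eq_continuous_at differentiable_imp_continuous_within)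

lemma Ck_Suc_imp_Ck: "Ck (Suc k) f \<Longrightarrow> Ck k f"
proof (induction k arbitrary: f)
  case 0
  from Ck_imp_continuous_on[OF this] show ?case by simp
next
  case (Suc k)
  from Suc.prems have "\<And>b. b \<in> Basis \<Longrightarrow> Ck (Suc k) (\<lambda>x. frechet_derivative f (at x) b)"
    by (subst (asm) Ck.simps) blast
  with Suc.IH Suc.prems show ?case
    by (metis Ck.simps(2))
qed

lemma Ck_SucI:
  assumes "\<And>x. (f has_derivative f' x) (at x)" "\<And>b. b \<in> Basis \<Longrightarrow> Ck k (\<lambda>x. f' x b)"
  shows "Ck (Suc k) f"
proof -
  have "frechet_derivative f (at x) = f' x" for x
    using assms(1) by (metis frechet_derivative_at)
  moreover have "f differentiable (at x)" for x
    using assms(1) differentiableI by blast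
  ultimately show ?thesis
    using assms(2) by simp
qed

lemma Ck_Suc_has_derivative:
  "Ck (Suc k) f \<Longrightarrow> (f has_derivative frechet_derivative f (at x)) (at x)"
  using frechet_derivative_works by fastforce

lemma Ck_const [simp]: "Ck k (\<lambda>x. c)"
proof (induction k arbitrary: c)
  case (Suc k)
  show ?case
    by (rule Ck_SucI[where f' = "\<lambda>x h. 0"]) (auto intro: Suc)
qed auto

lemma Ck_add:
  "Ck k f \<Longrightarrow> Ck k g \<Longrightarrow> Ck k (\<lambda>x. f x + g x)"
proof (induction k arbitrary: f g)
  case (Suc k)
  then show ?case
    by (intro Ck_SucI[where f' = "\<lambda>x h. frechet_derivative f (at x) h + frechet_derivative g (at x) h"])
      (auto intro!: has_derivative_add Ck_Suc_has_derivative[of k])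
qed (auto intro!: continuous_intros)

lemma Ck_sum:
  "(\<And>i. i \<in> I \<Longrightarrow> Ck k (f i)) \<Longrightarrow> Ck k (\<lambda>x. \<Sum>i\<in>I. f i x)"
  by (induction I rule: infinite_finite_induct) (auto intro: Ck_add)

lemma Ck_mult:
  fixes f g :: "'a::euclidean_space \<Rightarrow> real"
  shows "Ck k f \<Longrightarrow> Ck k g \<Longrightarrow> Ck k (\<lambda>x. f x * g x)"
proof (induction k arbitrary: f g)
  case 0
  then show ?case by (simp add: continuous_on_mult)
next
  case (Suc k)
  have fg: "Ck k f" "Ck k g"
    using Suc.prems Ck_Suc_imp_Ck by blast+
  have Df: "\<And>b. b \<in> Basis \<Longrightarrow> Ck k (\<lambda>x. frechet_derivative f (at x) b)"
    and Dg: "\<And>b. b \<in> Basis \<Longrightarrow> Ck k (\<lambda>x. frechet_derivative g (at x) b)"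
    using Suc.prems by auto
  show ?case
  proof (rule Ck_SucI)
    show "((\<lambda>x. f x * g x) has_derivative
        (\<lambda>h. f x * frechet_derivative g (at x) h + frechet_derivative f (at x) h * g x)) (at x)" for x
      by (intro has_derivative_mult Ck_Suc_has_derivative[OF Suc.prems(1)] Ck_Suc_has_derivative[OF Suc.prems(2)])
    show "Ck k (\<lambda>x. f x * frechet_derivative g (at x) b + frechet_derivative f (at x) b * g x)"
      if "b \<in> Basis" for b
      by (intro Ck_add Suc.IH fg Df Dg that)
  qed
qed

lemma Ck_inner: "Ck k (\<lambda>x. x \<bullet> b)"
proof (cases k)
  case (Suc k)
  show ?thesis unfolding Suc
    by (rule Ck_SucI[where f' = "\<lambda>x h. h \<bullet> b"]) (auto intro!: derivative_eq_intros)
qed (auto intro!: continuous_intros)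

text \<open>A derivative thus becomes a finite sum of scalar coefficient functions, so continuity,
  measurability and bounds in the base point need checking only on basis directions.\<close>

lemma linear_componentwise_sum:
  fixes D :: "'a::euclidean_space \<Rightarrow> 'b::real_vector"
  assumes "linear D"
  shows "D h = (\<Sum>i\<in>Basis. (h \<bullet> i) *\<^sub>R D i)"
proof -
  have "D h = D (\<Sum>i\<in>Basis. (h \<bullet> i) *\<^sub>R i)"
    by (simp add: euclidean_representation)
  then show ?thesis
    by (simp add: linear_sum[OF assms] linear_scale[OF assms])
qed

lemma Ck_compose_affine:
  fixes f :: "'a::euclidean_space \<Rightarrow> real" and L :: "'c::euclidean_space \<Rightarrow> 'a"
  assumes L: "bounded_linear L"
  shows "Ck k f \<Longrightarrow> Ck k (\<lambda>x. f (L x + c))"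
proof (induction k arbitrary: f)
  case 0
  have "continuous_on UNIV (\<lambda>x. L x + c)"
    using L by (intro continuous_intros linear_continuous_on)
  with 0 show ?case
    by (auto intro: continuous_on_compose2)
next
  case (Suc k)
  let ?D = "\<lambda>y. frechet_derivative f (at y)"
  have D: "(f has_derivative ?D y) (at y)" for y
    using Suc.prems by (rule Ck_Suc_has_derivative)
  have eq: "?D y h = (\<Sum>i\<in>Basis. (h \<bullet> i) * ?D y i)" for y h
    using linear_componentwise_sum[OF has_derivative_linear[OF D], of y h] by simp
  show ?case
  proof (rule Ck_SucI[where f' = "\<lambda>x h. ?D (L x + c) (L h)"])
    fix x
    have "((\<lambda>x. L x + c) has_derivative L) (at x)"
      using bounded_linear_imp_has_derivative[OF L] by (auto intro!: derivative_eq_intros)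
    from has_derivative_compose[OF this D]
    show "((\<lambda>x. f (L x + c)) has_derivative (\<lambda>h. ?D (L x + c) (L h))) (at x)" .
  next
    fix b :: 'c
    have "Ck k (\<lambda>x. \<Sum>i\<in>Basis. (L b \<bullet> i) * ?D (L x + c) i)"
      using Suc by (intro Ck_sum Ck_mult) auto
    then show "Ck k (\<lambda>x. ?D (L x + c) (L b))"
      by (subst eq)
  qed
qed

text \<open>The induction generalises over \<open>g\<close> only: the chain rule produces the
  derivative of \<open>g\<close> composed with the same inner function, again of the form
  treated.\<close>

lemma Ck_compose_real:
  fixes g :: "real \<Rightarrow> real"
  shows "Ck k g \<Longrightarrow> Ck k f \<Longrightarrow> Ck k (\<lambda>x. g (f x))"
proof (induction k arbitrary: g)
  case 0
  then show ?case by (auto intro: continuous_on_compose2)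
next
  case (Suc k)
  let ?D = "\<lambda>y. frechet_derivative g (at y)"
  have D: "(g has_derivative ?D y) (at y)" for y
    using Suc.prems(1) by (rule Ck_Suc_has_derivative)
  have eq: "?D y h = h * ?D y 1" for y h
    using linear_scale[OF has_derivative_linear[OF D], of y h 1] by simp
  have F: "(f has_derivative frechet_derivative f (at x)) (at x)" for x
    using Suc.prems(2) by (rule Ck_Suc_has_derivative)
  show ?case
  proof (rule Ck_SucI[where f' = "\<lambda>x h. frechet_derivative f (at x) h * ?D (f x) 1"])
    show "((\<lambda>x. g (f x)) has_derivative (\<lambda>h. frechet_derivative f (at x) h * ?D (f x) 1)) (at x)" for x
      using has_derivative_compose[OF F D, of x] by (subst (asm) eq)
    show "Ck k (\<lambda>x. frechet_derivative f (at x) b * ?D (f x) 1)" if "b \<in> Basis" for b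
      using Suc that Ck_Suc_imp_Ck[of k f] by (intro Ck_mult) auto
  qed
qed

text \<open>For \<open>p = 1\<close> this is the classical function \<open>exp (- 1 / x)\<close>
  extended by 0. The polynomial in \<open>1 / x\<close> makes the family closed under
  differentiation, so smoothness becomes a plain induction over all \<open>p\<close>.\<close>

definition flat :: "real poly \<Rightarrow> real \<Rightarrow> real" where
  "flat p x = (if x > 0 then poly p (1 / x) * exp (- (1 / x)) else 0)"

lemma poly_exp_decay: "((\<lambda>y. y * (poly p y * exp (- y))) \<longlongrightarrow> 0) (at_top :: real filter)"
proof -
  have "((\<lambda>y::real. \<Sum>i\<le>degree p. coeff p i * (y ^ Suc i / exp y)) \<longlongrightarrow> (\<Sum>i\<le>degree p. coeff p i * 0)) at_top"
    by (intro tendsto_intros tendsto_power_div_exp_0)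
  then show ?thesis
    by (simp add: poly_altdef sum_distrib_left sum_distrib_right exp_minus field_simps)
qed

text \<open>For positive \<open>x\<close> this is the product rule: differentiating
  \<open>1 / x\<close> produces a factor \<open>1 / x^2\<close>, hence the polynomial
  \<open>[:0, 0, 1:]\<close>, and the exponential contributes \<open>p\<close> beside
  \<open>- pderiv p\<close>.\<close>

lemma flat_has_derivative:
  "((flat p) has_real_derivative flat ([:0, 0, 1:] * (p - pderiv p)) x) (at x)"
proof -
  consider "x > 0" | "x < 0" | "x = 0" by linarith
  then show ?thesis
  proof cases
    case 1
    have inv: "((\<lambda>x. 1 / x) has_real_derivative - (1 / x) * (1 / x)) (at x)"
      using 1 by (auto intro!: derivative_eq_intros)
    have "((\<lambda>x. poly p (1 / x)) has_real_derivative poly (pderiv p) (1 / x) * (- (1 / x) * (1 / x))) (at x)"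
      by (rule DERIV_chain2[OF poly_DERIV inv])
    moreover have "((\<lambda>x. exp (- (1 / x))) has_real_derivative exp (- (1 / x)) * (- (- (1 / x) * (1 / x)))) (at x)"
      by (rule DERIV_chain2[OF DERIV_exp DERIV_minus[OF inv]])
    ultimately have "((\<lambda>x. poly p (1 / x) * exp (- (1 / x))) has_real_derivative
        poly (pderiv p) (1 / x) * (- (1 / x) * (1 / x)) * exp (- (1 / x)) +
        exp (- (1 / x)) * (- (- (1 / x) * (1 / x))) * poly p (1 / x)) (at x)"
      by (rule DERIV_mult)
    also have "poly (pderiv p) (1 / x) * (- (1 / x) * (1 / x)) * exp (- (1 / x)) +
        exp (- (1 / x)) * (- (- (1 / x) * (1 / x))) * poly p (1 / x)
        = flat ([:0, 0, 1:] * (p - pderiv p)) x"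
      using 1 by (simp add: flat_def algebra_simps)
    finally have "((\<lambda>x. poly p (1 / x) * exp (- (1 / x))) has_real_derivative
        flat ([:0, 0, 1:] * (p - pderiv p)) x) (at x)" .
    then show ?thesis
      by (rule has_field_derivative_transform_within_open[where S = "{0<..}"]) (use 1 in \<open>auto simp: flat_def\<close>)
  next
    case 2
    have "((\<lambda>x. 0) has_real_derivative flat ([:0, 0, 1:] * (p - pderiv p)) x) (at x)"
      using 2 by (auto simp: flat_def)
    then show ?thesis
      by (rule has_field_derivative_transform_within_open[where S = "{..<0}"]) (use 2 in \<open>auto simp: flat_def\<close>)
  next
    case 3
    \<comment> \<open>Substituting \<open>y = 1 / h\<close> turns the difference quotient into
      \<open>y * (poly p y * exp (- y))\<close> at infinity.\<close>
    have "((\<lambda>h. flat p h / h) \<longlongrightarrow> 0) (at_right 0)"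
      unfolding filterlim_at_right_to_top
      using poly_exp_decay[of p]
      by (rule Lim_transform_eventually)
        (auto intro!: eventually_mono[OF eventually_gt_at_top[of 0]] simp: flat_def field_simps)
    moreover have "((\<lambda>h. flat p h / h) \<longlongrightarrow> 0) (at_left 0)"
      by (rule Lim_transform_eventually[OF tendsto_const])
        (auto simp: flat_def eventually_at_filter)
    ultimately have "((\<lambda>h. flat p h / h) \<longlongrightarrow> 0) (at 0)"
      by (simp add: filterlim_split_at)
    then show ?thesis
      using 3 by (simp add: has_field_derivative_iff flat_def)
  qed
qed

lemma Ck_flat: "Ck k (flat p)"
proof (induction k arbitrary: p)
  case 0
  have "isCont (flat p) x" for x
    using flat_has_derivative by (rule DERIV_isCont)
  then show ?case
    by (simp add: continuous_on_eq_continuous_at)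
next
  case (Suc k)
  show ?case
    by (rule Ck_SucI[where f' = "\<lambda>x h. flat ([:0, 0, 1:] * (p - pderiv p)) x * h"])
      (use flat_has_derivative[of p] Suc in \<open>simp_all add: has_field_derivative_def Ck_mult del: Ck.simps mult_pCons_left\<close>)
qed

definition bump :: "real \<Rightarrow> 'a::euclidean_space \<Rightarrow> real" where
  "bump r x = flat 1 (r\<^sup>2 - x \<bullet> x)"

lemma bump_nonneg: "bump r x \<ge> 0"
  by (simp add: bump_def flat_def)

lemma bump_pos_iff: "r > 0 \<Longrightarrow> bump r x > 0 \<longleftrightarrow> norm x < r"
  by (auto simp: bump_def flat_def norm_lt_square power2_norm_eq_inner power2_eq_square)

lemma bump_eq_0: "r > 0 \<Longrightarrow> norm x \<ge> r \<Longrightarrow> bump r x = 0"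
  using bump_pos_iff[of r x] bump_nonneg[of r x] by linarith

lemma Ck_bump: "Ck k (bump r)"
proof -
  have "Ck k (\<lambda>x::'a. r\<^sup>2 + (\<Sum>b\<in>Basis. - 1 * ((x \<bullet> b) * (x \<bullet> b))))"
    by (intro Ck_add Ck_sum Ck_mult Ck_inner Ck_const)
  also have "(\<lambda>x::'a. r\<^sup>2 + (\<Sum>b\<in>Basis. - 1 * ((x \<bullet> b) * (x \<bullet> b)))) = (\<lambda>x. r\<^sup>2 - x \<bullet> x)"
  proof
    fix x :: 'a
    show "r\<^sup>2 + (\<Sum>b\<in>Basis. - 1 * ((x \<bullet> b) * (x \<bullet> b))) = r\<^sup>2 - x \<bullet> x"
      by (subst euclidean_inner[of x x]) (simp add: sum_negf)
  qed
  finally show ?thesis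
    unfolding bump_def by (rule Ck_compose_real[OF Ck_flat])
qed

lemma continuous_bump [continuous_intros]: "continuous_on S f \<Longrightarrow> continuous_on S (\<lambda>x. bump r (f x))"
  using continuous_on_compose2[OF Ck_imp_continuous_on[OF Ck_bump[of 0 r]], of S f] by auto

section \<open>Mollification\<close>

lemma lborel_distr_isometry:
  fixes t :: "'a::euclidean_space"
  assumes "c = 1 \<or> c = - 1"
  shows "distr lborel borel (\<lambda>x. t + c *\<^sub>R x) = lborel"
  using lborel_affine[of c t] assms by (auto simp: density_1)

lemma
  fixes t :: "'a::euclidean_space" and f :: "'a \<Rightarrow> 'b::{banach, second_countable_topology}"
  assumes [measurable]: "f \<in> borel_measurable borel"
  shows integrable_lborel_translate: "integrable lborel (\<lambda>x. f (t + x)) \<longleftrightarrow> integrable lborel f"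
    and integral_lborel_translate: "(LINT x|lborel. f (t + x)) = (LINT x|lborel. f x)"
    and integrable_lborel_reflect: "integrable lborel (\<lambda>x. f (t - x)) \<longleftrightarrow> integrable lborel f"
    and integral_lborel_reflect: "(LINT x|lborel. f (t - x)) = (LINT x|lborel. f x)"
proof -
  have 1: "distr lborel borel (\<lambda>x. t + x) = lborel" and 2: "distr lborel borel (\<lambda>x. t - x) = lborel"
    using lborel_distr_isometry[of 1 t] lborel_distr_isometry[of "-1" t] by simp_all
  show "integrable lborel (\<lambda>x. f (t + x)) \<longleftrightarrow> integrable lborel f"
    using integrable_distr_eq[of "\<lambda>x. t + x" lborel borel f] by (simp add: 1)
  show "integrable lborel (\<lambda>x. f (t - x)) \<longleftrightarrow> integrable lborel f"
    using integrable_distr_eq[of "\<lambda>x. t - x" lborel borel f] by (simp add: 2)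
  show "(LINT x|lborel. f (t + x)) = (LINT x|lborel. f x)"
    using integral_distr[of "\<lambda>x. t + x" lborel borel f] by (simp add: 1)
  show "(LINT x|lborel. f (t - x)) = (LINT x|lborel. f x)"
    using integral_distr[of "\<lambda>x. t - x" lborel borel f] by (simp add: 2)
qed

lemma integrable_compact_support:
  fixes f :: "'a::euclidean_space \<Rightarrow> 'b::{banach, second_countable_topology}"
  assumes "continuous_on UNIV f" "\<And>x. norm x > R \<Longrightarrow> f x = 0"
  shows "integrable lborel f"
proof -
  have "integrable lborel (\<lambda>x. indicator (cball 0 R) x *\<^sub>R f x)"
    using assms(1) by (intro borel_integrable_compact) (auto intro: continuous_on_subset)
  also have "(\<lambda>x. indicator (cball 0 R) x *\<^sub>R f x) = f"
    using assms(2) by (force simp: fun_eq_iff indicator_def)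
  finally show ?thesis .
qed

text \<open>Differentiation under the integral, with the derivative falling on
  \<open>\<phi>\<close>. The derivative is packed into a bounded linear function because the Leibniz
  rule integrates operator-valued derivatives; evaluating at \<open>h\<close> unpacks it.\<close>

lemma has_derivative_convolution_cbox:
  fixes \<phi> K :: "'a::euclidean_space \<Rightarrow> real"
  assumes K: "continuous_on UNIV K"
    and \<phi>: "\<And>z. (\<phi> has_derivative D z) (at z)"
    and D: "\<And>h. continuous_on UNIV (\<lambda>z. D z h)"
  shows "((\<lambda>z. integral (cbox a b) (\<lambda>y. K y * \<phi> (z - y)))
    has_derivative (\<lambda>h. integral (cbox a b) (\<lambda>y. K y * D (z - y) h))) (at z)"
proof -
  let ?B = "\<lambda>z y. K y *\<^sub>R Blinfun (D (z - y))"
  have app: "blinfun_apply (Blinfun (D z)) = D z" for z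
    using has_derivative_bounded_linear[OF \<phi>] by (rule bounded_linear_Blinfun_apply)
  have contB: "continuous_on UNIV (\<lambda>z. Blinfun (D z))"
    by (rule continuous_on_blinfun_componentwise) (simp add: app D)
  have cont\<phi>: "continuous_on UNIV \<phi>"
    using \<phi> has_derivative_continuous_on by blast
  have contB': "continuous_on (UNIV \<times> cbox a b) (\<lambda>(z, y). ?B z y)"
    unfolding split_beta
    by (intro continuous_intros continuous_on_compose2[OF contB] continuous_on_compose2[OF K]) auto
  have "((\<lambda>z. integral (cbox a b) (\<lambda>y. K y * \<phi> (z - y)))
    has_derivative integral (cbox a b) (?B z)) (at z within UNIV)"
  proof (rule leibniz_rule[OF _ _ contB'])
    fix z y
    have "((\<lambda>z. \<phi> (z - y)) has_derivative D (z - y)) (at z)"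
      by (rule has_derivative_compose[OF _ \<phi>, where f' = "\<lambda>h. h", simplified])
        (auto intro!: derivative_eq_intros)
    then show "((\<lambda>z. K y * \<phi> (z - y)) has_derivative blinfun_apply (?B z y)) (at z within UNIV)"
      by (auto intro!: derivative_eq_intros simp: scaleR_blinfun.rep_eq app fun_eq_iff)
  next
    fix z
    show "(\<lambda>y. K y * \<phi> (z - y)) integrable_on cbox a b"
      by (intro integrable_continuous continuous_intros continuous_on_subset[OF K]
          continuous_on_compose2[OF cont\<phi>]) auto
  qed auto
  moreover have app': "blinfun_apply (integral (cbox a b) (?B z)) h
      = integral (cbox a b) (\<lambda>y. K y * D (z - y) h)" for h
  proof -
    have "(?B z) integrable_on cbox a b"
      by (intro integrable_continuous continuous_intros continuous_on_subset[OF K]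
          continuous_on_compose2[OF contB]) auto
    from integral_linear[OF this blinfun.bounded_linear_left[of h]]
    show ?thesis by (simp add: o_def scaleR_blinfun.rep_eq app)
  qed
  ultimately show ?thesis by (simp add: app'[abs_def])
qed

text \<open>Smoothness passes from \<open>\<phi>\<close> to the convolution: each differentiation
  replaces \<open>\<phi>\<close> by a partial derivative, so the induction generalises over
  \<open>\<phi>\<close>, while \<open>K\<close> need only be continuous.\<close>

lemma Ck_convolution_cbox:
  fixes \<phi> K :: "'a::euclidean_space \<Rightarrow> real"
  assumes K: "continuous_on UNIV K"
  shows "Ck k \<phi> \<Longrightarrow> Ck k (\<lambda>z. integral (cbox a b) (\<lambda>y. K y * \<phi> (z - y)))"
proof (induction k arbitrary: \<phi>)
  case 0
  have "continuous_on (UNIV \<times> cbox a b) (\<lambda>(z, y). K y * \<phi> (z - y))"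
    unfolding split_beta
    by (intro continuous_intros continuous_on_compose2[OF 0[unfolded Ck.simps]] continuous_on_compose2[OF K]) auto
  then show ?case
    unfolding Ck.simps by (rule integral_continuous_on_param)
next
  case (Suc k)
  have D: "(\<phi> has_derivative frechet_derivative \<phi> (at z)) (at z)" for z
    using Suc.prems by (rule Ck_Suc_has_derivative)
  have b: "Ck k (\<lambda>z. frechet_derivative \<phi> (at z) b)" if "b \<in> Basis" for b
    using Suc.prems that by simp
  have cont: "continuous_on UNIV (\<lambda>z. frechet_derivative \<phi> (at z) h)" for h
    by (subst linear_componentwise_sum[OF has_derivative_linear[OF D]])
      (intro continuous_intros Ck_imp_continuous_on[OF b])
  show ?case
    by (rule Ck_SucI[OF has_derivative_convolution_cbox[OF K D cont]]) (intro Suc.IH b)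
qed

definition mollify :: "real \<Rightarrow> ('a::euclidean_space \<Rightarrow> real) \<Rightarrow> 'a \<Rightarrow> real" where
  "mollify \<delta> \<Psi> z = (LINT y|lborel. \<Psi> y * bump \<delta> (z - y)) / (LINT y|lborel. bump \<delta> (y::'a))"

lemma continuous_on_bump_UNIV: "continuous_on UNIV (bump r)"
  using Ck_bump Ck_imp_continuous_on by blast

lemma integrable_bump: "r > 0 \<Longrightarrow> integrable lborel (bump r)"
  by (rule integrable_compact_support[OF continuous_on_bump_UNIV, of r]) (auto intro: bump_eq_0)

text \<open>Otherwise the integral is 0, \<open>f\<close> vanishes almost everywhere, and the
  nonempty open set where it is positive would be negligible.\<close>

lemma integral_continuous_pos:
  fixes f :: "'a::euclidean_space \<Rightarrow> real"
  assumes f: "continuous_on UNIV f" "integrable lborel f" "\<And>x. f x \<ge> 0" and x0: "f x0 > 0"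
  shows "(LINT x|lborel. f x) > 0"
proof (rule ccontr)
  assume "\<not> ?thesis"
  moreover have "(LINT x|lborel. f x) \<ge> 0"
    by (simp add: f(3))
  ultimately have "(LINT x|lborel. f x) = 0" by linarith
  then have ae: "AE x in lborel. f x = 0"
    using integral_nonneg_eq_0_iff_AE[OF f(2)] f(3) by simp
  have op: "open {x. f x > 0}"
    using f(1) open_Collect_less[of "\<lambda>_. 0" f] by simp
  have "{x. f x > 0} \<in> null_sets lborel"
    using ae op by (subst AE_iff_null_sets) (auto elim: eventually_mono)
  then have "{x. f x > 0} \<in> null_sets lebesgue"
    using null_sets_completionI by blast
  then have "negligible {x. f x > 0}"
    by (simp add: negligible_iff_null_sets)
  then show False
    using open_not_negligible[OF op] x0 by auto
qed

lemma bump_mass_pos: "r > 0 \<Longrightarrow> (LINT y|lborel. bump r (y::'a::euclidean_space)) > 0"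
  by (rule integral_continuous_pos[OF continuous_on_bump_UNIV integrable_bump, of _ 0])
    (auto simp: bump_nonneg bump_pos_iff)

lemma bump_reflect:
  fixes z :: "'a::euclidean_space"
  assumes "r > 0"
  shows "integrable lborel (\<lambda>y. bump r (z - y))"
    "(LINT y|lborel. bump r (z - y)) = (LINT y|lborel. bump r (y::'a))"
  using integrable_bump[OF assms, where 'a='a] continuous_on_bump_UNIV[of r, where 'a='a]
  by (auto simp: integrable_lborel_reflect integral_lborel_reflect borel_measurable_continuous_onI)

context
  fixes \<Psi> :: "'a::euclidean_space \<Rightarrow> real" and R \<delta> :: real
  assumes \<Psi>: "continuous_on UNIV \<Psi>" and supp: "\<And>x. norm x > R \<Longrightarrow> \<Psi> x = 0" and \<delta>: "\<delta> > 0"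
begin

lemma integrable_mollify: "integrable lborel (\<lambda>y. \<Psi> y * bump \<delta> (z - y))"
  by (rule integrable_compact_support[of _ R])
    (auto simp: supp intro!: continuous_intros \<Psi>)

lemma mollify_cbox:
  assumes "cball 0 R \<subseteq> cbox a b"
  shows "(LINT y|lborel. \<Psi> y * bump \<delta> (z - y)) = integral (cbox a b) (\<lambda>y. \<Psi> y * bump \<delta> (z - y))"
proof -
  have "(LINT y|lborel. \<Psi> y * bump \<delta> (z - y)) = integral UNIV (\<lambda>y. \<Psi> y * bump \<delta> (z - y))"
    using integrable_mollify by (rule integral_lborel[symmetric])
  also have "\<dots> = integral UNIV (\<lambda>y. if y \<in> cbox a b then \<Psi> y * bump \<delta> (z - y) else 0)"
    using supp assms by (intro integral_cong) (force simp: subset_iff)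
  finally show ?thesis by (simp add: integral_restrict_UNIV)
qed

lemma Ck_mollify: "Ck k (mollify \<delta> \<Psi>)"
proof -
  obtain a :: 'a where a: "cball 0 R \<subseteq> cbox (- a) a"
    using bounded_subset_cbox_symmetric[OF bounded_cball] by blast
  have "Ck k (\<lambda>z. integral (cbox (-a) a) (\<lambda>y. \<Psi> y * bump \<delta> (z - y)) * (1 / (LINT y|lborel. bump \<delta> (y::'a))))"
    by (intro Ck_mult Ck_const Ck_convolution_cbox \<Psi> Ck_bump)
  then show ?thesis
    by (simp add: mollify_def[abs_def] mollify_cbox[OF a])
qed

lemma mollify_eq_0: "norm z > R + \<delta> \<Longrightarrow> mollify \<delta> \<Psi> z = 0"
proof -
  assume z: "norm z > R + \<delta>"
  have 0: "\<Psi> y * bump \<delta> (z - y) = 0" for y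
  proof (cases "norm y > R")
    case False
    then have "norm (z - y) \<ge> \<delta>" using z norm_triangle_ineq2[of z y] by linarith
    then show ?thesis using \<delta> by (simp add: bump_eq_0)
  qed (simp add: supp)
  show ?thesis by (simp only: mollify_def 0) simp
qed

text \<open>\<open>mollify \<delta> \<Psi> z\<close> is an average of \<open>\<Psi>\<close> over the
  ball of radius \<open>\<delta>\<close> about \<open>z\<close>, so it inherits any bound on the
  deviation from a constant there. The choice \<open>c = \<Psi> z\<close> gives uniform
  approximation, \<open>c = 0\<close> a bound for the mollification itself.\<close>

lemma mollify_close:
  assumes e: "\<And>y. norm (z - y) \<le> \<delta> \<Longrightarrow> \<bar>\<Psi> y - c\<bar> \<le> e"
  shows "\<bar>mollify \<delta> \<Psi> z - c\<bar> \<le> e"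
proof -
  let ?N = "LINT y|lborel. bump \<delta> (y::'a)"
  have N: "?N > 0" by (rule bump_mass_pos[OF \<delta>])
  have "\<bar>(LINT y|lborel. \<Psi> y * bump \<delta> (z - y)) - c * ?N\<bar>
      = \<bar>LINT y|lborel. (\<Psi> y - c) * bump \<delta> (z - y)\<bar>"
    using integrable_mollify[of z] bump_reflect[OF \<delta>, of z] by (simp add: left_diff_distrib)
  also have "\<dots> \<le> (LINT y|lborel. e * bump \<delta> (z - y))"
  proof (rule integral_abs_bound[THEN order_trans], rule integral_mono)
    show "integrable lborel (\<lambda>y. \<bar>(\<Psi> y - c) * bump \<delta> (z - y)\<bar>)"
      using integrable_mollify[of z] bump_reflect[OF \<delta>, of z] by (simp add: left_diff_distrib)
    show "integrable lborel (\<lambda>y. e * bump \<delta> (z - y))"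
      using bump_reflect[OF \<delta>, of z] by simp
    show "\<bar>(\<Psi> y - c) * bump \<delta> (z - y)\<bar> \<le> e * bump \<delta> (z - y)" for y
    proof (cases "norm (z - y) \<le> \<delta>")
      case True
      then show ?thesis using e[of y] bump_nonneg[of \<delta> "z - y"] by (simp add: abs_mult mult_right_mono)
    next
      case False
      then show ?thesis using \<delta> by (simp add: bump_eq_0)
    qed
  qed
  also have "\<dots> = e * ?N" using bump_reflect[OF \<delta>, of z] by simp
  finally have "\<bar>((LINT y|lborel. \<Psi> y * bump \<delta> (z - y)) - c * ?N) / ?N\<bar> \<le> e"
    using N by (simp add: field_simps)
  then show ?thesis using N by (simp add: mollify_def diff_divide_distrib)
qed

end

text \<open>\<open>Ck_mollify\<close> lets derivatives fall on the kernel. Here the reflection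
  \<open>y \<mapsto> z - y\<close> moves \<open>z\<close> into \<open>\<Psi>\<close>, so the
  derivative falls on \<open>\<Psi>\<close> and mollification commutes with differentiation;
  approximation in C^1 rests on this.\<close>

lemma mollify_has_derivative:
  fixes \<Psi> :: "'a::euclidean_space \<Rightarrow> real"
  assumes supp: "\<And>x. norm x > R \<Longrightarrow> \<Psi> x = 0" and \<delta>: "\<delta> > 0"
    and \<Psi>: "\<And>z. (\<Psi> has_derivative D z) (at z)" and D: "\<And>h. continuous_on UNIV (\<lambda>z. D z h)"
  shows "(mollify \<delta> \<Psi> has_derivative (\<lambda>h. mollify \<delta> (\<lambda>y. D y h) z)) (at z)"
proof -
  obtain a where a: "cball 0 \<delta> \<subseteq> cbox (- a) (a::'a)"
    using bounded_subset_cbox_symmetric[OF bounded_cball] by blast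
  have eq: "(LINT y|lborel. G y * bump \<delta> (z - y)) = integral (cbox (-a) a) (\<lambda>y. bump \<delta> y * G (z - y))"
    if G: "continuous_on UNIV G" for G :: "'a \<Rightarrow> real" and z
  proof -
    have m: "(\<lambda>y. G y * bump \<delta> (z - y)) \<in> borel_measurable borel"
      by (intro borel_measurable_continuous_onI continuous_intros G)
    have "(LINT y|lborel. G y * bump \<delta> (z - y)) = (LINT y|lborel. G (z - y) * bump \<delta> y)"
      using integral_lborel_reflect[OF m, of z] by simp
    also have "\<dots> = (LINT y|lborel. bump \<delta> y * G (z - y))"
      by (simp add: mult.commute)
    also have "\<dots> = integral UNIV (\<lambda>y. bump \<delta> y * G (z - y))"
      by (rule integral_lborel[symmetric], rule integrable_compact_support[of _ \<delta>])
        (use \<delta> in \<open>auto simp: bump_eq_0 intro!: continuous_intros continuous_on_compose2[OF G]\<close>)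
    also have "\<dots> = integral UNIV (\<lambda>y. if y \<in> cbox (-a) a then bump \<delta> y * G (z - y) else 0)"
      using a \<delta> by (intro integral_cong) (force simp: subset_iff bump_eq_0)
    finally show ?thesis by (simp add: integral_restrict_UNIV)
  qed
  have c\<Psi>: "continuous_on UNIV \<Psi>"
    using \<Psi> has_derivative_continuous_on by blast
  have "((\<lambda>z. integral (cbox (-a) a) (\<lambda>y. bump \<delta> y * \<Psi> (z - y)) * (1 / (LINT y|lborel. bump \<delta> (y::'a))))
     has_derivative (\<lambda>h. integral (cbox (-a) a) (\<lambda>y. bump \<delta> y * D (z - y) h) * (1 / (LINT y|lborel. bump \<delta> (y::'a))))) (at z)"
    by (rule has_derivative_mult_left[OF has_derivative_convolution_cbox[OF continuous_on_bump_UNIV \<Psi> D]])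
  then show ?thesis
    by (simp add: mollify_def[abs_def] eq[OF c\<Psi>] eq[OF D])
qed

section \<open>Sobolev embedding\<close>

lemma integral_Cauchy_Schwarz:
  fixes f g :: "'a \<Rightarrow> real"
  assumes [measurable]: "f \<in> borel_measurable M" "g \<in> borel_measurable M"
    and nn: "\<And>x. f x \<ge> 0" "\<And>x. g x \<ge> 0"
    and f2: "integrable M (\<lambda>x. (f x)\<^sup>2)" and g2: "integrable M (\<lambda>x. (g x)\<^sup>2)"
  shows "integrable M (\<lambda>x. f x * g x)"
    and "(LINT x|M. f x * g x) \<le> sqrt (LINT x|M. (f x)\<^sup>2) * sqrt (LINT x|M. (g x)\<^sup>2)"
proof -
  have b: "f x * g x \<le> (f x)\<^sup>2 + (g x)\<^sup>2" for x
    using sum_squares_bound[of "f x" "g x"] nn[of x] mult_nonneg_nonneg[of "f x" "g x"] by linarith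
  show i: "integrable M (\<lambda>x. f x * g x)"
    by (rule Bochner_Integration.integrable_bound[OF Bochner_Integration.integrable_add[OF f2 g2]])
      (use b nn in auto)
  have "(\<integral>\<^sup>+x. ennreal (f x) * ennreal (g x) \<partial>M)\<^sup>2
      \<le> (\<integral>\<^sup>+x. (ennreal (f x))\<^sup>2 \<partial>M) * (\<integral>\<^sup>+x. (ennreal (g x))\<^sup>2 \<partial>M)"
    by (rule Cauchy_Schwarz_nn_integral) auto
  then have "ennreal ((LINT x|M. f x * g x)\<^sup>2) \<le> ennreal ((LINT x|M. (f x)\<^sup>2) * (LINT x|M. (g x)\<^sup>2))"
    using nn f2 g2 i
    by (simp add: ennreal_mult[symmetric] ennreal_power nn_integral_eq_integral)
  then have "(LINT x|M. f x * g x)\<^sup>2 \<le> (LINT x|M. (f x)\<^sup>2) * (LINT x|M. (g x)\<^sup>2)"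
    by (subst (asm) ennreal_le_iff) auto
  then have "sqrt ((LINT x|M. f x * g x)\<^sup>2) \<le> sqrt ((LINT x|M. (f x)\<^sup>2) * (LINT x|M. (g x)\<^sup>2))"
    by (rule real_sqrt_le_mono)
  then show "(LINT x|M. f x * g x) \<le> sqrt (LINT x|M. (f x)\<^sup>2) * sqrt (LINT x|M. (g x)\<^sup>2)"
    by (simp add: real_sqrt_mult)
qed

text \<open>Compared with 1 on \<open>[-1, 1]\<close> and with \<open>|t|\<close> to the power
  \<open>- 2 * p\<close> outside, which is integrable since \<open>2 * p > 1\<close>.\<close>

lemma integrable_inverse_power_real:
  fixes p :: real
  assumes p: "p > 1 / 2"
  shows "integrable lborel (\<lambda>t::real. (1 + t\<^sup>2) powr (- p))"
proof -
  let ?h = "\<lambda>t::real. indicator {1..} t * t powr (- 2 * p)"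
  have "((\<lambda>t. t powr (- 2 * p)) has_integral -(1 powr (- 2 * p + 1)) / (- 2 * p + 1)) {1..}"
    using p by (intro has_integral_powr_to_inf) auto
  then have "(\<lambda>t::real. t powr (- 2 * p)) absolutely_integrable_on {1..}"
    by (intro nonnegative_absolutely_integrable_1) auto
  then have "integrable lebesgue ?h"
    by (simp add: set_integrable_def)
  then have h: "integrable lborel ?h"
    by (subst (asm) integrable_completion) auto
  have h': "integrable lborel (\<lambda>t. ?h (0 - t))"
    using h by (subst integrable_lborel_reflect) auto
  have "integrable lborel (\<lambda>t. indicator {-1..1} t + (?h t + ?h (0 - t)))"
    using h h' by (intro Bochner_Integration.integrable_add) auto
  then show ?thesis
  proof (rule Bochner_Integration.integrable_bound)
    have key: "(1 + t\<^sup>2) powr (- p) \<le> s powr (- 2 * p)" if "s \<ge> 1" "s\<^sup>2 = t\<^sup>2" for s t :: real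
    proof -
      have "s powr (- 2 * p) = (s\<^sup>2) powr (- p)"
        using that(1) powr_powr[of s 2 "- p"] by simp
      moreover have "(1 + s\<^sup>2) powr (- p) \<le> (s\<^sup>2) powr (- p)"
        using that p by (intro powr_mono2') auto
      ultimately show ?thesis using that by simp
    qed
    have one: "(1 + t\<^sup>2) powr (- p) \<le> 1" for t :: real
      using powr_mono2'[of "- p" 1 "1 + t\<^sup>2"] p by simp
    show "AE t in lborel. norm ((1 + t\<^sup>2) powr (- p)) \<le> norm (indicator {-1..1} t + (?h t + ?h (0 - t)))"
    proof (rule AE_I2)
      fix t :: real
      consider "t > 1" | "t < -1" | "t \<in> {-1..1}" by fastforce
      then show "norm ((1 + t\<^sup>2) powr (- p)) \<le> norm (indicator {-1..1} t + (?h t + ?h (0 - t)))"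
      proof cases
        case 1 then show ?thesis using key[of t t] by simp
      next
        case 2 then show ?thesis using key[of "- t" t] by simp
      next
        case 3
        have "1 \<le> norm (indicator {-1..1} t + (?h t + ?h (0 - t)))"
          using 3 by (simp add: abs_of_nonneg indicator_def)
        then show ?thesis using one[of t] by simp
      qed
    qed
  qed auto
qed

text \<open>Reduction to one dimension: \<open>1 + |x|^2\<close> dominates each
  \<open>1 + (x \<bullet> b)^2\<close>, so the function lies below a product of one-dimensional ones
  with exponent \<open>q / DIM('a) > 1 / 2\<close>, whose integral factorises.\<close>

lemma integrable_inverse_power:
  fixes q :: real
  assumes q: "q > DIM('a) / 2"
  shows "integrable lborel (\<lambda>x::'a::euclidean_space. (1 + (norm x)\<^sup>2) powr (- q))"
proof (rule integrableI_bounded)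
  define p where "p = q / DIM('a)"
  have p: "p > 1 / 2"
    using q by (simp add: p_def field_simps)
  have le: "(1 + (norm x)\<^sup>2) powr (- q) \<le> (\<Prod>b\<in>Basis. (1 + (x \<bullet> b)\<^sup>2) powr (- p))" for x :: 'a
  proof -
    have "((1 + (norm x)\<^sup>2) powr (- p)) ^ DIM('a) = (1 + (norm x)\<^sup>2) powr (DIM('a) * (- p))"
      by (rule powr_power) (use zero_le_power2[of "norm x"] in linarith)
    then have "(1 + (norm x)\<^sup>2) powr (- q) = ((1 + (norm x)\<^sup>2) powr (- p)) ^ DIM('a)"
      by (simp add: p_def)
    also have "\<dots> = (\<Prod>b\<in>(Basis::'a set). (1 + (norm x)\<^sup>2) powr (- p))"
      by simp
    also have "\<dots> \<le> (\<Prod>b\<in>Basis. (1 + (x \<bullet> b)\<^sup>2) powr (- p))"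
    proof (intro prod_mono conjI powr_mono2')
      fix b :: 'a assume "b \<in> Basis"
      then have "\<bar>x \<bullet> b\<bar> \<le> norm x" by (rule Basis_le_norm)
      then have "(x \<bullet> b)\<^sup>2 \<le> (norm x)\<^sup>2" by (simp add: abs_le_square_iff[symmetric])
      then show "1 + (x \<bullet> b)\<^sup>2 \<le> 1 + (norm x)\<^sup>2" by simp
    qed (use p in \<open>auto simp: add_pos_nonneg\<close>)
    finally show ?thesis .
  qed
  have fin: "(\<integral>\<^sup>+t. ennreal ((1 + t\<^sup>2) powr (- p)) \<partial>lborel) < \<infinity>"
    using integrableD(2)[OF integrable_inverse_power_real[OF p]] by (simp add: less_top[symmetric])
  have "(\<integral>\<^sup>+(x::'a). ennreal (norm ((1 + (norm x)\<^sup>2) powr (- q))) \<partial>lborel)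
      \<le> (\<integral>\<^sup>+(x::'a). (\<Prod>b\<in>Basis. ennreal ((1 + (x \<bullet> b)\<^sup>2) powr (- p))) \<partial>lborel)"
    using le by (intro nn_integral_mono) (auto simp: prod_ennreal intro!: ennreal_leI)
  also have "\<dots> = (\<Prod>b\<in>(Basis::'a set). (\<integral>\<^sup>+t. ennreal ((1 + t\<^sup>2) powr (- p)) \<partial>lborel))"
    by (rule nn_integral_lborel_prod) auto
  also have "\<dots> < \<infinity>"
    using fin by (simp add: power_less_top_ennreal)
  finally show "(\<integral>\<^sup>+(x::'a). ennreal (norm ((1 + (norm x)\<^sup>2) powr (- q))) \<partial>lborel) < \<infinity>" .
qed auto

lemma test_fun_bump:
  assumes "r > 0"
  shows "test_fun UNIV (\<lambda>x. bump r (x - c))"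
  unfolding test_fun_def smooth_def
proof (intro conjI allI exI[of _ "cball c r"] impI)
  show "Ck k (\<lambda>x. bump r (x - c))" for k
    using Ck_compose_affine[OF bounded_linear_ident Ck_bump, of k r "- c"] by simp
  show "x \<notin> cball c r \<Longrightarrow> bump r (x - c) = 0" for x
    using assms by (simp add: bump_eq_0 dist_norm norm_minus_commute)
qed auto

text \<open>If \<open>D x0 > 0\<close>, then \<open>D\<close> is positive on a small ball, and
  testing with a bump supported there gives a positive integral.\<close>

lemma continuous_nonpos_if_test_integrals:
  fixes D :: "'a::euclidean_space \<Rightarrow> real"
  assumes D: "continuous_on UNIV D"
    and 0: "\<And>\<phi>. test_fun UNIV \<phi> \<Longrightarrow> (LINT x|lborel. D x * \<phi> x) = 0"
  shows "D x0 \<le> 0"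
proof (rule ccontr)
  assume "\<not> ?thesis"
  then have pos: "D x0 > 0" by simp
  have "open {x. D x > 0}"
    using D open_Collect_less[of "\<lambda>_. 0" D] by simp
  then obtain r where r: "r > 0" "ball x0 r \<subseteq> {x. D x > 0}"
    using pos unfolding open_contains_ball by blast
  have nn: "D x * bump r (x - x0) \<ge> 0" for x
  proof (cases "x \<in> ball x0 r")
    case True
    then show ?thesis using r(2) bump_nonneg[of r "x - x0"] by fastforce
  next
    case False
    then show ?thesis using r(1) by (simp add: bump_eq_0 dist_norm norm_minus_commute)
  qed
  have c: "continuous_on UNIV (\<lambda>x. D x * bump r (x - x0))"
    by (intro continuous_intros D)
  have "bump r (x - x0) = 0" if "norm x > norm x0 + r" for x
    using norm_triangle_ineq2[of x x0] that r(1) by (intro bump_eq_0) auto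
  then have i: "integrable lborel (\<lambda>x. D x * bump r (x - x0))"
    by (intro integrable_compact_support[OF c, of "norm x0 + r"]) auto
  have "(LINT x|lborel. D x * bump r (x - x0)) > 0"
    by (rule integral_continuous_pos[OF c i nn, of x0]) (use pos r bump_pos_iff[of r "0::'a"] in auto)
  then show False
    using 0[OF test_fun_bump[OF r(1), of x0]] by simp
qed

lemma continuous_eq_if_test_integrals:
  fixes f F :: "'a::euclidean_space \<Rightarrow> real"
  assumes f: "continuous_on UNIV f" and F: "continuous_on UNIV F"
    and eq: "\<And>\<phi>. test_fun UNIV \<phi> \<Longrightarrow> (LINT x|lborel. f x * \<phi> x) = (LINT x|lborel. F x * \<phi> x)"
  shows "f = F"
proof -
  have i: "integrable lborel (\<lambda>x. g x * \<phi> x)" if cg: "continuous_on UNIV g" and t\<phi>: "test_fun UNIV \<phi>"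
    for g \<phi> :: "'a \<Rightarrow> real"
  proof -
    have \<phi>: "continuous_on UNIV \<phi>"
      using t\<phi> Ck_imp_continuous_on unfolding test_fun_def smooth_def by blast
    obtain K where K: "compact K" "\<And>x. x \<notin> K \<Longrightarrow> \<phi> x = 0"
      using t\<phi> unfolding test_fun_def by blast
    obtain R where R: "\<And>x. x \<in> K \<Longrightarrow> norm x \<le> R"
      using compact_imp_bounded[OF K(1)] by (auto simp: bounded_iff)
    show ?thesis
    proof (rule integrable_compact_support[OF continuous_on_mult[OF cg \<phi>]])
      fix x :: 'a assume "norm x > R"
      then have "x \<notin> K" using R by force
      then show "g x * \<phi> x = 0" by (simp add: K(2))
    qed
  qed
  have 1: "f x - F x \<le> 0" for x
    by (rule continuous_nonpos_if_test_integrals[of "\<lambda>x. f x - F x"])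
      (auto intro!: continuous_intros f F simp: left_diff_distrib i[OF f] i[OF F] eq)
  have 2: "F x - f x \<le> 0" for x
    by (rule continuous_nonpos_if_test_integrals[of "\<lambda>x. F x - f x"])
      (auto intro!: continuous_intros f F simp: left_diff_distrib i[OF f] i[OF F] eq)
  show ?thesis using 1 2 by (intro ext) (simp add: antisym)
qed

text \<open>The left side equals \<open>2 * |sin ((a - b) / 2)|\<close>, by the addition and
  half-angle formulas.\<close>

lemma norm_cis_diff_le: "cmod (cis a - cis b) \<le> \<bar>a - b\<bar>"
proof -
  have "(cmod (cis a - cis b))\<^sup>2 = (cos a - cos b)\<^sup>2 + (sin a - sin b)\<^sup>2"
    by (simp add: cmod_power2)
  also have "\<dots> = ((sin a)\<^sup>2 + (cos a)\<^sup>2) + ((sin b)\<^sup>2 + (cos b)\<^sup>2) - 2 * (cos a * cos b + sin a * sin b)"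
    by (simp add: power2_eq_square algebra_simps)
  also have "\<dots> = 2 - 2 * cos (a - b)"
    by (simp add: cos_diff)
  also have "cos (a - b) = cos (2 * ((a - b) / 2))"
    by (rule arg_cong[where f = cos]) (simp add: field_simps)
  also have "2 - 2 * \<dots> = 4 * (sin ((a - b) / 2))\<^sup>2"
    by (subst cos_double_sin) simp
  also have "\<dots> = (2 * sin ((a - b) / 2))\<^sup>2"
    by (simp add: power_mult_distrib)
  also have "\<dots> \<le> (a - b)\<^sup>2"
    using abs_sin_x_le_abs_x[of "(a - b) / 2"] by (subst abs_le_square_iff[symmetric]) simp
  finally show ?thesis
    by (metis abs_ge_zero power2_abs power2_le_imp_le)
qed

text \<open>Cauchy-Schwarz splits \<open>sqrt (1 + |\<xi>|^2) * |g|\<close> into the Sobolev density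
  and a power of the weight that is square integrable because \<open>q - 1 > d / 2\<close>. Hence
  \<open>g\<close> and \<open>|\<xi>| * g\<close> are integrable, and the inverse transform
  \<open>F\<close> is bounded and Lipschitz. Membership in \<open>sobolev\<close> determines
  \<open>f\<close> only up to null sets; its continuity identifies it with \<open>F\<close> at every
  point.\<close>

lemma sobolev_embedding:
  fixes f :: "real^'d \<Rightarrow> real"
  assumes q: "q > real CARD('d) / 2 + 1" and f: "f \<in> sobolev q" and c: "continuous_on UNIV f"
  defines "C \<equiv> sqrt (LINT \<xi>::real^'d|lborel. (1 + (norm \<xi>)\<^sup>2) powr (1 - q))"
  shows "\<bar>f x\<bar> \<le> C * sobolev_norm q f"
    and "\<bar>f x - f y\<bar> \<le> C * sobolev_norm q f * norm (x - y)"
proof -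
  define g where "g = fourier f"
  define W :: "real^'d \<Rightarrow> real" where "W \<xi> = 1 + (norm \<xi>)\<^sup>2" for \<xi>
  define a where "a \<xi> = W \<xi> powr (q / 2) * cmod (g \<xi>)" for \<xi>
  define b where "b \<xi> = W \<xi> powr ((1 - q) / 2)" for \<xi>
  define N where "N = (LINT \<xi>|lborel. a \<xi> * b \<xi>)"
  define F where "F x = (LINT \<xi>|lborel. g \<xi> * cis (x \<bullet> \<xi>)) / (2 * complex_of_real pi) ^ CARD('d)" for x
  have Wpos: "W \<xi> \<ge> 1" for \<xi> by (simp add: W_def)
  have Wnn: "0 \<le> W \<xi>" "0 < W \<xi>" for \<xi> using Wpos[of \<xi>] by linarith+
  have ft: "is_fourier_transform f g" and gq: "integrable lborel (\<lambda>\<xi>. W \<xi> powr q * (cmod (g \<xi>))\<^sup>2)"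
    using f by (auto simp: sobolev_def g_def W_def)
  have [measurable]: "g \<in> borel_measurable borel" "W \<in> borel_measurable borel"
    using ft by (auto simp: is_fourier_transform_def W_def[abs_def])
  have [measurable]: "a \<in> borel_measurable borel" "b \<in> borel_measurable borel"
    unfolding a_def[abs_def] b_def[abs_def] by auto
  have a2: "(a \<xi>)\<^sup>2 = W \<xi> powr q * (cmod (g \<xi>))\<^sup>2" for \<xi>
    using Wnn(2)[of \<xi>] by (simp add: a_def power_mult_distrib powr_power)
  have b2: "(b \<xi>)\<^sup>2 = W \<xi> powr (1 - q)" for \<xi>
    unfolding power2_eq_square b_def powr_add[symmetric] field_sum_of_halves ..
  have "integrable lborel (\<lambda>\<xi>::real^'d. (1 + (norm \<xi>)\<^sup>2) powr (- (q - 1)))"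
    using q by (intro integrable_inverse_power) simp
  then have bi: "integrable lborel (\<lambda>\<xi>. (b \<xi>)\<^sup>2)"
    by (simp add: b2 W_def)
  have ai: "integrable lborel (\<lambda>\<xi>. (a \<xi>)\<^sup>2)"
    using gq by (simp add: a2)
  have nn: "a \<xi> \<ge> 0" "b \<xi> \<ge> 0" for \<xi> by (simp_all add: a_def b_def)
  have abi: "integrable lborel (\<lambda>\<xi>. a \<xi> * b \<xi>)"
    and N: "N \<le> C * sobolev_norm q f"
    using integral_Cauchy_Schwarz[OF _ _ nn(1) nn(2) ai bi]
    by (simp_all add: N_def a2 b2 C_def sobolev_norm_def W_def g_def mult.commute)
  \<comment> \<open>The two powers of the weight add up to 1/2, which leaves exactly the one factor
    \<open>|\<xi>|\<close> that the Lipschitz bound consumes.\<close>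
  have ab: "a \<xi> * b \<xi> = sqrt (W \<xi>) * cmod (g \<xi>)" for \<xi>
  proof -
    have "W \<xi> powr (q / 2) * W \<xi> powr ((1 - q) / 2) = W \<xi> powr (1 / 2)"
      by (simp add: powr_add[symmetric] add_divide_distrib[symmetric])
    then show ?thesis using Wnn by (simp add: a_def b_def powr_half_sqrt)
  qed
  have gab: "cmod (g \<xi>) \<le> a \<xi> * b \<xi>" for \<xi>
    using mult_right_mono[of 1 "sqrt (W \<xi>)" "cmod (g \<xi>)"] Wpos[of \<xi>] by (simp add: ab)
  have gab': "cmod (g \<xi>) * norm \<xi> \<le> a \<xi> * b \<xi>" for \<xi>
  proof -
    have "norm \<xi> \<le> sqrt (W \<xi>)" by (rule real_le_rsqrt) (simp add: W_def)
    from mult_left_mono[OF this, of "cmod (g \<xi>)"] show ?thesis by (simp add: ab mult.commute)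
  qed
  have [measurable]: "cis \<in> borel_measurable borel"
    by (intro borel_measurable_continuous_onI continuous_intros)
  have gi: "integrable lborel (\<lambda>\<xi>. g \<xi> * cis (x \<bullet> \<xi>))" for x
    by (rule Bochner_Integration.integrable_bound[OF abi]) (use gab nn in \<open>auto simp: norm_mult\<close>)
  \<comment> \<open>The normalising factor of the inverse transform only helps, since
    \<open>(2 * pi) ^ CARD('d) \<ge> 1\<close>.\<close>
  have piN: "cmod (w / (2 * complex_of_real pi) ^ CARD('d)) \<le> cmod w" for w
  proof -
    have "1 \<le> (2 * pi) ^ CARD('d)"
      using pi_gt3 by (intro one_le_power) simp
    then have "cmod w / (2 * pi) ^ CARD('d) \<le> cmod w / 1"
      by (intro divide_left_mono) auto
    then show ?thesis
      by (simp add: norm_divide norm_power norm_mult)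
  qed
  have Fb: "cmod (F x) \<le> N" for x
  proof -
    have "cmod (F x) \<le> cmod (LINT \<xi>|lborel. g \<xi> * cis (x \<bullet> \<xi>))"
      unfolding F_def by (rule piN)
    also have "\<dots> \<le> N" unfolding N_def
      by (rule order_trans[OF integral_norm_bound], rule integral_mono[OF integrable_norm[OF gi] abi])
        (use gab in \<open>simp add: norm_mult\<close>)
    finally show ?thesis .
  qed
  have Fl: "cmod (F x - F y) \<le> N * norm (x - y)" for x y
  proof -
    have "F x - F y = (LINT \<xi>|lborel. g \<xi> * cis (x \<bullet> \<xi>) - g \<xi> * cis (y \<bullet> \<xi>)) / (2 * complex_of_real pi) ^ CARD('d)"
      unfolding F_def by (simp add: Bochner_Integration.integral_diff[OF gi gi] diff_divide_distrib)
    then have "cmod (F x - F y) \<le> cmod (LINT \<xi>|lborel. g \<xi> * cis (x \<bullet> \<xi>) - g \<xi> * cis (y \<bullet> \<xi>))"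
      using piN by simp
    also have "\<dots> \<le> (LINT \<xi>|lborel. a \<xi> * b \<xi> * norm (x - y))"
    proof (rule order_trans[OF integral_norm_bound], rule integral_mono)
      show "cmod (g \<xi> * cis (x \<bullet> \<xi>) - g \<xi> * cis (y \<bullet> \<xi>)) \<le> a \<xi> * b \<xi> * norm (x - y)" for \<xi>
      proof -
        have "cmod (g \<xi> * cis (x \<bullet> \<xi>) - g \<xi> * cis (y \<bullet> \<xi>)) = cmod (g \<xi>) * cmod (cis (x \<bullet> \<xi>) - cis (y \<bullet> \<xi>))"
          by (simp add: right_diff_distrib[symmetric] norm_mult)
        also have "\<dots> \<le> cmod (g \<xi>) * \<bar>(x - y) \<bullet> \<xi>\<bar>"
          using norm_cis_diff_le[of "x \<bullet> \<xi>" "y \<bullet> \<xi>"] by (intro mult_left_mono) (auto simp: inner_diff_left)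
        also have "\<dots> \<le> cmod (g \<xi>) * (norm (x - y) * norm \<xi>)"
          by (intro mult_left_mono Cauchy_Schwarz_ineq2) auto
        also have "\<dots> \<le> a \<xi> * b \<xi> * norm (x - y)"
          using mult_right_mono[OF gab'[of \<xi>], of "norm (x - y)"] by (simp add: mult_ac)
        finally show ?thesis .
      qed
    qed (use abi gi in auto)
    also have "\<dots> = N * norm (x - y)" by (simp add: N_def)
    finally show ?thesis .
  qed
  have cF: "continuous_on UNIV (\<lambda>x. Re (F x))"
  proof -
    have "N-lipschitz_on UNIV F"
    proof (rule lipschitz_onI)
      show "0 \<le> N" unfolding N_def by (simp add: nn)
    qed (use Fl in \<open>auto simp: dist_norm\<close>)
    then show ?thesis by (intro continuous_intros) (rule lipschitz_on_continuous_on)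
  qed
  \<comment> \<open>Both sides have the same pairing with test functions: for \<open>f\<close> by
    the distributional definition of the Fourier transform, for \<open>F\<close> by Fubini.\<close>
  have "f = (\<lambda>x. Re (F x))"
  proof (rule continuous_eq_if_test_integrals[OF c cF])
    fix \<phi> :: "real^'d \<Rightarrow> real" assume \<phi>: "test_fun UNIV \<phi>"
    have c\<phi>: "continuous_on UNIV \<phi>"
      using \<phi> Ck_imp_continuous_on unfolding test_fun_def smooth_def by blast
    then have [measurable]: "\<phi> \<in> borel_measurable borel" by (rule borel_measurable_continuous_onI)
    obtain K where K: "compact K" "\<And>x. x \<notin> K \<Longrightarrow> \<phi> x = 0"
      using \<phi> unfolding test_fun_def by blast
    obtain R where R: "\<And>x. x \<in> K \<Longrightarrow> norm x \<le> R"
      using compact_imp_bounded[OF K(1)] by (auto simp: bounded_iff)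
    have \<phi>i: "integrable lborel \<phi>"
    proof (rule integrable_compact_support[OF c\<phi>])
      fix x :: "real^'d" assume "norm x > R"
      then have "x \<notin> K" using R by force
      then show "\<phi> x = 0" by (simp add: K(2))
    qed
    let ?P = "(2 * complex_of_real pi) ^ CARD('d)"
    let ?G = "\<lambda>\<xi> x. g \<xi> * (cis (x \<bullet> \<xi>) * complex_of_real (\<phi> x))"
    have Gi: "integrable (lborel \<Otimes>\<^sub>M lborel) (case_prod ?G)"
    proof (rule lborel_pair.Fubini_integrable)
      show "integrable lborel (\<lambda>\<xi>. LINT x|lborel. norm (case (\<xi>, x) of (\<xi>, x) \<Rightarrow> ?G \<xi> x))"
        using integrable_norm[OF gi[of 0]] by (simp add: norm_mult)
      show "AE \<xi> in lborel. integrable lborel (\<lambda>x. case (\<xi>, x) of (\<xi>, x) \<Rightarrow> ?G \<xi> x)"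
      proof (rule AE_I2)
        fix \<xi> :: "real^'d"
        have "integrable lborel (\<lambda>x. cis (x \<bullet> \<xi>) * complex_of_real (\<phi> x))"
          by (rule Bochner_Integration.integrable_bound[OF \<phi>i]) (auto simp: norm_mult)
        then show "integrable lborel (\<lambda>x. case (\<xi>, x) of (\<xi>, x) \<Rightarrow> ?G \<xi> x)"
          by simp
      qed
    qed measurable
    have "complex_of_real (LINT x|lborel. f x * \<phi> x) = (LINT \<xi>|lborel. g \<xi> * inv_fourier \<phi> \<xi>)"
      using ft \<phi> by (simp add: is_fourier_transform_def)
    also have "\<dots> = (LINT \<xi>|lborel. (LINT x|lborel. ?G \<xi> x)) / ?P"
      by (simp add: inv_fourier_def)
    also have "\<dots> = (LINT x|lborel. (LINT \<xi>|lborel. ?G \<xi> x)) / ?P"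
      using lborel_pair.Fubini_integral[OF Gi] by simp
    also have "(\<lambda>x. LINT \<xi>|lborel. ?G \<xi> x) = (\<lambda>x. (LINT \<xi>|lborel. g \<xi> * cis (x \<bullet> \<xi>)) * complex_of_real (\<phi> x))"
      by (simp add: mult.assoc[symmetric])
    also have "(LINT x|lborel. (LINT \<xi>|lborel. g \<xi> * cis (x \<bullet> \<xi>)) * complex_of_real (\<phi> x)) / ?P
        = (LINT x|lborel. F x * complex_of_real (\<phi> x))"
      by (simp add: F_def)
    finally have "(LINT x|lborel. f x * \<phi> x) = Re (LINT x|lborel. F x * complex_of_real (\<phi> x))"
      by (metis Re_complex_of_real)
    also have "\<dots> = (LINT x|lborel. Re (F x * complex_of_real (\<phi> x)))"
    proof (rule integral_Re[symmetric])
      have "continuous_on UNIV F"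
        by (rule lipschitz_on_continuous_on[OF lipschitz_onI[of UNIV F N]])
          (use Fl in \<open>auto simp: dist_norm N_def nn\<close>)
      then have "F \<in> borel_measurable borel" by (rule borel_measurable_continuous_onI)
      then show "integrable lborel (\<lambda>x. F x * complex_of_real (\<phi> x))"
        by (intro Bochner_Integration.integrable_bound[OF integrable_mult_right[OF \<phi>i, of N]])
          (use Fb in \<open>auto simp: norm_mult abs_mult intro!: mult_mono order_trans[OF Fb abs_ge_self]\<close>)
    qed
    finally show "(LINT x|lborel. f x * \<phi> x) = (LINT x|lborel. Re (F x) * \<phi> x)" by simp
  qed
  then have fx: "f x = Re (F x)" for x by simp
  show "\<bar>f x\<bar> \<le> C * sobolev_norm q f"
    using abs_Re_le_cmod[of "F x"] Fb[of x] N by (simp add: fx)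
  have "\<bar>f x - f y\<bar> \<le> N * norm (x - y)"
    using abs_Re_le_cmod[of "F x - F y"] Fl[of x y] by (simp add: fx)
  also have "\<dots> \<le> C * sobolev_norm q f * norm (x - y)"
    using N by (intro mult_right_mono) auto
  finally show "\<bar>f x - f y\<bar> \<le> C * sobolev_norm q f * norm (x - y)" .
qed

section \<open>Velocity moments\<close>

locale phase_density =
  fixes g :: "(real^'d) \<times> (real^'d) \<Rightarrow> real"
  assumes nonneg: "g z \<ge> 0"
    and integrable: "integrable lborel g"
    and energy: "integrable lborel (\<lambda>(x, v). (norm v)\<^sup>2 * g (x, v))"
begin

abbreviation "m \<equiv> mass_density g"
abbreviation "w \<equiv> mean_velocity g"

lemma meas [measurable]: "g \<in> borel_measurable (borel \<Otimes>\<^sub>M borel)"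
  using integrable by (simp add: borel_prod borel_measurable_integrable)

text \<open>By Fubini almost every slice is of this kind. On the others the velocity integrals may
  take the default value 0, so pointwise identities between moments are claimed on good slices
  only.\<close>

definition good :: "real^'d \<Rightarrow> bool" where
  "good x \<longleftrightarrow> integrable lborel (\<lambda>v. g (x, v)) \<and> integrable lborel (\<lambda>v. (norm v)\<^sup>2 * g (x, v))"

lemma AE_good: "AE x in lborel. good x"
proof -
  have "AE x in lborel. integrable lborel (\<lambda>v. g (x, v))"
    using lborel_pair.AE_integrable_fst'[of g] integrable by (simp add: lborel_prod)
  moreover have "AE x in lborel. integrable lborel (\<lambda>v. (norm v)\<^sup>2 * g (x, v))"
    using lborel_pair.AE_integrable_fst'[of "\<lambda>(x, v). (norm v)\<^sup>2 * g (x, v)"] energy by (simp add: lborel_prod)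
  ultimately show ?thesis by eventually_elim (simp add: good_def)
qed

lemma integrable_slice:
  assumes "good x" and [measurable]: "h \<in> borel_measurable borel"
    and "\<And>v. norm (h v) \<le> C * (1 + (norm v)\<^sup>2)"
  shows "integrable lborel (\<lambda>v. g (x, v) *\<^sub>R (h v :: 'b::{banach, second_countable_topology}))"
proof (rule Bochner_Integration.integrable_bound)
  show "integrable lborel (\<lambda>v. C * (g (x, v) + (norm v)\<^sup>2 * g (x, v)))"
    using assms(1) by (simp add: good_def)
  show "AE v in lborel. norm (g (x, v) *\<^sub>R h v) \<le> norm (C * (g (x, v) + (norm v)\<^sup>2 * g (x, v)))"
  proof (rule AE_I2)
    fix v
    have "norm (g (x, v) *\<^sub>R h v) \<le> g (x, v) * (C * (1 + (norm v)\<^sup>2))"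
      using assms(3)[of v] nonneg by (simp add: mult_left_mono)
    also have "\<dots> = C * (g (x, v) + (norm v)\<^sup>2 * g (x, v))" by (simp add: algebra_simps)
    finally show "norm (g (x, v) *\<^sub>R h v) \<le> norm (C * (g (x, v) + (norm v)\<^sup>2 * g (x, v)))" by simp
  qed
qed measurable

lemma norm_le_one_plus_square: "norm v \<le> 1 * (1 + (norm v)\<^sup>2)" for v :: "'b::real_normed_vector"
  using sum_squares_bound[of "norm v" 1] norm_ge_zero[of v] by (simp, linarith)

lemma integrable_momentum_slice: "good x \<Longrightarrow> integrable lborel (\<lambda>v. g (x, v) *\<^sub>R v)"
  by (rule integrable_slice[of _ _ 1]) (use norm_le_one_plus_square in auto)

lemma mass_nonneg: "m x \<ge> 0"
  by (simp add: mass_density_def nonneg)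

text \<open>On a slice without mass \<open>g\<close> vanishes for almost every \<open>v\<close>, so
  the momentum is 0 and the default value of \<open>w\<close> is consistent with it.\<close>

lemma momentum:
  assumes "good x"
  shows "(LINT v|lborel. g (x, v) *\<^sub>R v) = m x *\<^sub>R w x"
proof (cases "m x = 0")
  case True
  then have "AE v in lborel. g (x, v) = 0"
    using assms nonneg integral_nonneg_eq_0_iff_AE[of lborel "\<lambda>v. g (x, v)"]
    by (simp add: mass_density_def good_def)
  then have "(LINT v|lborel. g (x, v) *\<^sub>R v) = 0"
    by (intro integral_eq_zero_AE) (auto elim: eventually_mono)
  then show ?thesis using True by simp
qed (simp add: mean_velocity_def)

lemma norm_diff_square_le: "(norm (v - c))\<^sup>2 \<le> 2 * (norm v)\<^sup>2 + 2 * (norm c)\<^sup>2" for v c :: "'b::real_normed_vector"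
proof -
  have "(norm (v - c))\<^sup>2 \<le> (norm v + norm c)\<^sup>2"
    by (intro power_mono norm_triangle_ineq4) auto
  also have "\<dots> \<le> 2 * (norm v)\<^sup>2 + 2 * (norm c)\<^sup>2"
    using sum_squares_bound[of "norm v" "norm c"] by (simp add: power2_sum)
  finally show ?thesis .
qed

lemma integrable_square_slice: "good x \<Longrightarrow> integrable lborel (\<lambda>v. g (x, v) * (norm (v - c))\<^sup>2)"
  using integrable_slice[of x "\<lambda>v. (norm (v - c))\<^sup>2" "2 + 2 * (norm c)\<^sup>2"]
proof -
  assume "good x"
  have "integrable lborel (\<lambda>v. g (x, v) *\<^sub>R (norm (v - c))\<^sup>2)"
  proof (rule integrable_slice[OF \<open>good x\<close>, of _ "2 + 2 * (norm c)\<^sup>2"])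
    show "norm ((norm (v - c))\<^sup>2) \<le> (2 + 2 * (norm c)\<^sup>2) * (1 + (norm v)\<^sup>2)" for v
    proof -
      have "0 \<le> (norm c)\<^sup>2 * (norm v)\<^sup>2" by simp
      moreover have "(2 + 2 * (norm c)\<^sup>2) * (1 + (norm v)\<^sup>2)
          = 2 + 2 * (norm c)\<^sup>2 + 2 * (norm v)\<^sup>2 + 2 * ((norm c)\<^sup>2 * (norm v)\<^sup>2)"
        by (simp add: algebra_simps)
      ultimately show ?thesis
        using norm_diff_square_le[of v c] unfolding real_norm_def abs_power2 by linarith
    qed
  qed measurable
  then show ?thesis by simp
qed

text \<open>Decomposition into variance and squared bias: the cross term vanishes because
  \<open>w x\<close> is the mean of \<open>v\<close> under \<open>g (x, v)\<close>.\<close>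

lemma variance_slice:
  assumes "good x"
  shows "(LINT v|lborel. g (x, v) * (norm (v - c))\<^sup>2)
    = (LINT v|lborel. g (x, v) * (norm (v - w x))\<^sup>2) + m x * (norm (w x - c))\<^sup>2"
proof -
  have mo: "integrable lborel (\<lambda>v. g (x, v) *\<^sub>R v)" by (rule integrable_momentum_slice[OF assms])
  have mi: "integrable lborel (\<lambda>v. g (x, v))" using assms by (simp add: good_def)
  have e: "(norm (v - c))\<^sup>2 = (norm (v - w x))\<^sup>2 + (2 * ((v - w x) \<bullet> (w x - c)) + (norm (w x - c))\<^sup>2)" for v
    by (simp add: power2_norm_eq_inner inner_diff_left inner_diff_right inner_commute algebra_simps)
  have "g (x, v) * (norm (v - c))\<^sup>2 = g (x, v) * (norm (v - w x))\<^sup>2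
     + (2 * ((g (x, v) *\<^sub>R v) \<bullet> (w x - c)) + g (x, v) * ((norm (w x - c))\<^sup>2 - 2 * (w x \<bullet> (w x - c))))" for v
    unfolding e[of v] by (simp add: inner_diff_left[of v "w x"] distrib_left right_diff_distrib)
  then have "(LINT v|lborel. g (x, v) * (norm (v - c))\<^sup>2)
    = (LINT v|lborel. g (x, v) * (norm (v - w x))\<^sup>2)
     + (2 * ((LINT v|lborel. g (x, v) *\<^sub>R v) \<bullet> (w x - c)) + m x * ((norm (w x - c))\<^sup>2 - 2 * (w x \<bullet> (w x - c))))"
    using mo mi integrable_square_slice[OF assms]
    by (simp add: mass_density_def del: inner_scaleR_left inner_real_def)
  also have "\<dots> = (LINT v|lborel. g (x, v) * (norm (v - w x))\<^sup>2) + m x * (norm (w x - c))\<^sup>2"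
    by (simp add: momentum[OF assms] algebra_simps)
  finally show ?thesis .
qed

lemma jensen_slice:
  assumes "good x"
  shows "m x * (norm (w x - c))\<^sup>2 \<le> (LINT v|lborel. g (x, v) * (norm (v - c))\<^sup>2)"
proof -
  have "0 \<le> (LINT v|lborel. g (x, v) * (norm (v - w x))\<^sup>2)" by (simp add: nonneg)
  then show ?thesis using variance_slice[OF assms, of c] by linarith
qed

lemma mass_measurable [measurable]: "m \<in> borel_measurable borel"
  unfolding mass_density_def[abs_def] by measurable

lemma mean_measurable [measurable]: "w \<in> borel_measurable borel"
  unfolding mean_velocity_def[abs_def] by measurable

lemma integrable_mass: "integrable lborel m"
  and integral_mass: "(LINT x|lborel. m x) = (LINT z|lborel. g z)"
  using lborel_pair.integrable_fst'[of g] lborel_pair.integral_fst'[of g] integrable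
  by (simp_all add: mass_density_def[abs_def] lborel_prod)

text \<open>Passes from the kinetic deviation of \<open>v\<close> from \<open>c\<close> to the
  deviation of the mean velocity, the quantity estimated in the theorem.\<close>

lemma
  fixes c :: "real^'d \<Rightarrow> real^'d"
  assumes [measurable]: "c \<in> borel_measurable borel"
    and i: "integrable lborel (\<lambda>(x, v). g (x, v) * (norm (v - c x))\<^sup>2)"
  shows integrable_jensen: "integrable lborel (\<lambda>x. m x * (norm (w x - c x))\<^sup>2)"
    and integral_jensen: "(LINT x|lborel. m x * (norm (w x - c x))\<^sup>2)
        \<le> (LINT (x, v)|lborel. g (x, v) * (norm (v - c x))\<^sup>2)"
proof -
  let ?h = "\<lambda>x. LINT v|lborel. g (x, v) * (norm (v - c x))\<^sup>2"
  have hi: "integrable lborel ?h"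
    and hI: "(LINT x|lborel. ?h x) = (LINT (x, v)|lborel. g (x, v) * (norm (v - c x))\<^sup>2)"
    using lborel_pair.integrable_fst'[of "\<lambda>(x, v). g (x, v) * (norm (v - c x))\<^sup>2"]
      lborel_pair.integral_fst'[of "\<lambda>(x, v). g (x, v) * (norm (v - c x))\<^sup>2"] i by (simp_all add: lborel_prod)
  show *: "integrable lborel (\<lambda>x. m x * (norm (w x - c x))\<^sup>2)"
    by (rule Bochner_Integration.integrable_bound[OF hi])
      (use AE_good in \<open>auto elim!: eventually_mono simp: mass_nonneg intro: order_trans[OF jensen_slice abs_ge_self]\<close>)
  have "(LINT x|lborel. m x * (norm (w x - c x))\<^sup>2) \<le> (LINT x|lborel. ?h x)"
    by (rule integral_mono_AE[OF * hi]) (use AE_good in \<open>auto elim!: eventually_mono intro: jensen_slice\<close>)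
  then show "(LINT x|lborel. m x * (norm (w x - c x))\<^sup>2)
        \<le> (LINT (x, v)|lborel. g (x, v) * (norm (v - c x))\<^sup>2)" by (simp add: hI)
qed

lemma
  fixes c :: "real^'d \<Rightarrow> real"
  assumes [measurable]: "c \<in> borel_measurable borel" and i: "integrable lborel (\<lambda>x. m x * c x)"
    and nn: "\<And>x. c x \<ge> 0"
  shows integrable_mass_weight: "integrable lborel (\<lambda>(x, v). g (x, v) * c x)"
    and integral_mass_weight: "(LINT (x, v)|lborel. g (x, v) * c x) = (LINT x|lborel. m x * c x)"
proof -
  have "integrable (lborel \<Otimes>\<^sub>M lborel) (\<lambda>(x, v). g (x, v) * c x)"
  proof (rule lborel_pair.Fubini_integrable)
    show "integrable lborel (\<lambda>x. LINT v|lborel. norm (case (x, v) of (x, v) \<Rightarrow> g (x, v) * c x))"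
      using i by (simp add: nonneg nn mass_density_def)
    show "AE x in lborel. integrable lborel (\<lambda>v. case (x, v) of (x, v) \<Rightarrow> g (x, v) * c x)"
      using AE_good by (auto elim!: eventually_mono simp: good_def)
  qed measurable
  then show "integrable lborel (\<lambda>(x, v). g (x, v) * c x)"
    and "(LINT (x, v)|lborel. g (x, v) * c x) = (LINT x|lborel. m x * c x)"
    using lborel_pair.integral_fst'[of "\<lambda>(x, v). g (x, v) * c x"]
    by (simp_all add: lborel_prod mass_density_def)
qed

text \<open>Jensen's inequality with \<open>c = 0\<close>; this is what allows \<open>|U|^2\<close>
  into the weight \<open>q\<close>.\<close>

lemma
  integrable_mean_energy: "integrable lborel (\<lambda>(x, v). g (x, v) * (norm (w x))\<^sup>2)" and
  integral_mean_energy: "(LINT (x, v)|lborel. g (x, v) * (norm (w x))\<^sup>2) \<le> (LINT (x, v)|lborel. (norm v)\<^sup>2 * g (x, v))"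
proof -
  have i: "integrable lborel (\<lambda>(x, v). g (x, v) * (norm (v - 0))\<^sup>2)"
    using energy by (simp add: mult.commute)
  from integrable_jensen[OF _ i] have *: "integrable lborel (\<lambda>x. m x * (norm (w x))\<^sup>2)" by simp
  from integral_jensen[OF _ i] have **: "(LINT x|lborel. m x * (norm (w x))\<^sup>2) \<le> (LINT (x, v)|lborel. (norm v)\<^sup>2 * g (x, v))"
    by (simp add: mult.commute)
  show "integrable lborel (\<lambda>(x, v). g (x, v) * (norm (w x))\<^sup>2)"
    by (rule integrable_mass_weight) (use * in auto)
  show "(LINT (x, v)|lborel. g (x, v) * (norm (w x))\<^sup>2) \<le> (LINT (x, v)|lborel. (norm v)\<^sup>2 * g (x, v))"
    by (subst integral_mass_weight) (use * ** in auto)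
qed

end

section \<open>Kinetic solutions\<close>

locale kinetic =
  fixes lam \<epsilon> :: real and f0 :: "(real^'d) \<times> (real^'d) \<Rightarrow> real"
    and f :: "real \<Rightarrow> (real^'d) \<times> (real^'d) \<Rightarrow> real"
  assumes lam_nonneg: "lam \<ge> 0" and eps_pos: "\<epsilon> > 0"
    and phase0: "phase_density f0"
    and f_nonneg: "\<And>t z. t \<ge> 0 \<Longrightarrow> f t z \<ge> 0"
    and weak: "weak_solution lam \<epsilon> f0 f"
    and init: "AE z in lborel. f 0 z = f0 z"
    and mass: "conserves_mass f0 f"
    and entropy: "entropy_inequality lam \<epsilon> f0 f"
begin

text \<open>Extension by 0 to negative times makes the density jointly Borel measurable on the whole
  line, so measurability in time and phase space carries no side condition.\<close>

definition F :: "real \<Rightarrow> (real^'d) \<times> (real^'d) \<Rightarrow> real" where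
  "F t z = (if t \<ge> 0 then f t z else 0)"

lemma F_eq: "t \<ge> 0 \<Longrightarrow> F t = f t"
  by (simp add: F_def fun_eq_iff)

definition M0 :: real where "M0 = (LINT z|lborel. f0 z)"
definition E0 :: real where "E0 = (LINT (x, v)|lborel. (norm v)\<^sup>2 * f0 (x, v))"
definition En :: "real \<Rightarrow> real" where "En t = (LINT (x, v)|lborel. (norm v)\<^sup>2 * F t (x, v))"
definition U :: "real \<Rightarrow> real^'d \<Rightarrow> real^'d" where "U t = mean_velocity (F t)"

lemma M0_nonneg: "M0 \<ge> 0" and E0_nonneg: "E0 \<ge> 0"
  unfolding M0_def E0_def
  by (auto intro!: Bochner_Integration.integral_nonneg simp: phase_density.nonneg[OF phase0])

text \<open>The weak formulation gives measurability on each slab \<open>[0, n + 1)\<close>, and the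
  restrictions to these slabs converge pointwise to \<open>F\<close>.\<close>

lemma F_measurable_borel: "(\<lambda>(t, z). F t z) \<in> borel_measurable borel"
proof -
  have s: "(\<lambda>p. indicator ({0..<real n + 1} \<times> UNIV) p *\<^sub>R (case p of (t, z) \<Rightarrow> f t z)) \<in> borel_measurable borel" for n
    using weak by (simp add: weak_solution_def set_borel_measurable_def add_pos_nonneg)
  show ?thesis
  proof (rule borel_measurable_LIMSEQ_metric[OF s])
    fix p :: "real \<times> ((real^'d) \<times> (real^'d))"
    obtain t z where p: "p = (t, z)" by (cases p)
    have "eventually (\<lambda>n. indicator ({0..<real n + 1} \<times> UNIV) p *\<^sub>R (case p of (t, z) \<Rightarrow> f t z) = (case p of (t, z) \<Rightarrow> F t z)) sequentially"
      unfolding eventually_sequentially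
    proof (rule exI, intro allI impI)
      fix n :: nat assume n: "nat \<lceil>t\<rceil> \<le> n"
      then have "t \<le> real n" by linarith
      then show "indicator ({0..<real n + 1} \<times> UNIV) p *\<^sub>R (case p of (t, z) \<Rightarrow> f t z) = (case p of (t, z) \<Rightarrow> F t z)"
        by (auto simp: p F_def indicator_def)
    qed
    then show "(\<lambda>n. indicator ({0..<real n + 1} \<times> UNIV) p *\<^sub>R (case p of (t, z) \<Rightarrow> f t z)) \<longlonglongrightarrow> (case p of (t, z) \<Rightarrow> F t z)"
      by (rule tendsto_eventually)
  qed
qed

lemma F_measurable: "(\<lambda>p. F (fst p) (snd p)) \<in> borel_measurable (borel \<Otimes>\<^sub>M (borel \<Otimes>\<^sub>M borel))"
  using F_measurable_borel by (simp add: borel_prod case_prod_beta case_prod_beta')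

lemma F_measurable' [measurable (raw)]:
  assumes [measurable]: "g \<in> borel_measurable M" "h \<in> M \<rightarrow>\<^sub>M (borel \<Otimes>\<^sub>M borel)"
  shows "(\<lambda>p. F (g p) (h p)) \<in> borel_measurable M"
proof -
  have "(\<lambda>p. (g p, h p)) \<in> M \<rightarrow>\<^sub>M (borel \<Otimes>\<^sub>M (borel \<Otimes>\<^sub>M borel))" by measurable
  from measurable_compose[OF this F_measurable] show ?thesis by simp
qed

lemma entropy_nn:
  assumes "t > 0"
  shows "(\<integral>\<^sup>+(x, v). ennreal ((norm v)\<^sup>2 / 2 * F t (x, v)) \<partial>lborel)
     + ennreal lam * (\<integral>\<^sup>+\<tau>\<in>{0..t}. (\<integral>\<^sup>+(x, v). ennreal ((norm v)\<^sup>2 * F \<tau> (x, v)) \<partial>lborel) \<partial>lborel)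
     \<le> ennreal (E0 / 2)"
proof -
  have eq: "(\<integral>\<^sup>+\<tau>\<in>{0..t}. (\<integral>\<^sup>+(x, v). ennreal ((norm v)\<^sup>2 * F \<tau> (x, v)) \<partial>lborel) \<partial>lborel)
     = (\<integral>\<^sup>+\<tau>\<in>{0..t}. (\<integral>\<^sup>+(x, v). ennreal ((norm v)\<^sup>2 * f \<tau> (x, v)) \<partial>lborel) \<partial>lborel)"
    by (intro nn_integral_cong) (auto simp: F_eq indicator_def)
  have i0: "integrable lborel (\<lambda>(x, v). (norm v)\<^sup>2 / 2 * f0 (x, v))"
    using integrable_mult_right[OF phase_density.energy[OF phase0], of "1/2"] by (simp add: case_prod_beta case_prod_beta')
  have "(\<integral>\<^sup>+(x, v). ennreal ((norm v)\<^sup>2 / 2 * f0 (x, v)) \<partial>lborel)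
      = ennreal (LINT (x, v)|lborel. (norm v)\<^sup>2 / 2 * f0 (x, v))"
    using nn_integral_eq_integral[OF i0] phase_density.nonneg[OF phase0] by (simp add: case_prod_beta case_prod_beta')
  also have "(LINT (x, v)|lborel. (norm v)\<^sup>2 / 2 * f0 (x, v)) = E0 / 2"
    using integral_mult_right_zero[of lborel "1/2" "\<lambda>(x, v). (norm v)\<^sup>2 * f0 (x, v)"]
    by (simp add: E0_def case_prod_beta case_prod_beta')
  finally have e0: "(\<integral>\<^sup>+(x, v). ennreal ((norm v)\<^sup>2 / 2 * f0 (x, v)) \<partial>lborel) = ennreal (E0 / 2)" .
  have *: "A + C \<le> D" if "A + B + C \<le> D" for A B C D :: ennreal
  proof -
    have "A \<le> A + B" by (rule add_increasing2) auto
    from add_right_mono[OF this, of C] show ?thesis using that by (rule order_trans)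
  qed
  show ?thesis
    unfolding eq F_eq[OF less_imp_le[OF assms]]
    by (rule *[OF entropy[unfolded entropy_inequality_def e0, rule_format, OF assms]])
qed

text \<open>The weak formulation bounds the energy only for almost every time. Finiteness at every
  time comes from the entropy inequality for \<open>t > 0\<close> and from the data at
  \<open>t = 0\<close>.\<close>

lemma phase_F: "phase_density (F t)"
proof (cases "t < 0")
  case True
  then have "F t = (\<lambda>_. 0)" by (auto simp: F_def)
  then show ?thesis by unfold_locales (auto simp: case_prod_beta')
next
  case False
  then have t: "t \<ge> 0" by simp
  have nn: "F t z \<ge> 0" for z using f_nonneg by (simp add: F_def)
  have i: "integrable lborel (F t)"
    using weak[unfolded weak_solution_def, rule_format, of "t + 1"] t by (simp add: F_eq)
  have [measurable]: "F t \<in> borel_measurable (borel \<Otimes>\<^sub>M borel)" by measurable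
  have e: "integrable lborel (\<lambda>(x, v). (norm v)\<^sup>2 * F t (x, v))"
  proof (cases "t = 0")
    case True
    have ae: "AE z in lborel. (\<lambda>(x, v). (norm v)\<^sup>2 * F t (x, v)) z = (\<lambda>(x, v). (norm v)\<^sup>2 * f0 (x, v)) z"
      using init by eventually_elim (auto simp: True F_eq)
    have "(\<lambda>(x, v). (norm v)\<^sup>2 * F t (x, v)) \<in> borel_measurable lborel"
      by (simp add: lborel_prod[symmetric])
    with ae phase_density.energy[OF phase0] show ?thesis
      using integrable_cong_AE[OF _ borel_measurable_integrable[OF phase_density.energy[OF phase0]] ae] by blast
  next
    case False
    then have "t > 0" using t by simp
    from entropy_nn[OF this] have "(\<integral>\<^sup>+(x, v). ennreal ((norm v)\<^sup>2 / 2 * F t (x, v)) \<partial>lborel) \<le> ennreal (E0 / 2)"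
      by (rule order_trans[rotated]) simp
    then have "(\<integral>\<^sup>+(x, v). ennreal ((norm v)\<^sup>2 / 2 * F t (x, v)) \<partial>lborel) < \<infinity>"
      by (rule le_less_trans) simp
    moreover have "(\<lambda>z. (norm (snd z))\<^sup>2 / 2 * F t z) \<in> borel_measurable (lborel \<Otimes>\<^sub>M lborel)"
      by measurable
    ultimately have "integrable (lborel \<Otimes>\<^sub>M lborel) (\<lambda>(x, v). (norm v)\<^sup>2 / 2 * F t (x, v))"
      by (intro integrableI_bounded) (auto simp: case_prod_beta' nn lborel_prod)
    then have "integrable lborel (\<lambda>z. 2 * (case z of (x, v) \<Rightarrow> (norm v)\<^sup>2 / 2 * F t (x, v)))"
      by (simp add: lborel_prod)
    then show ?thesis by (simp add: case_prod_beta case_prod_beta')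
  qed
  show ?thesis by unfold_locales (use nn i e in auto)
qed

sublocale ph: phase_density "F t" for t
  by (rule phase_F)

lemma F_nonneg: "F t z \<ge> 0" by (rule ph.nonneg)
lemma F_integrable: "integrable lborel (F t)" by (rule ph.integrable)

lemma mass_F: "t \<ge> 0 \<Longrightarrow> (LINT z|lborel. F t z) = M0"
proof (cases "t = 0")
  case True
  have "(LINT z|lborel. F t z) = (LINT z|lborel. f0 z)"
    by (rule integral_cong_AE[OF borel_measurable_integrable[OF F_integrable]
          borel_measurable_integrable[OF phase_density.integrable[OF phase0]]])
      (use init in \<open>simp add: True F_eq\<close>)
  then show ?thesis by (simp add: M0_def)
next
  case False
  assume "t \<ge> 0"
  with False have "t > 0" by simp
  then show ?thesis
    using mass f_nonneg phase_density.nonneg[OF phase0]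
    by (simp add: conserves_mass_def M0_def F_eq)
qed

lemma mass_F_le: "(LINT z|lborel. F t z) \<le> M0"
proof (cases "t \<ge> 0")
  case False
  then show ?thesis using M0_nonneg by (simp add: F_def)
qed (simp add: mass_F)

lemma En_nonneg: "En t \<ge> 0"
  unfolding En_def by (auto intro!: Bochner_Integration.integral_nonneg simp: F_nonneg)

lemma En_measurable [measurable]: "En \<in> borel_measurable borel"
proof -
  have "(\<lambda>t. LINT z|(lborel \<Otimes>\<^sub>M lborel). (norm (snd z))\<^sup>2 * F t z) \<in> borel_measurable borel"
    by measurable
  then show ?thesis by (simp add: En_def[abs_def] lborel_prod case_prod_beta case_prod_beta')
qed

lemma nn_En: "(\<integral>\<^sup>+(x, v). ennreal ((norm v)\<^sup>2 * F t (x, v)) \<partial>lborel) = ennreal (En t)"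
  using nn_integral_eq_integral[OF ph.energy[of t]] F_nonneg by (simp add: En_def case_prod_beta case_prod_beta')

lemma nn_En_half: "(\<integral>\<^sup>+(x, v). ennreal ((norm v)\<^sup>2 / 2 * F t (x, v)) \<partial>lborel) = ennreal (En t / 2)"
proof -
  have i: "integrable lborel (\<lambda>z. 1 / 2 * ((norm (snd z))\<^sup>2 * F t z))"
    using ph.energy[of t] by (simp add: case_prod_beta')
  from nn_integral_eq_integral[OF i] show ?thesis
    by (simp add: F_nonneg case_prod_beta' En_def)
qed

lemma En_le: "En t \<le> E0"
proof (cases "t > 0")
  case True
  have "ennreal (En t / 2) \<le> ennreal (E0 / 2)"
    by (rule order_trans[OF _ entropy_nn[OF True, unfolded nn_En_half]]) simp
  then show ?thesis using E0_nonneg by (simp add: ennreal_le_iff)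
next
  case False
  then consider "t < 0" | "t = 0" by linarith
  then show ?thesis
  proof cases
    case 1 then show ?thesis using E0_nonneg by (simp add: En_def F_def case_prod_beta')
  next
    case 2
    have "En t = E0"
      unfolding En_def E0_def using init
      by (intro integral_cong_AE borel_measurable_integrable ph.energy phase_density.energy[OF phase0])
        (auto simp: 2 F_eq)
    then show ?thesis by simp
  qed
qed

lemma En_entropy:
  assumes t: "t \<ge> 0"
  shows "En t / 2 + lam * (LINT \<tau>:{0..t}|lborel. En \<tau>) \<le> E0 / 2"
proof (cases "t = 0")
  case True
  have "(LINT \<tau>:{0..0}|lborel. En \<tau>) = 0"
    unfolding set_lebesgue_integral_def
    by (intro integral_eq_zero_AE AE_I'[of "{0}"]) (auto simp: indicator_def)
  then show ?thesis using En_le[of t] True by simp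
next
  case False
  then have t: "t > 0" using t by simp
  have i: "integrable lborel (\<lambda>\<tau>. indicator {0..t} \<tau> * En \<tau>)"
  proof (rule Bochner_Integration.integrable_bound[of _ "\<lambda>\<tau>. E0 * indicator {0..t} \<tau>"])
    show "integrable lborel (\<lambda>\<tau>. E0 * indicator {0..t} \<tau>)"
      by (intro integrable_mult_right integrable_real_indicator) (auto simp: emeasure_lborel_Icc_eq)
    show "AE \<tau> in lborel. norm (indicator {0..t} \<tau> * En \<tau>) \<le> norm (E0 * indicator {0..t} \<tau>)"
      using En_le En_nonneg E0_nonneg by (auto simp: indicator_def)
  qed measurable
  have "(\<integral>\<^sup>+\<tau>\<in>{0..t}. (\<integral>\<^sup>+(x, v). ennreal ((norm v)\<^sup>2 * F \<tau> (x, v)) \<partial>lborel) \<partial>lborel)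
      = (\<integral>\<^sup>+\<tau>. ennreal (indicator {0..t} \<tau> * En \<tau>) \<partial>lborel)"
    by (intro nn_integral_cong) (auto simp: nn_En indicator_def)
  also have "\<dots> = ennreal (LINT \<tau>:{0..t}|lborel. En \<tau>)"
    using nn_integral_eq_integral[OF i] En_nonneg by (simp add: set_lebesgue_integral_def)
  finally have "ennreal (En t / 2) + ennreal lam * ennreal (LINT \<tau>:{0..t}|lborel. En \<tau>) \<le> ennreal (E0 / 2)"
    using entropy_nn[OF t, unfolded nn_En_half] by simp
  moreover have "(LINT \<tau>:{0..t}|lborel. En \<tau>) \<ge> 0"
    unfolding set_lebesgue_integral_def by (simp add: En_nonneg)
  ultimately have "ennreal (En t / 2 + lam * (LINT \<tau>:{0..t}|lborel. En \<tau>)) \<le> ennreal (E0 / 2)"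
    using lam_nonneg En_nonneg[of t] by (simp add: ennreal_mult[symmetric] ennreal_plus[symmetric] del: ennreal_plus)
  then show ?thesis using E0_nonneg by (simp add: ennreal_le_iff)
qed

text \<open>Dominates everything the transport operator produces, including the relaxation term with
  the unbounded field \<open>U\<close>, while its moment stays finite: of the two multiples of
  \<open>E0\<close> in \<open>Q\<close>, one pays for \<open>|v|^2\<close>, the other for
  \<open>|U|^2\<close> by Jensen.\<close>

definition q :: "real \<Rightarrow> (real^'d) \<times> (real^'d) \<Rightarrow> real" where
  "q t = (\<lambda>(x, v). 1 + (norm v)\<^sup>2 + (norm (U t x))\<^sup>2)"

definition Q :: real where "Q = M0 + 2 * E0"

lemma Q_nonneg: "Q \<ge> 0" using M0_nonneg E0_nonneg by (simp add: Q_def)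

lemma q_ge_1: "q t z \<ge> 1" by (auto simp: q_def case_prod_beta case_prod_beta')

lemma integrable_Fq: "integrable lborel (\<lambda>z. F t z * q t z)"
  and integral_Fq: "(LINT z|lborel. F t z * q t z) \<le> Q"
proof -
  have eq: "F t z * q t z = F t z + (case z of (x, v) \<Rightarrow> (norm v)\<^sup>2 * F t (x, v)) + (case z of (x, v) \<Rightarrow> F t (x, v) * (norm (U t x))\<^sup>2)" for z
    by (cases z) (simp add: q_def algebra_simps)
  have i: "integrable lborel (\<lambda>(x, v). F t (x, v) * (norm (U t x))\<^sup>2)"
    unfolding U_def by (rule ph.integrable_mean_energy)
  have l: "(LINT (x, v)|lborel. F t (x, v) * (norm (U t x))\<^sup>2) \<le> E0"
    using ph.integral_mean_energy[of t] En_le[of t] unfolding U_def En_def by linarith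
  show "integrable lborel (\<lambda>z. F t z * q t z)"
    unfolding eq by (intro Bochner_Integration.integrable_add F_integrable ph.energy i)
  show "(LINT z|lborel. F t z * q t z) \<le> Q"
    unfolding eq using i ph.energy[of t] F_integrable[of t] l mass_F_le[of t] En_le[of t]
    by (simp add: Q_def En_def)
qed

lemma U_measurable' [measurable (raw)]:
  assumes [measurable]: "g \<in> borel_measurable M" "h \<in> borel_measurable M"
  shows "(\<lambda>p. U (g p) (h p)) \<in> borel_measurable M"
  unfolding U_def mean_velocity_def mass_density_def by measurable

lemma q_measurable' [measurable (raw)]:
  assumes [measurable]: "g \<in> borel_measurable M" "h \<in> M \<rightarrow>\<^sub>M (borel \<Otimes>\<^sub>M borel)"
  shows "(\<lambda>p. q (g p) (h p)) \<in> borel_measurable M"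
  unfolding q_def case_prod_beta by measurable

section \<open>Moments of observables dominated by the weight \<open>q\<close>\<close>

context
  fixes G :: "real \<Rightarrow> (real^'d) \<times> (real^'d) \<Rightarrow> real" and C :: real and S :: "real set"
  assumes G_meas: "(\<lambda>p. G (fst p) (snd p)) \<in> borel_measurable (borel \<Otimes>\<^sub>M (borel \<Otimes>\<^sub>M borel))"
    and G_bound: "\<And>t z. t \<in> S \<Longrightarrow> \<bar>G t z\<bar> \<le> C * q t z"
    and S [measurable]: "S \<in> sets borel" and S_fin: "emeasure lborel S < \<infinity>"
begin

lemma G_measurable':
  assumes [measurable]: "g \<in> borel_measurable M" "h \<in> M \<rightarrow>\<^sub>M (borel \<Otimes>\<^sub>M borel)"
  shows "(\<lambda>p. G (g p) (h p)) \<in> borel_measurable M"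
proof -
  have "(\<lambda>p. (g p, h p)) \<in> M \<rightarrow>\<^sub>M (borel \<Otimes>\<^sub>M (borel \<Otimes>\<^sub>M borel))" by measurable
  from measurable_compose[OF this G_meas] show ?thesis by simp
qed

lemma FG_bound: "t \<in> S \<Longrightarrow> \<bar>F t z * G t z\<bar> \<le> C * (F t z * q t z)"
  using mult_left_mono[OF G_bound[of t z] F_nonneg[of t z]] by (simp add: abs_mult F_nonneg mult_ac)

text \<open>A singleton \<open>S\<close> serves statements at one time, an interval serves integrals
  over time.\<close>

lemma FG_integrable: "t \<in> S \<Longrightarrow> integrable lborel (\<lambda>z. F t z * G t z)"
proof -
  note G_measurable' [measurable (raw)]
  assume t: "t \<in> S"
  have "(\<lambda>z. F t z * G t z) \<in> borel_measurable (lborel \<Otimes>\<^sub>M lborel)" by measurable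
  then show ?thesis
    by (intro Bochner_Integration.integrable_bound[OF integrable_mult_right[OF integrable_Fq[of t], of C]])
      (use FG_bound[OF t] in \<open>auto simp: lborel_prod intro!: AE_I2 intro: order_trans[OF _ abs_ge_self]\<close>)
qed

lemma FG_integral_le: "t \<in> S \<Longrightarrow> \<bar>LINT z|lborel. F t z * G t z\<bar> \<le> C * Q"
proof -
  assume t: "t \<in> S"
  \<comment> \<open>The sign of \<open>C\<close> is not assumed; it follows from
    \<open>q \<ge> 1\<close> and the bound on \<open>G\<close> at a time in
    \<open>S\<close>.\<close>
  have C: "C \<ge> 0"
  proof (rule ccontr)
    assume "\<not> C \<ge> 0"
    then have "C * q t 0 < 0" using q_ge_1[of t 0] by (simp add: mult_neg_pos)
    then show False using G_bound[OF t, of 0] by linarith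
  qed
  have "\<bar>LINT z|lborel. F t z * G t z\<bar> \<le> (LINT z|lborel. C * (F t z * q t z))"
    by (rule order_trans[OF integral_abs_bound], rule integral_mono)
      (use FG_integrable[OF t] integrable_Fq[of t] FG_bound[OF t] in auto)
  also have "\<dots> \<le> C * Q"
    using C integral_Fq[of t] by (simp add: mult_left_mono)
  finally show ?thesis .
qed

lemma FG_time_measurable: "(\<lambda>t. LINT z|lborel. F t z * G t z) \<in> borel_measurable borel"
proof -
  note G_measurable' [measurable (raw)]
  have "(\<lambda>t. LINT z|(lborel \<Otimes>\<^sub>M lborel). F t z * G t z) \<in> borel_measurable borel"
    by measurable
  then show ?thesis by (simp add: lborel_prod)
qed

lemma FG_set_integrable: "set_integrable lborel S (\<lambda>t. LINT z|lborel. F t z * G t z)"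
  unfolding set_integrable_def
proof (rule Bochner_Integration.integrable_bound[of _ "\<lambda>t. C * Q * indicator S t"])
  show "integrable lborel (\<lambda>t. C * Q * indicator S t)"
    using S_fin by simp
  show "AE t in lborel. norm (indicator S t *\<^sub>R (LINT z|lborel. F t z * G t z)) \<le> norm (C * Q * indicator S t)"
    using FG_integral_le by (intro AE_I2) (auto simp: indicator_def intro: order_trans[OF _ abs_ge_self])
qed (use FG_time_measurable in measurable)

lemma
  FG_joint_integrable: "integrable lborel (\<lambda>(t, z). indicator S t * (F t z * G t z))" and
  FG_joint_integral: "(LINT (t, z)|lborel. indicator S t * (F t z * G t z)) = (LINT t:S|lborel. LINT z|lborel. F t z * G t z)"
proof -
  note G_measurable' [measurable (raw)]
  have G: "\<And>t z. t \<in> S \<Longrightarrow> \<bar>\<bar>G t z\<bar>\<bar> \<le> C * q t z" using G_bound by simp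
  let ?m = "lborel \<Otimes>\<^sub>M (lborel \<Otimes>\<^sub>M lborel) :: (real \<times> (real^'d) \<times> (real^'d)) measure"
  have "integrable (lborel \<Otimes>\<^sub>M (lborel :: ((real^'d) \<times> (real^'d)) measure)) (\<lambda>(t, z). indicator S t * (F t z * G t z))"
  proof (rule lborel_pair.Fubini_integrable)
    have "(\<lambda>(t, z). indicator S t * (F t z * G t z)) \<in> borel_measurable ?m"
      by measurable
    then show "(\<lambda>(t, z). indicator S t * (F t z * G t z)) \<in> borel_measurable (lborel \<Otimes>\<^sub>M (lborel :: ((real^'d) \<times> (real^'d)) measure))"
      by (simp add: lborel_prod)
    have "(\<lambda>t. LINT z|lborel. norm (case (t, z) of (t, z) \<Rightarrow> indicator S t * (F t z * G t z)))
        = (\<lambda>t. indicator S t *\<^sub>R (LINT z|lborel. \<bar>F t z * G t z\<bar>))"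
      by (auto simp: indicator_def fun_eq_iff)
    moreover have "integrable lborel (\<lambda>t. indicator S t *\<^sub>R (LINT z|lborel. \<bar>F t z * G t z\<bar>))"
    proof (rule Bochner_Integration.integrable_bound[of _ "\<lambda>t. C * Q * indicator S t"])
      show "integrable lborel (\<lambda>t. C * Q * indicator S t)" using S_fin by simp
      have "(\<lambda>t. LINT z|(lborel \<Otimes>\<^sub>M lborel). \<bar>F t z * G t z\<bar>) \<in> borel_measurable borel"
        by measurable
      then have [measurable]: "(\<lambda>t. LINT z|lborel. \<bar>F t z * G t z\<bar>) \<in> borel_measurable borel"
        by (simp add: lborel_prod)
      show "(\<lambda>t. indicator S t *\<^sub>R (LINT z|lborel. \<bar>F t z * G t z\<bar>)) \<in> borel_measurable lborel" by measurable
      have "(LINT z|lborel. \<bar>F t z * G t z\<bar>) \<le> C * Q" if t: "t \<in> S" for t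
      proof -
        have "C \<ge> 0"
        proof (rule ccontr)
          assume "\<not> C \<ge> 0"
          then have "C * q t 0 < 0" using q_ge_1[of t 0] by (simp add: mult_neg_pos)
          then show False using G_bound[OF t, of 0] by linarith
        qed
        moreover have "(LINT z|lborel. \<bar>F t z * G t z\<bar>) \<le> (LINT z|lborel. C * (F t z * q t z))"
          by (rule integral_mono) (use FG_integrable[OF t] integrable_Fq[of t] FG_bound[OF t] in auto)
        ultimately show ?thesis using mult_left_mono[OF integral_Fq[of t], of C] by simp
      qed
      then show "AE t in lborel. norm (indicator S t *\<^sub>R (LINT z|lborel. \<bar>F t z * G t z\<bar>)) \<le> norm (C * Q * indicator S t)"
        by (intro AE_I2) (auto simp: indicator_def intro: order_trans[OF _ abs_ge_self])
    qed
    ultimately show "integrable lborel (\<lambda>t. LINT z|lborel. norm (case (t, z) of (t, z) \<Rightarrow> indicator S t * (F t z * G t z)))"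
      by simp
    show "AE t in lborel. integrable lborel (\<lambda>z. case (t, z) of (t, z) \<Rightarrow> indicator S t * (F t z * G t z))"
      using FG_integrable by (intro AE_I2) (auto simp: indicator_def)
  qed
  then show "integrable lborel (\<lambda>(t, z). indicator S t * (F t z * G t z))"
    and "(LINT (t, z)|lborel. indicator S t * (F t z * G t z)) = (LINT t:S|lborel. LINT z|lborel. F t z * G t z)"
    using lborel_pair.integral_fst'[of "\<lambda>(t, z). indicator S t * (F t z * G t z)"]
    by (simp_all add: lborel_prod set_lebesgue_integral_def)
qed

end

text \<open>The interval \<open>[0, t + 1)\<close> is a neighbourhood of \<open>t\<close> within the
  half-line, so continuity relative to it is continuity on the half-line.\<close>

lemma F_L1_continuous:
  assumes "t \<ge> 0"
  shows "((\<lambda>\<tau>. LINT z|lborel. \<bar>F \<tau> z - F t z\<bar>) \<longlongrightarrow> 0) (at t within {0..})"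
proof -
  have "((\<lambda>\<tau>. LINT z|lborel. \<bar>f \<tau> z - f t z\<bar>) \<longlongrightarrow> 0) (at t within {0..<t + 1})"
    using weak[unfolded weak_solution_def, rule_format, of "t + 1"] assms by simp
  moreover have "at t within {0..<t + 1} = at t within {0..}"
    by (rule at_within_nhd[of _ "{..<t + 1}"]) auto
  ultimately have "((\<lambda>\<tau>. LINT z|lborel. \<bar>f \<tau> z - f t z\<bar>) \<longlongrightarrow> 0) (at t within {0..})" by simp
  then show ?thesis
    by (rule Lim_transform_eventually) (use assms in \<open>auto simp: eventually_at_filter F_def\<close>)
qed

end

section \<open>Test functions for the weak formulation\<close>

lemma compact_support_bounded:
  fixes g :: "'a::euclidean_space \<Rightarrow> 'b::real_normed_vector"
  assumes "continuous_on UNIV g" "\<And>z. norm z > R \<Longrightarrow> g z = 0"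
  obtains K where "K \<ge> 0" "\<And>z. norm (g z) \<le> K"
proof -
  have "compact (g ` cball 0 R)"
    using assms(1) by (intro compact_continuous_image) (auto intro: continuous_on_subset)
  then have "bounded (g ` cball 0 R)" by (rule compact_imp_bounded)
  then obtain K where K: "\<And>z. norm z \<le> R \<Longrightarrow> norm (g z) \<le> K"
    by (force simp: bounded_iff)
  have "norm (g z) \<le> max 0 K" for z
    using K[of z] assms(2)[of z] by (cases "norm z \<le> R") auto
  then show ?thesis using that[of "max 0 K"] by auto
qed

lemma derivative_zero_outside_support:
  fixes \<psi> :: "'a::euclidean_space \<Rightarrow> real"
  assumes D: "(\<psi> has_derivative D) (at z)" and supp: "\<And>z. norm z > R \<Longrightarrow> \<psi> z = 0" and z: "norm z > R"
  shows "D h = 0"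
proof -
  have "open {z::'a. norm z > R}"
    by (intro open_Collect_less continuous_intros)
  have "((\<lambda>_. 0) has_derivative D) (at z)"
    by (rule has_derivative_transform_within_open[OF D \<open>open _\<close>]) (use z supp in auto)
  then have "D = (\<lambda>_. 0)"
    by (rule has_derivative_unique) (rule has_derivative_const)
  then show ?thesis by simp
qed

lemma compact_support_derivative_bounded:
  fixes \<psi> :: "'a::euclidean_space \<Rightarrow> real"
  assumes D: "\<And>z. (\<psi> has_derivative D z) (at z)" and c: "\<And>h. continuous_on UNIV (\<lambda>z. D z h)"
    and supp: "\<And>z. norm z > R \<Longrightarrow> \<psi> z = 0"
  obtains K where "K \<ge> 0" "\<And>z h. \<bar>D z h\<bar> \<le> K * norm h"
proof -
  have "\<exists>K\<ge>0. \<forall>z. norm (D z i) \<le> K" for i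
    using compact_support_bounded[OF c[of i], of R] derivative_zero_outside_support[OF D supp] by metis
  then obtain K where K: "\<And>i. K i \<ge> 0" "\<And>i z. norm (D z i) \<le> K i" by metis
  show ?thesis
  proof (rule that[of "\<Sum>i\<in>Basis. K i"])
    show "0 \<le> (\<Sum>i\<in>(Basis::'a set). K i)" by (intro sum_nonneg K)
    fix z h :: 'a
    have "\<bar>D z h\<bar> = \<bar>\<Sum>i\<in>Basis. (h \<bullet> i) * D z i\<bar>"
      using linear_componentwise_sum[OF has_derivative_linear[OF D], of z h] by simp
    also have "\<dots> \<le> (\<Sum>i\<in>Basis. \<bar>h \<bullet> i\<bar> * \<bar>D z i\<bar>)"
      using sum_abs[of "\<lambda>i. (h \<bullet> i) * D z i" Basis] by (simp add: abs_mult)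
    also have "\<dots> \<le> (\<Sum>i\<in>Basis. norm h * K i)"
      using K by (intro sum_mono mult_mono Basis_le_norm) auto
    also have "\<dots> = (\<Sum>i\<in>Basis. K i) * norm h"
      by (subst sum_distrib_right) (simp add: mult.commute)
    finally show "\<bar>D z h\<bar> \<le> (\<Sum>i\<in>Basis. K i) * norm h" .
  qed
qed

lemma smooth_derivative_continuous:
  fixes \<psi> :: "'a::euclidean_space \<Rightarrow> real"
  assumes "smooth \<psi>"
  shows "(\<psi> has_derivative frechet_derivative \<psi> (at z)) (at z)"
    and "continuous_on UNIV (\<lambda>z. frechet_derivative \<psi> (at z) h)"
proof -
  have 1: "Ck (Suc 0) \<psi>" using assms unfolding smooth_def by blast
  show D: "(\<psi> has_derivative frechet_derivative \<psi> (at z)) (at z)" for z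
    by (rule Ck_Suc_has_derivative[OF 1])
  show "continuous_on UNIV (\<lambda>z. frechet_derivative \<psi> (at z) h)"
    by (subst linear_componentwise_sum[OF has_derivative_linear[OF D]])
      (use 1 in \<open>auto intro!: continuous_intros\<close>)
qed

text \<open>\<open>\<Theta>\<close> approximates the indicator of \<open>[0, t]\<close> from
  outside: it rises before time 0, equals 1 on \<open>[0, t]\<close>, and its rate of descent
  \<open>\<eta>\<close> has unit mass on \<open>[t, t + 2 * r]\<close>, hence acts as a point mass
  at \<open>t\<close> from the right when \<open>r\<close> is small.\<close>

lemma time_cutoff:
  fixes t r :: real
  assumes t: "t \<ge> 0" and r: "r > 0"
  shows "\<exists>\<Theta> \<eta> :: real \<Rightarrow> real. smooth \<Theta> \<and> (\<forall>s. s \<notin> {- 2 * r..t + 2 * r} \<longrightarrow> \<Theta> s = 0) \<and>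
    (\<forall>s\<ge>0. frechet_derivative \<Theta> (at s) 1 = - \<eta> s) \<and> (\<forall>s\<in>{0..t}. \<Theta> s = 1) \<and>
    (\<forall>s\<ge>0. 0 \<le> \<Theta> s \<and> \<Theta> s \<le> 1) \<and> continuous_on UNIV \<eta> \<and> (\<forall>s. \<eta> s \<ge> 0) \<and>
    (\<forall>s. s \<notin> {t..t + 2 * r} \<longrightarrow> \<eta> s = 0) \<and> has_bochner_integral lborel \<eta> 1"
proof -
  define N where "N = (LINT y|lborel. bump r (y::real))"
  have N: "N > 0" unfolding N_def by (rule bump_mass_pos[OF r])
  define h where "h s = bump r (s - (t + r)) * (1 / N)" for s :: real
  have Ckh: "Ck k h" for k
    unfolding h_def using Ck_compose_affine[OF bounded_linear_ident Ck_bump[of k r], of "- (t + r)"]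
    by (intro Ck_mult Ck_const) (simp add: algebra_simps)
  have ch: "continuous_on UNIV h" using Ck_imp_continuous_on[OF Ckh[of 0]] .
  have hnn: "h s \<ge> 0" for s using N by (simp add: h_def bump_nonneg)
  have h0: "h s = 0" if "s \<notin> {t..t + 2 * r}" for s
    using that r by (auto simp: h_def intro!: bump_eq_0)
  have m: "(bump r :: real \<Rightarrow> real) \<in> borel_measurable borel"
    using continuous_on_bump_UNIV by (rule borel_measurable_continuous_onI)
  have hint: "has_bochner_integral lborel h 1"
  proof -
    have "integrable lborel (\<lambda>s. bump r (- (t + r) + s :: real))"
      using integrable_lborel_translate[OF m] integrable_bump[OF r] by blast
    moreover have "(LINT s|lborel. bump r (- (t + r) + s :: real)) = N"
      unfolding N_def by (rule integral_lborel_translate[OF m])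
    moreover have "h = (\<lambda>s. bump r (- (t + r) + s) * (1 / N))"
      by (auto simp: h_def fun_eq_iff intro!: arg_cong[where f = "bump r"])
    ultimately show ?thesis using N by (simp only: has_bochner_integral_iff) simp
  qed
  obtain P0 where P0: "\<And>x. (P0 has_vector_derivative h x) (at x)"
    using einterval_antiderivative[of "-\<infinity>" "\<infinity>" h] ch
    by (auto simp: continuous_on_eq_continuous_at)
  define P where "P s = P0 s - P0 t" for s
  have P: "(P has_real_derivative h s) (at s)" for s
    unfolding P_def using P0[of s]
    by (auto intro!: derivative_eq_intros simp: has_real_derivative_iff_has_vector_derivative)
  have mono: "P a \<le> P b" if "a \<le> b" for a b
    using that P hnn by (intro DERIV_nonneg_imp_nondecreasing[of a b P]) auto
  have Pt: "P t = 0" by (simp add: P_def)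
  have Pl: "P s = 0" if "s \<le> t" for s
  proof -
    have "P s = P t"
    proof (cases "s = t")
      case False
      then have "s < t" using that by simp
      then show "P s = P t"
      proof (rule DERIV_isconst_end[symmetric])
        show "continuous_on {s..t} P" using P by (meson DERIV_continuous_on DERIV_subset top_greatest)
        show "DERIV P x :> 0" if "s < x" "x < t" for x
          using P[of x] h0[of x] that by simp
      qed
    qed simp
    then show ?thesis by (simp add: Pt)
  qed
  have Pr': "P s = P (t + 2 * r)" if "s \<ge> t + 2 * r" for s
  proof (cases "s = t + 2 * r")
    case False
    then have "t + 2 * r < s" using that by simp
    then show ?thesis
    proof (rule DERIV_isconst_end)
      show "continuous_on {t + 2 * r..s} P" using P by (meson DERIV_continuous_on DERIV_subset top_greatest)
      show "DERIV P x :> 0" if "t + 2 * r < x" "x < s" for x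
        using P[of x] h0[of x] that by simp
    qed
  qed simp
  have "has_bochner_integral lborel (\<lambda>x. h x * indicator {t..t + 2 * r} x) (P (t + 2 * r) - P t)"
    using r ch hnn P by (intro has_bochner_integral_FTC_Icc_nonneg)
      (auto simp: continuous_on_eq_continuous_at has_field_derivative_at_within borel_measurable_continuous_onI[OF ch])
  moreover have "(\<lambda>x. h x * indicator {t..t + 2 * r} x) = h"
    using h0 by (auto simp: indicator_def fun_eq_iff)
  ultimately have "P (t + 2 * r) = 1"
    using hint Pt by (simp add: has_bochner_integral_eq)
  then have Pr: "P s = 1" if "s \<ge> t + 2 * r" for s using Pr'[OF that] by simp
  \<comment> \<open>\<open>P\<close> climbs from 0 to 1 on \<open>[t, t + 2 * r]\<close>. Shifting
    it by \<open>c\<close> places the rise of \<open>\<Theta>\<close> on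
    \<open>[- 2 * r, 0]\<close>, so it is finished by time 0.\<close>
  define c where "c = t + 2 * r"
  define \<Theta> where "\<Theta> s = P (s + c) - P s" for s
  have D\<Theta>: "(\<Theta> has_derivative (\<lambda>y. (h (s + c) + (- 1) * h s) * y)) (at s)" for s
  proof -
    have "((\<lambda>s. P (s + c)) has_real_derivative h (s + c)) (at s)"
      using DERIV_shift[of P "h (s + c)" s c] P[of "s + c"] by simp
    from DERIV_diff[OF this P[of s]] show ?thesis
      by (simp add: \<Theta>_def[abs_def] has_field_derivative_def)
  qed
  have "Ck k \<Theta>" for k
  proof (cases k)
    case 0
    have "continuous_on UNIV \<Theta>"
      by (rule has_derivative_continuous_on[OF has_derivative_at_withinI[OF D\<Theta>]])
    with 0 show ?thesis by simp
  next
    case (Suc k')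
    have "Ck k' (\<lambda>s. h (s + c) + (- 1) * h s)"
      using Ck_compose_affine[OF bounded_linear_ident Ckh[of k'], of c]
      by (intro Ck_add Ck_mult Ck_const Ckh) simp
    then show ?thesis unfolding Suc
      by (intro Ck_SucI[OF D\<Theta>]) (auto intro: Ck_mult)
  qed
  then have sm: "smooth \<Theta>" by (simp add: smooth_def)
  have nn: "\<Theta> s = 1 - P s" if "s \<ge> 0" for s using that by (simp add: \<Theta>_def Pr c_def)
  have P01: "0 \<le> P s" "P s \<le> 1" for s
    using mono[of s t] mono[of t s] mono[of s "t + 2 * r"] mono[of "t + 2 * r" s] Pl[of s] Pr[of s] Pr[of "t + 2 * r"] Pt
    by (cases "s \<le> t"; cases "s \<le> t + 2 * r"; simp)+
  have 1: "\<Theta> s = 0" if "s \<notin> {- 2 * r..t + 2 * r}" for s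
  proof (cases "s < - 2 * r")
    case True
    then show ?thesis using t r by (simp add: \<Theta>_def c_def Pl)
  next
    case False
    then have "s > t + 2 * r" using that by simp
    then show ?thesis using t r by (simp add: \<Theta>_def c_def Pr)
  qed
  have 2: "frechet_derivative \<Theta> (at s) 1 = - h s" if "s \<ge> 0" for s
  proof -
    have "h (s + c) = 0 \<or> s = 0" using that r h0[of "s + c"] by (auto simp: c_def)
    moreover have "h c = 0" using r by (auto simp: h_def c_def intro!: bump_eq_0)
    ultimately show ?thesis
      using frechet_derivative_at[OF D\<Theta>[of s], symmetric] by auto
  qed
  have 3: "\<Theta> s = 1" if "s \<in> {0..t}" for s using that nn Pl by simp
  have 4: "0 \<le> \<Theta> s \<and> \<Theta> s \<le> 1" if "s \<ge> 0" for s using nn[OF that] P01[of s] by simp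
  show ?thesis
    by (rule exI[of _ \<Theta>], rule exI[of _ h]) (use sm 1 2 3 4 ch hnn h0 hint in blast)
qed

lemma measurable_linear_family:
  fixes D :: "'a::euclidean_space \<Rightarrow> 'b::euclidean_space \<Rightarrow> real"
  assumes D: "\<And>z. linear (D z)" "\<And>h. continuous_on UNIV (\<lambda>z. D z h)"
    and [measurable]: "g \<in> borel_measurable M" "h \<in> borel_measurable M"
  shows "(\<lambda>p. D (g p) (h p)) \<in> borel_measurable M"
proof -
  have "(\<lambda>p. D (g p) i) \<in> borel_measurable M" for i
    by (rule measurable_compose[OF assms(3) borel_measurable_continuous_onI[OF D(2)]])
  then have "(\<lambda>p. \<Sum>i\<in>Basis. (h p \<bullet> i) * D (g p) i) \<in> borel_measurable M"
    by measurable
  then show ?thesis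
    by (subst linear_componentwise_sum[OF D(1)]) simp
qed

context kinetic
begin

text \<open>Acceleration along kinetic characteristics: \<open>(snd z, W t z)\<close> is the
  phase-space velocity, and the operator in the weak formulation is the derivative along it.\<close>

definition W :: "real \<Rightarrow> (real^'d) \<times> (real^'d) \<Rightarrow> real^'d" where
  "W t z = (1 / \<epsilon>) *\<^sub>R (U t (fst z) - snd z) - lam *\<^sub>R snd z"

definition \<kappa> :: real where "\<kappa> = 1 + lam + 1 / \<epsilon>"

lemma \<kappa>_pos: "\<kappa> > 0"
  using lam_nonneg eps_pos by (simp add: \<kappa>_def add_nonneg_pos)

lemma norm_le_q: "norm (snd z) + norm (U t (fst z)) \<le> q t z"
proof -
  have "a \<le> 1 / 2 + a\<^sup>2" for a :: real
    using zero_le_power2[of "a - 1 / 2"] by (simp add: power2_eq_square algebra_simps)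
  from add_mono[OF this[of "norm (snd z)"] this[of "norm (U t (fst z))"]] show ?thesis
    by (simp add: q_def case_prod_beta)
qed

text \<open>Kept linear in the velocities, beside the quadratic \<open>W_bound\<close>, because
  \<open>weak_general\<close> multiplies it by a test function that itself grows linearly.\<close>

lemma W_bound_linear: "norm (snd z, W t z) \<le> \<kappa> * (norm (snd z) + norm (U t (fst z)))"
proof -
  let ?v = "snd z" and ?u = "U t (fst z)"
  have "norm (W t z) \<le> (1 / \<epsilon>) * norm (?u - ?v) + lam * norm ?v"
    unfolding W_def using norm_triangle_ineq4[of "(1 / \<epsilon>) *\<^sub>R (?u - ?v)" "lam *\<^sub>R ?v"] eps_pos lam_nonneg by simp
  also have "\<dots> \<le> (1 / \<epsilon>) * (norm ?v + norm ?u) + lam * (norm ?v + norm ?u)"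
    using eps_pos lam_nonneg norm_triangle_ineq4[of ?u ?v]
    by (intro add_mono mult_left_mono) auto
  finally have "norm ?v + norm (W t z) \<le> (norm ?v + norm ?u) + ((1 / \<epsilon>) * (norm ?v + norm ?u) + lam * (norm ?v + norm ?u))"
    by (intro add_mono) auto
  also have "\<dots> = \<kappa> * (norm ?v + norm ?u)"
    by (simp add: \<kappa>_def algebra_simps)
  finally show ?thesis using norm_Pair_le[of ?v "W t z"] by linarith
qed

lemma W_bound: "norm (snd z, W t z) \<le> \<kappa> * q t z"
  using order_trans[OF W_bound_linear mult_left_mono[OF norm_le_q less_imp_le[OF \<kappa>_pos]]] .

lemma W_measurable:
  assumes "g \<in> borel_measurable M" "h \<in> M \<rightarrow>\<^sub>M (borel \<Otimes>\<^sub>M borel)"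
  shows "(\<lambda>p. W (g p) (h p)) \<in> borel_measurable M"
proof -
  have 1: "(\<lambda>p. fst (h p)) \<in> borel_measurable M" and 2: "(\<lambda>p. snd (h p)) \<in> borel_measurable M"
    using measurable_compose[OF assms(2) measurable_fst] measurable_compose[OF assms(2) measurable_snd] by simp_all
  show ?thesis unfolding W_def
    by (intro borel_measurable_diff borel_measurable_scaleR borel_measurable_const U_measurable' assms(1) 1 2)
qed

lemma velocity_acceleration_measurable: "(\<lambda>p. (snd (snd p), W (fst p) (snd p))) \<in> borel_measurable borel"
proof -
  have 1: "(\<lambda>p. W (fst p) (snd p)) \<in> borel_measurable (borel \<Otimes>\<^sub>M (borel \<Otimes>\<^sub>M borel))"
    by (rule W_measurable[OF measurable_fst measurable_snd])
  have 2: "(\<lambda>p. snd (snd p)) \<in> borel_measurable (borel \<Otimes>\<^sub>M (borel \<Otimes>\<^sub>M borel))"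
    by (rule measurable_compose[OF measurable_snd measurable_snd])
  show ?thesis
    by (rule measurable_Pair[OF 2 1, unfolded borel_prod])
qed

lemma generator_measurable:
  fixes D :: "real \<times> (real^'d) \<times> (real^'d) \<Rightarrow> real \<times> (real^'d) \<times> (real^'d) \<Rightarrow> real"
  assumes "\<And>p. linear (D p)" "\<And>h. continuous_on UNIV (\<lambda>p. D p h)"
  shows "(\<lambda>p. D p (1, snd (snd p), W (fst p) (snd p))) \<in> borel_measurable borel"
proof (rule measurable_linear_family[OF assms])
  show "(\<lambda>p. (1::real, snd (snd p), W (fst p) (snd p))) \<in> borel_measurable borel"
    using measurable_Pair[OF borel_measurable_const[of "1::real"] velocity_acceleration_measurable] by (simp only: borel_prod)
qed simp

lemma space_generator_measurable:
  fixes D :: "(real^'d) \<times> (real^'d) \<Rightarrow> (real^'d) \<times> (real^'d) \<Rightarrow> real"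
  assumes "\<And>p. linear (D p)" "\<And>h. continuous_on UNIV (\<lambda>p. D p h)"
  shows "(\<lambda>p. D (snd p) (snd (snd p), W (fst p) (snd p))) \<in> borel_measurable borel"
proof (rule measurable_linear_family[OF assms _ velocity_acceleration_measurable])
  show "(\<lambda>p. snd p) \<in> borel_measurable borel"
    by (rule borel_measurable_continuous_onI[OF continuous_on_snd[OF continuous_on_id]])
qed

lemma integrable_F_bounded:
  assumes "continuous_on UNIV \<psi>" "\<And>z. \<bar>\<psi> z\<bar> \<le> K"
  shows "integrable lborel (\<lambda>z. F t z * \<psi> z)"
proof -
  have i: "integrable lborel (\<lambda>z. K * F t z)" using F_integrable by simp
  show ?thesis
  proof (rule Bochner_Integration.integrable_bound[OF i])
    show "(\<lambda>z. F t z * \<psi> z) \<in> borel_measurable lborel"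
      using borel_measurable_continuous_onI[OF assms(1)] borel_measurable_integrable[OF F_integrable[of t]] by simp
    have "\<bar>\<psi> z\<bar> * F t z \<le> \<bar>K\<bar> * F t z" for z
      using assms(2)[of z] F_nonneg by (intro mult_right_mono) auto
    then show "AE z in lborel. norm (F t z * \<psi> z) \<le> norm (K * F t z)"
      using F_nonneg by (intro AE_I2) (simp add: abs_mult mult.commute)
  qed
qed

text \<open>For a product test function the directional derivatives of the weak formulation
  recombine, by linearity, into a time derivative and one derivative along
  \<open>(snd z, W t z)\<close>. The datum \<open>f0\<close> is replaced by \<open>F 0\<close>,
  equal to it almost everywhere.\<close>

lemma weak_smooth_product:
  assumes \<psi>: "smooth \<psi>" "\<And>z. norm z > R \<Longrightarrow> \<psi> z = 0"
    and \<Theta>: "smooth \<Theta>" "\<And>s. s \<notin> {A..B} \<Longrightarrow> \<Theta> s = 0" and S: "S > B" "S > 0"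
  shows "(LINT t:{0..<S}|lborel. LINT z|lborel. F t z *
      (frechet_derivative \<Theta> (at t) 1 * \<psi> z + \<Theta> t * frechet_derivative \<psi> (at z) (snd z, W t z)))
    + \<Theta> 0 * (LINT z|lborel. F 0 z * \<psi> z) = 0"
proof -
  let ?D = "\<lambda>z. frechet_derivative \<psi> (at z)" and ?\<Theta>' = "\<lambda>t. frechet_derivative \<Theta> (at t) 1"
  note d\<psi> = smooth_derivative_continuous[OF \<psi>(1)] and d\<Theta> = smooth_derivative_continuous[OF \<Theta>(1)]
  have c\<psi>: "continuous_on UNIV \<psi>" and c\<Theta>: "continuous_on UNIV \<Theta>"
    using \<psi>(1) \<Theta>(1) Ck_imp_continuous_on unfolding smooth_def by blast+
  have \<Theta>s: "\<Theta> s = 0" if "norm s > \<bar>A\<bar> + \<bar>B\<bar>" for s using that by (intro \<Theta>(2)) auto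
  obtain K1 where K1: "K1 \<ge> 0" "\<And>z. norm (\<psi> z) \<le> K1" using compact_support_bounded[OF c\<psi> \<psi>(2)] by blast
  obtain K2 where K2: "K2 \<ge> 0" "\<And>z h. \<bar>?D z h\<bar> \<le> K2 * norm h"
    using compact_support_derivative_bounded[OF d\<psi> \<psi>(2)] by blast
  obtain K3 where K3: "K3 \<ge> 0" "\<And>s. norm (\<Theta> s) \<le> K3" using compact_support_bounded[OF c\<Theta> \<Theta>s] by blast
  obtain K4 where K4: "K4 \<ge> 0" "\<And>s h. \<bar>frechet_derivative \<Theta> (at s) h\<bar> \<le> K4 * norm h"
    using compact_support_derivative_bounded[OF d\<Theta> \<Theta>s] by blast
  define G where "G t z = ?\<Theta>' t * \<psi> z + \<Theta> t * ?D z (snd z, W t z)" for t z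
  have Gm: "(\<lambda>p. G (fst p) (snd p)) \<in> borel_measurable (borel \<Otimes>\<^sub>M (borel \<Otimes>\<^sub>M borel))"
  proof -
    have 1: "?\<Theta>' \<in> borel_measurable borel" and 2: "\<Theta> \<in> borel_measurable borel"
      and 3: "\<psi> \<in> borel_measurable (borel \<Otimes>\<^sub>M borel)"
      using borel_measurable_continuous_onI[OF d\<Theta>(2)] borel_measurable_continuous_onI[OF c\<Theta>]
        borel_measurable_continuous_onI[OF c\<psi>] by (simp_all add: borel_prod)
    have 4: "(\<lambda>p. ?D (snd p) (snd (snd p), W (fst p) (snd p))) \<in> borel_measurable (borel \<Otimes>\<^sub>M (borel \<Otimes>\<^sub>M borel))"
      using space_generator_measurable[OF has_derivative_linear[OF d\<psi>(1)] d\<psi>(2)] by (simp only: borel_prod)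
    show ?thesis unfolding G_def
      by (intro borel_measurable_add borel_measurable_times 4 measurable_compose[OF measurable_fst 1]
          measurable_compose[OF measurable_fst 2] measurable_compose[OF measurable_snd 3])
  qed
  have Gb: "\<bar>G t z\<bar> \<le> (K4 * K1 + K3 * (K2 * \<kappa>)) * q t z" for t z
  proof -
    have "\<bar>G t z\<bar> \<le> \<bar>?\<Theta>' t\<bar> * \<bar>\<psi> z\<bar> + \<bar>\<Theta> t\<bar> * \<bar>?D z (snd z, W t z)\<bar>"
      unfolding G_def using abs_triangle_ineq by (simp add: abs_mult[symmetric])
    also have "\<dots> \<le> K4 * K1 + K3 * (K2 * (\<kappa> * q t z))"
    proof -
      have "\<bar>?\<Theta>' t\<bar> \<le> K4" "\<bar>\<psi> z\<bar> \<le> K1" "\<bar>\<Theta> t\<bar> \<le> K3"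
        using K4(2)[of t 1] K1(2)[of z] K3(2)[of t] by simp_all
      moreover have "\<bar>?D z (snd z, W t z)\<bar> \<le> K2 * (\<kappa> * q t z)"
        by (rule order_trans[OF K2(2) mult_left_mono[OF W_bound K2(1)]])
      ultimately show ?thesis
        using K1(1) K3(1) K4(1) by (intro add_mono mult_mono) auto
    qed
    also have "\<dots> \<le> K4 * K1 * q t z + K3 * (K2 * (\<kappa> * q t z))"
      using K1(1) K4(1) q_ge_1[of t z] mult_left_mono[of 1 "q t z" "K4 * K1"] by simp
    finally show ?thesis by (simp add: algebra_simps)
  qed
  let ?\<phi> = "\<lambda>p::real \<times> (real^'d) \<times> (real^'d). \<Theta> (fst p) * \<psi> (snd p)"
  have "test_fun ({..<S} \<times> UNIV) ?\<phi>"
    unfolding test_fun_def smooth_def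
  proof (intro conjI allI exI[of _ "{A..B} \<times> cball 0 R"] impI)
    show "Ck k ?\<phi>" for k
      using Ck_compose_affine[OF bounded_linear_fst, of k \<Theta> 0] Ck_compose_affine[OF bounded_linear_snd, of k \<psi> 0]
        \<psi>(1) \<Theta>(1) by (intro Ck_mult) (auto simp: smooth_def)
    show "?\<phi> p = 0" if "p \<notin> {A..B} \<times> cball 0 R" for p
      using that \<Theta>(2)[of "fst p"] \<psi>(2)[of "snd p"] by (cases p) auto
  qed (use S in \<open>auto intro!: compact_Times\<close>)
  note tf = this
  have w: "(LINT (t, x, v) : {0..<S} \<times> UNIV | lborel.
           let D = frechet_derivative ?\<phi> (at (t, x, v)) in
           f t (x, v) *
             (D (1, 0, 0) + D (0, v, 0) - lam * D (0, 0, v)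
              + (1 / \<epsilon>) * D (0, 0, mean_velocity (f t) x - v)))
        + (LINT z|lborel. f0 z * ?\<phi> (0, z)) = 0"
    by (rule weak[unfolded weak_solution_def, THEN spec, THEN mp, OF S(2), THEN conjunct2, THEN conjunct2,
          THEN conjunct2, THEN conjunct2, THEN spec, THEN mp, OF tf])
  have fd: "frechet_derivative ?\<phi> (at (t, z)) = (\<lambda>h. \<Theta> t * ?D z (snd h) + frechet_derivative \<Theta> (at t) (fst h) * \<psi> z)" for t z
  proof -
    have "((\<lambda>p. \<Theta> (fst p)) has_derivative (\<lambda>h. frechet_derivative \<Theta> (at t) (fst h))) (at (t, z))"
      using has_derivative_compose[OF has_derivative_fst[OF has_derivative_ident] d\<Theta>(1)[of "fst (t, z)"]] by simp
    moreover have "((\<lambda>p. \<psi> (snd p)) has_derivative (\<lambda>h. ?D z (snd h))) (at (t, z))"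
      using has_derivative_compose[OF has_derivative_snd[OF has_derivative_ident] d\<psi>(1)[of "snd (t, z)"]] by simp
    ultimately have "(?\<phi> has_derivative (\<lambda>h. \<Theta> (fst (t, z)) * ?D z (snd h) + frechet_derivative \<Theta> (at t) (fst h) * \<psi> (snd (t, z)))) (at (t, z))"
      by (rule has_derivative_mult)
    from frechet_derivative_at[OF this, symmetric] show ?thesis by simp
  qed
  have int_eq: "(let D = frechet_derivative ?\<phi> (at (t, x, v)) in
           f t (x, v) *
             (D (1, 0, 0) + D (0, v, 0) - lam * D (0, 0, v)
              + (1 / \<epsilon>) * D (0, 0, mean_velocity (f t) x - v))) = F t (x, v) * G t (x, v)" if "t \<ge> 0" for t x v
  proof -
    note l = has_derivative_linear[OF d\<psi>(1)[of "(x, v)"]]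
    have lt: "frechet_derivative \<Theta> (at t) 0 = 0"
      by (rule linear_0[OF has_derivative_linear[OF d\<Theta>(1)]])
    have z: "?D (x, v) 0 = 0" by (rule linear_0[OF l])
    have "(v, W t (x, v)) = ((v, 0) + (1 / \<epsilon>) *\<^sub>R (0, U t x - v)) - lam *\<^sub>R (0, v)"
      by (simp add: W_def)
    then have e: "?D (x, v) (v, W t (x, v)) = ?D (x, v) (v, 0) + (1 / \<epsilon>) * ?D (x, v) (0, U t x - v) - lam * ?D (x, v) (0, v)"
      by (simp only: linear_diff[OF l] linear_add[OF l] linear_scale[OF l] real_scaleR_def)
    show ?thesis
      using that z[unfolded zero_prod_def] by (simp add: fd Let_def lt F_eq G_def e U_def algebra_simps)
  qed
  have "(LINT (t, x, v) : {0..<S} \<times> UNIV | lborel.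
           let D = frechet_derivative ?\<phi> (at (t, x, v)) in
           f t (x, v) *
             (D (1, 0, 0) + D (0, v, 0) - lam * D (0, 0, v)
              + (1 / \<epsilon>) * D (0, 0, mean_velocity (f t) x - v)))
      = (LINT (t, z)|lborel. indicator {0..<S} t * (F t z * G t z))"
    unfolding set_lebesgue_integral_def
  proof (intro Bochner_Integration.integral_cong refl)
    fix p :: "real \<times> (real^'d) \<times> (real^'d)"
    obtain t x v where p: "p = (t, x, v)" by (cases p) auto
    show "indicator ({0..<S} \<times> UNIV) p *\<^sub>R (case p of (t, x, v) \<Rightarrow>
        let D = frechet_derivative ?\<phi> (at (t, x, v)) in
           f t (x, v) *
             (D (1, 0, 0) + D (0, v, 0) - lam * D (0, 0, v)
              + (1 / \<epsilon>) * D (0, 0, mean_velocity (f t) x - v)))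
      = (case p of (t, z) \<Rightarrow> indicator {0..<S} t * (F t z * G t z))"
    proof (cases "t \<in> {0..<S}")
      case True
      then have "t \<ge> 0" and "indicator ({0..<S} \<times> UNIV) (t, x, v) = (1::real)" "indicator {0..<S} t = (1::real)"
        by auto
      then show ?thesis
        by (simp only: p prod.case int_eq scaleR_one mult_1)
    qed (simp add: p indicator_def)
  qed
  also have "\<dots> = (LINT t:{0..<S}|lborel. LINT z|lborel. F t z * G t z)"
    by (rule FG_joint_integral[OF Gm Gb]) (use S in \<open>auto simp: emeasure_lborel_Ico\<close>)
  finally have 1: "(LINT (t, x, v) : {0..<S} \<times> UNIV | lborel.
           let D = frechet_derivative ?\<phi> (at (t, x, v)) in
           f t (x, v) *
             (D (1, 0, 0) + D (0, v, 0) - lam * D (0, 0, v)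
              + (1 / \<epsilon>) * D (0, 0, mean_velocity (f t) x - v)))
      = (LINT t:{0..<S}|lborel. LINT z|lborel. F t z * G t z)" .
  have mf: "(\<lambda>z. g z * ?\<phi> (0, z)) \<in> borel_measurable lborel" if "integrable lborel g" for g
    using borel_measurable_continuous_onI[OF c\<psi>] borel_measurable_integrable[OF that] by simp
  have "(LINT z|lborel. f0 z * ?\<phi> (0, z)) = (LINT z|lborel. F 0 z * ?\<phi> (0, z))"
    by (rule integral_cong_AE[OF mf[OF phase_density.integrable[OF phase0]] mf[OF F_integrable]])
      (use init in \<open>eventually_elim, simp add: F_eq\<close>)
  also have "\<dots> = \<Theta> 0 * (LINT z|lborel. F 0 z * \<psi> z)"
    by (simp add: integral_mult_right_zero[symmetric] mult_ac del: integral_mult_right_zero)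
  finally show ?thesis using w unfolding 1 by (simp add: G_def)
qed

end

section \<open>From smooth products to time-dependent C^1 test functions of linear growth\<close>

lemma compact_support_uniformly_continuous:
  fixes g :: "'a::euclidean_space \<Rightarrow> real"
  assumes c: "continuous_on UNIV g" and supp: "\<And>z. norm z > R \<Longrightarrow> g z = 0" and e: "e > 0"
  obtains d where "d > 0" "\<And>y z. norm (z - y) \<le> d \<Longrightarrow> \<bar>g y - g z\<bar> \<le> e"
proof -
  have "uniformly_continuous_on (cball 0 (R + 1)) g"
    by (intro compact_uniformly_continuous continuous_on_subset[OF c]) auto
  then obtain d where d: "d > 0" "\<And>y z. y \<in> cball 0 (R + 1) \<Longrightarrow> z \<in> cball 0 (R + 1) \<Longrightarrow> dist z y < d \<Longrightarrow> dist (g z) (g y) < e"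
    unfolding uniformly_continuous_on_def using e by metis
  show ?thesis
  proof (rule that[of "min (d / 2) 1"])
    show "min (d / 2) 1 > 0" using d by simp
    fix y z :: 'a assume yz: "norm (z - y) \<le> min (d / 2) 1"
    show "\<bar>g y - g z\<bar> \<le> e"
    proof (cases "norm y > R \<and> norm z > R")
      case True
      then show ?thesis using supp e by simp
    next
      case False
      have "norm y \<le> norm z + norm (z - y)" "norm z \<le> norm y + norm (z - y)"
        using norm_triangle_ineq2[of y z] norm_triangle_ineq2[of z y] by (simp_all add: norm_minus_commute)
      then have "norm y \<le> R + 1" "norm z \<le> R + 1" using False yz by linarith+
      moreover have "dist z y < d" using yz d by (simp add: dist_norm)
      ultimately show ?thesis using d(2)[of y z] by (simp add: dist_real_def abs_minus_commute)
    qed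
  qed
qed

lemma linear_family_close:
  fixes D E :: "'a::euclidean_space \<Rightarrow> real"
  assumes "linear D" "linear E" and e: "\<And>i. i \<in> Basis \<Longrightarrow> \<bar>D i - E i\<bar> \<le> e / DIM('a)"
  shows "\<bar>D h - E h\<bar> \<le> e * norm h"
proof -
  have "D h - E h = (\<Sum>i\<in>Basis. (h \<bullet> i) * (D i - E i))"
    using linear_componentwise_sum[OF assms(1), of h] linear_componentwise_sum[OF assms(2), of h]
    by (simp add: sum_subtractf right_diff_distrib)
  also have "\<bar>\<dots>\<bar> \<le> (\<Sum>i\<in>Basis. \<bar>(h \<bullet> i) * (D i - E i)\<bar>)"
    by (rule sum_abs)
  also have "\<dots> \<le> (\<Sum>i\<in>(Basis::'a set). norm h * (e / DIM('a)))"
    unfolding abs_mult using e by (intro sum_mono mult_mono Basis_le_norm) auto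
  also have "\<dots> = e * norm h" by simp
  finally show ?thesis .
qed

text \<open>Since mollification commutes with differentiation, a single radius
  \<open>\<delta>\<close>, chosen from the uniform continuity of \<open>\<psi>\<close> and of its
  finitely many partial derivatives, controls values and derivatives together. The bound
  \<open>\<delta> \<le> 1\<close> gives the support in radius \<open>R + 1\<close>.\<close>

lemma C1_smooth_approximation:
  fixes \<psi> :: "'a::euclidean_space \<Rightarrow> real"
  assumes D: "\<And>z. (\<psi> has_derivative D z) (at z)" and c: "\<And>h. continuous_on UNIV (\<lambda>z. D z h)"
    and supp: "\<And>z. norm z > R \<Longrightarrow> \<psi> z = 0" and e: "e > 0"
  obtains \<phi> where "smooth \<phi>" "\<And>z. norm z > R + 1 \<Longrightarrow> \<phi> z = 0" "\<And>z. \<bar>\<phi> z - \<psi> z\<bar> \<le> e"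
    "\<And>z h. \<bar>frechet_derivative \<phi> (at z) h - D z h\<bar> \<le> e * norm h"
proof -
  have c\<psi>: "continuous_on UNIV \<psi>"
    by (rule has_derivative_continuous_on[OF has_derivative_at_withinI[OF D]])
  have D0: "norm z > R \<Longrightarrow> D z h = 0" for z h
    using derivative_zero_outside_support[OF D supp] by blast
  obtain d0 where d0: "d0 > 0" "\<And>y z. norm (z - y) \<le> d0 \<Longrightarrow> \<bar>\<psi> y - \<psi> z\<bar> \<le> e"
    using compact_support_uniformly_continuous[OF c\<psi> supp e] by blast
  have "\<exists>d>0. \<forall>y z. norm (z - y) \<le> d \<longrightarrow> \<bar>D y i - D z i\<bar> \<le> e / DIM('a)" for i
  proof -
    have "e / DIM('a) > 0" using e by simp
    then show ?thesis
      using compact_support_uniformly_continuous[OF c[of i] D0, where e = "e / DIM('a)"] by metis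
  qed
  then obtain d where d: "\<And>i. d i > 0" "\<And>i y z. norm (z - y) \<le> d i \<Longrightarrow> \<bar>D y i - D z i\<bar> \<le> e / DIM('a)"
    by metis
  define \<delta> where "\<delta> = min (min d0 1) (Min (d ` (Basis :: 'a set)))"
  have \<delta>: "\<delta> > 0" "\<delta> \<le> d0" "\<delta> \<le> 1" "\<And>i. i \<in> (Basis :: 'a set) \<Longrightarrow> \<delta> \<le> d i"
    using d0(1) d(1) by (auto simp: \<delta>_def min_le_iff_disj)
  have Dm: "(mollify \<delta> \<psi> has_derivative (\<lambda>h. mollify \<delta> (\<lambda>y. D y h) z)) (at z)" for z
    by (rule mollify_has_derivative[OF supp \<delta>(1) D c])
  show ?thesis
  proof (rule that[of "mollify \<delta> \<psi>"])
    show "smooth (mollify \<delta> \<psi>)"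
      unfolding smooth_def using Ck_mollify[OF c\<psi> supp \<delta>(1)] by blast
    show "mollify \<delta> \<psi> z = 0" if "norm z > R + 1" for z
      using mollify_eq_0[OF c\<psi> supp \<delta>(1)] that \<delta>(3) by force
    show "\<bar>mollify \<delta> \<psi> z - \<psi> z\<bar> \<le> e" for z
      by (rule mollify_close[OF c\<psi> supp \<delta>(1)]) (use d0(2) \<delta>(2) in force)+
    show "\<bar>frechet_derivative (mollify \<delta> \<psi>) (at z) h - D z h\<bar> \<le> e * norm h" for z h
      unfolding frechet_derivative_at[OF Dm[of z], symmetric]
    proof (rule mollify_close[OF c D0 \<delta>(1)])
      fix y assume y: "norm (z - y) \<le> \<delta>"
      show "\<bar>D y h - D z h\<bar> \<le> e * norm h"
        by (rule linear_family_close[OF has_derivative_linear[OF D] has_derivative_linear[OF D]])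
          (use y \<delta>(4) d(2) in force)
    qed
  qed
qed

lemma set_integral_abs_le:
  fixes b :: "real \<Rightarrow> real"
  assumes "\<And>\<tau>. \<tau> \<in> {s<..t} \<Longrightarrow> \<bar>b \<tau>\<bar> \<le> B" "s \<le> t" "B \<ge> 0"
  shows "\<bar>LINT \<tau>:{s<..t}|lborel. b \<tau>\<bar> \<le> B * (t - s)"
proof -
  have "\<bar>LINT \<tau>:{s<..t}|lborel. b \<tau>\<bar> \<le> (LINT \<tau>|lborel. \<bar>indicator {s<..t} \<tau> * b \<tau>\<bar>)"
    unfolding set_lebesgue_integral_def using integral_abs_bound[of lborel "\<lambda>\<tau>. indicator {s<..t} \<tau> * b \<tau>"] by simp
  also have "\<dots> \<le> (LINT \<tau>|lborel. B * indicator {s<..t} \<tau>)"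
  proof (cases "integrable lborel (\<lambda>\<tau>. \<bar>indicator {s<..t} \<tau> * b \<tau>\<bar>)")
    case True
    then show ?thesis
    proof (rule integral_mono)
      show "integrable lborel (\<lambda>\<tau>. B * indicator {s<..t} \<tau>)"
        using assms(2) by (intro integrable_mult_right integrable_real_indicator) auto
    qed (use assms in \<open>auto simp: indicator_def\<close>)
  next
    \<comment> \<open>Without integrability the integral has the default value 0, so the bound still
      holds.\<close>
    case False
    then show ?thesis using assms(3) by (simp add: not_integrable_integral_eq)
  qed
  also have "\<dots> = B * (t - s)" using assms(2) by simp
  finally show ?thesis .
qed

lemma set_integral_Icc_diff:
  fixes b :: "real \<Rightarrow> real"
  assumes i: "set_integrable lborel {0..t} b" and st: "0 \<le> s" "s \<le> t"
  shows "(LINT \<tau>:{0..t}|lborel. b \<tau>) - (LINT \<tau>:{0..s}|lborel. b \<tau>) = (LINT \<tau>:{s<..t}|lborel. b \<tau>)"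
    and "set_integrable lborel {s<..t} b"
proof -
  have u: "{0..t} = {0..s} \<union> {s<..t}" using st by auto
  have i1: "set_integrable lborel {0..s} b" and i2: "set_integrable lborel {s<..t} b"
    using st by (auto intro!: set_integrable_subset[OF i])
  show "(LINT \<tau>:{0..t}|lborel. b \<tau>) - (LINT \<tau>:{0..s}|lborel. b \<tau>) = (LINT \<tau>:{s<..t}|lborel. b \<tau>)"
    unfolding u by (subst set_integral_Un[OF _ i1 i2]) auto
  show "set_integrable lborel {s<..t} b" by (rule i2)
qed

lemma eq_if_all_eps:
  fixes x y K :: real
  assumes "\<And>e. e > 0 \<Longrightarrow> \<bar>x - y\<bar> \<le> e * K"
  shows "x = y"
proof (rule ccontr)
  assume "x \<noteq> y"
  then have p: "\<bar>x - y\<bar> > 0" by simp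
  define e where "e = \<bar>x - y\<bar> / (2 * (\<bar>K\<bar> + 1))"
  have e: "e > 0" using p by (simp add: e_def)
  have "e * K \<le> e * (\<bar>K\<bar> + 1)" using e by (intro mult_left_mono) auto
  also have "\<dots> = \<bar>x - y\<bar> / 2" by (simp add: e_def field_simps)
  also have "\<dots> < \<bar>x - y\<bar>" using p by simp
  finally show False using assms[OF e] by simp
qed

context kinetic
begin

lemma bounded_moment:
  assumes c: "continuous_on UNIV \<psi>" and K: "\<And>z. \<bar>\<psi> z\<bar> \<le> K"
  shows "\<bar>LINT z|lborel. F t z * \<psi> z\<bar> \<le> K * M0"
    and "(\<lambda>t. LINT z|lborel. F t z * \<psi> z) \<in> borel_measurable borel"
proof -
  have Knn: "K \<ge> 0" using K[of 0] by linarith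
  have "\<bar>LINT z|lborel. F t z * \<psi> z\<bar> \<le> (LINT z|lborel. K * F t z)"
  proof (rule order_trans[OF integral_abs_bound], rule integral_mono)
    show "integrable lborel (\<lambda>z. \<bar>F t z * \<psi> z\<bar>)" using integrable_F_bounded[OF c K] by simp
    show "\<bar>F t z * \<psi> z\<bar> \<le> K * F t z" for z
      using K[of z] F_nonneg by (simp add: abs_mult mult.commute mult_right_mono)
  qed (use F_integrable in simp)
  also have "\<dots> \<le> K * M0" using Knn mass_F_le[of t] by (simp add: mult_left_mono)
  finally show "\<bar>LINT z|lborel. F t z * \<psi> z\<bar> \<le> K * M0" .
  have m: "(\<lambda>p. \<psi> (snd p)) \<in> borel_measurable (borel \<Otimes>\<^sub>M (borel \<Otimes>\<^sub>M borel))"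
    using measurable_compose[OF measurable_snd borel_measurable_continuous_onI[OF c]] by (simp add: borel_prod)
  have b: "\<bar>\<psi> z\<bar> \<le> K * q t z" for t z
    using mult_left_mono[OF q_ge_1[of t z] Knn] K[of z] by simp
  show "(\<lambda>t. LINT z|lborel. F t z * \<psi> z) \<in> borel_measurable borel"
    by (rule FG_time_measurable[where G = "\<lambda>t. \<psi>" and S = "{0..1}", OF m b]) auto
qed

lemma moment_continuous:
  assumes c: "continuous_on UNIV \<psi>" and K: "\<And>z. \<bar>\<psi> z\<bar> \<le> K" and t: "t \<ge> 0"
  shows "((\<lambda>\<tau>. LINT z|lborel. F \<tau> z * \<psi> z) \<longlongrightarrow> (LINT z|lborel. F t z * \<psi> z)) (at t within {0..})"
proof (rule LIM_zero_cancel, rule Lim_null_comparison)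
  show "((\<lambda>\<tau>. K * (LINT z|lborel. \<bar>F \<tau> z - F t z\<bar>)) \<longlongrightarrow> 0) (at t within {0..})"
    using tendsto_mult_left[OF F_L1_continuous[OF t], of K] by simp
  have "\<bar>(LINT z|lborel. F \<tau> z * \<psi> z) - (LINT z|lborel. F t z * \<psi> z)\<bar> \<le> K * (LINT z|lborel. \<bar>F \<tau> z - F t z\<bar>)" for \<tau>
  proof -
    note i = integrable_F_bounded[OF c K]
    have "(LINT z|lborel. F \<tau> z * \<psi> z) - (LINT z|lborel. F t z * \<psi> z) = (LINT z|lborel. (F \<tau> z - F t z) * \<psi> z)"
      using i[of \<tau>] i[of t] by (simp add: left_diff_distrib)
    also have "\<bar>\<dots>\<bar> \<le> (LINT z|lborel. K * \<bar>F \<tau> z - F t z\<bar>)"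
    proof (rule order_trans[OF integral_abs_bound], rule integral_mono)
      show "integrable lborel (\<lambda>z. \<bar>(F \<tau> z - F t z) * \<psi> z\<bar>)"
        using i[of \<tau>] i[of t] by (simp add: left_diff_distrib)
      show "\<bar>(F \<tau> z - F t z) * \<psi> z\<bar> \<le> K * \<bar>F \<tau> z - F t z\<bar>" for z
        using mult_right_mono[OF K[of z], of "\<bar>F \<tau> z - F t z\<bar>"] by (simp add: abs_mult mult.commute)
    qed (use F_integrable in simp)
    finally show ?thesis by simp
  qed
  then show "\<forall>\<^sub>F \<tau> in at t within {0..}. norm ((LINT z|lborel. F \<tau> z * \<psi> z) - (LINT z|lborel. F t z * \<psi> z))
      \<le> K * (LINT z|lborel. \<bar>F \<tau> z - F t z\<bar>)" by simp
qed

text \<open>Stated for an arbitrary linear family \<open>D\<close> rather than a derivative, so that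
  it also applies to the difference of two derivatives.\<close>

lemma generator_bounds:
  fixes D :: "(real^'d) \<times> (real^'d) \<Rightarrow> (real^'d) \<times> (real^'d) \<Rightarrow> real"
  assumes l: "\<And>z. linear (D z)" and c: "\<And>h. continuous_on UNIV (\<lambda>z. D z h)"
    and K: "K \<ge> 0" "\<And>z h. \<bar>D z h\<bar> \<le> K * norm h"
  shows "integrable lborel (\<lambda>z. F t z * D z (snd z, W t z))"
    and "\<bar>LINT z|lborel. F t z * D z (snd z, W t z)\<bar> \<le> K * (\<kappa> * Q)"
    and "(\<lambda>t. LINT z|lborel. F t z * D z (snd z, W t z)) \<in> borel_measurable borel"
    and "set_integrable lborel {0..s} (\<lambda>t. LINT z|lborel. F t z * D z (snd z, W t z))"
proof -
  have m: "(\<lambda>p. D (snd p) (snd (snd p), W (fst p) (snd p))) \<in> borel_measurable (borel \<Otimes>\<^sub>M (borel \<Otimes>\<^sub>M borel))"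
    using space_generator_measurable[OF l c] by (simp only: borel_prod)
  have b: "\<bar>D z (snd z, W t z)\<bar> \<le> K * \<kappa> * q t z" for t z
    using order_trans[OF K(2) mult_left_mono[OF W_bound K(1)]] by (simp add: mult.assoc)
  show "integrable lborel (\<lambda>z. F t z * D z (snd z, W t z))"
    by (rule FG_integrable[where S = "{t}", OF m b]) auto
  show "\<bar>LINT z|lborel. F t z * D z (snd z, W t z)\<bar> \<le> K * (\<kappa> * Q)"
    using FG_integral_le[where S = "{t}" and t = t, OF m b] by (simp add: mult.assoc)
  show "(\<lambda>t. LINT z|lborel. F t z * D z (snd z, W t z)) \<in> borel_measurable borel"
    by (rule FG_time_measurable[where S = "{0}", OF m b]) auto
  show "set_integrable lborel {0..s} (\<lambda>t. LINT z|lborel. F t z * D z (snd z, W t z))"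
    by (rule FG_set_integrable[OF m b]) (auto simp: emeasure_lborel_Icc_eq)
qed

text \<open>The cutoff \<open>\<Theta>\<close> is inserted into \<open>weak_smooth_product\<close>
  and its width made small. The term with \<open>\<eta>\<close> averages the moment \<open>a\<close>
  just after \<open>t\<close>, where \<open>a\<close> is continuous; replacing
  \<open>\<Theta>\<close> by the indicator of \<open>[0, t]\<close> costs at most the bound
  \<open>B\<close> times the width.\<close>

lemma weak_smooth:
  assumes \<psi>: "smooth \<psi>" "\<And>z. norm z > R \<Longrightarrow> \<psi> z = 0" and t: "t \<ge> 0"
  shows "(LINT z|lborel. F t z * \<psi> z) - (LINT z|lborel. F 0 z * \<psi> z)
    = (LINT \<tau>:{0..t}|lborel. LINT z|lborel. F \<tau> z * frechet_derivative \<psi> (at z) (snd z, W \<tau> z))"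
proof -
  let ?D = "\<lambda>z. frechet_derivative \<psi> (at z)"
  note d\<psi> = smooth_derivative_continuous[OF \<psi>(1)]
  have c\<psi>: "continuous_on UNIV \<psi>"
    using \<psi>(1) Ck_imp_continuous_on unfolding smooth_def by blast
  obtain K1 where K1: "K1 \<ge> 0" "\<And>z. norm (\<psi> z) \<le> K1" using compact_support_bounded[OF c\<psi> \<psi>(2)] by blast
  then have K1': "\<And>z. \<bar>\<psi> z\<bar> \<le> K1" by simp
  obtain K2 where K2: "K2 \<ge> 0" "\<And>z h. \<bar>?D z h\<bar> \<le> K2 * norm h"
    using compact_support_derivative_bounded[OF d\<psi> \<psi>(2)] by blast
  define a where "a \<tau> = (LINT z|lborel. F \<tau> z * \<psi> z)" for \<tau>
  define b where "b \<tau> = (LINT z|lborel. F \<tau> z * ?D z (snd z, W \<tau> z))" for \<tau>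
  define B where "B = K2 * (\<kappa> * Q)"
  note gb = generator_bounds[OF has_derivative_linear[OF d\<psi>(1)] d\<psi>(2) K2]
  have B: "\<bar>b \<tau>\<bar> \<le> B" for \<tau> unfolding b_def B_def by (rule gb(2))
  then have Bnn: "B \<ge> 0" using abs_ge_zero[of "b 0"] order_trans by blast
  have [measurable]: "a \<in> borel_measurable borel" "b \<in> borel_measurable borel"
    unfolding a_def[abs_def] b_def[abs_def] by (rule bounded_moment(2)[OF c\<psi> K1']) (rule gb(3))
  have aK: "\<bar>a \<tau>\<bar> \<le> K1 * M0" for \<tau> unfolding a_def by (rule bounded_moment(1)[OF c\<psi> K1'])
  have "a t - a 0 = (LINT \<tau>:{0..t}|lborel. b \<tau>)"
  proof (rule eq_if_all_eps[of _ _ 2])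
    fix e :: real assume e: "e > 0"
    have "(a \<longlongrightarrow> a t) (at t within {0..})"
      unfolding a_def[abs_def] by (rule moment_continuous[OF c\<psi> K1' t])
    then obtain d where d: "d > 0" "\<And>\<tau>. \<tau> \<ge> 0 \<Longrightarrow> \<tau> \<noteq> t \<Longrightarrow> dist \<tau> t < d \<Longrightarrow> dist (a \<tau>) (a t) < e"
      using e unfolding tendsto_iff eventually_at by fastforce
    \<comment> \<open>The first entry keeps \<open>[t, t + 2 * r]\<close> within distance
      \<open>d\<close> of \<open>t\<close>, the second makes \<open>2 * r * B \<le> e\<close>;
      \<open>B + 1\<close> avoids a zero denominator.\<close>
    define r where "r = min (d / 4) (e / (2 * (B + 1)))"
    have r: "r > 0" using d(1) e Bnn by (simp add: r_def)
    have rB: "2 * r * B \<le> e"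
    proof -
      have "2 * r * B \<le> 2 * r * (B + 1)" using r by simp
      also have "\<dots> \<le> 2 * (e / (2 * (B + 1))) * (B + 1)" using Bnn by (intro mult_right_mono mult_left_mono) (auto simp: r_def)
      also have "\<dots> = e" using Bnn by (simp add: field_simps)
      finally show ?thesis .
    qed
    have ae: "\<bar>a \<tau> - a t\<bar> \<le> e" if "\<tau> \<in> {t..t + 2 * r}" for \<tau>
    proof (cases "\<tau> = t")
      case False
      have "r \<le> d / 4" unfolding r_def by (rule min.cobounded1)
      then have "2 * r \<le> 2 * (d / 4)" by (rule mult_left_mono) simp
      also have "2 * (d / 4) < d" using d(1) by simp
      finally have "2 * r < d" .
      then show ?thesis using d(2)[of \<tau>] that t False by (simp add: dist_real_def)
    qed (use e in simp)
    obtain \<Theta> \<eta> :: "real \<Rightarrow> real" where TC: "smooth \<Theta>" "\<forall>s. s \<notin> {- 2 * r..t + 2 * r} \<longrightarrow> \<Theta> s = 0"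
      "\<forall>s\<ge>0. frechet_derivative \<Theta> (at s) 1 = - \<eta> s" "\<forall>s\<in>{0..t}. \<Theta> s = 1"
      "\<forall>s\<ge>0. 0 \<le> \<Theta> s \<and> \<Theta> s \<le> 1" "continuous_on UNIV \<eta>" "\<forall>s. \<eta> s \<ge> 0"
      "\<forall>s. s \<notin> {t..t + 2 * r} \<longrightarrow> \<eta> s = 0" "has_bochner_integral lborel \<eta> 1"
      using time_cutoff[OF t r] by blast
    note \<Theta> = TC(1) TC(2)[rule_format] TC(3)[rule_format] TC(4)[rule_format] TC(5)[rule_format]
      and \<eta> = TC(6) TC(7)[rule_format] TC(8)[rule_format] TC(9)
    define S where "S = t + 2 * r + 1"
    have [measurable]: "\<eta> \<in> borel_measurable borel" "\<Theta> \<in> borel_measurable borel"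
      using \<eta>(1) \<Theta>(1) Ck_imp_continuous_on unfolding smooth_def by (blast intro: borel_measurable_continuous_onI)+
    \<comment> \<open>\<open>k\<close> is the integrand of the weak formulation; \<open>k'\<close>
      is its limiting form, with \<open>a t\<close> in place of \<open>a\<close> and the indicator
      of \<open>[0, t]\<close> in place of \<open>\<Theta>\<close>.\<close>
    define k where "k \<tau> = indicator {0..<S} \<tau> * (- \<eta> \<tau> * a \<tau> + \<Theta> \<tau> * b \<tau>)" for \<tau>
    define k' where "k' \<tau> = - \<eta> \<tau> * a t + indicator {0..t} \<tau> * b \<tau>" for \<tau>
    have \<eta>i: "integrable lborel \<eta>" "(LINT \<tau>|lborel. \<eta> \<tau>) = 1" using \<eta>(4) by (auto simp: has_bochner_integral_iff)
    have bi: "integrable lborel (\<lambda>\<tau>. indicator {0..t} \<tau> * b \<tau>)"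
      using gb(4)[of t] unfolding b_def set_integrable_def by simp
    have ki: "integrable lborel k"
    proof (rule Bochner_Integration.integrable_bound)
      show "integrable lborel (\<lambda>\<tau>. K1 * M0 * \<eta> \<tau> + B * indicator {0..<S} \<tau>)"
        using \<eta>i by (intro Bochner_Integration.integrable_add integrable_mult_right integrable_real_indicator)
          (use t r in \<open>auto simp: emeasure_lborel_Ico S_def\<close>)
      have "\<bar>k \<tau>\<bar> \<le> K1 * M0 * \<eta> \<tau> + B * indicator {0..<S} \<tau>" for \<tau>
      proof (cases "\<tau> \<in> {0..<S}")
        case True
        have "\<bar>- \<eta> \<tau> * a \<tau> + \<Theta> \<tau> * b \<tau>\<bar> \<le> \<bar>\<eta> \<tau> * a \<tau>\<bar> + \<bar>\<Theta> \<tau> * b \<tau>\<bar>" by linarith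
        also have "\<dots> \<le> \<eta> \<tau> * (K1 * M0) + 1 * B"
          unfolding abs_mult using \<Theta>(5)[of \<tau>] True aK B \<eta>(2) by (intro add_mono mult_mono) auto
        finally show ?thesis using True by (simp add: k_def mult.commute)
      next
        case False
        then show ?thesis using K1(1) M0_nonneg \<eta>(2) by (simp add: k_def)
      qed
      then show "AE \<tau> in lborel. norm (k \<tau>) \<le> norm (K1 * M0 * \<eta> \<tau> + B * indicator {0..<S} \<tau>)"
        by (intro AE_I2) (auto intro: order_trans[OF _ abs_ge_self])
    qed (simp add: k_def[abs_def])
    have k'i: "integrable lborel k'"
      unfolding k'_def using \<eta>i bi by (intro Bochner_Integration.integrable_add) auto
    have "(LINT \<tau>|lborel. k \<tau>) = - a 0"
    proof -
      have "k \<tau> = indicator {0..<S} \<tau> * (LINT z|lborel. F \<tau> z *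
          (frechet_derivative \<Theta> (at \<tau>) 1 * \<psi> z + \<Theta> \<tau> * ?D z (snd z, W \<tau> z)))" for \<tau>
      proof (cases "\<tau> \<in> {0..<S}")
        case True
        have "(LINT z|lborel. F \<tau> z * (frechet_derivative \<Theta> (at \<tau>) 1 * \<psi> z + \<Theta> \<tau> * ?D z (snd z, W \<tau> z)))
          = (LINT z|lborel. - \<eta> \<tau> * (F \<tau> z * \<psi> z) + \<Theta> \<tau> * (F \<tau> z * ?D z (snd z, W \<tau> z)))"
          using True by (simp add: \<Theta>(3) algebra_simps)
        also have "\<dots> = - \<eta> \<tau> * a \<tau> + \<Theta> \<tau> * b \<tau>"
          using integrable_F_bounded[OF c\<psi> K1', of \<tau>] gb(1)[of \<tau>] by (simp add: a_def b_def)
        finally show ?thesis by (simp add: k_def)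
      qed (simp add: k_def)
      then have "(LINT \<tau>|lborel. k \<tau>) = (LINT \<tau>:{0..<S}|lborel. LINT z|lborel. F \<tau> z *
          (frechet_derivative \<Theta> (at \<tau>) 1 * \<psi> z + \<Theta> \<tau> * ?D z (snd z, W \<tau> z)))"
        by (simp add: set_lebesgue_integral_def)
      also have "\<dots> = - (\<Theta> 0 * a 0)"
        using weak_smooth_product[OF \<psi> \<Theta>(1,2), where S = S and A = "- 2 * r" and B = "t + 2 * r" and R = R] t r
        by (simp add: S_def a_def)
      finally show ?thesis using \<Theta>(4)[of 0] t by simp
    qed
    moreover have "(LINT \<tau>|lborel. k' \<tau>) = - a t + (LINT \<tau>:{0..t}|lborel. b \<tau>)"
      unfolding k'_def set_lebesgue_integral_def using \<eta>i bi by simp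
    moreover have "\<bar>(LINT \<tau>|lborel. k \<tau>) - (LINT \<tau>|lborel. k' \<tau>)\<bar> \<le> e + B * (2 * r)"
    proof -
      have p: "\<bar>k \<tau> - k' \<tau>\<bar> \<le> e * \<eta> \<tau> + B * indicator {t..t + 2 * r} \<tau>" for \<tau>
      proof -
        consider "\<tau> < 0" | "0 \<le> \<tau>" "\<tau> < t" | "\<tau> \<in> {t..t + 2 * r}" | "\<tau> > t + 2 * r" by fastforce
        then show ?thesis
        proof cases
          case 1 then show ?thesis using \<eta>(3)[of \<tau>] t by (simp add: k_def k'_def)
        next
          case 2 then show ?thesis using \<eta>(3)[of \<tau>] \<Theta>(4)[of \<tau>] r by (simp add: k_def k'_def S_def)
        next
          case 3
          have "\<bar>\<Theta> \<tau> * b \<tau> - indicator {0..t} \<tau> * b \<tau>\<bar> \<le> B"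
          proof -
            have "\<bar>\<Theta> \<tau> - indicator {0..t} \<tau>\<bar> \<le> 1"
              using 3 t \<Theta>(4)[of \<tau>] \<Theta>(5)[of \<tau>] by (auto simp: indicator_def)
            then have "\<bar>\<Theta> \<tau> - indicator {0..t} \<tau>\<bar> * \<bar>b \<tau>\<bar> \<le> 1 * B" using B by (intro mult_mono) auto
            then show ?thesis by (simp add: left_diff_distrib[symmetric] abs_mult)
          qed
          moreover have "\<bar>\<eta> \<tau> * (a \<tau> - a t)\<bar> \<le> \<eta> \<tau> * e"
            using ae[OF 3] \<eta>(2)[of \<tau>] by (simp add: abs_mult mult_left_mono)
          moreover have "k \<tau> - k' \<tau> = - (\<eta> \<tau> * (a \<tau> - a t)) + (\<Theta> \<tau> * b \<tau> - indicator {0..t} \<tau> * b \<tau>)"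
            using 3 t r by (simp add: k_def k'_def S_def algebra_simps)
          ultimately show ?thesis using 3 by (simp add: mult.commute)
        next
          case 4 then show ?thesis using \<eta>(3)[of \<tau>] \<Theta>(2)[of \<tau>] r by (simp add: k_def k'_def)
        qed
      qed
      have ii: "integrable lborel (\<lambda>\<tau>. e * \<eta> \<tau> + B * indicator {t..t + 2 * r} \<tau>)"
        using \<eta>i by (intro Bochner_Integration.integrable_add integrable_mult_right integrable_real_indicator)
          (auto simp: emeasure_lborel_Icc_eq)
      have "(LINT \<tau>|lborel. k \<tau>) - (LINT \<tau>|lborel. k' \<tau>) = (LINT \<tau>|lborel. k \<tau> - k' \<tau>)"
        using ki k'i by simp
      also have "\<bar>\<dots>\<bar> \<le> (LINT \<tau>|lborel. e * \<eta> \<tau> + B * indicator {t..t + 2 * r} \<tau>)"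
        by (rule order_trans[OF integral_abs_bound], rule integral_mono) (use ki k'i ii p in auto)
      also have "\<dots> = e + B * (2 * r)"
        using \<eta>i r by (subst Bochner_Integration.integral_add) (auto simp: emeasure_lborel_Icc_eq)
      finally show ?thesis .
    qed
    ultimately show "\<bar>a t - a 0 - (LINT \<tau>:{0..t}|lborel. b \<tau>)\<bar> \<le> e * 2"
      using rB mult.commute[of B "2 * r"] by linarith
  qed
  then show ?thesis by (simp add: a_def b_def)
qed

text \<open>Approximates \<open>\<psi>\<close> in C^1 by smooth functions. An error \<open>e\<close>
  costs \<open>e * M0\<close> at each of the two endpoints and \<open>e * (\<kappa> * Q) * t\<close>
  in the integrated generator.\<close>

lemma weak_C1:
  fixes \<psi> :: "(real^'d) \<times> (real^'d) \<Rightarrow> real"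
  assumes D: "\<And>z. (\<psi> has_derivative D z) (at z)" and c: "\<And>h. continuous_on UNIV (\<lambda>z. D z h)"
    and supp: "\<And>z. norm z > R \<Longrightarrow> \<psi> z = 0" and t: "t \<ge> 0"
  shows "(LINT z|lborel. F t z * \<psi> z) - (LINT z|lborel. F 0 z * \<psi> z)
    = (LINT \<tau>:{0..t}|lborel. LINT z|lborel. F \<tau> z * D z (snd z, W \<tau> z))"
proof (rule eq_if_all_eps[of _ _ "2 * M0 + \<kappa> * Q * t"])
  fix e :: real assume e: "e > 0"
  obtain \<phi> where \<phi>: "smooth \<phi>" "\<And>z. norm z > R + 1 \<Longrightarrow> \<phi> z = 0" "\<And>z. \<bar>\<phi> z - \<psi> z\<bar> \<le> e"
    "\<And>z h. \<bar>frechet_derivative \<phi> (at z) h - D z h\<bar> \<le> e * norm h"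
    using C1_smooth_approximation[OF D c supp e] by blast
  let ?E = "\<lambda>z. frechet_derivative \<phi> (at z)"
  note d\<phi> = smooth_derivative_continuous[OF \<phi>(1)]
  have c\<psi>: "continuous_on UNIV \<psi>"
    by (rule has_derivative_continuous_on[OF has_derivative_at_withinI[OF D]])
  have c\<phi>: "continuous_on UNIV \<phi>"
    using \<phi>(1) Ck_imp_continuous_on unfolding smooth_def by blast
  obtain K1 where K1: "\<And>z. \<bar>\<psi> z\<bar> \<le> K1" using compact_support_bounded[OF c\<psi> supp] by (metis real_norm_def)
  obtain K1' where K1': "\<And>z. \<bar>\<phi> z\<bar> \<le> K1'" using compact_support_bounded[OF c\<phi> \<phi>(2)] by (metis real_norm_def)
  obtain K2 where K2: "K2 \<ge> 0" "\<And>z h. \<bar>D z h\<bar> \<le> K2 * norm h"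
    using compact_support_derivative_bounded[OF D c supp] by blast
  obtain K3 where K3: "K3 \<ge> 0" "\<And>z h. \<bar>?E z h\<bar> \<le> K3 * norm h"
    using compact_support_derivative_bounded[OF d\<phi> \<phi>(2)] by blast
  note gD = generator_bounds[OF has_derivative_linear[OF D] c K2]
  note gE = generator_bounds[OF has_derivative_linear[OF d\<phi>(1)] d\<phi>(2) K3]
  have lDE: "linear (\<lambda>h. ?E z h - D z h)" for z
    by (intro linear_compose_sub has_derivative_linear[OF D] has_derivative_linear[OF d\<phi>(1)])
  have cDE: "continuous_on UNIV (\<lambda>z. ?E z h - D z h)" for h by (intro continuous_intros c d\<phi>(2))
  note gDE = generator_bounds[OF lDE cDE less_imp_le[OF e] \<phi>(4)]
  have 1: "\<bar>(LINT z|lborel. F s z * \<phi> z) - (LINT z|lborel. F s z * \<psi> z)\<bar> \<le> e * M0" for s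
    using bounded_moment(1)[OF continuous_on_diff[OF c\<phi> c\<psi>] \<phi>(3), of s]
      integrable_F_bounded[OF c\<phi> K1', of s] integrable_F_bounded[OF c\<psi> K1, of s]
    by (simp add: right_diff_distrib)
  have 2: "\<bar>(LINT \<tau>:{0..t}|lborel. LINT z|lborel. F \<tau> z * ?E z (snd z, W \<tau> z))
      - (LINT \<tau>:{0..t}|lborel. LINT z|lborel. F \<tau> z * D z (snd z, W \<tau> z))\<bar> \<le> e * (\<kappa> * Q) * t"
  proof -
    have z: "(LINT \<tau>:{0}|lborel. g \<tau>) = 0" for g :: "real \<Rightarrow> real"
      unfolding set_lebesgue_integral_def
      by (intro integral_eq_zero_AE AE_I'[of "{0}"]) (auto simp: indicator_def)
    have "(LINT \<tau>:{0..t}|lborel. LINT z|lborel. F \<tau> z * ?E z (snd z, W \<tau> z))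
      - (LINT \<tau>:{0..t}|lborel. LINT z|lborel. F \<tau> z * D z (snd z, W \<tau> z))
      = (LINT \<tau>:{0..t}|lborel. LINT z|lborel. F \<tau> z * (?E z (snd z, W \<tau> z) - D z (snd z, W \<tau> z)))"
      by (subst set_integral_diff(2)[OF gE(4) gD(4), symmetric])
        (simp add: right_diff_distrib Bochner_Integration.integral_diff[OF gE(1) gD(1)])
    also have "\<dots> = (LINT \<tau>:{0<..t}|lborel. LINT z|lborel. F \<tau> z * (?E z (snd z, W \<tau> z) - D z (snd z, W \<tau> z)))"
      using set_integral_Icc_diff(1)[OF gDE(4) order_refl t] by (simp add: z)
    also have "\<bar>\<dots>\<bar> \<le> e * (\<kappa> * Q) * (t - 0)"
      by (rule set_integral_abs_le[OF gDE(2) t]) (use e \<kappa>_pos Q_nonneg in simp)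
    finally show ?thesis by simp
  qed
  show "\<bar>(LINT z|lborel. F t z * \<psi> z) - (LINT z|lborel. F 0 z * \<psi> z)
    - (LINT \<tau>:{0..t}|lborel. LINT z|lborel. F \<tau> z * D z (snd z, W \<tau> z))\<bar> \<le> e * (2 * M0 + \<kappa> * Q * t)"
  proof -
    have "(LINT z|lborel. F t z * \<phi> z) - (LINT z|lborel. F 0 z * \<phi> z)
      = (LINT \<tau>:{0..t}|lborel. LINT z|lborel. F \<tau> z * ?E z (snd z, W \<tau> z))"
      by (rule weak_smooth[OF \<phi>(1,2) t])
    moreover have "e * (2 * M0 + \<kappa> * Q * t) = e * M0 + e * M0 + e * (\<kappa> * Q) * t"
      by (simp add: algebra_simps)
    ultimately show ?thesis
      using 1[of t] 1[of 0] 2 by linarith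
  qed
qed

end

lemma compact_linear_family_bounded:
  fixes D :: "'p::metric_space \<Rightarrow> 'a::euclidean_space \<Rightarrow> real"
  assumes K: "compact K" and l: "\<And>p. linear (D p)" and c: "\<And>h. continuous_on UNIV (\<lambda>p. D p h)"
  obtains B where "B \<ge> 0" "\<And>p h. p \<in> K \<Longrightarrow> \<bar>D p h\<bar> \<le> B * norm h"
proof -
  have "\<exists>B. \<forall>p\<in>K. \<bar>D p i\<bar> \<le> B" for i
  proof -
    have "bounded ((\<lambda>p. D p i) ` K)"
      by (intro compact_imp_bounded compact_continuous_image K continuous_on_subset[OF c]) auto
    then show ?thesis by (auto simp: bounded_iff)
  qed
  then obtain B where B: "\<And>i p. p \<in> K \<Longrightarrow> \<bar>D p i\<bar> \<le> B i" by metis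
  define C where "C = DIM('a) * (\<Sum>i\<in>(Basis::'a set). \<bar>B i\<bar>)"
  show ?thesis
  proof (rule that[of C])
    show "C \<ge> 0" by (simp add: C_def sum_nonneg)
    fix p h assume p: "p \<in> K"
    have "\<bar>D p h - (\<lambda>_. 0) h\<bar> \<le> C * norm h"
    proof (rule linear_family_close[OF l])
      fix i :: 'a assume "i \<in> Basis"
      then have "\<bar>B i\<bar> \<le> (\<Sum>i\<in>Basis. \<bar>B i\<bar>)" by (intro member_le_sum) auto
      moreover have "\<bar>D p i\<bar> \<le> \<bar>B i\<bar>" using B[OF p, of i] by simp
      ultimately show "\<bar>D p i - 0\<bar> \<le> C / DIM('a)" by (simp add: C_def)
    qed (simp add: linear_iff)
    then show "\<bar>D p h\<bar> \<le> C * norm h" by simp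
  qed
qed

lemma compact_linear_family_uniform:
  fixes D :: "'p::metric_space \<Rightarrow> 'a::euclidean_space \<Rightarrow> real"
  assumes K: "compact K" and l: "\<And>p. linear (D p)" and c: "\<And>h. continuous_on UNIV (\<lambda>p. D p h)" and e: "e > 0"
  obtains d where "d > 0" "\<And>p p' h. p \<in> K \<Longrightarrow> p' \<in> K \<Longrightarrow> dist p p' < d \<Longrightarrow> \<bar>D p h - D p' h\<bar> \<le> e * norm h"
proof -
  have "\<exists>d>0. \<forall>p\<in>K. \<forall>p'\<in>K. dist p p' < d \<longrightarrow> \<bar>D p i - D p' i\<bar> \<le> e / DIM('a)" for i
  proof -
    have "uniformly_continuous_on K (\<lambda>p. D p i)"
      by (intro compact_uniformly_continuous K continuous_on_subset[OF c]) auto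
    moreover have "e / DIM('a) > 0" using e by simp
    ultimately obtain d where "d > 0" "\<And>p p'. p \<in> K \<Longrightarrow> p' \<in> K \<Longrightarrow> dist p' p < d \<Longrightarrow> dist (D p' i) (D p i) < e / DIM('a)"
      unfolding uniformly_continuous_on_def by metis
    then show ?thesis by (intro exI[of _ d]) (force simp: dist_real_def)
  qed
  then obtain d where d: "\<And>i. d i > 0"
    "\<And>i p p'. p \<in> K \<Longrightarrow> p' \<in> K \<Longrightarrow> dist p p' < d i \<Longrightarrow> \<bar>D p i - D p' i\<bar> \<le> e / DIM('a)"
    by metis
  show ?thesis
  proof (rule that[of "Min (d ` (Basis::'a set))"])
    show "Min (d ` (Basis::'a set)) > 0" using d(1) by simp
    fix p p' h assume p: "p \<in> K" "p' \<in> K" "dist p p' < Min (d ` (Basis::'a set))"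
    show "\<bar>D p h - D p' h\<bar> \<le> e * norm h"
      by (rule linear_family_close[OF l l]) (use p d(2) in auto)
  qed
qed

lemma has_derivative_slices:
  fixes \<Psi> :: "real \<Rightarrow> 'a::real_normed_vector \<Rightarrow> 'b::real_normed_vector"
  assumes D: "((\<lambda>(t, z). \<Psi> t z) has_derivative D (t, z)) (at (t, z) within {a..b} \<times> UNIV)" and t: "t \<in> {a..b}"
  shows "(\<Psi> t has_derivative (\<lambda>h. D (t, z) (0, h))) (at z)"
    and "((\<lambda>\<tau>. \<Psi> \<tau> z) has_derivative (\<lambda>s. D (t, z) (s, 0))) (at t within {a..b})"
proof -
  have "((\<lambda>z. (t, z)) has_derivative (\<lambda>h. (0, h))) (at z within UNIV)"
    by (auto intro!: derivative_eq_intros)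
  moreover have "((\<lambda>(t, z). \<Psi> t z) has_derivative D (t, z)) (at (t, z) within (\<lambda>z. (t, z)) ` UNIV)"
    by (rule has_derivative_subset[OF D]) (use t in auto)
  ultimately show "(\<Psi> t has_derivative (\<lambda>h. D (t, z) (0, h))) (at z)"
    using has_derivative_in_compose[of "\<lambda>z. (t, z)" "\<lambda>h. (0, h)" z UNIV "\<lambda>(t, z). \<Psi> t z" "D (t, z)"] by simp
  have "((\<lambda>\<tau>. (\<tau>, z)) has_derivative (\<lambda>s. (s, 0))) (at t within {a..b})"
    by (auto intro!: derivative_eq_intros)
  moreover have "((\<lambda>(t, z). \<Psi> t z) has_derivative D (t, z)) (at (t, z) within (\<lambda>\<tau>. (\<tau>, z)) ` {a..b})"
    by (rule has_derivative_subset[OF D]) auto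
  ultimately show "((\<lambda>\<tau>. \<Psi> \<tau> z) has_derivative (\<lambda>s. D (t, z) (s, 0))) (at t within {a..b})"
    using has_derivative_in_compose[of "\<lambda>\<tau>. (\<tau>, z)" "\<lambda>s. (s, 0)" t "{a..b}" "\<lambda>(t, z). \<Psi> t z" "D (t, z)"] by simp
qed

text \<open>The premise forces derivative 0 at every point of \<open>[0, T]\<close>. It is phrased
  for pairs \<open>s \<le> t\<close> near \<open>t0\<close>, rather than for increments from
  \<open>t0\<close>, because the estimate it serves freezes a test function at the left
  endpoint.\<close>

lemma constant_if_locally_flat:
  fixes G :: "real \<Rightarrow> real"
  assumes flat: "\<And>t0 e. t0 \<in> {0..T} \<Longrightarrow> e > 0 \<Longrightarrow> \<exists>d>0. \<forall>s\<in>{0..T}. \<forall>t\<in>{0..T}.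
      s \<le> t \<longrightarrow> \<bar>s - t0\<bar> < d \<longrightarrow> \<bar>t - t0\<bar> < d \<longrightarrow> \<bar>G t - G s\<bar> \<le> e * C * (t - s)"
    and t: "t \<in> {0..T}"
  shows "G t = G 0"
proof -
  have "(G has_real_derivative 0) (at t0 within {0..T})" if t0: "t0 \<in> {0..T}" for t0
    unfolding has_field_derivative_iff
  proof (unfold tendsto_iff, intro allI impI)
    fix e :: real assume e: "e > 0"
    \<comment> \<open>Scaled so that \<open>C\<close>, of unknown sign and size, is absorbed with a
      factor 1/2 left over for the strict inequality.\<close>
    have "e / (2 * (\<bar>C\<bar> + 1)) > 0" using e by simp
    from flat[OF t0 this] obtain d where d: "d > 0"
      "\<And>s t. s \<in> {0..T} \<Longrightarrow> t \<in> {0..T} \<Longrightarrow> s \<le> t \<Longrightarrow> \<bar>s - t0\<bar> < d \<Longrightarrow> \<bar>t - t0\<bar> < d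
        \<Longrightarrow> \<bar>G t - G s\<bar> \<le> e / (2 * (\<bar>C\<bar> + 1)) * C * (t - s)" by blast
    have eC: "e / (2 * (\<bar>C\<bar> + 1)) * C \<le> e / 2"
    proof -
      have "e / (2 * (\<bar>C\<bar> + 1)) * C \<le> e / (2 * (\<bar>C\<bar> + 1)) * (\<bar>C\<bar> + 1)"
        using e by (intro mult_left_mono) auto
      also have "\<dots> = e / 2" by (simp add: field_simps)
      finally show ?thesis .
    qed
    have "\<bar>(G y - G t0) / (y - t0)\<bar> < e" if y: "y \<in> {0..T}" "y \<noteq> t0" "\<bar>y - t0\<bar> < d" for y
    proof -
      have "\<bar>G y - G t0\<bar> \<le> e / (2 * (\<bar>C\<bar> + 1)) * C * \<bar>y - t0\<bar>"
      proof (cases "y \<le> t0")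
        case True
        then show ?thesis using d(2)[OF y(1) t0 True y(3)] d(1) by (simp add: abs_minus_commute)
      next
        case False
        then show ?thesis using d(2)[OF t0 y(1) _ _ y(3)] d(1) by simp
      qed
      also have "\<dots> \<le> e / 2 * \<bar>y - t0\<bar>" using eC by (rule mult_right_mono) simp
      also have "\<dots> < e * \<bar>y - t0\<bar>" using e y(2) by simp
      finally show ?thesis using y(2) by (simp add: divide_less_eq)
    qed
    then show "\<forall>\<^sub>F y in at t0 within {0..T}. dist ((G y - G t0) / (y - t0)) 0 < e"
      unfolding eventually_at using d(1) by (intro exI[of _ d]) (auto simp: dist_real_def)
  qed
  then have "\<exists>c. \<forall>x\<in>{0..T}. G x = c"
    by (intro has_field_derivative_zero_constant) auto
  then show ?thesis using t by (metis atLeastAtMost_iff order_refl order_trans)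
qed

lemma positive_part_square_derivative:
  "((\<lambda>s::real. (max 0 s)\<^sup>2) has_real_derivative 2 * max 0 s) (at s)"
proof -
  consider "s > 0" | "s < 0" | "s = 0" by linarith
  then show ?thesis
  proof cases
    case 1
    have "((\<lambda>s::real. s\<^sup>2) has_real_derivative 2 * max 0 s) (at s)"
      using 1 by (auto intro!: derivative_eq_intros)
    then show ?thesis
      by (rule has_field_derivative_transform_within_open[where S = "{0<..}"]) (use 1 in auto)
  next
    case 2
    have "((\<lambda>s::real. 0) has_real_derivative 2 * max 0 s) (at s)" using 2 by simp
    then show ?thesis
      by (rule has_field_derivative_transform_within_open[where S = "{..<0}"]) (use 2 in auto)
  next
    case 3
    have "((\<lambda>h::real. (max 0 h)\<^sup>2 / h) \<longlongrightarrow> 0) (at 0)"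
    proof (rule Lim_null_comparison)
      show "\<forall>\<^sub>F h in at 0. norm ((max 0 h)\<^sup>2 / h) \<le> \<bar>h\<bar>" for h :: real
        by (intro always_eventually allI) (auto simp: max_def power2_eq_square)
      show "((\<lambda>h::real. \<bar>h\<bar>) \<longlongrightarrow> 0) (at 0)" by (intro tendsto_rabs_zero tendsto_ident_at)
    qed
    then show ?thesis using 3 by (simp add: has_field_derivative_iff)
  qed
qed

text \<open>Squaring the positive part makes the cutoff C^1, as much regularity as
  \<open>weak_C1_time\<close> asks for, and keeps its derivative explicit.\<close>

definition cutoff :: "real \<Rightarrow> 'a::real_inner \<Rightarrow> real" where
  "cutoff n z = (max 0 (1 - (z \<bullet> z) / n\<^sup>2))\<^sup>2"

definition dcutoff :: "real \<Rightarrow> 'a::real_inner \<Rightarrow> 'a \<Rightarrow> real" where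
  "dcutoff n z h = 2 * max 0 (1 - (z \<bullet> z) / n\<^sup>2) * (- (2 * (z \<bullet> h)) / n\<^sup>2)"

lemma cutoff_has_derivative: "(cutoff n has_derivative dcutoff n z) (at z)"
proof -
  have "((\<lambda>z. 1 - (z \<bullet> z) / n\<^sup>2) has_derivative (\<lambda>h. - (2 * (z \<bullet> h)) / n\<^sup>2)) (at z)"
    by (auto intro!: derivative_eq_intros simp: inner_commute divide_inverse algebra_simps)
  from has_derivative_compose[OF this positive_part_square_derivative[unfolded has_field_derivative_def]]
  show ?thesis by (simp add: cutoff_def[abs_def] dcutoff_def[abs_def])
qed

lemma continuous_dcutoff: "continuous_on UNIV (\<lambda>z. dcutoff n z h)"
  unfolding dcutoff_def divide_inverse by (intro continuous_intros)

lemma linear_dcutoff: "linear (dcutoff n z)"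
  using has_derivative_linear[OF cutoff_has_derivative] .

lemma cutoff_bounds: "0 \<le> cutoff n z" "cutoff n z \<le> 1"
proof -
  show "0 \<le> cutoff n z" by (simp add: cutoff_def)
  have "max 0 (1 - (z \<bullet> z) / n\<^sup>2) \<le> 1" by simp
  then show "cutoff n z \<le> 1" unfolding cutoff_def by (intro power_le_one) auto
qed

lemma cutoff_eq_0:
  assumes "n > 0" "norm z \<ge> n" shows "cutoff n z = 0" "dcutoff n z h = 0"
proof -
  have "n\<^sup>2 \<le> z \<bullet> z" using assms power_mono[of n "norm z" 2] by (simp add: power2_norm_eq_inner)
  then have "max 0 (1 - (z \<bullet> z) / n\<^sup>2) = 0" using assms(1) by simp
  then show "cutoff n z = 0" "dcutoff n z h = 0" by (simp_all add: cutoff_def dcutoff_def)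
qed

text \<open>On the support \<open>|z|\<close> is at most \<open>n\<close>, so the division by
  \<open>n^2\<close> leaves \<open>1 / n\<close>; this decay removes the cutoff's own derivative in
  the limit.\<close>

lemma dcutoff_bound:
  assumes n: "n > 0" shows "\<bar>dcutoff n z h\<bar> \<le> 4 / n * norm h"
proof (cases "norm z \<ge> n")
  case True
  then show ?thesis using cutoff_eq_0[OF n True] n by simp
next
  case False
  have "\<bar>z \<bullet> h\<bar> \<le> n * norm h"
    using Cauchy_Schwarz_ineq2[of z h] False mult_right_mono[of "norm z" n "norm h"] by simp
  then have "\<bar>- (2 * (z \<bullet> h)) / n\<^sup>2\<bar> \<le> 2 * (n * norm h) / n\<^sup>2"
    using n by (simp add: abs_mult divide_right_mono)
  then have "\<bar>2 * max 0 (1 - (z \<bullet> z) / n\<^sup>2)\<bar> * \<bar>- (2 * (z \<bullet> h)) / n\<^sup>2\<bar> \<le> 2 * (2 * (n * norm h) / n\<^sup>2)"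
    by (intro mult_mono) auto
  also have "\<dots> = 4 / n * norm h" using n by (simp add: power2_eq_square)
  finally show ?thesis by (simp add: dcutoff_def abs_mult)
qed

lemma cutoff_tendsto: "(\<lambda>n. cutoff (real (Suc n)) z) \<longlonglongrightarrow> 1"
proof -
  have "(\<lambda>n. (z \<bullet> z) / (real (Suc n))\<^sup>2) \<longlonglongrightarrow> 0"
    using tendsto_mult[OF tendsto_const[of "z \<bullet> z"] tendsto_power[OF LIMSEQ_inverse_real_of_nat, of 2]]
    by (simp add: divide_inverse power_inverse)
  then have "(\<lambda>n. (max 0 (1 - (z \<bullet> z) / (real (Suc n))\<^sup>2))\<^sup>2) \<longlonglongrightarrow> (max 0 (1 - 0))\<^sup>2"
    by (intro tendsto_intros)
  then show ?thesis by (simp add: cutoff_def)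
qed

lemma dcutoff_tendsto: "(\<lambda>n. dcutoff (real (Suc n)) z h) \<longlonglongrightarrow> 0"
proof (rule Lim_null_comparison)
  show "\<forall>\<^sub>F n in sequentially. norm (dcutoff (real (Suc n)) z h) \<le> 4 * norm h * inverse (real (Suc n))"
    using dcutoff_bound[of "real (Suc _)" z h] by (intro always_eventually) (simp add: divide_inverse mult_ac)
  show "(\<lambda>n. 4 * norm h * inverse (real (Suc n))) \<longlonglongrightarrow> 0"
    using tendsto_mult[OF tendsto_const LIMSEQ_inverse_real_of_nat] by simp
qed

context kinetic
begin

lemma tail_difference_bound:
  assumes c: "continuous_on UNIV \<psi>" and K: "\<And>z. \<bar>\<psi> z\<bar> \<le> K"
  shows "\<bar>(LINT z|lborel. F t z * \<psi> z) - (LINT z|lborel. F s z * \<psi> z)\<bar> \<le> K * (LINT z|lborel. \<bar>F t z - F s z\<bar>)"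
proof -
  note i = integrable_F_bounded[OF c K]
  have "(LINT z|lborel. F t z * \<psi> z) - (LINT z|lborel. F s z * \<psi> z) = (LINT z|lborel. (F t z - F s z) * \<psi> z)"
    using i[of t] i[of s] by (simp add: left_diff_distrib)
  also have "\<bar>\<dots>\<bar> \<le> (LINT z|lborel. K * \<bar>F t z - F s z\<bar>)"
  proof (rule order_trans[OF integral_abs_bound], rule integral_mono)
    show "integrable lborel (\<lambda>z. \<bar>(F t z - F s z) * \<psi> z\<bar>)"
      using i[of t] i[of s] by (simp add: left_diff_distrib)
    show "\<bar>(F t z - F s z) * \<psi> z\<bar> \<le> K * \<bar>F t z - F s z\<bar>" for z
      using mult_right_mono[OF K[of z], of "\<bar>F t z - F s z\<bar>"] by (simp add: abs_mult mult.commute)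
  qed (use F_integrable in simp)
  finally show ?thesis by simp
qed

lemma norm_full_velocity: "norm (1::real, snd z, W t z) \<le> (1 + \<kappa>) * q t z"
proof -
  have "norm (1::real, snd z, W t z) \<le> 1 + norm (snd z, W t z)"
    using norm_Pair_le[of "1::real" "(snd z, W t z)"] by simp
  also have "\<dots> \<le> q t z + \<kappa> * q t z" by (intro add_mono q_ge_1 W_bound)
  finally show ?thesis by (simp add: distrib_right)
qed

text \<open>\<open>F\<close> is merely continuous in L^1, so the moment of \<open>\<Psi> t\<close>
  cannot be differentiated by a product rule. On a short interval \<open>[s, t]\<close> the test
  function is frozen at time \<open>s\<close>, where \<open>weak_C1\<close> applies, and the
  remaining change of \<open>\<Psi>\<close> is linearised at \<open>s\<close>. The difference of the
  two sides then changes by less than any multiple of \<open>t - s\<close>, hence is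
  constant.\<close>

lemma weak_C1_time:
  fixes \<Psi> :: "real \<Rightarrow> (real^'d) \<times> (real^'d) \<Rightarrow> real"
  assumes D: "\<And>t z. t \<in> {0..T} \<Longrightarrow> ((\<lambda>(t, z). \<Psi> t z) has_derivative D (t, z)) (at (t, z) within {0..T} \<times> UNIV)"
    and l: "\<And>p. linear (D p)" and c: "\<And>h. continuous_on UNIV (\<lambda>p. D p h)"
    and supp: "\<And>t z. t \<in> {0..T} \<Longrightarrow> norm z > R \<Longrightarrow> \<Psi> t z = 0"
    and suppD: "\<And>t z h. t \<in> {0..T} \<Longrightarrow> norm z > R \<Longrightarrow> D (t, z) h = 0"
    and t: "t \<in> {0..T}"
  shows "(LINT z|lborel. F t z * \<Psi> t z) - (LINT z|lborel. F 0 z * \<Psi> 0 z)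
    = (LINT \<tau>:{0..t}|lborel. LINT z|lborel. F \<tau> z * D (\<tau>, z) (1, snd z, W \<tau> z))"
proof -
  have slice1: "(\<Psi> s has_derivative (\<lambda>h. D (s, z) (0, h))) (at z)" if "s \<in> {0..T}" for s z
    by (rule has_derivative_slices(1)[where \<Psi> = \<Psi> and D = D and t = s and z = z, OF D[OF that] that])
  have slice2: "((\<lambda>\<tau>. \<Psi> \<tau> z) has_derivative (\<lambda>h. D (s, z) (h, 0))) (at s within {0..T})" if "s \<in> {0..T}" for s z
    by (rule has_derivative_slices(2)[where \<Psi> = \<Psi> and D = D and t = s and z = z, OF D[OF that] that])
  define K where "K = {0..T} \<times> (cball 0 R :: ((real^'d) \<times> (real^'d)) set)"
  have cK: "compact K" unfolding K_def by (intro compact_Times) auto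
  obtain B where B: "B \<ge> 0" "\<And>p h. p \<in> K \<Longrightarrow> \<bar>D p h\<bar> \<le> B * norm h"
    using compact_linear_family_bounded[OF cK l c] by blast
  have DB: "\<bar>D (s, z) h\<bar> \<le> B * norm h" if "s \<in> {0..T}" for s z h
    using B(2)[of "(s, z)" h] suppD[OF that, of z h] B(1) that by (cases "norm z > R") (auto simp: K_def)
  define A where "A s = (LINT z|lborel. F s z * \<Psi> s z)" for s
  define cc where "cc \<tau> = (LINT z|lborel. F \<tau> z * D (\<tau>, z) (1, snd z, W \<tau> z))" for \<tau>
  have mD: "(\<lambda>p. D (fst p, snd p) (1, snd (snd p), W (fst p) (snd p))) \<in> borel_measurable (borel \<Otimes>\<^sub>M (borel \<Otimes>\<^sub>M borel))"
    using generator_measurable[OF l c] by (simp add: borel_prod)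
  have bD: "\<bar>D (\<tau>, z) (1, snd z, W \<tau> z)\<bar> \<le> B * (1 + \<kappa>) * q \<tau> z" if "\<tau> \<in> {0..T}" for \<tau> z
    using order_trans[OF DB[OF that] mult_left_mono[OF norm_full_velocity B(1)]] by (simp add: mult.assoc)
  have cci: "set_integrable lborel {0..s} cc" if "s \<in> {0..T}" for s
    unfolding cc_def by (rule FG_set_integrable[OF mD bD]) (use that in \<open>auto simp: emeasure_lborel_Icc_eq\<close>)
  \<comment> \<open>\<open>M0\<close> comes from linearising \<open>\<Psi>\<close> in time,
    \<open>(1 + \<kappa>) * Q\<close> from replacing \<open>D\<close> at time \<open>\<tau>\<close>
    by \<open>D\<close> at time \<open>s\<close>, and \<open>2 * B\<close> from moving
    \<open>F\<close> in the time-derivative term from \<open>\<tau>\<close> to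
    \<open>t\<close>.\<close>
  define C where "C = M0 + ((1 + \<kappa>) * Q + 2 * B)"
  have "A t - (LINT \<tau>:{0..t}|lborel. cc \<tau>) = A 0 - (LINT \<tau>:{0..0}|lborel. cc \<tau>)"
  proof (rule constant_if_locally_flat[OF _ t, of "\<lambda>s. A s - (LINT \<tau>:{0..s}|lborel. cc \<tau>)" C])
    fix t0 e :: real assume t0: "t0 \<in> {0..T}" and e: "e > 0"
    obtain d1 where d1: "d1 > 0" "\<And>p p' h. p \<in> K \<Longrightarrow> p' \<in> K \<Longrightarrow> dist p p' < d1 \<Longrightarrow> \<bar>D p h - D p' h\<bar> \<le> e * norm h"
      using compact_linear_family_uniform[OF cK l c e] by blast
    have Dc: "\<bar>D (s, z) h - D (s', z) h\<bar> \<le> e * norm h" if "s \<in> {0..T}" "s' \<in> {0..T}" "\<bar>s - s'\<bar> < d1" for s s' z h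
    proof (cases "norm z > R")
      case True
      then show ?thesis using suppD[of s z h] suppD[of s' z h] that e by simp
    next
      case False
      then show ?thesis using d1(2)[of "(s, z)" "(s', z)" h] that
        by (auto simp: K_def dist_Pair_Pair dist_real_def)
    qed
    have "((\<lambda>\<tau>. LINT z|lborel. \<bar>F \<tau> z - F t0 z\<bar>) \<longlongrightarrow> 0) (at t0 within {0..})"
      using F_L1_continuous t0 by simp
    then have "\<forall>\<^sub>F \<tau> in at t0 within {0..}. dist (LINT z|lborel. \<bar>F \<tau> z - F t0 z\<bar>) 0 < e"
      using e by (rule tendstoD)
    then obtain d2 where d2: "d2 > 0"
      "\<And>\<tau>. \<tau> \<in> {0..} \<Longrightarrow> \<tau> \<noteq> t0 \<Longrightarrow> dist \<tau> t0 < d2 \<Longrightarrow> dist (LINT z|lborel. \<bar>F \<tau> z - F t0 z\<bar>) 0 < e"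
      unfolding eventually_at by blast
    have F1: "(LINT z|lborel. \<bar>F \<tau> z - F t0 z\<bar>) \<le> e" if "\<tau> \<ge> 0" "\<bar>\<tau> - t0\<bar> < d2" for \<tau>
      using d2(2)[of \<tau>] that e by (cases "\<tau> = t0") (auto simp: dist_real_def)
    have F2: "(LINT z|lborel. \<bar>F t z - F \<tau> z\<bar>) \<le> 2 * e" if "\<tau> \<ge> 0" "\<bar>\<tau> - t0\<bar> < d2" "t \<ge> 0" "\<bar>t - t0\<bar> < d2" for \<tau> t
    proof -
      have "(LINT z|lborel. \<bar>F t z - F \<tau> z\<bar>) \<le> (LINT z|lborel. \<bar>F t z - F t0 z\<bar> + \<bar>F \<tau> z - F t0 z\<bar>)"
        by (rule integral_mono) (auto simp: F_integrable)
      also have "\<dots> = (LINT z|lborel. \<bar>F t z - F t0 z\<bar>) + (LINT z|lborel. \<bar>F \<tau> z - F t0 z\<bar>)"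
        by (simp add: F_integrable)
      finally show ?thesis using F1[OF that(1,2)] F1[OF that(3,4)] by linarith
    qed
    show "\<exists>d>0. \<forall>s\<in>{0..T}. \<forall>t\<in>{0..T}. s \<le> t \<longrightarrow> \<bar>s - t0\<bar> < d \<longrightarrow> \<bar>t - t0\<bar> < d \<longrightarrow>
        \<bar>(A t - (LINT \<tau>:{0..t}|lborel. cc \<tau>)) - (A s - (LINT \<tau>:{0..s}|lborel. cc \<tau>))\<bar> \<le> e * C * (t - s)"
    proof (intro exI[of _ "min (d1 / 2) d2"] conjI ballI impI)
      \<comment> \<open>Half of \<open>d1\<close>, so that two times this close to \<open>t0\<close>
        are closer than \<open>d1\<close> to each other.\<close>
      show "min (d1 / 2) d2 > 0" using d1(1) d2(1) by simp
      fix s t assume s: "s \<in> {0..T}" and t: "t \<in> {0..T}" and st: "s \<le> t"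
        and ds: "\<bar>s - t0\<bar> < min (d1 / 2) d2" and dt: "\<bar>t - t0\<bar> < min (d1 / 2) d2"
      have near: "\<bar>s - \<tau>\<bar> < d1" "\<bar>\<tau> - t0\<bar> < d2" "\<tau> \<in> {0..T}" if "\<tau> \<in> {s..t}" for \<tau>
      proof -
        have "s \<le> \<tau>" "\<tau> \<le> t" using that by auto
        then show "\<bar>s - \<tau>\<bar> < d1" "\<bar>\<tau> - t0\<bar> < d2" "\<tau> \<in> {0..T}"
          using s t ds dt unfolding min_less_iff_conj abs_less_iff atLeastAtMost_iff by linarith+
      qed
      have ds': "\<bar>s - t0\<bar> < d2" and dt': "\<bar>t - t0\<bar> < d2" using ds dt by auto
      have s0: "0 \<le> s" and t00: "0 \<le> t" using s t by auto
      note Ds = slice1[OF s]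
      have ls: "linear (\<lambda>h. D (s, z) (0, h))" for z by (rule has_derivative_linear[OF Ds])
      have cs: "continuous_on UNIV (\<lambda>z. D (s, z) h)" for h
        by (rule continuous_on_compose2[OF c[of h] continuous_on_Pair[OF continuous_on_const continuous_on_id]]) simp
      have cs0: "continuous_on UNIV (\<lambda>z. D (s, z) (0, h))" for h by (rule cs)
      have Bs: "\<bar>D (s, z) (0, h)\<bar> \<le> B * norm h" for z h using DB[OF s, of z "(0, h)"] by (simp add: norm_Pair)
      note gs = generator_bounds[OF ls cs0 B(1) Bs]
      define b where "b \<tau> = (LINT z|lborel. F \<tau> z * D (s, z) (0, snd z, W \<tau> z))" for \<tau>
      define m where "m = (LINT z|lborel. F t z * D (s, z) (1, 0))"
      have c\<Psi>: "continuous_on UNIV (\<Psi> r)" if "r \<in> {0..T}" for r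
        using has_derivative_continuous_on[OF has_derivative_at_withinI[OF slice1[OF that]]] .
      obtain Ks where Ks: "\<And>z. \<bar>\<Psi> s z\<bar> \<le> Ks"
        using compact_support_bounded[OF c\<Psi>[OF s] supp[OF s]] by (metis real_norm_def)
      obtain Kt where Kt: "\<And>z. \<bar>\<Psi> t z\<bar> \<le> Kt"
        using compact_support_bounded[OF c\<Psi>[OF t] supp[OF t]] by (metis real_norm_def)
      have B1: "\<bar>D (s, z) (1, 0)\<bar> \<le> B" for z using DB[OF s, of z "(1, 0)"] by (simp add: norm_Pair)
      \<comment> \<open>Only the density moves here; the test function stays at
        \<open>\<Psi> s\<close>.\<close>
      have first: "(LINT z|lborel. F t z * \<Psi> s z) - (LINT z|lborel. F s z * \<Psi> s z) = (LINT \<tau>:{s<..t}|lborel. b \<tau>)"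
      proof -
        have "(LINT z|lborel. F t z * \<Psi> s z) - (LINT z|lborel. F s z * \<Psi> s z)
           = (LINT \<tau>:{0..t}|lborel. b \<tau>) - (LINT \<tau>:{0..s}|lborel. b \<tau>)"
          using weak_C1[where R = R, OF Ds cs0 supp[OF s] t00] weak_C1[where R = R, OF Ds cs0 supp[OF s] s0] by (simp add: b_def)
        also have "\<dots> = (LINT \<tau>:{s<..t}|lborel. b \<tau>)"
          unfolding b_def by (rule set_integral_Icc_diff(1)[OF gs(4) s0 st])
        finally show ?thesis .
      qed
      \<comment> \<open>Only the test function moves here; the mean value theorem in time makes the
        linearisation error uniform in \<open>z\<close>.\<close>
      have second: "\<bar>(LINT z|lborel. F t z * \<Psi> t z) - (LINT z|lborel. F t z * \<Psi> s z) - (t - s) * m\<bar> \<le> e * (t - s) * M0"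
      proof -
        have p: "\<bar>\<Psi> t z - \<Psi> s z - (t - s) * D (s, z) (1, 0)\<bar> \<le> e * (t - s)" for z
        proof -
          have "\<exists>x\<in>{s..t}. \<Psi> t z - \<Psi> s z = D (x, z) (t - s, 0)"
          proof (rule mvt_very_simple[OF st])
            fix x assume x: "s \<le> x" "x \<le> t"
            then have xT: "x \<in> {0..T}" using s t by auto
            show "((\<lambda>\<tau>. \<Psi> \<tau> z) has_derivative (\<lambda>h. D (x, z) (h, 0))) (at x within {s..t})"
              by (rule has_derivative_subset[OF slice2[OF xT]]) (use s t in auto)
          qed
          then obtain x where x: "x \<in> {s..t}" "\<Psi> t z - \<Psi> s z = D (x, z) (t - s, 0)" by blast
          have "D (x, z) (t - s, 0) = (t - s) * D (x, z) (1, 0)"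
            using linear_scale[OF l, of "(x, z)" "t - s" "(1, 0)"] by simp
          then have "\<Psi> t z - \<Psi> s z - (t - s) * D (s, z) (1, 0) = (t - s) * (D (x, z) (1, 0) - D (s, z) (1, 0))"
            using x(2) by (simp add: right_diff_distrib)
          moreover have "\<bar>D (x, z) (1, 0) - D (s, z) (1, 0)\<bar> \<le> e"
            using Dc[OF near(3)[OF x(1)] s, of z "(1, 0)"] near(1)[OF x(1)] by (simp add: norm_Pair abs_minus_commute)
          ultimately show ?thesis using st mult_left_mono[of "\<bar>D (x, z) (1, 0) - D (s, z) (1, 0)\<bar>" e "t - s"]
            by (simp add: abs_mult mult.commute[of e])
        qed
        have cc1: "continuous_on UNIV (\<lambda>z. \<Psi> t z - \<Psi> s z - (t - s) * D (s, z) (1, 0))"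
          by (intro continuous_intros c\<Psi>[OF s] c\<Psi>[OF t] cs)
        have "(LINT z|lborel. F t z * (\<Psi> t z - \<Psi> s z - (t - s) * D (s, z) (1, 0)))
            = (LINT z|lborel. F t z * \<Psi> t z - F t z * \<Psi> s z - (t - s) * (F t z * D (s, z) (1, 0)))"
          by (simp add: algebra_simps)
        also have "\<dots> = (LINT z|lborel. F t z * \<Psi> t z) - (LINT z|lborel. F t z * \<Psi> s z) - (t - s) * m"
          using integrable_F_bounded[OF c\<Psi>[OF s] Ks, of t] integrable_F_bounded[OF c\<Psi>[OF t] Kt, of t]
            integrable_F_bounded[OF cs B1, of t] by (simp add: m_def)
        finally show ?thesis using bounded_moment(1)[OF cc1 p, of t] by simp
      qed
      have X: "\<bar>b \<tau> - cc \<tau> + m\<bar> \<le> e * ((1 + \<kappa>) * Q + 2 * B)" if "\<tau> \<in> {s<..t}" for \<tau>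
      proof -
        have \<tau>: "\<tau> \<in> {s..t}" using that by simp
        note n = near[OF \<tau>]
        have l2: "linear (D (s, snd p))" for p :: "real \<times> (real^'d) \<times> (real^'d)" by (rule l)
        have c2: "continuous_on UNIV (\<lambda>p::real \<times> (real^'d) \<times> (real^'d). D (s, snd p) h)" for h
          by (rule continuous_on_compose2[OF cs]) (auto intro!: continuous_intros)
        have mE: "(\<lambda>p. D (s, snd p) (1, snd (snd p), W (fst p) (snd p)) - D (fst p, snd p) (1, snd (snd p), W (fst p) (snd p)))
            \<in> borel_measurable (borel \<Otimes>\<^sub>M (borel \<Otimes>\<^sub>M borel))"
          using generator_measurable[of "\<lambda>p. D (s, snd p)", OF l2 c2] mD by (simp add: borel_prod)
        have mS: "(\<lambda>p. D (s, snd p) (1, snd (snd p), W (fst p) (snd p))) \<in> borel_measurable (borel \<Otimes>\<^sub>M (borel \<Otimes>\<^sub>M borel))"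
          using generator_measurable[of "\<lambda>p. D (s, snd p)", OF l2 c2] by (simp add: borel_prod)
        have bS: "\<bar>D (s, z) (1, snd z, W \<tau>' z)\<bar> \<le> B * (1 + \<kappa>) * q \<tau>' z" for \<tau>' z
          using order_trans[OF DB[OF s] mult_left_mono[OF norm_full_velocity B(1)]] by (simp add: mult.assoc)
        have bE: "\<bar>D (s, z) (1, snd z, W \<tau>' z) - D (\<tau>', z) (1, snd z, W \<tau>' z)\<bar> \<le> e * (1 + \<kappa>) * q \<tau>' z" if "\<tau>' \<in> {\<tau>}" for \<tau>' z
        proof -
          have "\<bar>D (s, z) (1, snd z, W \<tau> z) - D (\<tau>, z) (1, snd z, W \<tau> z)\<bar> \<le> e * norm (1::real, snd z, W \<tau> z)"
            by (rule Dc[OF s n(3) n(1)])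
          also have "\<dots> \<le> e * ((1 + \<kappa>) * q \<tau> z)" using e by (intro mult_left_mono norm_full_velocity) auto
          finally show ?thesis using that by (simp add: mult.assoc)
        qed
        have E: "\<bar>LINT z|lborel. F \<tau> z * (D (s, z) (1, snd z, W \<tau> z) - D (\<tau>, z) (1, snd z, W \<tau> z))\<bar> \<le> e * (1 + \<kappa>) * Q"
          using FG_integral_le[where S = "{\<tau>}" and t = \<tau> and G = "\<lambda>\<tau>' z. D (s, z) (1, snd z, W \<tau>' z) - D (\<tau>', z) (1, snd z, W \<tau>' z)",
            OF mE bE] by simp
        have i1: "integrable lborel (\<lambda>z. F \<tau> z * D (s, z) (1, snd z, W \<tau> z))"
          using FG_integrable[where S = "{\<tau>}" and t = \<tau> and G = "\<lambda>\<tau>' z. D (s, z) (1, snd z, W \<tau>' z)", OF mS bS] by simp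
        have i2: "integrable lborel (\<lambda>z. F \<tau> z * D (\<tau>, z) (1, snd z, W \<tau> z))"
          using FG_integrable[where S = "{0..T}" and t = \<tau> and G = "\<lambda>\<tau>' z. D (\<tau>', z) (1, snd z, W \<tau>' z)", OF mD bD] n(3)
          by (simp add: emeasure_lborel_Icc_eq)
        have "D (s, z) (0, snd z, W \<tau> z) = D (s, z) (1, snd z, W \<tau> z) - D (s, z) (1, 0)" for z
          using linear_diff[OF l, of "(s, z)" "(1, snd z, W \<tau> z)" "(1, 0)"] by (simp add: zero_prod_def)
        then have "b \<tau> = (LINT z|lborel. F \<tau> z * D (s, z) (1, snd z, W \<tau> z)) - (LINT z|lborel. F \<tau> z * D (s, z) (1, 0))"
          using i1 integrable_F_bounded[OF cs B1, of \<tau>] by (simp add: b_def right_diff_distrib)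
        then have "b \<tau> - cc \<tau> + m = (LINT z|lborel. F \<tau> z * (D (s, z) (1, snd z, W \<tau> z) - D (\<tau>, z) (1, snd z, W \<tau> z)))
            + (m - (LINT z|lborel. F \<tau> z * D (s, z) (1, 0)))"
          using i1 i2 by (simp add: cc_def right_diff_distrib)
        moreover have "\<bar>m - (LINT z|lborel. F \<tau> z * D (s, z) (1, 0))\<bar> \<le> B * (2 * e)"
          unfolding m_def
          by (rule order_trans[OF tail_difference_bound[OF cs B1] mult_left_mono[OF F2 B(1)]])
            (use n t00 dt' s0 \<tau> in auto)
        ultimately have "\<bar>b \<tau> - cc \<tau> + m\<bar> \<le> e * (1 + \<kappa>) * Q + B * (2 * e)" using E by linarith
        also have "\<dots> = e * ((1 + \<kappa>) * Q + 2 * B)" by (simp add: algebra_simps)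
        finally show ?thesis .
      qed
      have bi: "set_integrable lborel {s<..t} b" unfolding b_def by (rule set_integral_Icc_diff(2)[OF gs(4) s0 st])
      have ci: "set_integrable lborel {s<..t} cc" by (rule set_integral_Icc_diff(2)[OF cci[OF t] s0 st])
      have mi: "set_integrable lborel {s<..t} (\<lambda>_. m)" unfolding set_integrable_def using st by simp
      have mI: "(LINT \<tau>:{s<..t}|lborel. m) = (t - s) * m" unfolding set_lebesgue_integral_def using st by simp
      have "\<bar>LINT \<tau>:{s<..t}|lborel. b \<tau> - cc \<tau> + m\<bar> \<le> e * ((1 + \<kappa>) * Q + 2 * B) * (t - s)"
      proof (rule set_integral_abs_le[OF X st])
        show "0 \<le> e * ((1 + \<kappa>) * Q + 2 * B)"
          using e \<kappa>_pos Q_nonneg B(1) by (intro mult_nonneg_nonneg add_nonneg_nonneg) auto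
      qed
      moreover have "(LINT \<tau>:{s<..t}|lborel. b \<tau> - cc \<tau> + m)
          = (LINT \<tau>:{s<..t}|lborel. b \<tau>) - (LINT \<tau>:{s<..t}|lborel. cc \<tau>) + (t - s) * m"
        using bi ci mi by (simp add: set_integral_add set_integral_diff mI)
      moreover have "(LINT \<tau>:{0..t}|lborel. cc \<tau>) - (LINT \<tau>:{0..s}|lborel. cc \<tau>) = (LINT \<tau>:{s<..t}|lborel. cc \<tau>)"
        by (rule set_integral_Icc_diff(1)[OF cci[OF t] s0 st])
      moreover have "e * C * (t - s) = e * (t - s) * M0 + e * ((1 + \<kappa>) * Q + 2 * B) * (t - s)"
        by (simp add: C_def algebra_simps)
      ultimately show "\<bar>(A t - (LINT \<tau>:{0..t}|lborel. cc \<tau>)) - (A s - (LINT \<tau>:{0..s}|lborel. cc \<tau>))\<bar> \<le> e * C * (t - s)"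
        using first second unfolding A_def by linarith
    qed
  qed
  moreover have "(LINT \<tau>:{0..0}|lborel. cc \<tau>) = 0"
    unfolding set_lebesgue_integral_def
    by (intro integral_eq_zero_AE AE_I'[of "{0}"]) (auto simp: indicator_def)
  ultimately show ?thesis unfolding A_def cc_def by linarith
qed

text \<open>A cutoff multiplies the test function, and \<open>n\<close> tends to infinity by
  dominated convergence with a multiple of \<open>F * q\<close> as majorant. The bound on
  \<open>D\<close> is asked for only along the transport direction, the one that is
  integrated.\<close>

lemma weak_general:
  fixes \<Psi> :: "real \<Rightarrow> (real^'d) \<times> (real^'d) \<Rightarrow> real"
  assumes D: "\<And>t z. t \<in> {0..T} \<Longrightarrow> ((\<lambda>(t, z). \<Psi> t z) has_derivative D (t, z)) (at (t, z) within {0..T} \<times> UNIV)"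
    and l: "\<And>p. linear (D p)" and c: "\<And>h. continuous_on UNIV (\<lambda>p. D p h)"
    and c\<Psi>: "continuous_on UNIV (\<lambda>(t, z). \<Psi> t z)"
    and b\<Psi>: "\<And>t z. t \<in> {0..T} \<Longrightarrow> \<bar>\<Psi> t z\<bar> \<le> C * (1 + norm (snd z))"
    and bD: "\<And>t z. t \<in> {0..T} \<Longrightarrow> \<bar>D (t, z) (1, snd z, W t z)\<bar> \<le> C * q t z"
    and t: "t \<in> {0..T}"
  shows "(LINT z|lborel. F t z * \<Psi> t z) - (LINT z|lborel. F 0 z * \<Psi> 0 z)
    = (LINT \<tau>:{0..t}|lborel. LINT z|lborel. F \<tau> z * D (\<tau>, z) (1, snd z, W \<tau> z))"
proof -
  have T: "0 \<in> {0..T}" using t by auto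
  have C: "C \<ge> 0" using b\<Psi>[OF T, of 0] by (simp add: abs_le_iff)
  define N where "N n = real (Suc n)" for n
  have N: "N n \<ge> 1" "N n > 0" for n by (simp_all add: N_def)
  define \<Psi>' where "\<Psi>' n s z = cutoff (N n) z * \<Psi> s z" for n s z
  define D' where "D' n p h = cutoff (N n) (snd p) * D p h + dcutoff (N n) (snd p) (snd h) * (case p of (t, z) \<Rightarrow> \<Psi> t z)"
    for n and p h :: "real \<times> (real^'d) \<times> (real^'d)"
  have ccut: "continuous_on UNIV (cutoff k :: (real^'d) \<times> (real^'d) \<Rightarrow> real)" for k
    by (rule has_derivative_continuous_on[OF has_derivative_at_withinI[OF cutoff_has_derivative]])
  have c2: "continuous_on UNIV (\<lambda>p::real \<times> (real^'d) \<times> (real^'d). g (snd p))" if "continuous_on UNIV g" for g :: "_ \<Rightarrow> real"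
    by (rule continuous_on_compose2[OF that continuous_on_snd[OF continuous_on_id]]) simp
  have eq: "(LINT z|lborel. F t z * \<Psi>' n t z) - (LINT z|lborel. F 0 z * \<Psi>' n 0 z)
    = (LINT \<tau>:{0..t}|lborel. LINT z|lborel. F \<tau> z * D' n (\<tau>, z) (1, snd z, W \<tau> z))" for n
  proof (rule weak_C1_time[of T "\<Psi>' n" "D' n" "N n", OF _ _ _ _ _ t])
    fix s :: real and z :: "(real^'d) \<times> (real^'d)" assume s: "s \<in> {0..T}"
    have "((\<lambda>p. cutoff (N n) (snd p)) has_derivative (\<lambda>h. dcutoff (N n) z (snd h))) (at (s, z) within {0..T} \<times> UNIV)"
      using has_derivative_compose[OF has_derivative_snd[OF has_derivative_ident] cutoff_has_derivative[of "N n" "snd (s, z)"],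
          of "{0..T} \<times> UNIV"] by simp
    from has_derivative_mult[OF this D[OF s, of z]]
    show "((\<lambda>(t, z). \<Psi>' n t z) has_derivative D' n (s, z)) (at (s, z) within {0..T} \<times> UNIV)"
      by (simp add: \<Psi>'_def D'_def[abs_def] case_prod_beta')
    show "\<Psi>' n s z = 0" if "norm z > N n" using cutoff_eq_0[OF N(2), of n z] that by (simp add: \<Psi>'_def)
    show "D' n (s, z) h = 0" if "norm z > N n" for h using cutoff_eq_0[OF N(2), of n z] that by (simp add: D'_def)
  next
    fix p show "linear (D' n p)"
      unfolding D'_def linear_iff
      by (auto simp: linear_add[OF l] linear_scale[OF l] linear_add[OF linear_dcutoff] linear_scale[OF linear_dcutoff] algebra_simps)
  next
    fix h show "continuous_on UNIV (\<lambda>p. D' n p h)"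
      unfolding D'_def by (intro continuous_on_add continuous_on_mult c c\<Psi> c2 ccut continuous_dcutoff)
  qed
  have mD': "(\<lambda>p. D' n (fst p, snd p) (1, snd (snd p), W (fst p) (snd p))) \<in> borel_measurable (borel \<Otimes>\<^sub>M (borel \<Otimes>\<^sub>M borel))" for n
  proof -
    have 1: "linear (D' n p)" for p
      unfolding D'_def linear_iff
      by (auto simp: linear_add[OF l] linear_scale[OF l] linear_add[OF linear_dcutoff] linear_scale[OF linear_dcutoff] algebra_simps)
    have 2: "continuous_on UNIV (\<lambda>p. D' n p h)" for h
      unfolding D'_def by (intro continuous_on_add continuous_on_mult c c\<Psi> c2 ccut continuous_dcutoff)
    show ?thesis using generator_measurable[OF 1 2] by (simp add: borel_prod)
  qed
  have mD: "(\<lambda>p. D (fst p, snd p) (1, snd (snd p), W (fst p) (snd p))) \<in> borel_measurable (borel \<Otimes>\<^sub>M (borel \<Otimes>\<^sub>M borel))"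
    using generator_measurable[OF l c] by (simp add: borel_prod)
  define C' where "C' = C + 4 * \<kappa> * C * 3"
  \<comment> \<open>Pays for the product of the cutoff's derivative along \<open>(v, W)\<close> with
    \<open>\<Psi>\<close>: both factors grow linearly, and their product is still dominated by
    \<open>q\<close>.\<close>
  have q3: "(1 + norm (snd z)) * (norm (snd z) + norm (U \<tau> (fst z))) \<le> 3 * q \<tau> z" for \<tau> z
  proof -
    let ?a = "norm (snd z)" and ?b = "norm (U \<tau> (fst z))"
    have "2 * (?a * ?b) \<le> ?a\<^sup>2 + ?b\<^sup>2" using sum_squares_bound[of ?a ?b] by (simp add: mult.assoc)
    moreover have "?a + ?b \<le> q \<tau> z" by (rule norm_le_q)
    moreover have "q \<tau> z = 1 + ?a\<^sup>2 + ?b\<^sup>2" by (simp add: q_def case_prod_beta)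
    moreover have "(1 + ?a) * (?a + ?b) = (?a + ?b) + ?a\<^sup>2 + ?a * ?b" by (simp add: power2_eq_square algebra_simps)
    moreover have "?a\<^sup>2 \<ge> 0" "?b\<^sup>2 \<ge> 0" "?a * ?b \<ge> 0" by simp_all
    ultimately show ?thesis by argo
  qed
  have bD': "\<bar>D' n (\<tau>, z) (1, snd z, W \<tau> z)\<bar> \<le> C' * q \<tau> z" if \<tau>: "\<tau> \<in> {0..T}" for n \<tau> z
  proof -
    have "\<bar>cutoff (N n) z * D (\<tau>, z) (1, snd z, W \<tau> z)\<bar> \<le> 1 * (C * q \<tau> z)"
      unfolding abs_mult using cutoff_bounds[of "N n" z] bD[OF \<tau>] by (intro mult_mono) auto
    moreover have "\<bar>dcutoff (N n) z (snd z, W \<tau> z) * \<Psi> \<tau> z\<bar> \<le> 4 * \<kappa> * C * 3 * q \<tau> z"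
    proof -
      have "4 / N n \<le> 4" using N(1)[of n] by (simp add: divide_le_eq)
      then have "\<bar>dcutoff (N n) z (snd z, W \<tau> z)\<bar> \<le> 4 * norm (snd z, W \<tau> z)"
        using dcutoff_bound[OF N(2), of n z "(snd z, W \<tau> z)"] mult_right_mono[of "4 / N n" 4 "norm (snd z, W \<tau> z)"] by simp
      also have "\<dots> \<le> 4 * (\<kappa> * (norm (snd z) + norm (U \<tau> (fst z))))" by (intro mult_left_mono W_bound_linear) auto
      finally have "\<bar>dcutoff (N n) z (snd z, W \<tau> z) * \<Psi> \<tau> z\<bar>
          \<le> 4 * (\<kappa> * (norm (snd z) + norm (U \<tau> (fst z)))) * (C * (1 + norm (snd z)))"
        unfolding abs_mult using b\<Psi>[OF \<tau>, of z] \<kappa>_pos by (intro mult_mono) auto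
      also have "\<dots> = 4 * \<kappa> * C * ((1 + norm (snd z)) * (norm (snd z) + norm (U \<tau> (fst z))))" by (simp add: mult_ac)
      also have "\<dots> \<le> 4 * \<kappa> * C * (3 * q \<tau> z)" using C \<kappa>_pos by (intro mult_left_mono q3) auto
      finally show ?thesis by (simp add: mult.assoc)
    qed
    ultimately have "\<bar>D' n (\<tau>, z) (1, snd z, W \<tau> z)\<bar> \<le> 1 * (C * q \<tau> z) + 4 * \<kappa> * C * 3 * q \<tau> z"
      unfolding D'_def snd_conv prod.case by linarith
    then show ?thesis by (simp add: C'_def algebra_simps)
  qed
  have limD': "(\<lambda>n. D' n (\<tau>, z) h) \<longlonglongrightarrow> D (\<tau>, z) h" for \<tau> z h
  proof -
    have "(\<lambda>n. cutoff (N n) z * D (\<tau>, z) h + dcutoff (N n) z (snd h) * \<Psi> \<tau> z) \<longlonglongrightarrow> 1 * D (\<tau>, z) h + 0 * \<Psi> \<tau> z"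
      unfolding N_def by (intro tendsto_intros cutoff_tendsto dcutoff_tendsto)
    then show ?thesis by (simp add: D'_def)
  qed
  have inner: "(\<lambda>n. LINT z|lborel. F \<tau> z * D' n (\<tau>, z) (1, snd z, W \<tau> z)) \<longlonglongrightarrow> (LINT z|lborel. F \<tau> z * D (\<tau>, z) (1, snd z, W \<tau> z))"
    if \<tau>: "\<tau> \<in> {0..T}" for \<tau>
  proof (rule integral_dominated_convergence[where w = "\<lambda>z. C' * (F \<tau> z * q \<tau> z)"])
    show "(\<lambda>z. F \<tau> z * D (\<tau>, z) (1, snd z, W \<tau> z)) \<in> borel_measurable lborel"
      by (rule borel_measurable_integrable, rule FG_integrable[OF mD bD _ _ \<tau>]) (auto simp: emeasure_lborel_Icc_eq)
    show "(\<lambda>z. F \<tau> z * D' n (\<tau>, z) (1, snd z, W \<tau> z)) \<in> borel_measurable lborel" for n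
      by (rule borel_measurable_integrable, rule FG_integrable[OF mD' bD' _ _ \<tau>]) (auto simp: emeasure_lborel_Icc_eq)
    show "integrable lborel (\<lambda>z. C' * (F \<tau> z * q \<tau> z))" using integrable_Fq by simp
    show "AE z in lborel. (\<lambda>n. F \<tau> z * D' n (\<tau>, z) (1, snd z, W \<tau> z)) \<longlonglongrightarrow> F \<tau> z * D (\<tau>, z) (1, snd z, W \<tau> z)"
      by (intro AE_I2 tendsto_intros limD')
    show "AE z in lborel. norm (F \<tau> z * D' n (\<tau>, z) (1, snd z, W \<tau> z)) \<le> C' * (F \<tau> z * q \<tau> z)" for n
    proof (rule AE_I2)
      fix z
      show "norm (F \<tau> z * D' n (\<tau>, z) (1, snd z, W \<tau> z)) \<le> C' * (F \<tau> z * q \<tau> z)"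
        using mult_left_mono[OF bD'[OF \<tau>, of n z] F_nonneg[of \<tau> z]] F_nonneg[of \<tau> z] by (simp add: abs_mult mult_ac)
    qed
  qed
  have tT: "\<tau> \<in> {0..T}" if "\<tau> \<in> {0..t}" for \<tau> using that t by auto
  have outer: "(\<lambda>n. LINT \<tau>:{0..t}|lborel. LINT z|lborel. F \<tau> z * D' n (\<tau>, z) (1, snd z, W \<tau> z))
      \<longlonglongrightarrow> (LINT \<tau>:{0..t}|lborel. LINT z|lborel. F \<tau> z * D (\<tau>, z) (1, snd z, W \<tau> z))"
    unfolding set_lebesgue_integral_def
  proof (rule integral_dominated_convergence[where w = "\<lambda>\<tau>. C' * Q * indicator {0..t} \<tau>"])
    have mt: "(\<lambda>\<tau>. LINT z|lborel. F \<tau> z * D (\<tau>, z) (1, snd z, W \<tau> z)) \<in> borel_measurable borel"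
      by (rule FG_time_measurable[OF mD bD]) (auto simp: emeasure_lborel_Icc_eq)
    have mt': "(\<lambda>\<tau>. LINT z|lborel. F \<tau> z * D' n (\<tau>, z) (1, snd z, W \<tau> z)) \<in> borel_measurable borel" for n
      by (rule FG_time_measurable[OF mD' bD']) (auto simp: emeasure_lborel_Icc_eq)
    show "(\<lambda>\<tau>. indicat_real {0..t} \<tau> *\<^sub>R (LINT z|lborel. F \<tau> z * D (\<tau>, z) (1, snd z, W \<tau> z))) \<in> borel_measurable lborel"
      using mt by simp
    show "(\<lambda>\<tau>. indicat_real {0..t} \<tau> *\<^sub>R (LINT z|lborel. F \<tau> z * D' n (\<tau>, z) (1, snd z, W \<tau> z))) \<in> borel_measurable lborel" for n
      using mt' by simp
    show "integrable lborel (\<lambda>\<tau>. C' * Q * indicator {0..t} \<tau>)"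
      using t by (intro integrable_mult_right integrable_real_indicator) auto
    show "AE \<tau> in lborel. (\<lambda>n. indicat_real {0..t} \<tau> *\<^sub>R (LINT z|lborel. F \<tau> z * D' n (\<tau>, z) (1, snd z, W \<tau> z)))
        \<longlonglongrightarrow> indicat_real {0..t} \<tau> *\<^sub>R (LINT z|lborel. F \<tau> z * D (\<tau>, z) (1, snd z, W \<tau> z))"
      using inner[OF tT] by (intro AE_I2) (auto simp: indicator_def)
    show "AE \<tau> in lborel. norm (indicat_real {0..t} \<tau> *\<^sub>R (LINT z|lborel. F \<tau> z * D' n (\<tau>, z) (1, snd z, W \<tau> z)))
        \<le> C' * Q * indicator {0..t} \<tau>" for n
    proof (rule AE_I2)
      fix \<tau>
      have "\<bar>LINT z|lborel. F \<tau> z * D' n (\<tau>, z) (1, snd z, W \<tau> z)\<bar> \<le> C' * Q" if "\<tau> \<in> {0..t}"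
        by (rule FG_integral_le[OF mD' bD' _ _ tT[OF that]]) (auto simp: emeasure_lborel_Icc_eq)
      then show "norm (indicat_real {0..t} \<tau> *\<^sub>R (LINT z|lborel. F \<tau> z * D' n (\<tau>, z) (1, snd z, W \<tau> z)))
        \<le> C' * Q * indicator {0..t} \<tau>" by (auto simp: indicator_def)
    qed
  qed
  have end_lim: "(\<lambda>n. LINT z|lborel. F s z * \<Psi>' n s z) \<longlonglongrightarrow> (LINT z|lborel. F s z * \<Psi> s z)" if s: "s \<in> {0..T}" for s
  proof (rule integral_dominated_convergence[where w = "\<lambda>z. 2 * C * (F s z * q s z)"])
    have cs: "continuous_on UNIV (\<Psi> s)"
      using continuous_on_compose2[OF c\<Psi> continuous_on_Pair[OF continuous_on_const[of UNIV s] continuous_on_id[of UNIV]]] by simp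
    note m = borel_measurable_integrable[OF F_integrable[of s]] borel_measurable_continuous_onI[OF cs] borel_measurable_continuous_onI[OF ccut]
    show "(\<lambda>z. F s z * \<Psi> s z) \<in> borel_measurable lborel" using m by simp
    show "(\<lambda>z. F s z * \<Psi>' n s z) \<in> borel_measurable lborel" for n unfolding \<Psi>'_def using m by simp
    show "integrable lborel (\<lambda>z. 2 * C * (F s z * q s z))" using integrable_Fq by simp
    show "AE z in lborel. (\<lambda>n. F s z * \<Psi>' n s z) \<longlonglongrightarrow> F s z * \<Psi> s z"
    proof (rule AE_I2)
      fix z
      have "(\<lambda>n. F s z * (cutoff (N n) z * \<Psi> s z)) \<longlonglongrightarrow> F s z * (1 * \<Psi> s z)"
        unfolding N_def by (intro tendsto_intros cutoff_tendsto)
      then show "(\<lambda>n. F s z * \<Psi>' n s z) \<longlonglongrightarrow> F s z * \<Psi> s z" by (simp add: \<Psi>'_def)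
    qed
    show "AE z in lborel. norm (F s z * \<Psi>' n s z) \<le> 2 * C * (F s z * q s z)" for n
    proof (rule AE_I2)
      fix z
      have "\<bar>\<Psi>' n s z\<bar> \<le> 1 * (C * (1 + norm (snd z)))"
        unfolding \<Psi>'_def abs_mult using cutoff_bounds[of "N n" z] b\<Psi>[OF s, of z] by (intro mult_mono) auto
      also have "\<dots> \<le> C * (2 * q s z)"
        using C q_ge_1[of s z] norm_le_q[of z s] norm_ge_zero[of "U s (fst z)"] by (simp, intro mult_left_mono) linarith+
      finally show "norm (F s z * \<Psi>' n s z) \<le> 2 * C * (F s z * q s z)"
        using mult_left_mono[of "\<bar>\<Psi>' n s z\<bar>" "C * (2 * q s z)" "F s z"] F_nonneg[of s z] by (simp add: abs_mult mult_ac)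
    qed
  qed
  show ?thesis
    by (rule LIMSEQ_unique[OF tendsto_diff[OF end_lim[OF t] end_lim[OF T]]]) (use outer in \<open>simp add: eq\<close>)
qed

end

section \<open>The Euler flow\<close>

text \<open>A minimum principle in place of solving for characteristics. On the backward cone of
  slope \<open>M\<close> below \<open>(t1, x1)\<close>, a compact set, a damped copy
  \<open>w\<close> of \<open>g\<close> attains its minimum. If that were negative, moving back in
  time along the flow would stay in the cone and decrease \<open>w\<close> further.\<close>

lemma positivity_along_flow:
  fixes g :: "real \<Rightarrow> real^'d \<Rightarrow> real" and u :: "real \<Rightarrow> real^'d \<Rightarrow> real^'d"
  assumes D: "\<And>t x. t \<in> {0..T} \<Longrightarrow> ((\<lambda>(t, x). g t x) has_derivative D (t, x)) (at (t, x) within {0..T} \<times> UNIV)"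
    and u: "\<And>t x. t \<in> {0..T} \<Longrightarrow> norm (u t x) \<le> M"
    and c: "\<And>t x. t \<in> {0..T} \<Longrightarrow> \<bar>c t x\<bar> \<le> K"
    and eq: "\<And>t x. t \<in> {0..T} \<Longrightarrow> D (t, x) (1, u t x) = - g t x * c t x"
    and pos: "\<And>x. g 0 x > 0" and t1: "t1 \<in> {0..T}"
  shows "g t1 x1 > 0"
proof -
  have M: "M \<ge> 0" using u[OF t1, of 0] norm_ge_zero order_trans by blast
  have K: "K \<ge> 0" using c[OF t1, of 0] abs_ge_zero order_trans by blast
  define k where "k = K + 1"
  have cg: "continuous_on ({0..T} \<times> UNIV) (\<lambda>(t, x). g t x)"
    by (rule has_derivative_continuous_on[where f' = D]) (use D in auto)
  define cone where "cone = {p. 0 \<le> fst p \<and> fst p \<le> t1 \<and> norm (snd p - x1) \<le> M * (t1 - fst p)}"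
  have sub: "cone \<subseteq> {0..T} \<times> UNIV" using t1 by (auto simp: cone_def)
  have "closed cone"
    unfolding cone_def by (intro closed_Collect_conj closed_Collect_le continuous_intros)
  moreover have "cone \<subseteq> {0..t1} \<times> cball x1 (M * t1)"
  proof
    fix p assume p: "p \<in> cone"
    then have "M * (t1 - fst p) \<le> M * t1" using M by (intro mult_left_mono) (auto simp: cone_def)
    then show "p \<in> {0..t1} \<times> cball x1 (M * t1)"
      using p by (cases p) (auto simp: cone_def dist_norm norm_minus_commute)
  qed
  then have "bounded cone"
    by (rule bounded_subset[rotated]) (intro bounded_Times bounded_closed_interval bounded_cball)
  ultimately have cpt: "compact cone" by (simp add: compact_eq_bounded_closed)
  have "continuous_on (cball x1 (M * t1)) (\<lambda>x. g 0 x)"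
  proof -
    have "continuous_on (cball x1 (M * t1)) (\<lambda>x. (\<lambda>(t, x). g t x) (0, x))"
      by (rule continuous_on_compose2[OF cg]) (use t1 in \<open>auto intro!: continuous_intros\<close>)
    then show ?thesis by simp
  qed
  then obtain y where y: "y \<in> cball x1 (M * t1)" "\<And>x. x \<in> cball x1 (M * t1) \<Longrightarrow> g 0 y \<le> g 0 x"
    using continuous_attains_inf[of "cball x1 (M * t1)" "\<lambda>x. g 0 x"] M t1
    by (metis atLeastAtMost_iff cball_eq_empty compact_cball mult_nonneg_nonneg not_less)
  \<comment> \<open>Half the minimum of \<open>g 0\<close> on the base of the cone, which makes
    \<open>w\<close> positive at time 0.\<close>
  define \<beta> where "\<beta> = g 0 y / 2"
  have \<beta>: "\<beta> > 0" using pos[of y] by (simp add: \<beta>_def)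
  \<comment> \<open>The factor \<open>exp (- k * t)\<close> with \<open>k > |c|\<close> gives the
    zero-order coefficient a sign; the faster decay of the subtracted term makes the final
    inequality strict.\<close>
  define w where "w p = exp (- k * fst p) * (\<lambda>(t, x). g t x) p - \<beta> * exp (- 2 * k * fst p)" for p
  have "continuous_on cone w"
    unfolding w_def by (intro continuous_intros continuous_on_subset[OF cg sub])
  moreover have "(t1, x1) \<in> cone" using t1 by (simp add: cone_def)
  ultimately obtain p where p: "p \<in> cone" "\<And>p'. p' \<in> cone \<Longrightarrow> w p \<le> w p'"
    using continuous_attains_inf[OF cpt, of w] by blast
  obtain t x where px: "p = (t, x)" by (cases p)
  have t: "t \<in> {0..T}" "0 \<le> t" "t \<le> t1" and x: "norm (x - x1) \<le> M * (t1 - t)"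
    using p(1) t1 by (auto simp: px cone_def)
  have "w p \<ge> 0"
  proof (rule ccontr)
    assume "\<not> w p \<ge> 0"
    then have neg: "w p < 0" by simp
    have "t \<noteq> 0"
    proof
      assume t0: "t = 0"
      then have "x \<in> cball x1 (M * t1)" using x by (simp add: dist_norm norm_minus_commute)
      then have "g 0 x \<ge> g 0 y" by (rule y(2))
      then have "w p > 0" using pos[of y] by (simp add: w_def px t0 \<beta>_def)
      then show False using neg by simp
    qed
    then have tpos: "t > 0" using t by simp
    let ?v = "u t x"
    let ?m = "\<lambda>h. (t - h, x - h *\<^sub>R ?v)"
    \<comment> \<open>A backward step of length \<open>h\<close> moves the point by at most
      \<open>h * M\<close>, exactly the amount by which the cone widens.\<close>
    have inS: "?m h \<in> cone" if "h \<in> {0..t}" for h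
    proof -
      have "norm ((x - x1) - h *\<^sub>R ?v) \<le> M * (t1 - t) + h * M"
        using norm_triangle_ineq4[of "x - x1" "h *\<^sub>R ?v"] x mult_left_mono[OF u[OF t(1), of x], of h] that by simp
      then show ?thesis using that t by (simp add: cone_def algebra_simps)
    qed
    have mder: "(?m has_derivative (\<lambda>h. - h *\<^sub>R (1, ?v))) (at 0 within {0..t})"
      by (auto intro!: derivative_eq_intros)
    have "((\<lambda>h. (\<lambda>(t, x). g t x) (?m h)) has_derivative (\<lambda>h. D (t, x) (- h *\<^sub>R (1, ?v)))) (at 0 within {0..t})"
    proof (rule has_derivative_in_compose[OF mder])
      have "?m ` {0..t} \<subseteq> {0..T} \<times> UNIV" using inS sub by blast
      from has_derivative_subset[OF D[OF t(1), of x] this]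
      show "((\<lambda>(t, x). g t x) has_derivative D (t, x)) (at (?m 0) within ?m ` {0..t})" by simp
    qed
    moreover have "D (t, x) (- h *\<^sub>R (1, ?v)) = h * (g t x * c t x)" for h
      using linear_scale[OF has_derivative_linear[OF D[OF t(1), of x]], of "- h" "(1, ?v)"] eq[OF t(1), of x] by simp
    ultimately have gder: "((\<lambda>h. (\<lambda>(t, x). g t x) (?m h)) has_real_derivative g t x * c t x) (at 0 within {0..t})"
      by (simp add: has_field_derivative_def mult.commute[of _ "g t x * c t x"])
    have e1: "((\<lambda>h. exp (- k * (t - h))) has_real_derivative k * exp (- k * t)) (at 0 within {0..t})"
      and e2: "((\<lambda>h. exp (- 2 * k * (t - h))) has_real_derivative 2 * k * exp (- 2 * k * t)) (at 0 within {0..t})"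
      by (auto intro!: derivative_eq_intros)
    have wder: "((\<lambda>h. w (?m h)) has_real_derivative
        (k * exp (- k * t) * g t x + g t x * c t x * exp (- k * t)) - \<beta> * (2 * k * exp (- 2 * k * t))) (at 0 within {0..t})"
      using DERIV_diff[OF DERIV_mult[OF e1 gder] DERIV_cmult[OF e2, of \<beta>]] by (simp add: w_def)
    have "(k * exp (- k * t) * g t x + g t x * c t x * exp (- k * t)) - \<beta> * (2 * k * exp (- 2 * k * t))
        = (k + c t x) * w p - (k - c t x) * (\<beta> * exp (- 2 * k * t))"
      by (simp add: w_def px algebra_simps)
    also have "\<dots> < 0"
    proof -
      have "k + c t x > 0" "k - c t x > 0" using c[OF t(1), of x] by (auto simp: k_def abs_le_iff)
      then have "(k + c t x) * w p < 0" "(k - c t x) * (\<beta> * exp (- 2 * k * t)) > 0"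
        using neg \<beta> by (auto intro: mult_pos_neg)
      then show ?thesis by simp
    qed
    finally obtain d where d: "d > 0" "\<And>h. h > 0 \<Longrightarrow> 0 + h \<in> {0..t} \<Longrightarrow> h < d \<Longrightarrow> w (?m (0 + h)) < w (?m 0)"
      using has_real_derivative_neg_dec_right[OF wder] by blast
    define h where "h = min (d / 2) t"
    have h: "h > 0" "h \<in> {0..t}" "h < d" using d(1) tpos by (auto simp: h_def)
    have "w (?m h) < w p" using d(2)[of h] h by (simp add: px)
    moreover have "w p \<le> w (?m h)" by (rule p(2)[OF inS[OF h(2)]])
    ultimately show False by simp
  qed
  then have "w (t1, x1) \<ge> 0" using p(2)[OF \<open>(t1, x1) \<in> cone\<close>] by simp
  then have "exp (- k * t1) * g t1 x1 \<ge> \<beta> * exp (- 2 * k * t1)" by (simp add: w_def)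
  moreover have "\<beta> * exp (- 2 * k * t1) > 0" using \<beta> by simp
  ultimately have "exp (- k * t1) * g t1 x1 > 0" by linarith
  then show ?thesis by (simp add: zero_less_mult_iff)
qed

text \<open>Near each time the embedding is applied separately to \<open>g t\<close> and to the
  small difference \<open>g \<tau> - g t\<close>, so no triangle inequality for
  \<open>sobolev_norm\<close> enters. A finite subcover of \<open>[0, T]\<close> makes the local
  bounds uniform.\<close>

lemma C0_sobolev_uniform_bounds:
  fixes g :: "real \<Rightarrow> real^'d \<Rightarrow> real"
  assumes q: "q > real CARD('d) / 2 + 1" and g: "C0_sobolev T q g"
    and c: "\<And>t. t \<in> {0..T} \<Longrightarrow> continuous_on UNIV (g t)"
  shows "\<exists>B\<ge>0. \<forall>t\<in>{0..T}. \<forall>x y. \<bar>g t x\<bar> \<le> B \<and> \<bar>g t x - g t y\<bar> \<le> B * norm (x - y)"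
proof -
  define C where "C = sqrt (LINT \<xi>::real^'d|lborel. (1 + (norm \<xi>)\<^sup>2) powr (1 - q))"
  have C: "C \<ge> 0" by (simp add: C_def)
  define P where "P t B \<longleftrightarrow> (\<forall>x. \<bar>g t x\<bar> \<le> B) \<and> (\<forall>x y. \<bar>g t x - g t y\<bar> \<le> B * norm (x - y))" for t B
  have "\<exists>d>0. \<exists>B\<ge>0. \<forall>\<tau>\<in>{0..T}. \<bar>\<tau> - t\<bar> < d \<longrightarrow> P \<tau> B" if t: "t \<in> {0..T}" for t
  proof -
    have gs: "g t \<in> sobolev q" and gt: "sobolev_tendsto q g (g t) (at t within {0..T})"
      using g t by (auto simp: C0_sobolev_def)
    define N where "N = sobolev_norm q (g t)"
    have N: "N \<ge> 0" by (simp add: N_def sobolev_norm_def)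
    have ev: "\<forall>\<^sub>F \<tau> in at t within {0..T}. (\<lambda>x. g \<tau> x - g t x) \<in> sobolev q \<and> sobolev_norm q (\<lambda>x. g \<tau> x - g t x) < 1"
      using gt order_tendstoD(2)[of "\<lambda>\<tau>. sobolev_norm q (\<lambda>x. g \<tau> x - g t x)" 0 _ 1]
      by (auto simp: sobolev_tendsto_def intro: eventually_conj)
    then obtain d where d: "d > 0" "\<And>\<tau>. \<tau> \<in> {0..T} \<Longrightarrow> \<tau> \<noteq> t \<Longrightarrow> dist \<tau> t < d \<Longrightarrow>
        (\<lambda>x. g \<tau> x - g t x) \<in> sobolev q \<and> sobolev_norm q (\<lambda>x. g \<tau> x - g t x) < 1"
      unfolding eventually_at by blast
    note et = sobolev_embedding[OF q gs c[OF t], folded C_def N_def]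
    have "P \<tau> (C * (N + 1))" if \<tau>: "\<tau> \<in> {0..T}" "\<bar>\<tau> - t\<bar> < d" for \<tau>
    proof (cases "\<tau> = t")
      case True
      have "C * N \<le> C * (N + 1)" using C by (intro mult_left_mono) auto
      then show ?thesis unfolding P_def True
        using et by (meson order_trans mult_right_mono norm_ge_zero)
    next
      case False
      have s: "(\<lambda>x. g \<tau> x - g t x) \<in> sobolev q" "sobolev_norm q (\<lambda>x. g \<tau> x - g t x) < 1"
        using d(2)[OF \<tau>(1) False] \<tau>(2) by (auto simp: dist_real_def)
      have cd: "continuous_on UNIV (\<lambda>x. g \<tau> x - g t x)" by (intro continuous_intros c \<tau>(1) t)
      note es = sobolev_embedding[OF q s(1) cd, folded C_def]
      have C1: "C * sobolev_norm q (\<lambda>x. g \<tau> x - g t x) \<le> C" using s(2) C mult_left_mono[of _ 1 C] by simp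
      show ?thesis unfolding P_def
      proof (intro conjI allI)
        fix x y
        have "\<bar>g \<tau> x\<bar> \<le> C + C * N" using es(1)[of x] et(1)[of x] C1 by linarith
        then show "\<bar>g \<tau> x\<bar> \<le> C * (N + 1)" by (simp add: algebra_simps)
        have "\<bar>(g \<tau> x - g t x) - (g \<tau> y - g t y)\<bar> \<le> C * norm (x - y)"
          using es(2)[of x y] mult_right_mono[OF C1, of "norm (x - y)"] by simp
        then have "\<bar>g \<tau> x - g \<tau> y\<bar> \<le> C * norm (x - y) + C * N * norm (x - y)"
          using et(2)[of x y] by linarith
        then show "\<bar>g \<tau> x - g \<tau> y\<bar> \<le> C * (N + 1) * norm (x - y)" by (simp add: algebra_simps)
      qed
    qed
    then show ?thesis using d(1) C N by (intro exI[of _ d] conjI exI[of _ "C * (N + 1)"]) auto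
  qed
  then obtain d B where dB: "\<And>t. t \<in> {0..T} \<Longrightarrow> d t > 0" "\<And>t. t \<in> {0..T} \<Longrightarrow> B t \<ge> 0"
    "\<And>t \<tau>. t \<in> {0..T} \<Longrightarrow> \<tau> \<in> {0..T} \<Longrightarrow> \<bar>\<tau> - t\<bar> < d t \<Longrightarrow> P \<tau> (B t)"
    by metis
  have "{0..T} \<subseteq> (\<Union>t\<in>{0..T}. ball t (d t))" using dB(1) by fastforce
  then obtain I where I: "I \<subseteq> {0..T}" "finite I" "{0..T} \<subseteq> (\<Union>t\<in>I. ball t (d t))"
    using compactE_image[OF compact_Icc, of "{0..T}" "\<lambda>t. ball t (d t)"] by (metis open_ball)
  define B' where "B' = (\<Sum>t\<in>I. B t)"
  have P': "P \<tau> B'" if \<tau>: "\<tau> \<in> {0..T}" for \<tau>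
  proof -
    obtain t where t: "t \<in> I" "\<bar>\<tau> - t\<bar> < d t" using I(3) \<tau> by (force simp: dist_real_def abs_minus_commute)
    have "P \<tau> (B t)" using dB(3)[of t \<tau>] t I(1) \<tau> by blast
    moreover have "B t \<le> B'" unfolding B'_def using t(1) I dB(2) by (intro member_le_sum) auto
    ultimately show ?thesis unfolding P_def by (meson order_trans mult_right_mono norm_ge_zero)
  qed
  show ?thesis
  proof (intro exI[of _ B'] conjI ballI allI)
    show "B' \<ge> 0" unfolding B'_def using dB(2) I(1) by (intro sum_nonneg) auto
  qed (use P' in \<open>auto simp: P_def\<close>)
qed

text \<open>Composing with this projection of the time axis onto \<open>[0, T]\<close> extends the
  solution to all times with the same bounds, so the global continuity demanded by
  \<open>weak_general\<close> holds.\<close>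

definition clip :: "real \<Rightarrow> real \<Rightarrow> real" where "clip T t = max 0 (min T t)"

lemma clip_in: "T \<ge> 0 \<Longrightarrow> clip T t \<in> {0..T}" by (simp add: clip_def)
lemma clip_eq: "t \<in> {0..T} \<Longrightarrow> clip T t = t" by (simp add: clip_def)

lemma continuous_on_clip:
  assumes "continuous_on ({0..T} \<times> UNIV) g" "T \<ge> 0"
  shows "continuous_on UNIV (\<lambda>p. g (clip T (fst p), snd p))"
  unfolding clip_def
  by (rule continuous_on_compose2[OF assms(1)])
    (use assms(2) in \<open>auto intro!: continuous_on_Pair continuous_on_max continuous_on_min continuous_on_fst continuous_on_snd continuous_on_const continuous_on_id\<close>)

text \<open>The derivative family is extended along with the function; its last property reduces
  bounds at any time to bounds on \<open>[0, T]\<close>.\<close>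

lemma C1_on_clip:
  fixes g :: "real \<Rightarrow> 'a::euclidean_space \<Rightarrow> 'b::real_normed_vector"
  assumes C1: "C1_on ({0..T} \<times> UNIV) (\<lambda>(t, x). g t x)" and T: "T \<ge> 0"
  shows "\<exists>D. (\<forall>t\<in>{0..T}. \<forall>x. ((\<lambda>(t, x). g (clip T t) x) has_derivative D (t, x)) (at (t, x) within {0..T} \<times> UNIV)) \<and>
    (\<forall>p. linear (D p)) \<and> (\<forall>h. continuous_on UNIV (\<lambda>p. D p h)) \<and>
    (\<forall>t\<in>{0..T}. \<forall>x. (g t has_derivative (\<lambda>h. D (t, x) (0, h))) (at x)) \<and>
    (\<forall>t\<in>{0..T}. \<forall>x. ((\<lambda>\<tau>. g \<tau> x) has_derivative (\<lambda>h. D (t, x) (h, 0))) (at t within {0..T})) \<and>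
    continuous_on UNIV (\<lambda>(t, x). g (clip T t) x) \<and> (\<forall>t x. D (t, x) = D (clip T t, x))"
proof -
  obtain g' where g': "continuous_on ({0..T} \<times> UNIV) g'"
    "\<And>p. p \<in> {0..T} \<times> UNIV \<Longrightarrow> ((\<lambda>(t, x). g t x) has_derivative blinfun_apply (g' p)) (at p within {0..T} \<times> UNIV)"
    using C1 unfolding C1_on_def by blast
  define D where "D p h = blinfun_apply (g' (clip T (fst p), snd p)) h" for p h
  have gd: "((\<lambda>(t, x). g t x) has_derivative D (t, x)) (at (t, x) within {0..T} \<times> UNIV)" if "t \<in> {0..T}" for t x
    using g'(2)[of "(t, x)"] that by (simp add: D_def[abs_def] clip_eq)
  have cg: "continuous_on ({0..T} \<times> UNIV) (\<lambda>(t, x). g t x)"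
    by (rule has_derivative_continuous_on[where f' = "\<lambda>p. blinfun_apply (g' p)"]) (rule g'(2))
  show ?thesis
  proof (intro exI[of _ D] conjI ballI allI)
    fix t x assume t: "t \<in> {0..T}"
    show "((\<lambda>(t, x). g (clip T t) x) has_derivative D (t, x)) (at (t, x) within {0..T} \<times> UNIV)"
      by (rule has_derivative_transform[OF _ _ gd[OF t]]) (use t in \<open>auto simp: clip_eq\<close>)
    show "(g t has_derivative (\<lambda>h. D (t, x) (0, h))) (at x)"
      by (rule has_derivative_slices(1)[where \<Psi> = g and D = D, OF gd[OF t] t])
    show "((\<lambda>\<tau>. g \<tau> x) has_derivative (\<lambda>h. D (t, x) (h, 0))) (at t within {0..T})"
      by (rule has_derivative_slices(2)[where \<Psi> = g and D = D, OF gd[OF t] t])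
  next
    show "linear (D p)" for p unfolding D_def by (intro bounded_linear.linear blinfun.bounded_linear_right)
    show "continuous_on UNIV (\<lambda>p. D p h)" for h
      unfolding D_def by (intro continuous_intros continuous_on_clip[OF g'(1) T])
    show "continuous_on UNIV (\<lambda>(t, x). g (clip T t) x)"
      using continuous_on_clip[OF cg T] by (simp add: case_prod_beta')
    show "D (t, x) = D (clip T t, x)" for t x
      using clip_eq[OF clip_in[OF T]] by (simp add: D_def[abs_def])
  qed
qed

text \<open>\<open>Du (t, x) (1, u t x)\<close> is the derivative of \<open>u\<close> along the
  flow, so \<open>u_eq\<close> and \<open>\<rho>_eq\<close> are the Euler system in transport form,
  the sum in the latter being the divergence of \<open>u\<close>. Bounds hold at all times, the
  equations on \<open>[0, T]\<close>.\<close>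

locale euler_flow =
  fixes lam T :: real and \<rho> :: "real \<Rightarrow> real^'d \<Rightarrow> real" and u :: "real \<Rightarrow> real^'d \<Rightarrow> real^'d"
    and D\<rho> :: "real \<times> (real^'d) \<Rightarrow> real \<times> (real^'d) \<Rightarrow> real" and Du :: "real \<times> (real^'d) \<Rightarrow> real \<times> (real^'d) \<Rightarrow> real^'d"
    and L M :: real
  assumes T_pos: "T > 0" and lam0: "lam \<ge> 0"
    and u_deriv: "\<And>t x. t \<in> {0..T} \<Longrightarrow> ((\<lambda>(t, x). u t x) has_derivative Du (t, x)) (at (t, x) within {0..T} \<times> UNIV)"
    and Du_linear: "\<And>p. linear (Du p)" and Du_cont: "\<And>h. continuous_on UNIV (\<lambda>p. Du p h)"
    and u_cont: "continuous_on UNIV (\<lambda>(t, x). u t x)"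
    and \<rho>_deriv: "\<And>t x. t \<in> {0..T} \<Longrightarrow> ((\<lambda>(t, x). \<rho> t x) has_derivative D\<rho> (t, x)) (at (t, x) within {0..T} \<times> UNIV)"
    and D\<rho>_linear: "\<And>p. linear (D\<rho> p)" and D\<rho>_cont: "\<And>h. continuous_on UNIV (\<lambda>p. D\<rho> p h)"
    and \<rho>_cont: "continuous_on UNIV (\<lambda>(t, x). \<rho> t x)"
    and M: "\<And>t x. norm (u t x) \<le> M" and L: "\<And>t x h. norm (Du (t, x) (0, h)) \<le> L * norm h"
    and M0: "M \<ge> 0" and L0: "L \<ge> 0"
    and u_eq: "\<And>t x. t \<in> {0..T} \<Longrightarrow> Du (t, x) (1, u t x) = - lam *\<^sub>R u t x"
    and \<rho>_eq: "\<And>t x. t \<in> {0..T} \<Longrightarrow> D\<rho> (t, x) (1, u t x) = - \<rho> t x * (\<Sum>i\<in>UNIV. Du (t, x) (0, axis i 1) $ i)"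

lemma derivative_norm_le_lipschitz:
  fixes f :: "'a::real_normed_vector \<Rightarrow> 'b::real_normed_vector"
  assumes D: "(f has_derivative D) (at x)" and B: "\<And>x y. norm (f x - f y) \<le> B * norm (x - y)"
  shows "norm (D h) \<le> B * norm h"
proof (rule field_le_epsilon)
  fix e :: real assume e: "e > 0"
  show "norm (D h) \<le> B * norm h + e"
  proof (cases "h = 0")
    case True
    then show ?thesis using e linear_0[OF has_derivative_linear[OF D]] by simp
  next
    case False
    then have h: "norm h > 0" by simp
    have "e / norm h > 0" using e h by simp
    then obtain d where d: "d > 0"
      "\<And>y. norm (y - x) < d \<Longrightarrow> norm (f y - f x - D (y - x)) \<le> e / norm h * norm (y - x)"
      using D unfolding has_derivative_at_alt by meson
    define r where "r = d / (2 * norm h)"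
    have r: "r > 0" using d(1) h by (simp add: r_def)
    have "norm (r *\<^sub>R h) < d" using d(1) h by (simp add: r_def)
    then have "norm (f (x + r *\<^sub>R h) - f x - D (r *\<^sub>R h)) \<le> e / norm h * norm (r *\<^sub>R h)"
      using d(2)[of "x + r *\<^sub>R h"] by simp
    moreover have "norm (f (x + r *\<^sub>R h) - f x) \<le> B * norm (r *\<^sub>R h)"
      using B[of "x + r *\<^sub>R h" x] by simp
    moreover have "norm (D (r *\<^sub>R h)) \<le> norm (f (x + r *\<^sub>R h) - f x) + norm (f (x + r *\<^sub>R h) - f x - D (r *\<^sub>R h))"
      using norm_triangle_ineq4[of "f (x + r *\<^sub>R h) - f x" "f (x + r *\<^sub>R h) - f x - D (r *\<^sub>R h)"] by simp
    ultimately have "norm (D (r *\<^sub>R h)) \<le> B * norm (r *\<^sub>R h) + e / norm h * norm (r *\<^sub>R h)" by linarith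
    then have "r * norm (D h) \<le> r * (B * norm h + e)"
      using r h by (simp add: linear_scale[OF has_derivative_linear[OF D]] algebra_simps)
    then show ?thesis using r by simp
  qed
qed

lemma within_interval_unique:
  fixes f :: "real \<Rightarrow> real"
  assumes "T > 0" "t \<in> {0..T}" "(f has_real_derivative a) (at t within {0..T})" "(f has_real_derivative b) (at t within {0..T})"
  shows "a = b"
  using vector_derivative_unique_within_closed_interval[of 0 T t f a b] assms
  by (simp add: has_real_derivative_iff_has_vector_derivative)

lemma linear_axis_sum:
  fixes D :: "real^'d \<Rightarrow> real"
  assumes "linear D" shows "D v = (\<Sum>i\<in>UNIV. D (axis i 1) * v $ i)"
proof -
  have "D v = D (\<Sum>i\<in>UNIV. v $ i *\<^sub>R axis i 1)"
    by (metis basis_expansion scalar_mult_eq_scaleR)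
  then show ?thesis by (simp add: linear_sum[OF assms] linear_scale[OF assms] mult.commute)
qed

text \<open>The momentum equation minus \<open>u\<close> times the continuity equation leaves
  \<open>\<rho>\<close> times the transport equation for \<open>u\<close>. Cancelling
  \<open>\<rho>\<close> needs positivity at all times, which is obtained first, from the continuity
  equation in transport form.\<close>

lemma classical_solution_euler_flow:
  fixes \<rho> :: "real \<Rightarrow> real^'d \<Rightarrow> real" and u :: "real \<Rightarrow> real^'d \<Rightarrow> real^'d"
  assumes sol: "classical_solution lam s T \<rho>0 u0 \<rho> u" and T: "T > 0" and lam: "lam \<ge> 0"
    and s: "s > real CARD('d) / 2 + 1" and pos: "\<And>x. \<rho>0 x > 0"
  obtains D\<rho> Du L M where
    "euler_flow lam T (\<lambda>t. \<rho> (clip T t)) (\<lambda>t. u (clip T t)) D\<rho> Du L M"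
    "\<And>x. \<bar>\<rho> 0 x\<bar> \<le> M"
proof -
  have C1r: "C1_on ({0..T} \<times> UNIV) (\<lambda>(t, x). \<rho> t x)" and C1u: "C1_on ({0..T} \<times> UNIV) (\<lambda>(t, x). u t x)"
    and Sr: "C0_sobolev T s \<rho>" and Su: "\<And>i. C0_sobolev T (s + 1) (\<lambda>t x. u t x $ i)"
    and er: "\<And>t x. t \<in> {0..T} \<Longrightarrow> ((\<lambda>\<tau>. \<rho> \<tau> x) has_real_derivative - divergence (\<lambda>y. \<rho> t y *\<^sub>R u t y) x) (at t within {0..T})"
    and eu: "\<And>t x i. t \<in> {0..T} \<Longrightarrow> ((\<lambda>\<tau>. \<rho> \<tau> x * u \<tau> x $ i) has_real_derivative
           - divergence (\<lambda>y. (\<rho> t y * u t y $ i) *\<^sub>R u t y) x - lam * (\<rho> t x * u t x $ i)) (at t within {0..T})"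
    and ini: "\<And>x. \<rho> 0 x = \<rho>0 x"
    using sol unfolding classical_solution_def by blast+
  have T0: "T \<ge> 0" and 0: "0 \<in> {0..T}" using T by auto
  obtain Dr :: "real \<times> (real^'d) \<Rightarrow> real \<times> (real^'d) \<Rightarrow> real" where Dr':
    "\<forall>t\<in>{0..T}. \<forall>x. ((\<lambda>(t, x). \<rho> (clip T t) x) has_derivative Dr (t, x)) (at (t, x) within {0..T} \<times> UNIV)"
    "\<forall>p. linear (Dr p)" "\<forall>h. continuous_on UNIV (\<lambda>p. Dr p h)"
    "\<forall>t\<in>{0..T}. \<forall>x. (\<rho> t has_derivative (\<lambda>h. Dr (t, x) (0, h))) (at x)"
    "\<forall>t\<in>{0..T}. \<forall>x. ((\<lambda>\<tau>. \<rho> \<tau> x) has_derivative (\<lambda>h. Dr (t, x) (h, 0))) (at t within {0..T})"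
    "continuous_on UNIV (\<lambda>(t, x). \<rho> (clip T t) x)" "\<forall>t x. Dr (t, x) = Dr (clip T t, x)"
    using C1_on_clip[OF C1r T0] by blast
  note Dr = Dr'(1)[rule_format] Dr'(2)[rule_format] Dr'(3)[rule_format] Dr'(4)[rule_format] Dr'(5)[rule_format] Dr'(6) Dr'(7)[rule_format]
  obtain Du :: "real \<times> (real^'d) \<Rightarrow> real \<times> (real^'d) \<Rightarrow> real^'d" where Du':
    "\<forall>t\<in>{0..T}. \<forall>x. ((\<lambda>(t, x). u (clip T t) x) has_derivative Du (t, x)) (at (t, x) within {0..T} \<times> UNIV)"
    "\<forall>p. linear (Du p)" "\<forall>h. continuous_on UNIV (\<lambda>p. Du p h)"
    "\<forall>t\<in>{0..T}. \<forall>x. (u t has_derivative (\<lambda>h. Du (t, x) (0, h))) (at x)"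
    "\<forall>t\<in>{0..T}. \<forall>x. ((\<lambda>\<tau>. u \<tau> x) has_derivative (\<lambda>h. Du (t, x) (h, 0))) (at t within {0..T})"
    "continuous_on UNIV (\<lambda>(t, x). u (clip T t) x)" "\<forall>t x. Du (t, x) = Du (clip T t, x)"
    using C1_on_clip[OF C1u T0] by blast
  note Du = Du'(1)[rule_format] Du'(2)[rule_format] Du'(3)[rule_format] Du'(4)[rule_format] Du'(5)[rule_format] Du'(6) Du'(7)[rule_format]
  have cu: "continuous_on UNIV (u t)" and cr: "continuous_on UNIV (\<rho> t)" if "t \<in> {0..T}" for t
    using has_derivative_continuous_on[OF has_derivative_at_withinI[OF Du(4)[OF that]]]
      has_derivative_continuous_on[OF has_derivative_at_withinI[OF Dr(4)[OF that]]] by blast+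
  have "\<exists>B\<ge>0. \<forall>t\<in>{0..T}. \<forall>x y. \<bar>u t x $ i\<bar> \<le> B \<and> \<bar>u t x $ i - u t y $ i\<bar> \<le> B * norm (x - y)" for i
  proof -
    have "s + 1 > real CARD('d) / 2 + 1" using s by simp
    moreover have "continuous_on UNIV (\<lambda>x. u t x $ i)" if "t \<in> {0..T}" for t
      by (intro continuous_on_component cu that)
    ultimately show ?thesis
      using C0_sobolev_uniform_bounds[OF _ Su[of i]] by simp
  qed
  then obtain B where B: "\<And>i. B i \<ge> 0" "\<And>i t x. t \<in> {0..T} \<Longrightarrow> \<bar>u t x $ i\<bar> \<le> B i"
    "\<And>i t x y. t \<in> {0..T} \<Longrightarrow> \<bar>u t x $ i - u t y $ i\<bar> \<le> B i * norm (x - y)" by metis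
  obtain Mr where Mr: "Mr \<ge> 0" "\<And>t x. t \<in> {0..T} \<Longrightarrow> \<bar>\<rho> t x\<bar> \<le> Mr"
    using C0_sobolev_uniform_bounds[OF s Sr cr] by blast
  define S where "S = (\<Sum>i\<in>UNIV. B i)"
  have S: "S \<ge> 0" unfolding S_def by (intro sum_nonneg B)
  have uS: "norm (u t x) \<le> S" if "t \<in> {0..T}" for t x
    unfolding S_def using norm_le_l1_cart[of "u t x"] sum_mono[of UNIV "\<lambda>i. \<bar>u t x $ i\<bar>" B] B(2)[OF that] by force
  have uL: "norm (u t x - u t y) \<le> S * norm (x - y)" if "t \<in> {0..T}" for t x y
  proof -
    have "norm (u t x - u t y) \<le> (\<Sum>i\<in>UNIV. B i * norm (x - y))"
      by (rule order_trans[OF norm_le_l1_cart sum_mono]) (use B(3)[OF that] in simp)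
    then show ?thesis by (simp add: S_def sum_distrib_right)
  qed
  have DuL: "norm (Du (t, x) (0, h)) \<le> S * norm h" for t x h
    using derivative_norm_le_lipschitz[OF Du(4) uL, OF clip_in[OF T0] clip_in[OF T0], of t x h] Du(7)[of t x] by simp
  define dv where "dv t x = (\<Sum>i\<in>UNIV. Du (t, x) (0, axis i 1) $ i)" for t x
  have dvb: "\<bar>dv t x\<bar> \<le> real CARD('d) * S" for t x
  proof -
    have "\<bar>Du (t, x) (0, axis i 1) $ i\<bar> \<le> S" for i
      using component_le_norm_cart[of "Du (t, x) (0, axis i 1)" i] DuL[of t x "axis i 1"] by (simp add: norm_axis_1)
    then have "(\<Sum>i\<in>UNIV. \<bar>Du (t, x) (0, axis i 1) $ i\<bar>) \<le> (\<Sum>i\<in>(UNIV::'d set). S)" by (intro sum_mono) auto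
    from order_trans[OF sum_abs this] show ?thesis by (simp add: dv_def)
  qed
  \<comment> \<open>Product rule for the divergence of \<open>w u\<close>, applied with
    \<open>w\<close> equal to \<open>\<rho>\<close> and to \<open>\<rho>\<close> times a component
    of \<open>u\<close>.\<close>
  have dvg: "divergence (\<lambda>y. w y *\<^sub>R u t y) x = w x * dv t x + Dw (u t x)"
    if t: "t \<in> {0..T}" and Dw: "(w has_derivative Dw) (at x)" for w :: "real^'d \<Rightarrow> real" and Dw t x
  proof -
    have "((\<lambda>y. w y *\<^sub>R u t y) has_derivative (\<lambda>h. w x *\<^sub>R Du (t, x) (0, h) + Dw h *\<^sub>R u t x)) (at x)"
      by (rule has_derivative_scaleR[OF Dw Du(4)[OF t]])
    from frechet_derivative_at[OF this, symmetric]
    have "divergence (\<lambda>y. w y *\<^sub>R u t y) x = (\<Sum>i\<in>UNIV. w x * Du (t, x) (0, axis i 1) $ i + Dw (axis i 1) * u t x $ i)"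
      by (simp add: divergence_def)
    also have "\<dots> = w x * dv t x + Dw (u t x)"
      using linear_axis_sum[OF has_derivative_linear[OF Dw], of "u t x"]
      by (simp add: sum.distrib sum_distrib_left dv_def)
    finally show ?thesis .
  qed
  have split: "D (1, v) = D (1, 0) + D (0, v)" if "linear D" for D :: "real \<times> (real^'d) \<Rightarrow> 'c::real_vector" and v
    using linear_add[OF that, of "(1, 0)" "(0, v)"] by simp
  have rt: "Dr (t, x) (1, 0) = - (\<rho> t x * dv t x + Dr (t, x) (0, u t x))" if t: "t \<in> {0..T}" for t x
  proof (rule within_interval_unique[OF T t])
    show "((\<lambda>\<tau>. \<rho> \<tau> x) has_real_derivative - (\<rho> t x * dv t x + Dr (t, x) (0, u t x))) (at t within {0..T})"
      using er[OF t, of x] dvg[OF t Dr(4)[OF t]] by simp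
    have "(\<lambda>h. Dr (t, x) (h, 0)) = (*) (Dr (t, x) (1, 0))"
    proof
      fix h
      show "Dr (t, x) (h, 0) = Dr (t, x) (1, 0) * h"
        using linear_scale[OF Dr(2), of "(t, x)" h "(1, 0)"] by (simp add: mult.commute)
    qed
    then show "((\<lambda>\<tau>. \<rho> \<tau> x) has_real_derivative Dr (t, x) (1, 0)) (at t within {0..T})"
      using Dr(5)[OF t, of x] unfolding has_field_derivative_def by metis
  qed
  have r_eq: "Dr (t, x) (1, u t x) = - \<rho> t x * dv t x" if t: "t \<in> {0..T}" for t x
    using rt[OF t, of x] split[OF Dr(2), of "(t, x)" "u t x"] by linarith
  have r_pos: "\<rho> t x > 0" if t: "t \<in> {0..T}" for t x
  proof -
    have "(\<lambda>t. \<rho> (clip T t)) t x > 0"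
      by (rule positivity_along_flow[of T "\<lambda>t. \<rho> (clip T t)" Dr u S dv "real CARD('d) * S", OF Dr(1) uS dvb _ _ t])
        (use r_eq pos ini in \<open>auto simp: clip_eq[OF 0] clip_eq\<close>)
    then show ?thesis using t by (simp add: clip_eq)
  qed
  have u_eq: "Du (t, x) (1, u t x) = - lam *\<^sub>R u t x" if t: "t \<in> {0..T}" for t x
  proof (subst vec_eq_iff, rule allI)
    fix i
    have Dui: "((\<lambda>y. u t y $ i) has_derivative (\<lambda>h. Du (t, x) (0, h) $ i)) (at x)"
      using bounded_linear.has_derivative[OF bounded_linear_vec_nth Du(4)[OF t]] .
    have Duit: "((\<lambda>\<tau>. u \<tau> x $ i) has_derivative (\<lambda>h. Du (t, x) (h, 0) $ i)) (at t within {0..T})"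
      using bounded_linear.has_derivative[OF bounded_linear_vec_nth Du(5)[OF t]] .
    have hom: "Dr (t, x) (h, 0) = h * Dr (t, x) (1, 0)" "Du (t, x) (h, 0) $ i = h * Du (t, x) (1, 0) $ i" for h
      using linear_scale[OF Dr(2), of "(t, x)" h "(1, 0)"] linear_scale[OF Du(2), of "(t, x)" h "(1, 0)"] by simp_all
    have "\<rho> t x * Du (t, x) (1, 0) $ i + Dr (t, x) (1, 0) * u t x $ i
       = - ((\<rho> t x * u t x $ i) * dv t x + (\<rho> t x * Du (t, x) (0, u t x) $ i + Dr (t, x) (0, u t x) * u t x $ i)) - lam * (\<rho> t x * u t x $ i)"
    proof (rule within_interval_unique[OF T t])
      show "((\<lambda>\<tau>. \<rho> \<tau> x * u \<tau> x $ i) has_real_derivative \<rho> t x * Du (t, x) (1, 0) $ i + Dr (t, x) (1, 0) * u t x $ i) (at t within {0..T})"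
      proof -
        have "(\<lambda>h. \<rho> t x * Du (t, x) (h, 0) $ i + Dr (t, x) (h, 0) * u t x $ i)
          = (*) (\<rho> t x * Du (t, x) (1, 0) $ i + Dr (t, x) (1, 0) * u t x $ i)"
        proof
          fix h
          show "\<rho> t x * Du (t, x) (h, 0) $ i + Dr (t, x) (h, 0) * u t x $ i
            = (\<rho> t x * Du (t, x) (1, 0) $ i + Dr (t, x) (1, 0) * u t x $ i) * h"
            by (subst hom(1)[of h], subst hom(2)[of h]) (simp add: algebra_simps)
        qed
        then show ?thesis
          using has_derivative_mult[OF Dr(5)[OF t, of x] Duit] unfolding has_field_derivative_def by metis
      qed
      show "((\<lambda>\<tau>. \<rho> \<tau> x * u \<tau> x $ i) has_real_derivative - ((\<rho> t x * u t x $ i) * dv t x + (\<rho> t x * Du (t, x) (0, u t x) $ i + Dr (t, x) (0, u t x) * u t x $ i)) - lam * (\<rho> t x * u t x $ i)) (at t within {0..T})"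
        using eu[OF t, of x i] dvg[OF t has_derivative_mult[OF Dr(4)[OF t] Dui]] by simp
    qed
    then have "\<rho> t x * (Du (t, x) (1, 0) $ i + Du (t, x) (0, u t x) $ i + lam * u t x $ i) = 0"
      using rt[OF t, of x] by (simp add: algebra_simps)
    then have "Du (t, x) (1, 0) $ i + Du (t, x) (0, u t x) $ i + lam * u t x $ i = 0"
      using r_pos[OF t, of x] by simp
    then show "Du (t, x) (1, u t x) $ i = (- lam *\<^sub>R u t x) $ i"
      using split[OF Du(2), of "(t, x)" "u t x"] by simp
  qed
  show ?thesis
  \<comment> \<open>The sum lets one constant bound both \<open>u\<close> and the initial
    density.\<close>
  proof (rule that[of Dr Du S "S + Mr"])
    show "euler_flow lam T (\<lambda>t. \<rho> (clip T t)) (\<lambda>t. u (clip T t)) Dr Du S (S + Mr)"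
    proof (rule euler_flow.intro)
      show "norm (u (clip T t) x) \<le> S + Mr" for t x
        using uS[OF clip_in[OF T0], of t x] Mr(1) by simp
    qed (use T lam Du(1-3,6) Dr(1-3,6) DuL S Mr(1) u_eq r_eq in \<open>simp_all add: clip_eq dv_def\<close>)
    show "\<bar>\<rho> 0 x\<bar> \<le> S + Mr" for x using Mr(2)[OF 0, of x] S by simp
  qed
qed

section \<open>Relative entropy\<close>

text \<open>\<open>y\<close> is bounded but need not be continuous. With \<open>S\<close> the
  supremum of \<open>y s * exp (- k * s)\<close>, integrating \<open>S * exp (k * \<tau>)\<close>
  contributes the fraction \<open>c / k \<le> 1 / 2\<close> of \<open>S\<close>, which is absorbed;
  hence \<open>k = 2 * c + 1\<close> and the factor 2.\<close>

lemma gronwall_bounded: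
  fixes y :: "real \<Rightarrow> real"
  assumes i: "set_integrable lborel {0..T} y"
    and nn: "\<And>t. t \<in> {0..T} \<Longrightarrow> 0 \<le> y t" and B: "\<And>t. t \<in> {0..T} \<Longrightarrow> y t \<le> B"
    and c: "c \<ge> 0" and a: "a \<ge> 0"
    and le: "\<And>t. t \<in> {0..T} \<Longrightarrow> y t \<le> a + c * (LINT \<tau>:{0..t}|lborel. y \<tau>)"
    and t: "t \<in> {0..T}"
  shows "y t \<le> 2 * a * exp ((2 * c + 1) * T)"
proof -
  define k where "k = 2 * c + 1"
  have k: "k > 0" using c by (simp add: k_def)
  define S where "S = (SUP s\<in>{0..T}. y s * exp (- k * s))"
  have bdd: "bdd_above ((\<lambda>s. y s * exp (- k * s)) ` {0..T})"
  proof (rule bdd_aboveI2)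
    fix s assume s: "s \<in> {0..T}"
    have "y s * exp (- k * s) \<le> y s * 1" using nn[OF s] s k by (intro mult_left_mono) auto
    then show "y s * exp (- k * s) \<le> B" using B[OF s] by simp
  qed
  have yS: "y s * exp (- k * s) \<le> S" if "s \<in> {0..T}" for s
    unfolding S_def by (rule cSUP_upper[OF that bdd])
  have yS': "y s \<le> S * exp (k * s)" if "s \<in> {0..T}" for s
    using mult_right_mono[OF yS[OF that], of "exp (k * s)"] by (simp add: mult.assoc exp_add[symmetric])
  have "0 \<le> y t * exp (- k * t)" by (intro mult_nonneg_nonneg nn t) simp
  then have Snn: "S \<ge> 0" using yS[OF t] by (rule order_trans)
  have "y s * exp (- k * s) \<le> a + S / 2" if s: "s \<in> {0..T}" for s
  proof -
    have ex: "(\<integral>\<tau>. (S * exp (k * \<tau>)) * indicator {0..s} \<tau> \<partial>lborel) = S * exp (k * s) / k - S * exp (k * 0) / k"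
      by (rule integral_FTC_Icc_real) (use s k in \<open>auto intro!: derivative_eq_intros\<close>)
    have "(LINT \<tau>:{0..s}|lborel. y \<tau>) \<le> (\<integral>\<tau>. (S * exp (k * \<tau>)) * indicator {0..s} \<tau> \<partial>lborel)"
      unfolding set_lebesgue_integral_def
    proof (rule integral_mono)
      show "integrable lborel (\<lambda>\<tau>. indicat_real {0..s} \<tau> *\<^sub>R y \<tau>)"
        using set_integrable_subset[OF i, of "{0..s}"] s by (simp add: set_integrable_def)
      have "integrable lborel (\<lambda>\<tau>. indicator {0..s} \<tau> *\<^sub>R (S * exp (k * \<tau>)))"
        by (rule borel_integrable_compact) (auto intro!: continuous_intros)
      then show "integrable lborel (\<lambda>\<tau>. (S * exp (k * \<tau>)) * indicator {0..s} \<tau>)" by (simp add: mult.commute)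
      show "indicat_real {0..s} \<tau> *\<^sub>R y \<tau> \<le> (S * exp (k * \<tau>)) * indicator {0..s} \<tau>" for \<tau>
        using yS'[of \<tau>] s by (auto simp: indicator_def)
    qed
    also have "\<dots> \<le> S * exp (k * s) / k" using ex Snn k by simp
    finally have "c * (LINT \<tau>:{0..s}|lborel. y \<tau>) \<le> c * (S * exp (k * s) / k)" using c by (rule mult_left_mono)
    also have "\<dots> = (c / k) * (S * exp (k * s))" by simp
    also have "\<dots> \<le> (1 / 2) * (S * exp (k * s))"
      using c Snn by (intro mult_right_mono) (auto simp: k_def field_simps)
    finally have "y s \<le> a + S * exp (k * s) / 2" using le[OF s] by simp
    then have "y s * exp (- k * s) \<le> (a + S * exp (k * s) / 2) * exp (- k * s)" by (rule mult_right_mono) simp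
    also have "\<dots> = a * exp (- k * s) + S / 2" by (simp add: distrib_right exp_minus)
    also have "\<dots> \<le> a * 1 + S / 2" using a s k by (intro add_right_mono mult_left_mono) auto
    finally show ?thesis by simp
  qed
  then have "S \<le> a + S / 2" unfolding S_def using t by (intro cSUP_least) auto
  then have "S \<le> 2 * a" by simp
  then have "S * exp (k * t) \<le> 2 * a * exp (k * t)" by (rule mult_right_mono) simp
  with yS'[OF t] have "y t \<le> 2 * a * exp (k * t)" by (rule order_trans)
  also have "\<dots> \<le> 2 * a * exp (k * T)" using a t k by (intro mult_left_mono) auto
  finally show ?thesis by (simp add: k_def)
qed

text \<open>The exponent exceeds \<open>DIM('a) / 2\<close>, so the weight is integrable. Being a
  power, it also controls its own gradient, as a balance of weighted mass requires.\<close>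

definition wt :: "'a::euclidean_space \<Rightarrow> real" where
  "wt x = (1 + (norm x)\<^sup>2) powr (- real DIM('a))"

lemma wt_pos: "wt x > 0"
  by (simp add: wt_def add_pos_nonneg less_imp_neq[THEN not_sym])

lemma wt_le_1: "wt x \<le> 1"
  using powr_mono2'[of "- real DIM('a)" 1 "1 + (norm x)\<^sup>2"] by (simp add: wt_def)

lemma integrable_wt: "integrable lborel (wt :: 'a::euclidean_space \<Rightarrow> real)"
  unfolding wt_def[abs_def] by (rule integrable_inverse_power) (simp add: DIM_positive)

definition dwt :: "'a::euclidean_space \<Rightarrow> 'a \<Rightarrow> real" where
  "dwt x h = - real DIM('a) * wt x * (2 * (x \<bullet> h) / (1 + x \<bullet> x))"

lemma wt_alt: "wt x = exp (- real DIM('a) * ln (1 + x \<bullet> x))" for x :: "'a::euclidean_space"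
proof -
  have "1 + x \<bullet> x \<noteq> 0" using inner_ge_zero[of x] by linarith
  then show ?thesis by (simp add: wt_def powr_def power2_norm_eq_inner)
qed

lemma wt_has_derivative: "(wt has_derivative dwt x) (at x)"
proof -
  have p: "1 + x \<bullet> x > 0" using inner_ge_zero[of x] by linarith
  have "((\<lambda>x. 1 + x \<bullet> x) has_derivative (\<lambda>h. 2 * (x \<bullet> h))) (at x)"
    by (auto intro!: derivative_eq_intros simp: inner_commute)
  moreover have "((\<lambda>s. exp (- real DIM('a) * ln s)) has_derivative (\<lambda>h. exp (- real DIM('a) * ln (1 + x \<bullet> x)) * (- real DIM('a) * (1 / (1 + x \<bullet> x))) * h)) (at (1 + x \<bullet> x))"
    unfolding has_field_derivative_def[symmetric]
    using p by (auto intro!: derivative_eq_intros)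
  ultimately have "((\<lambda>x. exp (- real DIM('a) * ln (1 + x \<bullet> x))) has_derivative
      (\<lambda>h. exp (- real DIM('a) * ln (1 + x \<bullet> x)) * (- real DIM('a) * (1 / (1 + x \<bullet> x))) * (2 * (x \<bullet> h)))) (at x)"
    by (rule has_derivative_compose)
  then show ?thesis
    by (simp add: wt_alt[abs_def] dwt_def[abs_def] mult_ac)
qed

lemma continuous_wt: "continuous_on UNIV wt"
  by (rule has_derivative_continuous_on[OF has_derivative_at_withinI[OF wt_has_derivative]])

lemma continuous_dwt: "continuous_on UNIV (\<lambda>x. dwt x h)"
proof -
  have "1 + x \<bullet> x \<noteq> 0" for x :: 'a using inner_ge_zero[of x] by linarith
  then show ?thesis unfolding dwt_def by (intro continuous_intros continuous_wt) auto
qed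

text \<open>The logarithmic gradient is bounded because
  \<open>2 * |x| \<le> 1 + |x|^2\<close>.\<close>

lemma dwt_bound: "\<bar>dwt x h\<bar> \<le> real DIM('a) * wt x * norm h" for x h :: "'a::euclidean_space"
proof -
  have p: "1 + x \<bullet> x > 0" using inner_ge_zero[of x] by linarith
  have "2 * \<bar>x \<bullet> h\<bar> \<le> 2 * (norm x * norm h)" using Cauchy_Schwarz_ineq2[of x h] by simp
  also have "\<dots> \<le> (1 + x \<bullet> x) * norm h"
    using sum_squares_bound[of "norm x" 1] mult_right_mono[of "2 * norm x" "1 + x \<bullet> x" "norm h"]
    by (simp add: power2_norm_eq_inner algebra_simps)
  finally have "\<bar>2 * (x \<bullet> h) / (1 + x \<bullet> x)\<bar> \<le> norm h" using p by (simp add: abs_mult divide_le_eq mult.commute)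
  then have "real DIM('a) * wt x * \<bar>2 * (x \<bullet> h) / (1 + x \<bullet> x)\<bar> \<le> real DIM('a) * wt x * norm h"
    using wt_pos[of x] by (intro mult_left_mono) auto
  then show ?thesis using wt_pos[of x] by (simp add: dwt_def abs_mult)
qed

section \<open>Evolution of the relative energy\<close>

locale relative = kinetic lam \<epsilon> f0 f + euler_flow lam T \<rho> u D\<rho> Du L M
  for lam \<epsilon> :: real and f0 :: "(real^'d) \<times> (real^'d) \<Rightarrow> real" and f :: "real \<Rightarrow> (real^'d) \<times> (real^'d) \<Rightarrow> real"
    and T :: real and \<rho> :: "real \<Rightarrow> real^'d \<Rightarrow> real" and u :: "real \<Rightarrow> real^'d \<Rightarrow> real^'d"
    and D\<rho> Du and L M :: real
begin

definition sq :: "real \<Rightarrow> (real^'d) \<times> (real^'d) \<Rightarrow> real" where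
  "sq t z = (norm (snd z - u t (fst z)))\<^sup>2"

definition H :: "real \<Rightarrow> real" where "H t = (LINT z|lborel. F t z * sq t z)"

lemma continuous_fst_snd:
  "continuous_on UNIV (\<lambda>p::real \<times> (real^'d) \<times> (real^'d). u (fst p) (fst (snd p)))"
  "continuous_on UNIV (\<lambda>p::real \<times> (real^'d) \<times> (real^'d). snd (snd p))"
  "continuous_on UNIV (\<lambda>p::real \<times> (real^'d) \<times> (real^'d). Du (fst p, fst (snd p)) h)"
  "continuous_on UNIV (\<lambda>p::real \<times> (real^'d) \<times> (real^'d). fst (snd p))"
proof -
  have 1: "continuous_on UNIV (\<lambda>p::real \<times> (real^'d) \<times> (real^'d). (fst p, fst (snd p)))"
    by (intro continuous_on_Pair continuous_on_fst continuous_on_snd continuous_on_id)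
  show "continuous_on UNIV (\<lambda>p::real \<times> (real^'d) \<times> (real^'d). u (fst p) (fst (snd p)))"
    using continuous_on_compose2[OF u_cont 1] by simp
  show "continuous_on UNIV (\<lambda>p::real \<times> (real^'d) \<times> (real^'d). Du (fst p, fst (snd p)) h)"
    using continuous_on_compose2[OF Du_cont 1] by simp
  show "continuous_on UNIV (\<lambda>p::real \<times> (real^'d) \<times> (real^'d). snd (snd p))"
    "continuous_on UNIV (\<lambda>p::real \<times> (real^'d) \<times> (real^'d). fst (snd p))"
    by (intro continuous_on_fst continuous_on_snd continuous_on_id)+
qed

lemma sq_nonneg: "sq t z \<ge> 0" by (simp add: sq_def)

lemma sq_continuous: "continuous_on UNIV (\<lambda>p. sq (fst p) (snd p))"
  unfolding sq_def by (intro continuous_intros continuous_fst_snd)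

lemma continuous_measurable:
  fixes g :: "real \<times> (real^'d) \<times> (real^'d) \<Rightarrow> real"
  assumes "continuous_on UNIV g"
  shows "g \<in> borel_measurable (borel \<Otimes>\<^sub>M (borel \<Otimes>\<^sub>M borel))"
  using borel_measurable_continuous_onI[OF assms] by (simp add: borel_prod)

lemma sq_bound: "\<bar>sq t z\<bar> \<le> (2 + 2 * M\<^sup>2) * q t z"
proof -
  have "sq t z \<le> 2 * (norm (snd z))\<^sup>2 + 2 * (norm (u t (fst z)))\<^sup>2"
    unfolding sq_def by (rule ph.norm_diff_square_le)
  also have "\<dots> \<le> 2 * q t z + 2 * (M\<^sup>2 * q t z)"
  proof -
    have "(norm (u t (fst z)))\<^sup>2 \<le> M\<^sup>2" using M[of t "fst z"] by (intro power_mono) auto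
    also have "\<dots> \<le> M\<^sup>2 * q t z" using mult_left_mono[OF q_ge_1[of t z], of "M\<^sup>2"] by simp
    finally have 1: "(norm (u t (fst z)))\<^sup>2 \<le> M\<^sup>2 * q t z" .
    have 2: "(norm (snd z))\<^sup>2 \<le> q t z" by (simp add: q_def case_prod_beta)
    show ?thesis using 1 2 by (intro add_mono mult_left_mono) auto
  qed
  finally show ?thesis using sq_nonneg by (simp add: algebra_simps)
qed

lemmas sq_meas = continuous_measurable[OF sq_continuous]

lemma integrable_F_sq: "integrable lborel (\<lambda>z. F t z * sq t z)"
  by (rule FG_integrable[where S = "{t}", OF sq_meas sq_bound]) auto

lemma H_nonneg: "H t \<ge> 0"
  unfolding H_def by (intro Bochner_Integration.integral_nonneg mult_nonneg_nonneg F_nonneg sq_nonneg)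

lemma H_bound: "H t \<le> (2 + 2 * M\<^sup>2) * Q"
  using FG_integral_le[where S = "{t}" and t = t, OF sq_meas sq_bound] by (simp add: H_def)

lemma H_integrable: "set_integrable lborel {0..s} H"
  unfolding H_def[abs_def] by (rule FG_set_integrable[OF sq_meas sq_bound]) (auto simp: emeasure_lborel_Icc_eq)

text \<open>The relaxation term drops out because \<open>\<rho> U\<close> is the exact momentum.\<close>

lemma relaxation_vanishes:
  assumes b: "continuous_on UNIV b" "\<And>x. norm (b x) \<le> K"
  shows "integrable lborel (\<lambda>z. F t z * ((U t (fst z) - snd z) \<bullet> b (fst z)))"
    and "(LINT z|lborel. F t z * ((U t (fst z) - snd z) \<bullet> b (fst z))) = 0"
proof -
  have [measurable]: "b \<in> borel_measurable borel" by (rule borel_measurable_continuous_onI[OF b(1)])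
  have K: "K \<ge> 0" using b(2)[of 0] norm_ge_zero order_trans by blast
  have bd: "\<bar>(U t (fst z) - snd z) \<bullet> b (fst z)\<bar> \<le> K * q t z" for z
  proof -
    have "\<bar>(U t (fst z) - snd z) \<bullet> b (fst z)\<bar> \<le> norm (U t (fst z) - snd z) * norm (b (fst z))"
      by (rule Cauchy_Schwarz_ineq2)
    also have "\<dots> \<le> q t z * K"
      using norm_triangle_ineq4[of "U t (fst z)" "snd z"] norm_le_q[of z t] b(2) order_trans[OF zero_le_one q_ge_1]
      by (intro mult_mono) auto
    finally show ?thesis by (simp add: mult.commute)
  qed
  have "(\<lambda>z. F t z * ((U t (fst z) - snd z) \<bullet> b (fst z))) \<in> borel_measurable (lborel \<Otimes>\<^sub>M lborel)" by measurable
  then show i: "integrable lborel (\<lambda>z. F t z * ((U t (fst z) - snd z) \<bullet> b (fst z)))"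
  proof (intro Bochner_Integration.integrable_bound[OF integrable_mult_right[OF integrable_Fq[of t], of K]])
    show "AE z in lborel. norm (F t z * ((U t (fst z) - snd z) \<bullet> b (fst z))) \<le> norm (K * (F t z * q t z))"
    proof (rule AE_I2)
      fix z
      have "F t z * \<bar>(U t (fst z) - snd z) \<bullet> b (fst z)\<bar> \<le> F t z * (K * q t z)"
        by (intro mult_left_mono bd F_nonneg)
      then show "norm (F t z * ((U t (fst z) - snd z) \<bullet> b (fst z))) \<le> norm (K * (F t z * q t z))"
        using F_nonneg[of t z] K order_trans[OF zero_le_one q_ge_1[of t z]] by (simp add: abs_mult mult_ac)
    qed
  qed (simp add: lborel_prod)
  have "(LINT z|lborel. F t z * ((U t (fst z) - snd z) \<bullet> b (fst z)))
      = (LINT x|lborel. LINT v|lborel. F t (x, v) * ((U t x - v) \<bullet> b x))"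
    using lborel_pair.integral_fst'[of "\<lambda>z. F t z * ((U t (fst z) - snd z) \<bullet> b (fst z))"] i by (simp add: lborel_prod)
  also have "\<dots> = 0"
  proof (rule integral_eq_zero_AE)
    show "AE x in lborel. (LINT v|lborel. F t (x, v) * ((U t x - v) \<bullet> b x)) = 0"
      using ph.AE_good[of t]
    proof eventually_elim
      case (elim x)
      have mo: "integrable lborel (\<lambda>v. F t (x, v) *\<^sub>R v)" by (rule ph.integrable_momentum_slice[OF elim])
      have mi: "integrable lborel (\<lambda>v. F t (x, v))" using elim by (simp add: ph.good_def)
      have "(LINT v|lborel. F t (x, v) * ((U t x - v) \<bullet> b x)) = (LINT v|lborel. F t (x, v) * (U t x \<bullet> b x) - (F t (x, v) *\<^sub>R v) \<bullet> b x)"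
        by (simp add: inner_diff_left right_diff_distrib)
      also have "\<dots> = mass_density (F t) x * (U t x \<bullet> b x) - (mass_density (F t) x *\<^sub>R U t x) \<bullet> b x"
        using mo mi ph.momentum[OF elim] by (simp add: mass_density_def U_def del: inner_scaleR_left)
      finally show ?case by simp
    qed
  qed
  finally show "(LINT z|lborel. F t z * ((U t (fst z) - snd z) \<bullet> b (fst z))) = 0" by simp
qed

text \<open>This is \<open>sq / 2\<close> without \<open>|v|^2 / 2\<close>, the part that the
  entropy inequality handles. What remains grows only linearly in \<open>v\<close>, as
  \<open>weak_general\<close> requires.\<close>

definition \<Psi> :: "real \<Rightarrow> (real^'d) \<times> (real^'d) \<Rightarrow> real" where
  "\<Psi> t z = (norm (u t (fst z)))\<^sup>2 / 2 - snd z \<bullet> u t (fst z)"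

definition D\<Psi> :: "real \<times> (real^'d) \<times> (real^'d) \<Rightarrow> real \<times> (real^'d) \<times> (real^'d) \<Rightarrow> real" where
  "D\<Psi> p h = (u (fst p) (fst (snd p)) - snd (snd p)) \<bullet> Du (fst p, fst (snd p)) (fst h, fst (snd h))
     - snd (snd h) \<bullet> u (fst p) (fst (snd p))"

lemma \<Psi>_deriv:
  assumes t: "t \<in> {0..T}"
  shows "((\<lambda>(t, z). \<Psi> t z) has_derivative D\<Psi> (t, z)) (at (t, z) within {0..T} \<times> UNIV)"
proof -
  let ?S = "{0..T} \<times> (UNIV :: ((real^'d) \<times> (real^'d)) set)"
  have m: "((\<lambda>p::real \<times> (real^'d) \<times> (real^'d). (fst p, fst (snd p))) has_derivative (\<lambda>h. (fst h, fst (snd h)))) (at (t, z) within ?S)"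
    by (intro has_derivative_Pair has_derivative_fst has_derivative_snd has_derivative_ident)
  have "((\<lambda>(t, x). u t x) has_derivative Du (t, fst z)) (at (t, fst z) within (\<lambda>p. (fst p, fst (snd p))) ` ?S)"
    by (rule has_derivative_subset[OF u_deriv[OF t]]) auto
  from has_derivative_in_compose[OF m] this
  have du: "((\<lambda>p. u (fst p) (fst (snd p))) has_derivative (\<lambda>h. Du (t, fst z) (fst h, fst (snd h)))) (at (t, z) within ?S)"
    by fastforce
  have dv: "((\<lambda>p::real \<times> (real^'d) \<times> (real^'d). snd (snd p)) has_derivative (\<lambda>h. snd (snd h))) (at (t, z) within ?S)"
    by (intro has_derivative_snd has_derivative_ident)
  have "((\<lambda>p. (u (fst p) (fst (snd p)) \<bullet> u (fst p) (fst (snd p))) * (1 / 2) - snd (snd p) \<bullet> u (fst p) (fst (snd p))) has_derivative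
      (\<lambda>h. (u t (fst z) \<bullet> Du (t, fst z) (fst h, fst (snd h)) + Du (t, fst z) (fst h, fst (snd h)) \<bullet> u t (fst z)) * (1 / 2)
        - (snd z \<bullet> Du (t, fst z) (fst h, fst (snd h)) + snd (snd h) \<bullet> u t (fst z)))) (at (t, z) within ?S)"
    using has_derivative_diff[OF has_derivative_mult_left[OF has_derivative_inner[OF du du], of "1/2"] has_derivative_inner[OF dv du]] by simp
  moreover have "(\<lambda>h. (u t (fst z) \<bullet> Du (t, fst z) (fst h, fst (snd h)) + Du (t, fst z) (fst h, fst (snd h)) \<bullet> u t (fst z)) * (1 / 2)
        - (snd z \<bullet> Du (t, fst z) (fst h, fst (snd h)) + snd (snd h) \<bullet> u t (fst z))) = D\<Psi> (t, z)"
    by (auto simp: D\<Psi>_def fun_eq_iff inner_commute inner_diff_left)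
  ultimately show ?thesis by (simp add: \<Psi>_def case_prod_beta' power2_norm_eq_inner)
qed

text \<open>Splitting \<open>(1, v) = (1, u) + (0, v - u)\<close> brings in the Euler equation; the
  damping terms of the two equations then combine to
  \<open>lam * |v|^2 - lam * |v - u|^2\<close>.\<close>

lemma D\<Psi>_generator:
  assumes t: "t \<in> {0..T}"
  shows "D\<Psi> (t, z) (1, snd z, W t z) = lam * (norm (snd z))\<^sup>2 - lam * sq t z
    - (snd z - u t (fst z)) \<bullet> Du (t, fst z) (0, snd z - u t (fst z)) - (1 / \<epsilon>) * ((U t (fst z) - snd z) \<bullet> u t (fst z))"
proof -
  let ?u = "u t (fst z)" and ?v = "snd z"
  have "Du (t, fst z) (1, ?v) = Du (t, fst z) (1, ?u) + Du (t, fst z) (0, ?v - ?u)"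
    using linear_add[OF Du_linear, of "(t, fst z)" "(1, ?u)" "(0, ?v - ?u)"] by simp
  then have e: "Du (t, fst z) (1, ?v) = - lam *\<^sub>R ?u + Du (t, fst z) (0, ?v - ?u)" using u_eq[OF t] by simp
  show ?thesis
    by (simp add: D\<Psi>_def W_def sq_def e power2_norm_eq_inner inner_commute algebra_simps inner_diff_left inner_diff_right inner_add_right)
qed

lemma D\<Psi>_linear: "linear (D\<Psi> p)"
proof -
  have "Du q (fst h + fst k, fst (snd h) + fst (snd k)) = Du q (fst h, fst (snd h)) + Du q (fst k, fst (snd k))" for q and h k :: "real \<times> (real^'d) \<times> (real^'d)"
    using linear_add[OF Du_linear, of q "(fst h, fst (snd h))" "(fst k, fst (snd k))"] by simp
  moreover have "Du q (c * fst h, c *\<^sub>R fst (snd h)) = c *\<^sub>R Du q (fst h, fst (snd h))" for q c and h :: "real \<times> (real^'d) \<times> (real^'d)"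
    using linear_scale[OF Du_linear, of q c "(fst h, fst (snd h))"] by simp
  ultimately show ?thesis
    by (simp add: D\<Psi>_def linear_iff inner_add_right inner_add_left algebra_simps)
qed

lemma D\<Psi>_cont: "continuous_on UNIV (\<lambda>p. D\<Psi> p h)"
  unfolding D\<Psi>_def by (intro continuous_intros continuous_fst_snd)

definition stretch :: "real \<Rightarrow> (real^'d) \<times> (real^'d) \<Rightarrow> real" where
  "stretch t z = (snd z - u t (fst z)) \<bullet> Du (t, fst z) (0, snd z - u t (fst z))"

lemma stretch_bound: "\<bar>stretch t z\<bar> \<le> L * sq t z"
proof -
  have "\<bar>stretch t z\<bar> \<le> norm (snd z - u t (fst z)) * norm (Du (t, fst z) (0, snd z - u t (fst z)))"
    unfolding stretch_def by (rule Cauchy_Schwarz_ineq2)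
  also have "\<dots> \<le> norm (snd z - u t (fst z)) * (L * norm (snd z - u t (fst z)))"
    by (intro mult_left_mono L) auto
  finally show ?thesis by (simp add: sq_def power2_eq_square mult_ac)
qed

text \<open>\<open>- lam * sq\<close> is dropped by its sign, the gradient term costs
  \<open>L * sq\<close>, and the relaxation term integrates to 0. The energy integral stays explicit
  because it will cancel against the damping term of the entropy inequality.\<close>

lemma relative_entropy_identity:
  assumes t: "t \<in> {0..T}"
  shows "(LINT z|lborel. F t z * \<Psi> t z) - (LINT z|lborel. F 0 z * \<Psi> 0 z)
    \<le> lam * (LINT \<tau>:{0..t}|lborel. En \<tau>) + L * (LINT \<tau>:{0..t}|lborel. H \<tau>)"
proof -
  \<comment> \<open>A witness of integrability only: it contains \<open>1 / \<epsilon>\<close> and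
    does not reach the conclusion.\<close>
  define C where "C = M + M\<^sup>2 + (lam + lam * (2 + 2 * M\<^sup>2) + L * (2 + 2 * M\<^sup>2) + (1 / \<epsilon>) * M)"
  have Cnn: "0 \<le> lam + lam * (2 + 2 * M\<^sup>2) + L * (2 + 2 * M\<^sup>2) + (1 / \<epsilon>) * M" "0 \<le> M + M\<^sup>2"
    using lam0 L0 M0 eps_pos by (auto intro!: add_nonneg_nonneg mult_nonneg_nonneg)
  have b\<Psi>: "\<bar>\<Psi> s z\<bar> \<le> C * (1 + norm (snd z))" for s z
  proof -
    have "\<bar>\<Psi> s z\<bar> \<le> (norm (u s (fst z)))\<^sup>2 / 2 + \<bar>snd z \<bullet> u s (fst z)\<bar>"
      unfolding \<Psi>_def by (rule order_trans[OF abs_triangle_ineq4]) simp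
    also have "\<dots> \<le> M\<^sup>2 + norm (snd z) * M"
    proof (intro add_mono)
      have "(norm (u s (fst z)))\<^sup>2 \<le> M\<^sup>2" using M by (intro power_mono) auto
      moreover have "(norm (u s (fst z)))\<^sup>2 / 2 \<le> (norm (u s (fst z)))\<^sup>2" by simp
      ultimately show "(norm (u s (fst z)))\<^sup>2 / 2 \<le> M\<^sup>2" by (rule order_trans[rotated])
      show "\<bar>snd z \<bullet> u s (fst z)\<bar> \<le> norm (snd z) * M"
        by (rule order_trans[OF Cauchy_Schwarz_ineq2]) (intro mult_left_mono M norm_ge_zero)
    qed
    also have "\<dots> \<le> (M + M\<^sup>2) * (1 + norm (snd z))"
      using M0 by (simp add: algebra_simps)
    also have "\<dots> \<le> C * (1 + norm (snd z))" using Cnn by (intro mult_right_mono) (auto simp: C_def)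
    finally show ?thesis .
  qed
  have bD: "\<bar>D\<Psi> (s, z) (1, snd z, W s z)\<bar> \<le> C * q s z" if s: "s \<in> {0..T}" for s z
  proof -
    have 1: "\<bar>lam * (norm (snd z))\<^sup>2\<bar> \<le> lam * q s z"
      using lam0 by (simp add: q_def case_prod_beta mult_left_mono)
    have 2: "\<bar>lam * sq s z\<bar> \<le> lam * ((2 + 2 * M\<^sup>2) * q s z)"
      using mult_left_mono[OF sq_bound lam0, of s z] lam0 by (simp add: abs_mult)
    have 3: "\<bar>stretch s z\<bar> \<le> L * ((2 + 2 * M\<^sup>2) * q s z)"
      using stretch_bound[of s z] mult_left_mono[OF sq_bound L0, of s z] sq_nonneg[of s z] by simp
    have 4: "\<bar>(1 / \<epsilon>) * ((U s (fst z) - snd z) \<bullet> u s (fst z))\<bar> \<le> (1 / \<epsilon>) * (q s z * M)"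
    proof -
      have "\<bar>(U s (fst z) - snd z) \<bullet> u s (fst z)\<bar> \<le> norm (U s (fst z) - snd z) * norm (u s (fst z))"
        by (rule Cauchy_Schwarz_ineq2)
      also have "\<dots> \<le> q s z * M"
        using norm_triangle_ineq4[of "U s (fst z)" "snd z"] norm_le_q[of z s] M order_trans[OF zero_le_one q_ge_1]
        by (intro mult_mono) auto
      finally show ?thesis using eps_pos by (simp add: abs_mult divide_right_mono)
    qed
    have "\<bar>D\<Psi> (s, z) (1, snd z, W s z)\<bar> \<le> \<bar>lam * (norm (snd z))\<^sup>2\<bar> + \<bar>lam * sq s z\<bar> + \<bar>stretch s z\<bar> + \<bar>(1 / \<epsilon>) * ((U s (fst z) - snd z) \<bullet> u s (fst z))\<bar>"
      unfolding D\<Psi>_generator[OF s] stretch_def by linarith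
    also have "\<dots> \<le> lam * q s z + lam * ((2 + 2 * M\<^sup>2) * q s z) + L * ((2 + 2 * M\<^sup>2) * q s z) + (1 / \<epsilon>) * (q s z * M)"
      by (intro add_mono 1 2 3 4)
    also have "\<dots> = (lam + lam * (2 + 2 * M\<^sup>2) + L * (2 + 2 * M\<^sup>2) + (1 / \<epsilon>) * M) * q s z" by (simp add: algebra_simps)
    also have "\<dots> \<le> C * q s z" using Cnn order_trans[OF zero_le_one q_ge_1] by (intro mult_right_mono) (auto simp: C_def)
    finally show ?thesis .
  qed
  have c\<Psi>: "continuous_on UNIV (\<lambda>(t, z). \<Psi> t z)"
    unfolding \<Psi>_def case_prod_beta' by (intro continuous_intros continuous_fst_snd) auto
  note id = weak_general[OF \<Psi>_deriv D\<Psi>_linear D\<Psi>_cont c\<Psi> b\<Psi> bD t]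
  have mD: "(\<lambda>p. D\<Psi> (fst p, snd p) (1, snd (snd p), W (fst p) (snd p))) \<in> borel_measurable (borel \<Otimes>\<^sub>M (borel \<Otimes>\<^sub>M borel))"
    using generator_measurable[OF D\<Psi>_linear D\<Psi>_cont] by (simp add: borel_prod)
  have tT: "\<tau> \<in> {0..T}" if "\<tau> \<in> {0..t}" for \<tau> using that t by auto
  have i1: "set_integrable lborel {0..t} (\<lambda>\<tau>. LINT z|lborel. F \<tau> z * D\<Psi> (\<tau>, z) (1, snd z, W \<tau> z))"
    by (rule FG_set_integrable[OF mD bD[OF tT]]) (auto simp: emeasure_lborel_Icc_eq)
  have Eni: "set_integrable lborel {0..t} En"
    unfolding set_integrable_def
  proof (rule Bochner_Integration.integrable_bound[of _ "\<lambda>\<tau>. E0 * indicator {0..t} \<tau>"])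
    show "integrable lborel (\<lambda>\<tau>. E0 * indicator {0..t} \<tau>)"
      by (intro integrable_mult_right integrable_real_indicator) (auto simp: emeasure_lborel_Icc_eq)
    show "AE \<tau> in lborel. norm (indicator {0..t} \<tau> *\<^sub>R En \<tau>) \<le> norm (E0 * indicator {0..t} \<tau>)"
      using En_le En_nonneg E0_nonneg by (auto simp: indicator_def)
  qed measurable
  have i2: "set_integrable lborel {0..t} (\<lambda>\<tau>. lam * En \<tau> + L * H \<tau>)"
    using Eni H_integrable[of t] by (intro set_integral_add set_integrable_mult_right)
  have "(LINT \<tau>:{0..t}|lborel. LINT z|lborel. F \<tau> z * D\<Psi> (\<tau>, z) (1, snd z, W \<tau> z))
     \<le> (LINT \<tau>:{0..t}|lborel. lam * En \<tau> + L * H \<tau>)"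
  proof (rule set_integral_mono[OF i1 i2])
    fix \<tau> assume "\<tau> \<in> {0..t}"
    then have \<tau>: "\<tau> \<in> {0..T}" by (rule tT)
    have cu: "continuous_on UNIV (u \<tau>)"
      using continuous_on_compose2[OF u_cont continuous_on_Pair[OF continuous_on_const[of UNIV \<tau>] continuous_on_id[of UNIV]]] by simp
    note rv = relaxation_vanishes[OF cu M, of \<tau>]
    have ie: "integrable lborel (\<lambda>z. F \<tau> z * (norm (snd z))\<^sup>2)"
      using ph.energy[of \<tau>] by (simp add: case_prod_beta' mult.commute)
    have En': "(LINT z|lborel. F \<tau> z * (norm (snd z))\<^sup>2) = En \<tau>"
      by (simp add: En_def case_prod_beta' mult.commute)
    have iD: "integrable lborel (\<lambda>z. F \<tau> z * D\<Psi> (\<tau>, z) (1, snd z, W \<tau> z))"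
      by (rule FG_integrable[OF mD bD _ _ \<tau>]) (auto simp: emeasure_lborel_Icc_eq)
    have "(LINT z|lborel. F \<tau> z * D\<Psi> (\<tau>, z) (1, snd z, W \<tau> z))
      \<le> (LINT z|lborel. lam * (F \<tau> z * (norm (snd z))\<^sup>2) + L * (F \<tau> z * sq \<tau> z)
          - (1 / \<epsilon>) * (F \<tau> z * ((U \<tau> (fst z) - snd z) \<bullet> u \<tau> (fst z))))"
    proof (rule integral_mono[OF iD])
      show "integrable lborel (\<lambda>z. lam * (F \<tau> z * (norm (snd z))\<^sup>2) + L * (F \<tau> z * sq \<tau> z)
          - (1 / \<epsilon>) * (F \<tau> z * ((U \<tau> (fst z) - snd z) \<bullet> u \<tau> (fst z))))"
        by (intro Bochner_Integration.integrable_diff Bochner_Integration.integrable_add integrable_mult_right ie integrable_F_sq rv(1))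
      fix z
      have "D\<Psi> (\<tau>, z) (1, snd z, W \<tau> z) \<le> lam * (norm (snd z))\<^sup>2 + L * sq \<tau> z - (1 / \<epsilon>) * ((U \<tau> (fst z) - snd z) \<bullet> u \<tau> (fst z))"
        using stretch_bound[of \<tau> z] mult_nonneg_nonneg[OF lam0 sq_nonneg[of \<tau> z]]
        unfolding D\<Psi>_generator[OF \<tau>] stretch_def by linarith
      from mult_left_mono[OF this F_nonneg[of \<tau> z]]
      show "F \<tau> z * D\<Psi> (\<tau>, z) (1, snd z, W \<tau> z) \<le> lam * (F \<tau> z * (norm (snd z))\<^sup>2) + L * (F \<tau> z * sq \<tau> z)
          - (1 / \<epsilon>) * (F \<tau> z * ((U \<tau> (fst z) - snd z) \<bullet> u \<tau> (fst z)))"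
        by (simp add: algebra_simps)
    qed
    also have "\<dots> = lam * En \<tau> + L * H \<tau>"
      using ie integrable_F_sq[of \<tau>] rv by (simp add: En' H_def)
    finally show "(LINT z|lborel. F \<tau> z * D\<Psi> (\<tau>, z) (1, snd z, W \<tau> z)) \<le> lam * En \<tau> + L * H \<tau>" .
  qed
  also have "\<dots> = lam * (LINT \<tau>:{0..t}|lborel. En \<tau>) + L * (LINT \<tau>:{0..t}|lborel. H \<tau>)"
    using Eni H_integrable[of t] by (simp add: set_integral_add set_integrable_mult_right)
  finally show ?thesis using id by linarith
qed

definition H0 :: real where "H0 = (LINT z|lborel. f0 z * (norm (snd z - u 0 (fst z)))\<^sup>2)"

lemma integrable_F_\<Psi>: "integrable lborel (\<lambda>z. F t z * \<Psi> t z)"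
  and H_split: "H t = En t + 2 * (LINT z|lborel. F t z * \<Psi> t z)"
proof -
  have ie: "integrable lborel (\<lambda>z. F t z * (norm (snd z))\<^sup>2)"
    using ph.energy[of t] by (simp add: case_prod_beta' mult.commute)
  have e: "F t z * \<Psi> t z = 1 / 2 * (F t z * sq t z) - 1 / 2 * (F t z * (norm (snd z))\<^sup>2)" for z
    by (simp add: \<Psi>_def sq_def power2_norm_eq_inner inner_diff_left inner_diff_right inner_commute algebra_simps)
  show "integrable lborel (\<lambda>z. F t z * \<Psi> t z)"
    unfolding e by (intro Bochner_Integration.integrable_diff integrable_mult_right ie integrable_F_sq)
  show "H t = En t + 2 * (LINT z|lborel. F t z * \<Psi> t z)"
    unfolding e using ie integrable_F_sq[of t] by (simp add: H_def En_def case_prod_beta' mult.commute)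
qed

text \<open>By \<open>H_split\<close>, twice the entropy inequality is added to twice
  \<open>relative_entropy_identity\<close>; the damping and energy integrals, each with factor
  \<open>2 * lam\<close>, cancel.\<close>

lemma H_gronwall_premise:
  assumes t: "t \<in> {0..T}"
  shows "H t \<le> H0 + 2 * L * (LINT \<tau>:{0..t}|lborel. H \<tau>)"
proof -
  have "F 0 z * sq 0 z = f0 z * (norm (snd z - u 0 (fst z)))\<^sup>2" if "f 0 z = f0 z" for z
    using that by (simp add: F_eq sq_def)
  moreover have "(\<lambda>z. f0 z * (norm (snd z - u 0 (fst z)))\<^sup>2) \<in> borel_measurable lborel"
  proof -
    have "continuous_on UNIV (\<lambda>z. sq 0 z)"
      using continuous_on_compose2[OF sq_continuous continuous_on_Pair[OF continuous_on_const[of UNIV 0] continuous_on_id[of UNIV]]] by simp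
    from borel_measurable_continuous_onI[OF this] borel_measurable_integrable[OF phase_density.integrable[OF phase0]]
    show ?thesis unfolding sq_def by simp
  qed
  ultimately have H0: "H 0 = H0"
    unfolding H_def H0_def using init borel_measurable_integrable[OF integrable_F_sq[of 0]]
    by (intro integral_cong_AE) (auto elim!: eventually_mono)
  have En0: "En 0 = E0"
  proof -
    have "(\<lambda>(x, v). (norm v)\<^sup>2 * F 0 (x, v)) \<in> borel_measurable lborel" "(\<lambda>(x, v). (norm v)\<^sup>2 * f0 (x, v)) \<in> borel_measurable lborel"
      using ph.energy[of 0] phase_density.energy[OF phase0] by auto
    then show ?thesis unfolding En_def E0_def using init by (intro integral_cong_AE) (auto elim!: eventually_mono simp: F_eq)
  qed
  have "t \<ge> 0" using t by simp
  from En_entropy[OF this] relative_entropy_identity[OF t] H_split[of t] H_split[of 0] show ?thesis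
    unfolding H0 En0 by linarith
qed

text \<open>Gronwall uses \<open>H_bound\<close> only to know that \<open>H\<close> is bounded, so
  the total mass does not enter the estimate.\<close>

lemma H_le:
  assumes t: "t \<in> {0..T}"
  shows "H t \<le> 2 * H0 * exp ((2 * (2 * L) + 1) * T)"
proof (rule gronwall_bounded[OF H_integrable H_nonneg H_bound _ _ H_gronwall_premise t])
  show "0 \<le> 2 * L" using L0 by simp
  show "0 \<le> H0" unfolding H0_def by (simp add: phase_density.nonneg[OF phase0])
qed

end

text \<open>The mass is not bounded uniformly, so \<open>m |b - w| |b|\<close> cannot be estimated by \<open>\<delta> m |b|\<close>;
  the excess of \<open>m\<close> over \<open>r\<close> is absorbed into \<open>m |w - b|\<^sup>2\<close>.\<close>

context phase_density
begin

lemma initial_relative_energy: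
  assumes [measurable]: "b \<in> borel_measurable borel" and bM: "\<And>x. norm (b x) \<le> Mb"
    and r2: "integrable lborel (\<lambda>x. (r x)\<^sup>2)" and b2: "integrable lborel (\<lambda>x. (norm (b x))\<^sup>2)"
    and rb: "integrable lborel (\<lambda>x. r x * (norm (b x))\<^sup>2 / 2)"
    and r0: "\<And>x. r x \<ge> 0" and c: "c \<ge> 0"
    and mr: "AE x in lborel. \<bar>m x - r x\<bar> \<le> c" and wb: "AE x in lborel. norm (w x - b x) \<le> c"
    and A: "(LINT x|lborel. (LINT v|lborel. (norm v)\<^sup>2 / 2 * g (x, v)) - r x * (norm (b x))\<^sup>2 / 2) \<le> c"
  shows "(LINT (x, v)|lborel. g (x, v) * (norm (v - b x))\<^sup>2)
    \<le> c * (4 + 2 * (LINT x|lborel. (r x)\<^sup>2) + 8 * (LINT x|lborel. (norm (b x))\<^sup>2))"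
proof -
  define h where "h x = (LINT v|lborel. g (x, v) * (norm (v - b x))\<^sup>2)" for x
  define e where "e x = (LINT v|lborel. (norm v)\<^sup>2 / 2 * g (x, v))" for x
  have "integrable (lborel \<Otimes>\<^sub>M lborel) (\<lambda>z. g z * (norm (snd z - b (fst z)))\<^sup>2)"
  proof (rule Bochner_Integration.integrable_bound)
    show "integrable (lborel \<Otimes>\<^sub>M lborel) (\<lambda>z. 2 * ((norm (snd z))\<^sup>2 * g z) + 2 * Mb\<^sup>2 * g z)"
      using energy integrable by (simp add: lborel_prod case_prod_beta')
    show "AE z in lborel \<Otimes>\<^sub>M lborel. norm (g z * (norm (snd z - b (fst z)))\<^sup>2) \<le> norm (2 * ((norm (snd z))\<^sup>2 * g z) + 2 * Mb\<^sup>2 * g z)"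
    proof (rule AE_I2)
      fix z :: "(real^'d) \<times> (real^'d)"
      have "(norm (b (fst z)))\<^sup>2 \<le> Mb\<^sup>2" using bM by (intro power_mono) auto
      then have "(norm (snd z - b (fst z)))\<^sup>2 \<le> 2 * (norm (snd z))\<^sup>2 + 2 * Mb\<^sup>2"
        using norm_diff_square_le[of "snd z" "b (fst z)"] by linarith
      then have "g z * (norm (snd z - b (fst z)))\<^sup>2 \<le> g z * (2 * (norm (snd z))\<^sup>2 + 2 * Mb\<^sup>2)"
        by (intro mult_left_mono nonneg)
      then show "norm (g z * (norm (snd z - b (fst z)))\<^sup>2) \<le> norm (2 * ((norm (snd z))\<^sup>2 * g z) + 2 * Mb\<^sup>2 * g z)"
        using nonneg[of z] by (simp add: abs_mult algebra_simps)
    qed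
  qed measurable
  then have hi: "integrable lborel h" and hI: "(LINT x|lborel. h x) = (LINT z|lborel. g z * (norm (snd z - b (fst z)))\<^sup>2)"
    using lborel_pair.integrable_fst'[of "\<lambda>z. g z * (norm (snd z - b (fst z)))\<^sup>2"]
      lborel_pair.integral_fst'[of "\<lambda>z. g z * (norm (snd z - b (fst z)))\<^sup>2"] by (simp_all add: h_def[abs_def] lborel_prod)
  have "integrable lborel (\<lambda>x. LINT v|lborel. (norm v)\<^sup>2 * g (x, v))"
    using lborel_pair.integrable_fst'[of "\<lambda>(x, v). (norm v)\<^sup>2 * g (x, v)"] energy by (simp add: lborel_prod)
  from integrable_mult_right[OF this, of "1/2"] have ei: "integrable lborel e"
    unfolding e_def by (simp add: mult.assoc[symmetric])
  have "AE x in lborel. h x \<le> 4 * (e x - r x * (norm (b x))\<^sup>2 / 2) + c * (2 * (r x)\<^sup>2 + 8 * (norm (b x))\<^sup>2)"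
    using AE_good mr wb
  proof eventually_elim
    case (elim x)
    let ?B = "norm (b x)" and ?G = "norm (w x - b x)"
    define V where "V = (LINT v|lborel. g (x, v) * (norm (v - w x))\<^sup>2)"
    have V: "V \<ge> 0" unfolding V_def by (simp add: nonneg)
    have h: "h x = V + m x * ?G\<^sup>2"
      unfolding h_def V_def by (rule variance_slice[OF elim(1)])
    have "(LINT v|lborel. g (x, v) * (norm (v - 0))\<^sup>2) = V + m x * (norm (w x - 0))\<^sup>2"
      unfolding V_def by (rule variance_slice[OF elim(1)])
    then have e: "2 * e x = V + m x * (norm (w x))\<^sup>2"
      unfolding e_def by (simp add: mult.commute)
    have "m x * (?B\<^sup>2 - (norm (w x))\<^sup>2 + ?G\<^sup>2) = 2 * m x * ((b x - w x) \<bullet> b x)"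
      by (simp add: power2_norm_eq_inner inner_diff_left inner_diff_right inner_commute algebra_simps)
    also have "\<dots> \<le> 2 * m x * (?G * ?B)"
      using norm_cauchy_schwarz[of "b x - w x" "b x"] mass_nonneg[of x]
      by (intro mult_left_mono) (auto simp: norm_minus_commute)
    finally have 1: "m x * (?B\<^sup>2 - (norm (w x))\<^sup>2 + ?G\<^sup>2) \<le> 2 * (m x * (?G * ?B))" by simp
    have 2: "m x * (?G * ?B) \<le> c * ((r x)\<^sup>2 / 2 + ?B\<^sup>2 / 2) + m x * ?G\<^sup>2 / 4 + c * ?B\<^sup>2"
    proof -
      define p where "p = max 0 (m x - r x)"
      have p: "0 \<le> p" "p \<le> m x" "p \<le> c" "m x \<le> r x + p"
        using r0[of x] mass_nonneg[of x] elim(2) c by (auto simp: p_def)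
      have "?G * ?B \<le> ?G\<^sup>2 / 4 + ?B\<^sup>2"
        using zero_le_power2[of "?G / 2 - ?B"] by (simp add: power2_diff power_divide)
      then have "p * (?G * ?B) \<le> p * (?G\<^sup>2 / 4 + ?B\<^sup>2)" using p(1) by (rule mult_left_mono)
      also have "\<dots> \<le> m x * ?G\<^sup>2 / 4 + c * ?B\<^sup>2"
        using mult_right_mono[OF p(2), of "?G\<^sup>2"] mult_right_mono[OF p(3), of "?B\<^sup>2"] by (simp add: algebra_simps)
      finally have pp: "p * (?G * ?B) \<le> m x * ?G\<^sup>2 / 4 + c * ?B\<^sup>2" .
      have "r x * (?G * ?B) \<le> r x * (c * ?B)"
        using elim(3) r0[of x] by (intro mult_left_mono mult_right_mono) auto
      also have "\<dots> = c * (r x * ?B)" by simp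
      also have "\<dots> \<le> c * ((r x)\<^sup>2 / 2 + ?B\<^sup>2 / 2)"
        using sum_squares_bound[of "r x" ?B] c by (intro mult_left_mono) auto
      finally have rr: "r x * (?G * ?B) \<le> c * ((r x)\<^sup>2 / 2 + ?B\<^sup>2 / 2)" .
      have "m x * (?G * ?B) \<le> (r x + p) * (?G * ?B)" using p(4) by (intro mult_right_mono) auto
      then show ?thesis using pp rr by (simp add: distrib_right)
    qed
    have 3: "(r x - m x) * ?B\<^sup>2 \<le> c * ?B\<^sup>2" using elim(2) by (intro mult_right_mono) auto
    have 4: "m x * ?G\<^sup>2 \<le> h x" using h V by simp
    have lin: "h \<le> 2 * E + a + 2 * (p + h / 4 + b)"
      if "h = 2 * E + q1 + q2" "q2 \<le> 2 * q3" "q3 \<le> p + q4 / 4 + b" "q1 \<le> a" "q4 \<le> h"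
      for h E a p b q1 q2 q3 q4 :: real using that by (argo | (simp add: field_simps) | smt (verit))
    have "h x = 2 * (e x - r x * ?B\<^sup>2 / 2) + (r x - m x) * ?B\<^sup>2 + m x * (?B\<^sup>2 - (norm (w x))\<^sup>2 + ?G\<^sup>2)"
      using h e by (simp add: algebra_simps)
    then have "h x \<le> 2 * (e x - r x * ?B\<^sup>2 / 2) + c * ?B\<^sup>2 + 2 * (c * ((r x)\<^sup>2 / 2 + ?B\<^sup>2 / 2) + h x / 4 + c * ?B\<^sup>2)"
      using 1 2 3 4 by (rule lin)
    \<comment> \<open>Half of \<open>h x\<close> stands on the right; moving it to the left doubles
      the remaining coefficients, which become 4, 2 and 8.\<close>
    then show ?case by (simp add: algebra_simps)
  qed
  note h_le = this
  have Ei: "integrable lborel (\<lambda>x. e x - r x * (norm (b x))\<^sup>2 / 2)"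
    by (rule Bochner_Integration.integrable_diff[OF ei rb])
  have ri: "integrable lborel (\<lambda>x. 2 * (r x)\<^sup>2 + 8 * (norm (b x))\<^sup>2)"
    by (intro Bochner_Integration.integrable_add integrable_mult_right r2 b2)
  have "(LINT x|lborel. h x) \<le> (LINT x|lborel. 4 * (e x - r x * (norm (b x))\<^sup>2 / 2) + c * (2 * (r x)\<^sup>2 + 8 * (norm (b x))\<^sup>2))"
    by (intro integral_mono_AE hi h_le Bochner_Integration.integrable_add integrable_mult_right Ei ri)
  also have "\<dots> = 4 * (LINT x|lborel. e x - r x * (norm (b x))\<^sup>2 / 2) + c * (LINT x|lborel. 2 * (r x)\<^sup>2 + 8 * (norm (b x))\<^sup>2)"
    by (simp only: Bochner_Integration.integral_add[OF integrable_mult_right[OF Ei] integrable_mult_right[OF ri]] integral_mult_right_zero)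
  also have "(LINT x|lborel. 2 * (r x)\<^sup>2 + 8 * (norm (b x))\<^sup>2) = 2 * (LINT x|lborel. (r x)\<^sup>2) + 8 * (LINT x|lborel. (norm (b x))\<^sup>2)"
    using r2 b2 by simp
  also have "4 * (LINT x|lborel. e x - r x * (norm (b x))\<^sup>2 / 2) + c * (2 * (LINT x|lborel. (r x)\<^sup>2) + 8 * (LINT x|lborel. (norm (b x))\<^sup>2))
     \<le> 4 * c + c * (2 * (LINT x|lborel. (r x)\<^sup>2) + 8 * (LINT x|lborel. (norm (b x))\<^sup>2))"
    using A unfolding e_def by simp
  finally show ?thesis by (simp add: hI case_prod_beta' algebra_simps)
qed

end

section \<open>Growth of the weighted mass\<close>

context relative
begin

definition mw :: "real \<Rightarrow> real" where "mw t = (LINT z|lborel. F t z * wt (fst z))"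

lemma continuous_wt_fst: "continuous_on UNIV (\<lambda>z::(real^'d) \<times> (real^'d). wt (fst z))"
  by (rule continuous_on_compose2[OF continuous_wt continuous_on_fst[OF continuous_on_id]]) simp

lemma wt_abs_le: "\<bar>wt (fst z)\<bar> \<le> 1" using wt_le_1[of "fst z"] wt_pos[of "fst z"] by simp

lemma integrable_F_wt: "integrable lborel (\<lambda>z. F t z * wt (fst z))"
  by (rule integrable_F_bounded[OF continuous_wt_fst wt_abs_le])

lemma mw_nonneg: "mw t \<ge> 0"
  unfolding mw_def by (intro Bochner_Integration.integral_nonneg mult_nonneg_nonneg F_nonneg less_imp_le[OF wt_pos])

lemma mw_le: "mw t \<le> M0"
  using bounded_moment(1)[OF continuous_wt_fst wt_abs_le, of t] by (simp add: mw_def)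

lemma mw_integrable: "set_integrable lborel {0..s} mw"
proof -
  have m: "(\<lambda>p::real \<times> (real^'d) \<times> (real^'d). wt (fst (snd p))) \<in> borel_measurable (borel \<Otimes>\<^sub>M (borel \<Otimes>\<^sub>M borel))"
  proof (rule continuous_measurable)
    show "continuous_on UNIV (\<lambda>p::real \<times> (real^'d) \<times> (real^'d). wt (fst (snd p)))"
      by (rule continuous_on_compose2[OF continuous_wt continuous_fst_snd(4)]) simp
  qed
  have b: "\<bar>wt (fst z)\<bar> \<le> 1 * q t z" for t z using wt_abs_le[of z] q_ge_1[of t z] by simp
  show ?thesis unfolding mw_def[abs_def]
    by (rule FG_set_integrable[where G = "\<lambda>t z. wt (fst z)", OF m b]) (auto simp: emeasure_lborel_Icc_eq)
qed

text \<open>Since \<open>|v| \<le> M + 1 + |v - u|^2\<close> and the gradient of the weight is at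
  most \<open>CARD('d) * wt\<close>, the weighted mass grows at rate
  \<open>CARD('d) * (M + 1)\<close> with source \<open>CARD('d) * H\<close>. A uniform bound on
  \<open>H\<close> thus yields one on \<open>mw\<close>, whatever the total mass.\<close>

lemma mw_growth:
  fixes Hm :: real
  assumes Hm: "\<And>s. s \<in> {0..T} \<Longrightarrow> H s \<le> Hm" and t: "t \<in> {0..T}"
  shows "mw t \<le> 2 * (mw 0 + real CARD('d) * Hm * T) * exp ((2 * (CARD('d) * (M + 1)) + 1) * T)"
proof -
  define n where "n = real CARD('d)"
  have n: "n \<ge> 1" by (simp add: n_def Suc_leI)
  have Hm0: "Hm \<ge> 0" using Hm[OF t] H_nonneg[of t] by linarith
  define D where "D p h = dwt (fst (snd p)) (fst (snd h))" for p h :: "real \<times> (real^'d) \<times> (real^'d)"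
  have ld: "linear (dwt (x::real^'d))" for x by (rule has_derivative_linear[OF wt_has_derivative])
  have l: "linear (D p)" for p
    by (simp add: D_def linear_iff linear_add[OF ld] linear_scale[OF ld])
  have c: "continuous_on UNIV (\<lambda>p. D p h)" for h
    unfolding D_def by (rule continuous_on_compose2[OF continuous_dwt continuous_fst_snd(4)]) simp
  have db: "\<bar>D (s, z) (1, snd z, W s z)\<bar> \<le> n * (wt (fst z) * norm (snd z))" for s z
    using dwt_bound[of "fst z" "snd z"] by (simp add: D_def n_def)
  have bD: "\<bar>D (s, z) (1, snd z, W s z)\<bar> \<le> n * q s z" for s z
  proof -
    have "wt (fst z) * norm (snd z) \<le> 1 * q s z"
    proof (rule mult_mono)
      show "norm (snd z) \<le> q s z" using norm_le_q[of z s] norm_ge_zero[of "U s (fst z)"] by linarith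
    qed (use wt_le_1[of "fst z"] in auto)
    then have "n * (wt (fst z) * norm (snd z)) \<le> n * q s z" using n by (intro mult_left_mono) auto
    then show ?thesis using db[of s z] by linarith
  qed
  have mwt: "mw s \<le> (mw 0 + n * Hm * T) + n * (M + 1) * (LINT \<tau>:{0..s}|lborel. mw \<tau>)" if s: "s \<in> {0..T}" for s
  proof -
    have id: "(LINT z|lborel. F s z * wt (fst z)) - (LINT z|lborel. F 0 z * wt (fst z))
        = (LINT \<tau>:{0..s}|lborel. LINT z|lborel. F \<tau> z * D (\<tau>, z) (1, snd z, W \<tau> z))"
    proof (rule weak_general[where \<Psi> = "\<lambda>t z. wt (fst z)" and D = D and C = n, OF _ l c _ _ bD s])
      show "((\<lambda>(t, z). wt (fst z)) has_derivative D (r, z)) (at (r, z) within {0..T} \<times> UNIV)" for r z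
        using has_derivative_compose[OF has_derivative_fst[OF has_derivative_snd[OF has_derivative_ident]] wt_has_derivative[of "fst (snd (r, z))"], of "{0..T} \<times> UNIV"]
        by (simp add: D_def[abs_def] case_prod_beta')
      show "continuous_on UNIV (\<lambda>(t::real, z::(real^'d) \<times> (real^'d)). wt (fst z))"
        unfolding case_prod_beta' by (rule continuous_on_compose2[OF continuous_wt continuous_fst_snd(4)]) simp
      show "\<bar>wt (fst z)\<bar> \<le> n * (1 + norm (snd z))" for z :: "(real^'d) \<times> (real^'d)"
        using wt_abs_le[of z] mult_mono[of 1 n 1 "1 + norm (snd z)"] n by simp
    qed
    have mD: "(\<lambda>p. D (fst p, snd p) (1, snd (snd p), W (fst p) (snd p))) \<in> borel_measurable (borel \<Otimes>\<^sub>M (borel \<Otimes>\<^sub>M borel))"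
      using generator_measurable[OF l c] by (simp add: borel_prod)
    have i1: "set_integrable lborel {0..s} (\<lambda>\<tau>. LINT z|lborel. F \<tau> z * D (\<tau>, z) (1, snd z, W \<tau> z))"
      by (rule FG_set_integrable[OF mD bD]) (auto simp: emeasure_lborel_Icc_eq)
    have ci: "set_integrable lborel {0..s} (\<lambda>_. n * Hm)" unfolding set_integrable_def
      by (intro integrable_scaleR_left integrable_real_indicator) (auto simp: emeasure_lborel_Icc_eq)
    have i2: "set_integrable lborel {0..s} (\<lambda>\<tau>. n * Hm + n * (M + 1) * mw \<tau>)"
      by (intro set_integral_add(1) ci set_integrable_mult_right mw_integrable)
    have "(LINT \<tau>:{0..s}|lborel. LINT z|lborel. F \<tau> z * D (\<tau>, z) (1, snd z, W \<tau> z)) \<le> (LINT \<tau>:{0..s}|lborel. n * Hm + n * (M + 1) * mw \<tau>)"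
    proof (rule set_integral_mono[OF i1 i2])
      fix \<tau> assume "\<tau> \<in> {0..s}"
      then have \<tau>: "\<tau> \<in> {0..T}" using s by auto
      have "(LINT z|lborel. F \<tau> z * D (\<tau>, z) (1, snd z, W \<tau> z)) \<le> (LINT z|lborel. n * (F \<tau> z * sq \<tau> z) + n * (M + 1) * (F \<tau> z * wt (fst z)))"
      proof (rule integral_mono)
        show "integrable lborel (\<lambda>z. F \<tau> z * D (\<tau>, z) (1, snd z, W \<tau> z))"
          by (rule FG_integrable[where S = "{\<tau>}", OF mD bD]) auto
        show "integrable lborel (\<lambda>z. n * (F \<tau> z * sq \<tau> z) + n * (M + 1) * (F \<tau> z * wt (fst z)))"
          by (intro Bochner_Integration.integrable_add integrable_mult_right integrable_F_sq integrable_F_wt)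
        fix z
        let ?d = "norm (snd z - u \<tau> (fst z))"
        have "norm (snd z) \<le> M + ?d"
          using norm_triangle_ineq2[of "snd z" "u \<tau> (fst z)"] M[of \<tau> "fst z"] by linarith
        also have "?d \<le> 1 * (1 + ?d\<^sup>2)" by (rule ph.norm_le_one_plus_square)
        finally have "wt (fst z) * norm (snd z) \<le> wt (fst z) * (M + 1 + sq \<tau> z)"
          using wt_pos[of "fst z"] by (intro mult_left_mono) (auto simp: sq_def)
        also have "\<dots> \<le> (M + 1) * wt (fst z) + sq \<tau> z"
          using mult_right_mono[OF wt_le_1[of "fst z"] sq_nonneg[of \<tau> z]] by (simp add: algebra_simps)
        finally have "n * (wt (fst z) * norm (snd z)) \<le> n * ((M + 1) * wt (fst z) + sq \<tau> z)" using n by (intro mult_left_mono) auto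
        then have "D (\<tau>, z) (1, snd z, W \<tau> z) \<le> n * ((M + 1) * wt (fst z) + sq \<tau> z)" using db[of \<tau> z] by linarith
        from mult_left_mono[OF this F_nonneg[of \<tau> z]]
        show "F \<tau> z * D (\<tau>, z) (1, snd z, W \<tau> z) \<le> n * (F \<tau> z * sq \<tau> z) + n * (M + 1) * (F \<tau> z * wt (fst z))"
          by (simp add: algebra_simps)
      qed
      also have "\<dots> = n * H \<tau> + n * (M + 1) * mw \<tau>"
        using integrable_F_sq[of \<tau>] integrable_F_wt[of \<tau>] by (simp add: H_def mw_def)
      also have "\<dots> \<le> n * Hm + n * (M + 1) * mw \<tau>" using Hm[OF \<tau>] n by (intro add_right_mono mult_left_mono) auto
      finally show "(LINT z|lborel. F \<tau> z * D (\<tau>, z) (1, snd z, W \<tau> z)) \<le> n * Hm + n * (M + 1) * mw \<tau>" .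
    qed
    also have "\<dots> = (LINT \<tau>:{0..s}|lborel. n * Hm) + n * (M + 1) * (LINT \<tau>:{0..s}|lborel. mw \<tau>)"
      using ci mw_integrable[of s] by (simp add: set_integral_add set_integrable_mult_right)
    also have "(LINT \<tau>:{0..s}|lborel. n * Hm) = n * Hm * s"
      using s by (simp add: set_lebesgue_integral_def)
    finally have "mw s - mw 0 \<le> n * Hm * s + n * (M + 1) * (LINT \<tau>:{0..s}|lborel. mw \<tau>)" using id by (simp add: mw_def)
    moreover have "n * Hm * s \<le> n * Hm * T" using s n Hm0 by (intro mult_left_mono) auto
    ultimately show ?thesis by linarith
  qed
  have "mw t \<le> 2 * (mw 0 + n * Hm * T) * exp ((2 * (n * (M + 1)) + 1) * T)"
    by (rule gronwall_bounded[OF mw_integrable mw_nonneg mw_le _ _ mwt t])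
      (use n M0 Hm0 mw_nonneg[of 0] T_pos euler_flow_axioms in \<open>auto intro!: add_nonneg_nonneg mult_nonneg_nonneg\<close>)
  then show ?thesis by (simp add: n_def)
qed

text \<open>A bounded density against an integrable weight: initial closeness in L^\<infinity> takes
  the place of a bound on the total mass.\<close>

lemma mw_initial:
  assumes r: "\<And>x. \<bar>\<rho> 0 x\<bar> \<le> R0" and mr: "AE x in lborel. \<bar>mass_density f0 x - \<rho> 0 x\<bar> \<le> c"
  shows "mw 0 \<le> (R0 + c) * (LINT x|lborel. wt (x::real^'d))"
proof -
  have [measurable]: "(wt :: real^'d \<Rightarrow> real) \<in> borel_measurable borel" by (rule borel_measurable_continuous_onI[OF continuous_wt])
  have i: "integrable lborel (\<lambda>x. mass_density f0 x * wt x)"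
  proof (rule Bochner_Integration.integrable_bound[OF phase_density.integrable_mass[OF phase0]])
    show "(\<lambda>x. mass_density f0 x * wt x) \<in> borel_measurable lborel"
      using phase_density.mass_measurable[OF phase0] by simp
    show "AE x in lborel. norm (mass_density f0 x * wt x) \<le> norm (mass_density f0 x)"
    proof (rule AE_I2)
      fix x :: "real^'d"
      show "norm (mass_density f0 x * wt x) \<le> norm (mass_density f0 x)"
        using mult_left_le[OF wt_le_1[of x] phase_density.mass_nonneg[OF phase0, of x]] wt_pos[of x]
          phase_density.mass_nonneg[OF phase0, of x] by (simp add: abs_mult)
    qed
  qed
  have f0m: "f0 \<in> borel_measurable lborel" using phase_density.integrable[OF phase0] by auto
  have wm: "(\<lambda>z::(real^'d) \<times> (real^'d). wt (fst z)) \<in> borel_measurable lborel"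
    using borel_measurable_continuous_onI[OF continuous_wt_fst] by simp
  have "mw 0 = (LINT z|lborel. f0 z * wt (fst z))"
    unfolding mw_def
    by (rule integral_cong_AE[OF borel_measurable_integrable[OF integrable_F_wt]])
      (use f0m wm init in \<open>auto elim!: eventually_mono simp: F_eq\<close>)
  also have "\<dots> = (LINT x|lborel. mass_density f0 x * wt x)"
    using phase_density.integral_mass_weight[OF phase0 _ i less_imp_le[OF wt_pos]] by (simp add: case_prod_beta')
  also have "\<dots> \<le> (LINT x|lborel. (R0 + c) * wt (x::real^'d))"
  proof (rule integral_mono_AE[OF i])
    show "integrable lborel (\<lambda>x::real^'d. (R0 + c) * wt x)" by (rule integrable_mult_right[OF integrable_wt])
    show "AE x in lborel. mass_density f0 x * wt x \<le> (R0 + c) * wt x"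
      using mr
    proof eventually_elim
      case (elim x)
      then have "mass_density f0 x \<le> R0 + c" using r[of x] by linarith
      then show ?case using wt_pos[of x] by (intro mult_right_mono) auto
    qed
  qed
  finally show ?thesis by simp
qed

end

section \<open>Transported test functions\<close>

text \<open>A support bounded uniformly in time reduces the integral to a fixed box, where the
  Leibniz rule applies; derivatives at the ends of the interval are one-sided.\<close>

lemma has_real_derivative_integral_compact:
  fixes r :: "real \<Rightarrow> 'a::euclidean_space \<Rightarrow> real"
  assumes D: "\<And>t x. t \<in> {a..b} \<Longrightarrow> ((\<lambda>s. r s x) has_real_derivative r' t x) (at t within {a..b})"
    and c: "\<And>t. t \<in> {a..b} \<Longrightarrow> continuous_on UNIV (r t)" and c': "continuous_on ({a..b} \<times> UNIV) (\<lambda>(t, x). r' t x)"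
    and s: "\<And>t x. t \<in> {a..b} \<Longrightarrow> norm x > R \<Longrightarrow> r t x = 0" and s': "\<And>t x. t \<in> {a..b} \<Longrightarrow> norm x > R \<Longrightarrow> r' t x = 0"
    and t: "t \<in> {a..b}"
  shows "((\<lambda>t. LINT x|lborel. r t x) has_real_derivative (LINT x|lborel. r' t x)) (at t within {a..b})"
proof -
  obtain B :: 'a where B: "cball 0 R \<subseteq> cbox (- B) B"
    using bounded_subset_cbox_symmetric[OF bounded_cball] by blast
  have eq: "(LINT x|lborel. g x) = integral (cbox (- B) B) g"
    if g: "continuous_on UNIV g" "\<And>x. norm x > R \<Longrightarrow> g x = 0" for g :: "'a \<Rightarrow> real"
  proof -
    have "(LINT x|lborel. g x) = integral UNIV g"
      using integrable_compact_support[OF g] by (rule integral_lborel[symmetric])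
    also have "\<dots> = integral UNIV (\<lambda>x. if x \<in> cbox (- B) B then g x else 0)"
      using g(2) B by (intro arg_cong[where f = "integral UNIV"] ext) (force simp: subset_iff not_le)
    also have "\<dots> = integral (cbox (- B) B) g" by (rule integral_restrict_UNIV)
    finally show ?thesis .
  qed
  have c'': "continuous_on UNIV (r' t)" if "t \<in> {a..b}" for t
  proof -
    have 1: "continuous_on UNIV (\<lambda>x::'a. (t, x))" by (intro continuous_intros)
    have 2: "(\<lambda>x::'a. (t, x)) ` UNIV \<subseteq> {a..b} \<times> UNIV" using that by auto
    show ?thesis using continuous_on_compose2[OF c' 1 2] by simp
  qed
  have "((\<lambda>t. integral (cbox (- B) B) (r t)) has_real_derivative integral (cbox (- B) B) (r' t)) (at t within {a..b})"
  proof (rule leibniz_rule_field_derivative[OF D _ _ t])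
    show "r x integrable_on cbox (- B) B" if "x \<in> {a..b}" for x
      by (intro integrable_continuous continuous_on_subset[OF c[OF that]]) auto
    show "continuous_on ({a..b} \<times> cbox (- B) B) (\<lambda>(t, x). r' t x)" by (rule continuous_on_subset[OF c']) auto
  qed auto
  note d = this[unfolded has_field_derivative_def]
  have e1: "(LINT x|lborel. r' t x) = integral (cbox (- B) B) (r' t)" by (rule eq[OF c''[OF t] s'[OF t]])
  have e2: "(LINT x|lborel. r s x) = integral (cbox (- B) B) (r s)" if "s \<in> {a..b}" for s by (rule eq[OF c[OF that] s[OF that]])
  have "((\<lambda>t. LINT x|lborel. r t x) has_derivative (*) (integral (cbox (- B) B) (r' t))) (at t within {a..b})"
    by (rule has_derivative_transform[OF t e2 d])
  then show ?thesis by (simp only: has_field_derivative_def e1)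
qed

text \<open>By translation invariance the integral of \<open>h (t *\<^sub>R e + x)\<close> over
  \<open>x\<close> does not depend on \<open>t\<close>, and its derivative at \<open>t = 0\<close>
  is the left side.\<close>

lemma integral_derivative_zero:
  fixes h :: "'a::euclidean_space \<Rightarrow> real"
  assumes D: "\<And>x. (h has_derivative D x) (at x)" and c: "\<And>e. continuous_on UNIV (\<lambda>x. D x e)"
    and s: "\<And>x. norm x > R \<Longrightarrow> h x = 0"
  shows "(LINT x|lborel. D x e) = 0"
proof -
  have ch: "continuous_on UNIV h" by (rule has_derivative_continuous_on[OF has_derivative_at_withinI[OF D]])
  have far: "norm (t *\<^sub>R e + x) > R" if "t \<in> {0..1}" "norm x > R + norm e" for t x
  proof -
    have "norm (t *\<^sub>R e) \<le> norm e" using that(1) by (simp add: mult_left_le_one_le)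
    then show ?thesis using norm_diff_ineq[of x "t *\<^sub>R e"] that(2) by (simp add: add.commute)
  qed
  have swap: "(\<lambda>s. s * k) = (*) k" for k :: real by (simp add: fun_eq_iff mult.commute)
  have cm: "continuous_on A (\<lambda>p. fst p *\<^sub>R e + snd p)" for A :: "(real \<times> 'a) set" by (intro continuous_intros)
  have "((\<lambda>t. LINT x|lborel. h (t *\<^sub>R e + x)) has_real_derivative (LINT x|lborel. D (0 *\<^sub>R e + x) e)) (at 0 within {0..1})"
  proof (rule has_real_derivative_integral_compact[where R = "R + norm e"])
    fix t :: real and x assume t: "t \<in> {0..1}"
    have "((\<lambda>s. s *\<^sub>R e + x) has_derivative (\<lambda>s. s *\<^sub>R e)) (at t)" by (auto intro!: derivative_eq_intros)
    note d = has_derivative_compose[OF this D]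
    have "D (t *\<^sub>R e + x) (s *\<^sub>R e) = s * D (t *\<^sub>R e + x) e" for s
      using linear_scale[OF has_derivative_linear[OF D], of "t *\<^sub>R e + x" s e] by simp
    note d = d[unfolded this swap]
    show "((\<lambda>s. h (s *\<^sub>R e + x)) has_real_derivative D (t *\<^sub>R e + x) e) (at t within {0..1})"
      unfolding has_field_derivative_def by (rule has_derivative_at_withinI[OF d])
    show "h (t *\<^sub>R e + x) = 0" "D (t *\<^sub>R e + x) e = 0" if "norm x > R + norm e"
      using far[OF t that] s derivative_zero_outside_support[OF D s] by auto
    show "continuous_on UNIV (\<lambda>x. h (t *\<^sub>R e + x))"
      by (rule continuous_on_compose2[OF ch]) (auto intro!: continuous_intros)
  next
    show "continuous_on ({0..1} \<times> UNIV) (\<lambda>(t, x). D (t *\<^sub>R e + x) e)"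
      unfolding case_prod_beta' by (rule continuous_on_compose2[OF c cm]) simp
  qed auto
  moreover have "(LINT x|lborel. h (t *\<^sub>R e + x)) = (LINT x|lborel. h x)" for t
    by (rule integral_lborel_translate) (rule borel_measurable_continuous_onI[OF ch])
  ultimately have "((\<lambda>t::real. LINT x|lborel. h x) has_real_derivative (LINT x|lborel. D x e)) (at 0 within {0..1})" by simp
  from within_interval_unique[OF _ _ this DERIV_const] show ?thesis by simp
qed

text \<open>Velocity decays like \<open>exp (- lam t)\<close> along characteristics, so a particle at \<open>x\<close> with velocity
  \<open>u\<close> is at \<open>x + travel s u\<close> after time \<open>s\<close>: transported test functions are explicit.\<close>

context euler_flow
begin

definition travel :: "real \<Rightarrow> real" where
  "travel s = (if lam = 0 then s else (1 - exp (- lam * s)) / lam)"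

lemma travel_0: "travel 0 = 0" by (simp add: travel_def)

lemma travel_deriv: "(travel has_real_derivative (1 - lam * travel s)) (at s)"
proof (cases "lam = 0")
  case True
  then show ?thesis unfolding travel_def[abs_def] if_P[OF True] by simp
next
  case False
  then show ?thesis unfolding travel_def[abs_def] by (auto intro!: derivative_eq_intros)
qed

lemma travel_cont: "continuous_on UNIV travel"
  by (rule has_derivative_continuous_on[OF has_derivative_at_withinI[OF travel_deriv[unfolded has_field_derivative_def]]])

text \<open>Bounds \<open>travel\<close> on \<open>[- T, T]\<close>, where its derivative
  \<open>exp (- lam * y)\<close> is at most \<open>exp (lam * T)\<close>. Negative arguments occur
  because test functions are transported from \<open>t1\<close> in both time directions.\<close>

definition reach :: real where "reach = T * exp (lam * T)"

lemma reach_nonneg: "reach \<ge> 0" using T_pos by (simp add: reach_def)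

lemma travel_bound:
  assumes "\<bar>s\<bar> \<le> T" shows "\<bar>travel s\<bar> \<le> reach"
proof -
  have d: "norm (1 - lam * travel y) \<le> exp (lam * T)" if "y \<in> {- T..T}" for y
  proof -
    have "1 - lam * travel y = exp (- lam * y)" by (simp add: travel_def)
    moreover have "lam * (- y) \<le> lam * T" using that lam0 by (intro mult_left_mono) auto
    ultimately show ?thesis by simp
  qed
  have "norm (travel s - travel 0) \<le> exp (lam * T) * norm (s - 0)"
    by (rule field_differentiable_bound[of "{- T..T}" travel _ _ s 0, OF _ has_field_derivative_at_within[OF travel_deriv] d])
      (use assms T_pos in auto)
  also have "\<dots> \<le> exp (lam * T) * T" using assms by (intro mult_left_mono) auto
  finally show ?thesis by (simp add: travel_0 reach_def mult.commute)
qed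

definition test :: "(real^'d \<Rightarrow> real) \<Rightarrow> real \<Rightarrow> real \<Rightarrow> real^'d \<Rightarrow> real" where
  "test \<phi> t1 t x = \<phi> (x + travel (t1 - t) *\<^sub>R u t x)"

definition Dtest :: "(real^'d \<Rightarrow> real^'d \<Rightarrow> real) \<Rightarrow> real \<Rightarrow> real \<times> (real^'d) \<Rightarrow> real \<times> (real^'d) \<Rightarrow> real" where
  "Dtest D1 t1 p h = D1 (snd p + travel (t1 - fst p) *\<^sub>R u (fst p) (snd p))
     (snd h + travel (t1 - fst p) *\<^sub>R Du p h - (fst h * (1 - lam * travel (t1 - fst p))) *\<^sub>R u (fst p) (snd p))"

context
  fixes \<phi> :: "real^'d \<Rightarrow> real" and D1 :: "real^'d \<Rightarrow> real^'d \<Rightarrow> real" and R B t1 :: real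
  assumes D1: "\<And>x. (\<phi> has_derivative D1 x) (at x)" and D1c: "\<And>e. continuous_on UNIV (\<lambda>x. D1 x e)"
    and supp: "\<And>x. norm x > R \<Longrightarrow> \<phi> x = 0" and D1B: "\<And>x h. \<bar>D1 x h\<bar> \<le> B * norm h"
    and t1: "t1 \<in> {0..T}"
begin

lemma D1_linear: "linear (D1 x)" by (rule has_derivative_linear[OF D1])

lemma point_cont: "continuous_on UNIV (\<lambda>p. snd p + travel (t1 - fst p) *\<^sub>R u (fst p) (snd p))"
  "continuous_on UNIV (\<lambda>p::real \<times> (real^'d). travel (t1 - fst p))" "continuous_on UNIV (\<lambda>p. u (fst p) (snd p))"
proof -
  show 1: "continuous_on UNIV (\<lambda>p::real \<times> (real^'d). travel (t1 - fst p))"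
    by (rule continuous_on_compose2[OF travel_cont]) (auto intro!: continuous_intros)
  show 2: "continuous_on UNIV (\<lambda>p. u (fst p) (snd p))" using u_cont by (simp add: case_prod_beta')
  show "continuous_on UNIV (\<lambda>p. snd p + travel (t1 - fst p) *\<^sub>R u (fst p) (snd p))"
    by (intro continuous_intros 1 2)
qed

lemma test_cont: "continuous_on UNIV (\<lambda>p. test \<phi> t1 (fst p) (snd p))"
  unfolding test_def
  by (rule continuous_on_compose2[of UNIV \<phi>, OF has_derivative_continuous_on[OF has_derivative_at_withinI[OF D1]] point_cont(1)]) simp

lemma test_deriv:
  assumes t: "t \<in> {0..T}"
  shows "((\<lambda>(t, x). test \<phi> t1 t x) has_derivative Dtest D1 t1 (t, x)) (at (t, x) within {0..T} \<times> UNIV)"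
proof -
  let ?S = "{0..T} \<times> (UNIV :: (real^'d) set)"
  have "((\<lambda>p::real \<times> (real^'d). t1 - fst p) has_derivative (\<lambda>h. - fst h)) (at (t, x) within ?S)"
    by (auto intro!: derivative_eq_intros)
  note sub = this
  have swap: "(\<lambda>h. h * c) = (*) c" for c :: real by (simp add: fun_eq_iff mult.commute)
  from has_derivative_compose[OF sub, of travel "\<lambda>h. h * (1 - lam * travel (t1 - t))"]
  have tr: "((\<lambda>p::real \<times> (real^'d). travel (t1 - fst p)) has_derivative (\<lambda>h. - fst h * (1 - lam * travel (t1 - t)))) (at (t, x) within ?S)"
    using travel_deriv[of "t1 - t"] swap[of "1 - lam * travel (t1 - t)"] by (simp add: has_field_derivative_def)
  have du: "((\<lambda>p. u (fst p) (snd p)) has_derivative Du (t, x)) (at (t, x) within ?S)"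
    using u_deriv[OF t] by (simp add: case_prod_beta')
  have sn: "((\<lambda>p::real \<times> (real^'d). snd p) has_derivative (\<lambda>h. snd h)) (at (t, x) within ?S)"
    by (intro has_derivative_snd has_derivative_ident)
  have "((\<lambda>p. snd p + travel (t1 - fst p) *\<^sub>R u (fst p) (snd p)) has_derivative
      (\<lambda>h. snd h + (travel (t1 - fst (t, x)) *\<^sub>R Du (t, x) h + (- fst h * (1 - lam * travel (t1 - t))) *\<^sub>R u (fst (t, x)) (snd (t, x)))))
      (at (t, x) within ?S)"
    by (rule has_derivative_add[OF sn has_derivative_scaleR[OF tr du]])
  from has_derivative_compose[OF this D1]
  show ?thesis by (simp add: test_def Dtest_def[abs_def] case_prod_beta' algebra_simps)
qed

lemma Dtest_linear: "linear (Dtest D1 t1 p)"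
proof -
  have "linear (\<lambda>h. snd h + c *\<^sub>R Du p h - (fst h * k) *\<^sub>R w)" for c k w
    by (rule linearI) (simp_all add: linear_add[OF Du_linear] linear_scale[OF Du_linear] algebra_simps)
  from linear_compose[OF this D1_linear] show ?thesis unfolding Dtest_def o_def .
qed

lemma Dtest_cont: "continuous_on UNIV (\<lambda>p. Dtest D1 t1 p h)"
proof -
  have "Dtest D1 t1 p h = (\<Sum>i\<in>UNIV. D1 (snd p + travel (t1 - fst p) *\<^sub>R u (fst p) (snd p)) (axis i 1) *
     (snd h + travel (t1 - fst p) *\<^sub>R Du p h - (fst h * (1 - lam * travel (t1 - fst p))) *\<^sub>R u (fst p) (snd p)) $ i)" for p
    unfolding Dtest_def by (rule linear_axis_sum[OF D1_linear])
  moreover have "continuous_on UNIV (\<lambda>p. D1 (snd p + travel (t1 - fst p) *\<^sub>R u (fst p) (snd p)) e)" for e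
    by (rule continuous_on_compose2[OF D1c point_cont(1)]) simp
  ultimately show ?thesis
    by simp (intro continuous_intros point_cont Du_cont)
qed

lemma point_far: "t \<in> {0..T} \<Longrightarrow> norm x > R + reach * M \<Longrightarrow> norm (x + travel (t1 - t) *\<^sub>R u t x) > R"
proof -
  assume t: "t \<in> {0..T}" and x: "norm x > R + reach * M"
  have "norm (travel (t1 - t) *\<^sub>R u t x) \<le> reach * M"
    using travel_bound[of "t1 - t"] t t1 M[of t x] M0 reach_nonneg by (auto intro!: mult_mono)
  then show ?thesis using norm_diff_ineq[of x "travel (t1 - t) *\<^sub>R u t x"] x by linarith
qed

lemma test_supp: "t \<in> {0..T} \<Longrightarrow> norm x > R + reach * M \<Longrightarrow> test \<phi> t1 t x = 0"
  unfolding test_def by (rule supp[OF point_far])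

lemma Dtest_supp: "t \<in> {0..T} \<Longrightarrow> norm x > R + reach * M \<Longrightarrow> Dtest D1 t1 (t, x) h = 0"
  unfolding Dtest_def using derivative_zero_outside_support[OF D1 supp point_far] by simp

text \<open>The predicted position at time \<open>t1\<close> is constant along the flow. As
  \<open>u\<close> changes at rate \<open>- lam *\<^sub>R u\<close>, the increment is
  \<open>u\<close> minus \<open>lam * travel\<close> times \<open>u\<close> minus
  \<open>1 - lam * travel\<close> times \<open>u\<close>, which is 0.\<close>

lemma Dtest_transport: "t \<in> {0..T} \<Longrightarrow> Dtest D1 t1 (t, x) (1, u t x) = 0"
  using u_eq[of t x] linear_0[OF D1_linear] by (simp add: Dtest_def algebra_simps)

lemma Dtest_space: "t \<in> {0..T} \<Longrightarrow> \<bar>Dtest D1 t1 (t, x) (0, h)\<bar> \<le> B * (1 + reach * L) * norm h"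
proof -
  assume t: "t \<in> {0..T}"
  have B: "B \<ge> 0" using order_trans[OF abs_ge_zero D1B[of 0 "axis undefined 1"]] by simp
  have "norm (travel (t1 - t) *\<^sub>R Du (t, x) (0, h)) \<le> reach * (L * norm h)"
    using travel_bound[of "t1 - t"] t t1 L[of t x h] reach_nonneg by (auto intro!: mult_mono)
  then have "norm (h + travel (t1 - t) *\<^sub>R Du (t, x) (0, h)) \<le> (1 + reach * L) * norm h"
    using norm_triangle_ineq[of h "travel (t1 - t) *\<^sub>R Du (t, x) (0, h)"] by (simp add: algebra_simps)
  then have le: "B * norm (h + travel (t1 - t) *\<^sub>R Du (t, x) (0, h)) \<le> B * ((1 + reach * L) * norm h)"
    by (rule mult_left_mono[OF _ B])
  have e: "Dtest D1 t1 (t, x) (0, h) = D1 (x + travel (t1 - t) *\<^sub>R u t x) (h + travel (t1 - t) *\<^sub>R Du (t, x) (0, h))"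
    by (simp add: Dtest_def)
  show ?thesis unfolding e mult.assoc by (rule order_trans[OF D1B le])
qed

text \<open>Because \<open>test\<close> is constant along the flow, the time derivative is minus the
  integral of the divergence of \<open>\<rho>\<close> times \<open>test\<close> times
  \<open>u\<close>, and compact support makes that integral vanish.\<close>

lemma test_conserved:
  assumes t: "t \<in> {0..T}"
  shows "(LINT x|lborel. \<rho> t x * test \<phi> t1 t x) = (LINT x|lborel. \<rho> 0 x * test \<phi> t1 0 x)"
proof -
  let ?r = "\<lambda>t x. \<rho> t x * test \<phi> t1 t x"
  define Dr where "Dr p h = \<rho> (fst p) (snd p) * Dtest D1 t1 p h + D\<rho> p h * test \<phi> t1 (fst p) (snd p)" for p h
  have rc: "continuous_on UNIV (\<lambda>p. \<rho> (fst p) (snd p))" using \<rho>_cont by (simp add: case_prod_beta')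
  have Drd: "((\<lambda>(t, x). ?r t x) has_derivative Dr (t, x)) (at (t, x) within {0..T} \<times> UNIV)" if "t \<in> {0..T}" for t x
    using has_derivative_mult[OF \<rho>_deriv[OF that] test_deriv[OF that]]
    by (simp add: Dr_def[abs_def] case_prod_beta')
  have Drl: "linear (Dr p)" for p
    unfolding Dr_def
    by (rule linearI) (simp_all add: linear_add[OF Dtest_linear] linear_scale[OF Dtest_linear] linear_add[OF D\<rho>_linear] linear_scale[OF D\<rho>_linear] algebra_simps)
  have Drc: "continuous_on UNIV (\<lambda>p. Dr p h)" for h
    unfolding Dr_def by (intro continuous_intros rc Dtest_cont D\<rho>_cont test_cont)
  have rsup: "?r t x = 0" "Dr (t, x) h = 0" if "t \<in> {0..T}" "norm x > R + reach * M" for t x h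
    using test_supp[OF that] Dtest_supp[OF that] by (simp_all add: Dr_def)
  have slice: "continuous_on UNIV (\<lambda>x. g (t, x))" if "continuous_on UNIV g" for g :: "real \<times> (real^'d) \<Rightarrow> real" and t
    by (rule continuous_on_compose2[OF that]) (auto intro!: continuous_on_Pair continuous_on_const continuous_on_id)
  have "((\<lambda>t. LINT x|lborel. ?r t x) has_real_derivative 0) (at t within {0..T})" if t: "t \<in> {0..T}" for t
  proof -
    have "((\<lambda>t. LINT x|lborel. ?r t x) has_real_derivative (LINT x|lborel. Dr (t, x) (1, 0))) (at t within {0..T})"
    proof (rule has_real_derivative_integral_compact[where R = "R + reach * M", OF _ _ _ rsup(1) rsup(2) t])
      fix t x assume t: "t \<in> {0..T}"
      have "((\<lambda>\<tau>. ?r \<tau> x) has_derivative (\<lambda>s. Dr (t, x) (s, 0))) (at t within {0..T})"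
        by (rule has_derivative_slices(2)[where \<Psi> = ?r and D = Dr, OF Drd[OF t] t])
      moreover have "(\<lambda>s. Dr (t, x) (s, 0)) = (*) (Dr (t, x) (1, 0))"
      proof
        fix s show "Dr (t, x) (s, 0) = Dr (t, x) (1, 0) * s"
          using linear_scale[OF Drl, of "(t, x)" s "(1, 0)"] by simp
      qed
      ultimately show "((\<lambda>s. ?r s x) has_real_derivative Dr (t, x) (1, 0)) (at t within {0..T})"
        by (simp only: has_field_derivative_def)
    next
      fix t show "continuous_on UNIV (?r t)"
        using slice[OF continuous_on_mult[OF rc test_cont], of t] by simp
    next
      show "continuous_on ({0..T} \<times> UNIV) (\<lambda>(t, x). Dr (t, x) (1, 0))"
        using continuous_on_subset[OF Drc subset_UNIV] by (simp add: case_prod_beta')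
    qed
    moreover have "(LINT x|lborel. Dr (t, x) (1, 0)) = 0"
    proof -
      \<comment> \<open>\<open>K i x (axis i 1)\<close> is the \<open>i\<close>-th partial
        derivative of the \<open>i\<close>-th component of \<open>\<rho>\<close> times
        \<open>test\<close> times \<open>u\<close>.\<close>
      define K where "K i x h = ?r t x * Du (t, x) (0, h) $ i + Dr (t, x) (0, h) * u t x $ i" for i x h
      have e: "Dr (t, x) (1, 0) = - (\<Sum>i\<in>UNIV. K i x (axis i 1))" for x
      proof -
        have "Dr (t, x) (1, 0) = Dr (t, x) (1, u t x) - Dr (t, x) (0, u t x)"
          using linear_diff[OF Drl, of "(t, x)" "(1, u t x)" "(0, u t x)"] by simp
        also have "Dr (t, x) (1, u t x) = - ?r t x * (\<Sum>i\<in>UNIV. Du (t, x) (0, axis i 1) $ i)"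
          by (simp add: Dr_def Dtest_transport[OF t] \<rho>_eq[OF t])
        also have "Dr (t, x) (0, u t x) = (\<Sum>i\<in>UNIV. Dr (t, x) (0, axis i 1) * u t x $ i)"
        proof (rule linear_axis_sum)
          have "linear (\<lambda>h::real^'d. (0::real, h))" by (rule linearI) simp_all
          from linear_compose[OF this Drl] show "linear (\<lambda>h. Dr (t, x) (0, h))" unfolding o_def .
        qed
        finally show ?thesis by (simp add: K_def sum.distrib sum_distrib_left sum_negf)
      qed
      have cK: "continuous_on UNIV (\<lambda>x. K i x h)" for i h
      proof -
        have 1: "continuous_on UNIV (\<lambda>x. ?r t x)" using slice[OF continuous_on_mult[OF rc test_cont], of t] by simp
        have 2: "continuous_on UNIV (\<lambda>x. Du (t, x) (0, h) $ i)" using slice[OF continuous_on_component[OF Du_cont], of t "(0, h)" i] by simp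
        have 3: "continuous_on UNIV (\<lambda>x. Dr (t, x) (0, h))" by (rule slice[OF Drc])
        have 4: "continuous_on UNIV (\<lambda>x. u t x $ i)" using slice[OF continuous_on_component[OF point_cont(3)], of t i] by simp
        show ?thesis unfolding K_def
          by (rule continuous_on_add[OF continuous_on_mult[OF 1 2] continuous_on_mult[OF 3 4]])
      qed
      have dK: "((\<lambda>x. ?r t x * u t x $ i) has_derivative K i x) (at x)" for i x
      proof -
        have "((\<lambda>x. u t x $ i) has_derivative (\<lambda>h. Du (t, x) (0, h) $ i)) (at x)"
          by (rule bounded_linear.has_derivative[OF bounded_linear_vec_nth has_derivative_slices(1)[where \<Psi> = u and D = Du, OF u_deriv[OF t] t]])
        from has_derivative_mult[OF has_derivative_slices(1)[where \<Psi> = ?r and D = Dr, OF Drd[OF t] t] this]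
        show ?thesis by (simp add: K_def[abs_def])
      qed
      have sK: "?r t x * u t x $ i = 0" if "norm x > R + reach * M" for x i using rsup(1)[OF t that] by simp
      have iK: "integrable lborel (\<lambda>x. K i x (axis i 1))" for i
        by (rule integrable_compact_support[OF cK, of "R + reach * M"]) (simp add: K_def rsup[OF t])
      have "(LINT x|lborel. (\<Sum>i\<in>UNIV. K i x (axis i 1))) = (\<Sum>i\<in>UNIV. LINT x|lborel. K i x (axis i 1))"
        using iK by (intro Bochner_Integration.integral_sum)
      also have "\<dots> = 0" using integral_derivative_zero[OF dK cK sK] by simp
      finally show ?thesis unfolding e by simp
    qed
    ultimately show ?thesis by simp
  qed
  then have "\<exists>c. \<forall>t\<in>{0..T}. (LINT x|lborel. ?r t x) = c"
    by (intro has_field_derivative_zero_constant) auto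
  then show ?thesis using t T_pos by force
qed

end

end

lemma set_integral_product_close:
  fixes P Q :: "real \<times> 'a::euclidean_space \<Rightarrow> real"
  assumes P: "set_integrable lborel ({0..T} \<times> UNIV) P" and Q: "set_integrable lborel ({0..T} \<times> UNIV) Q"
    and T: "T \<ge> 0" and K: "\<And>t. t \<in> {0..T} \<Longrightarrow> \<bar>(LINT x|lborel. P (t, x)) - (LINT x|lborel. Q (t, x))\<bar> \<le> K"
  shows "\<bar>(LINT p:{0..T} \<times> UNIV|lborel. P p) - (LINT p:{0..T} \<times> UNIV|lborel. Q p)\<bar> \<le> K * T"
proof -
  have K0: "K \<ge> 0" using order_trans[OF abs_ge_zero K[of 0]] T by simp
  have *: "integrable lborel (\<lambda>t. indicator {0..T} t * (LINT x|lborel. P (t, x)))"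
    "(LINT p:{0..T} \<times> UNIV|lborel. P p) = (LINT t|lborel. indicator {0..T} t * (LINT x|lborel. P (t, x)))"
    if P: "set_integrable lborel ({0..T} \<times> UNIV) P" for P :: "real \<times> 'a \<Rightarrow> real"
  proof -
    have i: "integrable (lborel \<Otimes>\<^sub>M lborel) (\<lambda>p. indicator ({0..T} \<times> UNIV) p *\<^sub>R P p)"
      using P by (simp add: set_integrable_def lborel_prod)
    have e: "(LINT x|lborel. indicator ({0..T} \<times> UNIV) (t, x) *\<^sub>R P (t, x)) = indicator {0..T} t * (LINT x|lborel. P (t, x))" for t
      by (simp add: indicator_times)
    show "integrable lborel (\<lambda>t. indicator {0..T} t * (LINT x|lborel. P (t, x)))"
      using lborel_pair.integrable_fst'[OF i] unfolding e .
    show "(LINT p:{0..T} \<times> UNIV|lborel. P p) = (LINT t|lborel. indicator {0..T} t * (LINT x|lborel. P (t, x)))"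
      using lborel_pair.integral_fst'[OF i] unfolding e by (simp add: set_lebesgue_integral_def lborel_prod)
  qed
  have "\<bar>(LINT p:{0..T} \<times> UNIV|lborel. P p) - (LINT p:{0..T} \<times> UNIV|lborel. Q p)\<bar>
      = \<bar>LINT t|lborel. indicator {0..T} t * (LINT x|lborel. P (t, x)) - indicator {0..T} t * (LINT x|lborel. Q (t, x))\<bar>"
    unfolding *(2)[OF P] *(2)[OF Q] by (simp only: Bochner_Integration.integral_diff[OF *(1)[OF P] *(1)[OF Q]])
  also have "\<dots> \<le> (LINT t|lborel. K * indicator {0..T} t)"
  proof (rule order_trans[OF integral_abs_bound], rule integral_mono)
    show "integrable lborel (\<lambda>t. \<bar>indicator {0..T} t * (LINT x|lborel. P (t, x)) - indicator {0..T} t * (LINT x|lborel. Q (t, x))\<bar>)"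
      by (intro integrable_abs Bochner_Integration.integrable_diff *(1) P Q)
    show "integrable lborel (\<lambda>t. K * indicator {0..T} t)"
      by (intro integrable_mult_right integrable_real_indicator) (auto simp: emeasure_lborel_Icc_eq)
    show "\<bar>indicator {0..T} t * (LINT x|lborel. P (t, x)) - indicator {0..T} t * (LINT x|lborel. Q (t, x))\<bar> \<le> K * indicator {0..T} t" for t
      using K[of t] K0 by (cases "t \<in> {0..T}") auto
  qed
  also have "\<dots> = K * T" using T by simp
  finally show ?thesis .
qed

lemma (in phase_density)
  assumes [measurable]: "c \<in> borel_measurable borel" and K: "\<And>x. \<bar>c x\<bar> \<le> K"
  shows integrable_bounded_weight: "integrable lborel (\<lambda>x. m x * c x)"
    and integral_bounded_weight: "(LINT x|lborel. m x * c x) = (LINT z|lborel. g z * c (fst z))"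
proof -
  have i: "integrable (lborel \<Otimes>\<^sub>M lborel) (\<lambda>z. g z * c (fst z))"
  proof (rule Bochner_Integration.integrable_bound)
    show "integrable (lborel \<Otimes>\<^sub>M lborel) (\<lambda>z. K * g z)" using integrable by (simp add: lborel_prod)
    show "AE z in lborel \<Otimes>\<^sub>M lborel. norm (g z * c (fst z)) \<le> norm (K * g z)"
      using K order_trans[OF abs_ge_zero K] nonneg by (intro AE_I2) (auto simp: abs_mult mult.commute intro!: mult_right_mono)
  qed measurable
  have e: "(LINT v|lborel. g (x, v) * c (fst (x, v))) = m x * c x" for x by (simp add: mass_density_def)
  show "integrable lborel (\<lambda>x. m x * c x)" using lborel_pair.integrable_fst'[OF i] unfolding e .
  show "(LINT x|lborel. m x * c x) = (LINT z|lborel. g z * c (fst z))"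
    using lborel_pair.integral_fst'[OF i] unfolding e by (simp add: lborel_prod)
qed

context euler_flow
begin

text \<open>The value of \<open>wt\<close> on the sphere of radius \<open>r\<close>, its minimum
  over the ball; dividing by it converts a local estimate into a weighted one.\<close>

definition wl :: "real \<Rightarrow> real" where "wl r = (1 + r\<^sup>2) powr (- real CARD('d))"

lemma wl_pos: "wl r > 0" by (simp add: wl_def add_pos_nonneg less_imp_neq[THEN not_sym])

lemma wt_ge: "norm (x::real^'d) \<le> r \<Longrightarrow> wl r \<le> wt x"
  unfolding wl_def wt_def using powr_mono2'[of "- real CARD('d)" "1 + (norm x)\<^sup>2" "1 + r\<^sup>2"]
  by (simp add: power_mono add_pos_nonneg)

text \<open>The constant of \<open>near_transport\<close>: the first part comes from the deviation
  of \<open>v\<close> from \<open>u\<close> during transport over time \<open>T\<close>, the second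
  from the initial density error on the support of the transported test function.\<close>

definition slip :: "real \<Rightarrow> real \<Rightarrow> real" where
  "slip R B = B * (1 + reach * L) / wl (R + reach * M) * T + B * measure lborel (cball (0::real^'d) (R + reach * M))"

lemma u_measurable' [measurable (raw)]:
  assumes [measurable]: "g \<in> borel_measurable N" "h \<in> borel_measurable N"
  shows "(\<lambda>p. u (g p) (h p)) \<in> borel_measurable N"
proof -
  have "(\<lambda>p. u (fst p) (snd p)) \<in> borel_measurable (borel \<Otimes>\<^sub>M borel)"
    using borel_measurable_continuous_onI[OF u_cont] by (simp add: borel_prod case_prod_beta')
  moreover have "(\<lambda>p. (g p, h p)) \<in> N \<rightarrow>\<^sub>M (borel \<Otimes>\<^sub>M borel)" by measurable
  ultimately show ?thesis using measurable_compose[of "\<lambda>p. (g p, h p)" N _ "\<lambda>p. u (fst p) (snd p)"] by simp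
qed

end

context relative
begin

lemma wt_measurable [measurable]: "(wt :: real^'d \<Rightarrow> real) \<in> borel_measurable borel"
  by (rule borel_measurable_continuous_onI[OF continuous_wt])

text \<open>First moment of the deviation; the weight is needed because interpolating between the
  total mass and \<open>H\<close> would not be uniform in \<open>\<epsilon>\<close>.\<close>

definition A :: "real \<Rightarrow> real" where "A t = (LINT z|lborel. F t z * (wt (fst z) * norm (snd z - u t (fst z))))"

definition b1 :: "real \<Rightarrow> real^'d \<Rightarrow> real" where "b1 t x = (LINT v|lborel. F t (x, v) * norm (v - u t x))"
definition b2 :: "real \<Rightarrow> real^'d \<Rightarrow> real" where "b2 t x = (LINT v|lborel. F t (x, v) * (norm (v - u t x))\<^sup>2)"

lemma slice_integral:
  assumes G: "(\<lambda>z. G z) \<in> borel_measurable (borel \<Otimes>\<^sub>M borel)" and b: "\<And>z. \<bar>G z\<bar> \<le> C * q t z"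
  shows "integrable lborel (\<lambda>z. F t z * G z)" "integrable lborel (\<lambda>x. LINT v|lborel. F t (x, v) * G (x, v))"
    "(LINT x|lborel. LINT v|lborel. F t (x, v) * G (x, v)) = (LINT z|lborel. F t z * G z)"
    "(LINT z|lborel. F t z * G z) \<le> C * Q"
proof -
  have m: "(\<lambda>p::real \<times> _. G (snd p)) \<in> borel_measurable (borel \<Otimes>\<^sub>M (borel \<Otimes>\<^sub>M borel))"
    by (rule measurable_compose[OF measurable_snd G])
  show i: "integrable lborel (\<lambda>z. F t z * G z)"
    by (rule FG_integrable[where S = "{t}" and G = "\<lambda>_. G", OF m]) (use b in auto)
  have "\<bar>LINT z|lborel. F t z * G z\<bar> \<le> C * Q"
    by (rule FG_integral_le[where S = "{t}" and G = "\<lambda>_. G", OF m]) (use b in auto)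
  then show "(LINT z|lborel. F t z * G z) \<le> C * Q" by simp
  show "integrable lborel (\<lambda>x. LINT v|lborel. F t (x, v) * G (x, v))"
    "(LINT x|lborel. LINT v|lborel. F t (x, v) * G (x, v)) = (LINT z|lborel. F t z * G z)"
    using lborel_pair.integrable_fst'[of "\<lambda>z. F t z * G z"] lborel_pair.integral_fst'[of "\<lambda>z. F t z * G z"] i
    by (simp_all add: lborel_prod)
qed

lemma dev_le_q: "norm (snd z - u t (fst z)) \<le> (1 + M) * q t z"
proof -
  have "norm (snd z - u t (fst z)) \<le> norm (snd z) + M"
    using norm_triangle_ineq4[of "snd z" "u t (fst z)"] M[of t "fst z"] by linarith
  also have "norm (snd z) \<le> q t z" using norm_le_q[of z t] norm_ge_zero[of "U t (fst z)"] by linarith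
  also have "M \<le> M * q t z" using mult_left_mono[OF q_ge_1[of t z] M0] by simp
  finally show ?thesis by (simp add: algebra_simps)
qed

lemma wt_dev_le_q: "\<bar>wt (fst z) * norm (snd z - u t (fst z))\<bar> \<le> (1 + M) * q t z"
  using mult_right_mono[OF wt_le_1[of "fst z"], of "norm (snd z - u t (fst z))"] dev_le_q[of z t] wt_pos[of "fst z"]
  by (simp add: abs_mult)

lemma meas_dev: "(\<lambda>z. norm (snd z - u t (fst z))) \<in> borel_measurable (borel \<Otimes>\<^sub>M borel)"
  "(\<lambda>z. wt (fst z) * norm (snd z - u t (fst z))) \<in> borel_measurable (borel \<Otimes>\<^sub>M borel)"
  "(\<lambda>z. sq t z) \<in> borel_measurable (borel \<Otimes>\<^sub>M borel)"
  unfolding sq_def by measurable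

text \<open>Young's inequality \<open>|v - u| \<le> \<eta> / 2 + |v - u|^2 / (2 * \<eta>)\<close>.
  Once \<open>H\<close> is of order \<open>\<eta>^2\<close>, both terms are of order
  \<open>\<eta>\<close>.\<close>

lemma A_le:
  assumes \<eta>: "\<eta> > 0"
  shows "A t \<le> \<eta> / 2 * mw t + 1 / (2 * \<eta>) * H t"
proof -
  have "A t \<le> (LINT z|lborel. \<eta> / 2 * (F t z * wt (fst z)) + 1 / (2 * \<eta>) * (F t z * sq t z))"
    unfolding A_def
  proof (rule integral_mono)
    show "integrable lborel (\<lambda>z. F t z * (wt (fst z) * norm (snd z - u t (fst z))))"
      by (rule slice_integral(1)[OF meas_dev(2) wt_dev_le_q])
    show "integrable lborel (\<lambda>z. \<eta> / 2 * (F t z * wt (fst z)) + 1 / (2 * \<eta>) * (F t z * sq t z))"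
      by (intro Bochner_Integration.integrable_add integrable_mult_right integrable_F_sq integrable_F_wt)
    fix z
    let ?n = "norm (snd z - u t (fst z))"
    have "?n \<le> \<eta> / 2 + 1 / (2 * \<eta>) * ?n\<^sup>2"
    proof -
      have "2 * \<eta> * ?n \<le> \<eta>\<^sup>2 + ?n\<^sup>2" using sum_squares_bound[of \<eta> ?n] by simp
      then have "(2 * \<eta> * ?n) / (2 * \<eta>) \<le> (\<eta>\<^sup>2 + ?n\<^sup>2) / (2 * \<eta>)" using \<eta> by (intro divide_right_mono) auto
      then show ?thesis using \<eta> by (simp add: add_divide_distrib power2_eq_square)
    qed
    then have "wt (fst z) * ?n \<le> wt (fst z) * (\<eta> / 2 + 1 / (2 * \<eta>) * ?n\<^sup>2)"
      using wt_pos[of "fst z"] by (intro mult_left_mono) auto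
    also have "\<dots> \<le> \<eta> / 2 * wt (fst z) + 1 / (2 * \<eta>) * sq t z"
      using mult_right_mono[OF wt_le_1[of "fst z"], of "1 / (2 * \<eta>) * sq t z"] \<eta> sq_nonneg[of t z]
      by (simp add: sq_def algebra_simps)
    finally show "F t z * (wt (fst z) * ?n) \<le> \<eta> / 2 * (F t z * wt (fst z)) + 1 / (2 * \<eta>) * (F t z * sq t z)"
      using mult_left_mono[OF _ F_nonneg[of t z], of "wt (fst z) * ?n" "\<eta> / 2 * wt (fst z) + 1 / (2 * \<eta>) * sq t z"]
      by (simp add: algebra_simps)
  qed
  also have "\<dots> = \<eta> / 2 * mw t + 1 / (2 * \<eta>) * H t"
    using integrable_F_sq[of t] integrable_F_wt[of t] by (simp add: H_def mw_def)
  finally show ?thesis .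
qed

text \<open>Collects what the limits use about \<open>\<epsilon>\<close>: a smallness
  \<open>\<tau>\<close> for the deviations and the initial density error, and a bound
  \<open>Mm\<close> for the weighted mass.\<close>

definition near :: "real \<Rightarrow> real \<Rightarrow> bool" where
  "near \<tau> Mm \<longleftrightarrow> \<tau> \<ge> 0 \<and> (\<forall>t\<in>{0..T}. A t \<le> \<tau> \<and> H t \<le> \<tau> \<and> mw t \<le> Mm) \<and>
     (AE x in lborel. \<bar>mass_density f0 x - \<rho> 0 x\<bar> \<le> \<tau>)"

lemma \<rho>_slice_cont: "continuous_on UNIV (\<rho> t)" and u_slice_cont: "continuous_on UNIV (u t)"
  using continuous_on_compose2[OF \<rho>_cont, of UNIV "\<lambda>x. (t, x)"] continuous_on_compose2[OF u_cont, of UNIV "\<lambda>x. (t, x)"]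
  by (simp_all add: continuous_on_Pair continuous_on_const continuous_on_id)

text \<open>Both equations are tested with \<open>test\<close>. For Euler the pairing is constant in
  time; for the kinetic equation the derivative along \<open>(1, v)\<close> reduces to the one along
  \<open>(0, v - u)\<close>, whose integral is controlled by \<open>A\<close>. A test function of
  position alone does not see the acceleration \<open>W\<close> with its factor
  \<open>1 / \<epsilon>\<close>.\<close>

lemma near_transport:
  assumes near: "near \<tau> Mm" and D1: "\<And>x. (\<phi> has_derivative D1 x) (at x)" and D1c: "\<And>e. continuous_on UNIV (\<lambda>x. D1 x e)"
    and supp: "\<And>x. norm x > R \<Longrightarrow> \<phi> x = 0" and D1B: "\<And>x h. \<bar>D1 x h\<bar> \<le> B * norm h" and B: "\<And>x. \<bar>\<phi> x\<bar> \<le> B"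
    and t: "t \<in> {0..T}"
  shows "\<bar>(LINT z|lborel. F t z * \<phi> (fst z)) - (LINT x|lborel. \<rho> t x * \<phi> x)\<bar> \<le> slip R B * \<tau>"
proof -
  let ?\<psi> = "test \<phi> t" and ?D = "Dtest D1 t"
  let ?R = "R + reach * M"
  note a = D1 D1c supp D1B t
  \<comment> \<open>Beyond radius \<open>?R\<close> the derivative of the transported test function
    vanishes, within it \<open>wt \<ge> wl ?R\<close>; hence the division.\<close>
  define K where "K = B * (1 + reach * L) / wl ?R"
  have B0: "B \<ge> 0" using order_trans[OF abs_ge_zero B] .
  have K0: "K \<ge> 0" using B0 L0 reach_nonneg wl_pos[of ?R] by (simp add: K_def)
  have \<tau>: "\<tau> \<ge> 0" "\<And>s. s \<in> {0..T} \<Longrightarrow> A s \<le> \<tau>" and ini: "AE x in lborel. \<bar>mass_density f0 x - \<rho> 0 x\<bar> \<le> \<tau>"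
    using near by (auto simp: near_def)
  define D where "D p h = ?D (fst p, fst (snd p)) (fst h, fst (snd h))" for p h :: "real \<times> (real^'d) \<times> (real^'d)"
  have bt: "\<bar>?\<psi> s x\<bar> \<le> B" for s x by (simp add: test_def B)
  have db: "\<bar>D (s, z) (1, snd z, W s z)\<bar> \<le> K * (wt (fst z) * norm (snd z - u s (fst z)))" if s: "s \<in> {0..T}" for s z
  proof -
    have lin: "linear (?D (s, fst z))" by (rule Dtest_linear[OF a])
    have tr: "?D (s, fst z) (1, u s (fst z)) = 0" by (rule Dtest_transport[OF a s])
    have sp: "\<bar>?D (s, fst z) (0, snd z - u s (fst z))\<bar> \<le> B * (1 + reach * L) * norm (snd z - u s (fst z))"
      by (rule Dtest_space[OF a s])
    have "D (s, z) (1, snd z, W s z) = ?D (s, fst z) ((1, u s (fst z)) + (0, snd z - u s (fst z)))" by (simp add: D_def)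
    also have "\<dots> = ?D (s, fst z) (0, snd z - u s (fst z))"
      using linear_add[OF lin, of "(1, u s (fst z))" "(0, snd z - u s (fst z))"] tr by simp
    finally have e: "D (s, z) (1, snd z, W s z) = ?D (s, fst z) (0, snd z - u s (fst z))" .
    show ?thesis
    proof (cases "norm (fst z) > ?R")
      case True
      then show ?thesis unfolding e using Dtest_supp[OF a s True] K0 wt_pos[of "fst z"] by simp
    next
      case False
      then have "wl ?R \<le> wt (fst z)" by (intro wt_ge) simp
      have "B * (1 + reach * L) \<le> K * wt (fst z)"
        using mult_left_mono[OF \<open>wl ?R \<le> wt (fst z)\<close> K0] wl_pos[of ?R] by (simp add: K_def)
      then have "B * (1 + reach * L) * norm (snd z - u s (fst z)) \<le> K * wt (fst z) * norm (snd z - u s (fst z))" by (intro mult_right_mono) auto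
      then show ?thesis unfolding e using sp by (simp add: mult.assoc)
    qed
  qed
  define C where "C = B + K * (1 + M)"
  have C: "B \<le> C" "K * (1 + M) \<le> C" using B0 K0 M0 by (simp_all add: C_def)
  have bD: "\<bar>D (s, z) (1, snd z, W s z)\<bar> \<le> C * q s z" if s: "s \<in> {0..T}" for s z
  proof -
    have "\<bar>D (s, z) (1, snd z, W s z)\<bar> \<le> K * ((1 + M) * q s z)"
      using db[OF s, of z] mult_left_mono[OF order_trans[OF abs_ge_self wt_dev_le_q] K0, of z s] by linarith
    also have "\<dots> \<le> C * q s z" using C(2) q_ge_1[of s z] mult_right_mono[of "K * (1 + M)" C "q s z"] by (simp add: mult.assoc)
    finally show ?thesis .
  qed
  have m: "continuous_on UNIV (\<lambda>p::real \<times> (real^'d) \<times> (real^'d). (fst p, fst (snd p)))"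
    by (intro continuous_on_Pair continuous_on_fst continuous_on_snd continuous_on_id)
  have lD: "linear (D p)" for p
  proof -
    have "linear (\<lambda>h::real \<times> (real^'d) \<times> (real^'d). (fst h, fst (snd h)))" by (rule linearI) simp_all
    from linear_compose[OF this Dtest_linear[OF a]] show ?thesis unfolding D_def o_def .
  qed
  have cD: "continuous_on UNIV (\<lambda>p. D p h)" for h
    unfolding D_def by (rule continuous_on_compose2[OF Dtest_cont[OF a] m subset_UNIV])
  have "\<bar>(LINT z|lborel. F t z * ?\<psi> t (fst z)) - (LINT z|lborel. F 0 z * ?\<psi> 0 (fst z))\<bar> \<le> K * T * \<tau>"
  proof -
    have id: "(LINT z|lborel. F t z * ?\<psi> t (fst z)) - (LINT z|lborel. F 0 z * ?\<psi> 0 (fst z))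
        = (LINT s:{0..t}|lborel. LINT z|lborel. F s z * D (s, z) (1, snd z, W s z))"
    proof (rule weak_general[where \<Psi> = "\<lambda>t z. ?\<psi> t (fst z)" and D = D and C = C, OF _ lD cD _ _ bD t])
      show "((\<lambda>(t', z). ?\<psi> t' (fst z)) has_derivative D (s, z)) (at (s, z) within {0..T} \<times> UNIV)" if s: "s \<in> {0..T}" for s z
      proof -
        let ?S = "{0..T} \<times> (UNIV :: ((real^'d) \<times> (real^'d)) set)"
        have mm: "((\<lambda>p::real \<times> (real^'d) \<times> (real^'d). (fst p, fst (snd p))) has_derivative (\<lambda>h. (fst h, fst (snd h)))) (at (s, z) within ?S)"
          by (intro has_derivative_Pair has_derivative_fst has_derivative_snd has_derivative_ident)
        have "((\<lambda>(t', x). ?\<psi> t' x) has_derivative ?D (s, fst z)) (at (s, fst z) within (\<lambda>p. (fst p, fst (snd p))) ` ?S)"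
          by (rule has_derivative_subset[OF test_deriv[OF a s]]) auto
        from has_derivative_in_compose[OF mm] this
        have "((\<lambda>p. ?\<psi> (fst p) (fst (snd p))) has_derivative (\<lambda>h. ?D (s, fst z) (fst h, fst (snd h)))) (at (s, z) within ?S)"
          by fastforce
        then show ?thesis by (simp add: D_def[abs_def] case_prod_beta')
      qed
      show "continuous_on UNIV (\<lambda>(t', z::(real^'d) \<times> (real^'d)). ?\<psi> t' (fst z))"
        using continuous_on_compose2[OF test_cont[OF a] m subset_UNIV] by (simp add: case_prod_beta')
      show "\<bar>?\<psi> s (fst z)\<bar> \<le> C * (1 + norm (snd z))" for s and z :: "(real^'d) \<times> (real^'d)"
        using bt[of s "fst z"] C(1) B0 mult_mono[of B C 1 "1 + norm (snd z)"] by simp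
    qed
    have mD: "(\<lambda>p. D (fst p, snd p) (1, snd (snd p), W (fst p) (snd p))) \<in> borel_measurable (borel \<Otimes>\<^sub>M (borel \<Otimes>\<^sub>M borel))"
      using generator_measurable[OF lD cD] by (simp add: borel_prod)
    have tT: "s \<in> {0..T}" if "s \<in> {0..t}" for s using that t by auto
    have i1: "set_integrable lborel {0..t} (\<lambda>s. LINT z|lborel. F s z * D (s, z) (1, snd z, W s z))"
      by (rule FG_set_integrable[OF mD bD[OF tT]]) (auto simp: emeasure_lborel_Icc_eq)
    have le: "\<bar>LINT z|lborel. F s z * D (s, z) (1, snd z, W s z)\<bar> \<le> K * \<tau>" if s: "s \<in> {0..T}" for s
    proof -
      have iD: "integrable lborel (\<lambda>z. F s z * D (s, z) (1, snd z, W s z))"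
        by (rule FG_integrable[OF mD bD _ _ s]) (auto simp: emeasure_lborel_Icc_eq)
      have "\<bar>LINT z|lborel. F s z * D (s, z) (1, snd z, W s z)\<bar> \<le> (LINT z|lborel. K * (F s z * (wt (fst z) * norm (snd z - u s (fst z)))))"
      proof (rule order_trans[OF integral_abs_bound], rule integral_mono)
        show "integrable lborel (\<lambda>z. \<bar>F s z * D (s, z) (1, snd z, W s z)\<bar>)" by (rule integrable_abs[OF iD])
        show "integrable lborel (\<lambda>z. K * (F s z * (wt (fst z) * norm (snd z - u s (fst z)))))"
          by (intro integrable_mult_right slice_integral(1)[OF meas_dev(2) wt_dev_le_q])
        show "\<bar>F s z * D (s, z) (1, snd z, W s z)\<bar> \<le> K * (F s z * (wt (fst z) * norm (snd z - u s (fst z))))" for z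
          using mult_left_mono[OF db[OF s, of z] F_nonneg[of s z]] F_nonneg[of s z] by (simp add: abs_mult mult_ac)
      qed
      also have "\<dots> = K * A s" by (simp add: A_def)
      also have "\<dots> \<le> K * \<tau>" by (rule mult_left_mono[OF \<tau>(2)[OF s] K0])
      finally show ?thesis .
    qed
    have "\<bar>LINT s:{0..t}|lborel. LINT z|lborel. F s z * D (s, z) (1, snd z, W s z)\<bar> \<le> (LINT s|lborel. K * \<tau> * indicator {0..t} s)"
      unfolding set_lebesgue_integral_def
    proof (rule order_trans[OF integral_abs_bound], rule integral_mono)
      show "integrable lborel (\<lambda>s. \<bar>indicator {0..t} s *\<^sub>R (LINT z|lborel. F s z * D (s, z) (1, snd z, W s z))\<bar>)"
        using i1 unfolding set_integrable_def by (rule integrable_abs)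
      show "integrable lborel (\<lambda>s. K * \<tau> * indicator {0..t} s)"
        by (intro integrable_mult_right integrable_real_indicator) (auto simp: emeasure_lborel_Icc_eq)
      show "\<bar>indicator {0..t} s *\<^sub>R (LINT z|lborel. F s z * D (s, z) (1, snd z, W s z))\<bar> \<le> K * \<tau> * indicator {0..t} s" for s
        using le[OF tT, of s] by (cases "s \<in> {0..t}") auto
    qed
    also have "\<dots> = K * \<tau> * t" using t by simp
    also have "\<dots> \<le> K * \<tau> * T" using t K0 \<tau>(1) by (intro mult_left_mono) auto
    finally show ?thesis unfolding id by (simp add: mult_ac)
  qed
  \<comment> \<open>At the target time nothing is left to travel, so \<open>test\<close> is
    \<open>\<phi>\<close> itself.\<close>
  moreover have "?\<psi> t (fst z) = \<phi> (fst z)" for z :: "(real^'d) \<times> (real^'d)" by (simp add: test_def travel_0)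
  ultimately have 1: "\<bar>(LINT z|lborel. F t z * \<phi> (fst z)) - (LINT z|lborel. F 0 z * ?\<psi> 0 (fst z))\<bar> \<le> K * T * \<tau>" by simp
  have "?\<psi> t x = \<phi> x" for x by (simp add: test_def travel_0)
  then have 2: "(LINT x|lborel. \<rho> t x * \<phi> x) = (LINT x|lborel. \<rho> 0 x * ?\<psi> 0 x)"
    using test_conserved[OF a t] by simp
  have c0: "continuous_on UNIV (?\<psi> 0)"
  proof -
    have "continuous_on UNIV (\<lambda>x::real^'d. (0::real, x))" by (intro continuous_intros)
    from continuous_on_compose2[OF test_cont[OF a] this subset_UNIV] show ?thesis by simp
  qed
  have m0[measurable]: "?\<psi> 0 \<in> borel_measurable borel" by (rule borel_measurable_continuous_onI[OF c0])
  have z0: "0 \<in> {0..T}" using t by auto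
  have 3: "(LINT z|lborel. F 0 z * ?\<psi> 0 (fst z)) = (LINT x|lborel. mass_density f0 x * ?\<psi> 0 x)"
  proof -
    have tm: "(\<lambda>z::(real^'d) \<times> (real^'d). ?\<psi> 0 (fst z)) \<in> borel_measurable lborel"
      using borel_measurable_continuous_onI[OF continuous_on_compose2[OF c0 continuous_on_fst[OF continuous_on_id] subset_UNIV]] by simp
    have "(LINT z|lborel. F 0 z * ?\<psi> 0 (fst z)) = (LINT z|lborel. f0 z * ?\<psi> 0 (fst z))"
    proof (rule integral_cong_AE[OF borel_measurable_times[OF borel_measurable_integrable[OF F_integrable] tm]
          borel_measurable_times[OF borel_measurable_integrable[OF phase_density.integrable[OF phase0]] tm]])
      show "AE z in lborel. F 0 z * ?\<psi> 0 (fst z) = f0 z * ?\<psi> 0 (fst z)"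
        using init by eventually_elim (simp add: F_eq)
    qed
    then show ?thesis using phase_density.integral_bounded_weight[OF phase0 m0 bt] by simp
  qed
  have i0: "integrable lborel (\<lambda>x. mass_density f0 x * ?\<psi> 0 x)" by (rule phase_density.integrable_bounded_weight[OF phase0 m0 bt])
  have i\<rho>: "integrable lborel (\<lambda>x. \<rho> 0 x * ?\<psi> 0 x)"
    by (rule integrable_compact_support[OF continuous_on_mult[OF \<rho>_slice_cont c0], of ?R]) (simp add: test_supp[OF a z0])
  have "\<bar>(LINT x|lborel. mass_density f0 x * ?\<psi> 0 x) - (LINT x|lborel. \<rho> 0 x * ?\<psi> 0 x)\<bar>
      = \<bar>LINT x|lborel. mass_density f0 x * ?\<psi> 0 x - \<rho> 0 x * ?\<psi> 0 x\<bar>"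
    using i0 i\<rho> by simp
  also have "\<dots> \<le> (LINT x|lborel. \<bar>mass_density f0 x * ?\<psi> 0 x - \<rho> 0 x * ?\<psi> 0 x\<bar>)" by (rule integral_abs_bound)
  also have "\<dots> \<le> (LINT x|lborel. \<tau> * B * indicator (cball (0::real^'d) ?R) x)"
  proof (rule integral_mono_AE)
    show "integrable lborel (\<lambda>x. \<bar>mass_density f0 x * ?\<psi> 0 x - \<rho> 0 x * ?\<psi> 0 x\<bar>)"
      by (intro integrable_abs Bochner_Integration.integrable_diff i0 i\<rho>)
    show "integrable lborel (\<lambda>x::real^'d. \<tau> * B * indicator (cball (0::real^'d) ?R) x)"
      by (intro integrable_mult_right integrable_real_indicator) (simp, rule emeasure_bounded_finite[OF bounded_cball])
    show "AE x in lborel. \<bar>mass_density f0 x * ?\<psi> 0 x - \<rho> 0 x * ?\<psi> 0 x\<bar> \<le> \<tau> * B * indicator (cball (0::real^'d) ?R) x"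
      using ini
    proof eventually_elim
      case (elim x)
      show ?case
      proof (cases "norm x > ?R")
        case True
        then show ?thesis using test_supp[OF a z0 True] by (simp add: indicator_def)
      next
        case False
        have "\<bar>mass_density f0 x - \<rho> 0 x\<bar> * \<bar>?\<psi> 0 x\<bar> \<le> \<tau> * B" using elim bt[of 0 x] \<tau>(1) by (intro mult_mono) auto
        then show ?thesis using False by (simp add: left_diff_distrib[symmetric] abs_mult)
      qed
    qed
  qed
  also have "\<dots> = \<tau> * B * measure lborel (cball (0::real^'d) ?R)" by simp
  finally have 4: "\<bar>(LINT x|lborel. mass_density f0 x * ?\<psi> 0 x) - (LINT x|lborel. \<rho> 0 x * ?\<psi> 0 x)\<bar> \<le> \<tau> * B * measure lborel (cball (0::real^'d) ?R)" .
  have "slip R B * \<tau> = K * T * \<tau> + \<tau> * B * measure lborel (cball (0::real^'d) ?R)"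
    by (simp add: slip_def K_def algebra_simps)
  then show ?thesis using 1 4 unfolding 2 3 by linarith
qed

end

section \<open>Weak limits\<close>

lemma set_integrable_slab:
  fixes h :: "real \<times> 'a::euclidean_space \<Rightarrow> real"
  assumes c: "continuous_on UNIV h" and z: "\<And>t x. norm x > R \<Longrightarrow> h (t, x) = 0"
  shows "set_integrable lborel ({0..T} \<times> UNIV) h"
proof -
  have "integrable lborel (\<lambda>p. indicator ({0..T} \<times> cball 0 R) p *\<^sub>R h p)"
    by (rule borel_integrable_compact) (auto intro!: compact_Times continuous_on_subset[OF c])
  moreover have "(\<lambda>p. indicator ({0..T} \<times> cball 0 R) p *\<^sub>R h p) = (\<lambda>p. indicator ({0..T} \<times> UNIV) p *\<^sub>R h p)"
  proof
    fix p show "indicator ({0..T} \<times> cball 0 R) p *\<^sub>R h p = indicator ({0..T} \<times> UNIV) p *\<^sub>R h p"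
      using z[of "snd p" "fst p"] by (cases p) (auto simp: indicator_def)
  qed
  ultimately show ?thesis by (simp only: set_integrable_def)
qed

context relative
begin

text \<open>Replaces the C^1 function by a continuous one. The error is measured against the
  weighted mass, since \<open>e\<close> times the total mass would not be uniformly small.\<close>

lemma near_continuous:
  assumes near: "near \<tau> Mm" and c\<Phi>: "continuous_on UNIV \<Phi>" and s\<Phi>: "\<And>x. norm x > R \<Longrightarrow> \<Phi> x = 0"
    and D1: "\<And>x. (\<psi> has_derivative D1 x) (at x)" and D1c: "\<And>e. continuous_on UNIV (\<lambda>x. D1 x e)"
    and supp: "\<And>x. norm x > R \<Longrightarrow> \<psi> x = 0" and D1B: "\<And>x h. \<bar>D1 x h\<bar> \<le> B * norm h" and B: "\<And>x. \<bar>\<psi> x\<bar> \<le> B"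
    and e: "\<And>x. \<bar>\<Phi> x - \<psi> x\<bar> \<le> e" and Rr: "\<And>x. norm x \<le> R \<Longrightarrow> \<bar>\<rho> t x\<bar> \<le> Rr" and t: "t \<in> {0..T}"
  shows "\<bar>(LINT x|lborel. mass_density (F t) x * \<Phi> x) - (LINT x|lborel. \<rho> t x * \<Phi> x)\<bar>
    \<le> slip R B * \<tau> + e * (Mm / wl R + Rr * measure lborel (cball (0::real^'d) R))"
proof -
  have e0: "e \<ge> 0" using order_trans[OF abs_ge_zero e] .
  have c\<psi>: "continuous_on UNIV \<psi>" by (rule has_derivative_continuous_on[OF has_derivative_at_withinI[OF D1]])
  have b\<Phi>: "\<bar>\<Phi> x\<bar> \<le> e + B" for x using e[of x] B[of x] by linarith
  have cf: "continuous_on UNIV (\<lambda>z::(real^'d) \<times> (real^'d). \<Phi> (fst z))" "continuous_on UNIV (\<lambda>z::(real^'d) \<times> (real^'d). \<psi> (fst z))"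
    by (rule continuous_on_compose2[OF c\<Phi> continuous_on_fst[OF continuous_on_id] subset_UNIV])
      (rule continuous_on_compose2[OF c\<psi> continuous_on_fst[OF continuous_on_id] subset_UNIV])
  have i1: "integrable lborel (\<lambda>z. F t z * \<Phi> (fst z))" by (rule integrable_F_bounded[OF cf(1) b\<Phi>])
  have i2: "integrable lborel (\<lambda>z. F t z * \<psi> (fst z))" by (rule integrable_F_bounded[OF cf(2) B])
  have mt: "mw t \<le> Mm" using near t by (simp add: near_def)
  have 1: "(LINT x|lborel. mass_density (F t) x * \<Phi> x) = (LINT z|lborel. F t z * \<Phi> (fst z))"
    by (rule ph.integral_bounded_weight[OF borel_measurable_continuous_onI[OF c\<Phi>] b\<Phi>])
  have "\<bar>(LINT z|lborel. F t z * \<Phi> (fst z)) - (LINT z|lborel. F t z * \<psi> (fst z))\<bar> = \<bar>LINT z|lborel. F t z * \<Phi> (fst z) - F t z * \<psi> (fst z)\<bar>"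
    by (simp only: Bochner_Integration.integral_diff[OF i1 i2])
  also have "\<dots> \<le> (LINT z|lborel. e / wl R * (F t z * wt (fst z)))"
  proof (rule order_trans[OF integral_abs_bound], rule integral_mono)
    show "integrable lborel (\<lambda>z. \<bar>F t z * \<Phi> (fst z) - F t z * \<psi> (fst z)\<bar>)"
      by (intro integrable_abs Bochner_Integration.integrable_diff i1 i2)
    show "integrable lborel (\<lambda>z. e / wl R * (F t z * wt (fst z)))" by (intro integrable_mult_right integrable_F_wt)
    fix z :: "(real^'d) \<times> (real^'d)"
    have "\<bar>\<Phi> (fst z) - \<psi> (fst z)\<bar> \<le> e / wl R * wt (fst z)"
    proof (cases "norm (fst z) > R")
      case True
      then show ?thesis using s\<Phi>[OF True] supp[OF True] e0 wl_pos[of R] wt_pos[of "fst z"] by simp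
    next
      case False
      then have "e / wl R * wl R \<le> e / wl R * wt (fst z)" using e0 wl_pos[of R] by (intro mult_left_mono wt_ge) auto
      then show ?thesis using e[of "fst z"] wl_pos[of R] by simp
    qed
    note le = mult_left_mono[OF this F_nonneg[of t z]]
    have ab: "\<bar>F t z * \<Phi> (fst z) - F t z * \<psi> (fst z)\<bar> = F t z * \<bar>\<Phi> (fst z) - \<psi> (fst z)\<bar>"
      using F_nonneg[of t z] by (simp add: right_diff_distrib[symmetric] abs_mult)
    show "\<bar>F t z * \<Phi> (fst z) - F t z * \<psi> (fst z)\<bar> \<le> e / wl R * (F t z * wt (fst z))"
      unfolding ab using le by (simp only: mult_ac)
  qed
  also have "\<dots> = e / wl R * mw t" by (simp add: mw_def)
  also have "\<dots> \<le> e / wl R * Mm" using e0 wl_pos[of R] by (intro mult_left_mono mt) auto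
  finally have 2: "\<bar>(LINT z|lborel. F t z * \<Phi> (fst z)) - (LINT z|lborel. F t z * \<psi> (fst z))\<bar> \<le> e / wl R * Mm" .
  have j1: "integrable lborel (\<lambda>x. \<rho> t x * \<Phi> x)"
    by (rule integrable_compact_support[OF continuous_on_mult[OF \<rho>_slice_cont c\<Phi>], of R]) (simp add: s\<Phi>)
  have j2: "integrable lborel (\<lambda>x. \<rho> t x * \<psi> x)"
    by (rule integrable_compact_support[OF continuous_on_mult[OF \<rho>_slice_cont c\<psi>], of R]) (simp add: supp)
  have "\<bar>(LINT x|lborel. \<rho> t x * \<Phi> x) - (LINT x|lborel. \<rho> t x * \<psi> x)\<bar> = \<bar>LINT x|lborel. \<rho> t x * \<Phi> x - \<rho> t x * \<psi> x\<bar>"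
    by (simp only: Bochner_Integration.integral_diff[OF j1 j2])
  also have "\<dots> \<le> (LINT x|lborel. Rr * e * indicator (cball (0::real^'d) R) x)"
  proof (rule order_trans[OF integral_abs_bound], rule integral_mono)
    show "integrable lborel (\<lambda>x. \<bar>\<rho> t x * \<Phi> x - \<rho> t x * \<psi> x\<bar>)"
      by (intro integrable_abs Bochner_Integration.integrable_diff j1 j2)
    show "integrable lborel (\<lambda>x::real^'d. Rr * e * indicator (cball (0::real^'d) R) x)"
      by (intro integrable_mult_right integrable_real_indicator) (simp, rule emeasure_bounded_finite[OF bounded_cball])
    fix x
    show "\<bar>\<rho> t x * \<Phi> x - \<rho> t x * \<psi> x\<bar> \<le> Rr * e * indicator (cball (0::real^'d) R) x"
    proof (cases "norm x > R")
      case True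
      then show ?thesis using s\<Phi>[OF True] supp[OF True] by (simp add: indicator_def)
    next
      case False
      then have "\<bar>\<rho> t x\<bar> \<le> Rr" by (intro Rr) simp
      then have "\<bar>\<rho> t x\<bar> * \<bar>\<Phi> x - \<psi> x\<bar> \<le> Rr * e" using e[of x] by (intro mult_mono) auto
      then show ?thesis using False by (simp add: right_diff_distrib[symmetric] abs_mult)
    qed
  qed
  also have "\<dots> = Rr * e * measure lborel (cball (0::real^'d) R)" by simp
  finally have 3: "\<bar>(LINT x|lborel. \<rho> t x * \<Phi> x) - (LINT x|lborel. \<rho> t x * \<psi> x)\<bar> \<le> Rr * e * measure lborel (cball (0::real^'d) R)" .
  have "e * (Mm / wl R + Rr * measure lborel (cball (0::real^'d) R)) = e / wl R * Mm + Rr * e * measure lborel (cball (0::real^'d) R)"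
    by (simp add: distrib_left mult_ac)
  moreover have "\<bar>(LINT z|lborel. F t z * \<psi> (fst z)) - (LINT x|lborel. \<rho> t x * \<psi> x)\<bar> \<le> slip R B * \<tau>"
    by (rule near_transport[OF near D1 D1c supp D1B B t])
  ultimately show ?thesis using 2 3 unfolding 1 by linarith
qed

lemma integrable_b1: "integrable lborel (b1 t)" and integral_b1: "(LINT x|lborel. b1 t x) \<le> (1 + M) * Q"
  and integrable_b2: "integrable lborel (b2 t)" and integral_b2: "(LINT x|lborel. b2 t x) = H t"
  and integrable_wt_b1: "integrable lborel (\<lambda>x. wt x * b1 t x)" and integral_wt_b1: "(LINT x|lborel. wt x * b1 t x) = A t"
proof -
  have n: "\<bar>norm (snd z - u t (fst z))\<bar> \<le> (1 + M) * q t z" for z using dev_le_q[of z t] by simp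
  note s1 = slice_integral[where t = t, OF meas_dev(1) n] and s2 = slice_integral[where t = t, OF meas_dev(3) sq_bound]
    and s3 = slice_integral[where t = t, OF meas_dev(2) wt_dev_le_q]
  show "integrable lborel (b1 t)" using s1(2) by (simp add: b1_def[abs_def])
  show "(LINT x|lborel. b1 t x) \<le> (1 + M) * Q" using s1(3,4) by (simp add: b1_def)
  show "integrable lborel (b2 t)" using s2(2) by (simp add: b2_def[abs_def] sq_def)
  show "(LINT x|lborel. b2 t x) = H t" using s2(3) by (simp add: b2_def sq_def H_def)
  have w: "(LINT v|lborel. F t (x, v) * (wt (fst (x, v)) * norm (snd (x, v) - u t (fst (x, v))))) = wt x * b1 t x" for x
    by (simp add: b1_def mult.left_commute[of _ "wt x"])
  show "integrable lborel (\<lambda>x. wt x * b1 t x)" using s3(2) unfolding w .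
  show "(LINT x|lborel. wt x * b1 t x) = A t" using s3(3) unfolding w by (simp add: A_def)
qed

lemma b_nonneg: "b1 t x \<ge> 0" "b2 t x \<ge> 0"
  unfolding b1_def b2_def by (auto intro!: Bochner_Integration.integral_nonneg simp: F_nonneg)

section \<open>A general macroscopic moment \<open>X\<close> close to the density times
  \<open>g\<close>\<close>

context
  fixes X g :: "real \<Rightarrow> real^'d \<Rightarrow> real" and \<Gamma> Kg :: real
  assumes Xm: "(\<lambda>p. X (fst p) (snd p)) \<in> borel_measurable (borel \<Otimes>\<^sub>M borel)"
    and Xe: "\<And>t. t \<in> {0..T} \<Longrightarrow> AE x in lborel. \<bar>X t x - mass_density (F t) x * g t x\<bar> \<le> \<Gamma> * (b1 t x + b2 t x)"
    and gc: "continuous_on UNIV (\<lambda>p. g (fst p) (snd p))" and gK: "\<And>t x. \<bar>g t x\<bar> \<le> Kg" and \<Gamma>: "\<Gamma> \<ge> 0"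
begin

lemma X_slice_measurable: "X t \<in> borel_measurable borel"
  using measurable_Pair2[OF Xm, of t] by simp

lemma g_slice_cont: "continuous_on UNIV (g t)"
proof -
  have "continuous_on UNIV (\<lambda>x::real^'d. (t, x))" by (intro continuous_intros)
  from continuous_on_compose2[OF gc this subset_UNIV] show ?thesis by simp
qed

text \<open>The bound involves \<open>Q\<close> and need not be uniform in
  \<open>\<epsilon>\<close>; it serves to obtain joint integrability in time and space.\<close>

lemma X_slice:
  assumes t: "t \<in> {0..T}"
  shows "integrable lborel (X t)" "(LINT x|lborel. \<bar>X t x\<bar>) \<le> (Kg + \<Gamma> * ((1 + M) + (2 + 2 * M\<^sup>2))) * Q"
proof -
  let ?b = "\<lambda>x. Kg * mass_density (F t) x + \<Gamma> * (b1 t x + b2 t x)"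
  have K0: "Kg \<ge> 0" using order_trans[OF abs_ge_zero gK] .
  have bi: "integrable lborel ?b"
    by (intro Bochner_Integration.integrable_add integrable_mult_right ph.integrable_mass integrable_b1 integrable_b2)
  have le: "AE x in lborel. \<bar>X t x\<bar> \<le> ?b x"
    using Xe[OF t]
  proof eventually_elim
    case (elim x)
    have "\<bar>mass_density (F t) x * g t x\<bar> \<le> Kg * mass_density (F t) x"
      using mult_left_mono[OF gK[of t x] ph.mass_nonneg[of t x]] ph.mass_nonneg[of t x] by (simp add: abs_mult mult.commute)
    then show ?case using elim by linarith
  qed
  have b0: "?b x \<ge> 0" for x using K0 \<Gamma> b_nonneg[of t x] ph.mass_nonneg[of t x] by simp
  show i: "integrable lborel (X t)"
  proof (rule Bochner_Integration.integrable_bound[OF bi])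
    show "X t \<in> borel_measurable lborel" using X_slice_measurable by simp
    show "AE x in lborel. norm (X t x) \<le> norm (?b x)" using le b0 by (auto elim!: eventually_mono)
  qed
  have "(LINT x|lborel. \<bar>X t x\<bar>) \<le> (LINT x|lborel. ?b x)"
    by (rule integral_mono_AE[OF integrable_abs[OF i] bi le])
  also have "\<dots> = Kg * (LINT z|lborel. F t z) + \<Gamma> * ((LINT x|lborel. b1 t x) + H t)"
    using ph.integrable_mass[of t] integrable_b1[of t] integrable_b2[of t] by (simp add: ph.integral_mass integral_b2)
  also have "\<dots> \<le> Kg * Q + \<Gamma> * ((1 + M) * Q + (2 + 2 * M\<^sup>2) * Q)"
    using mass_F_le[of t] E0_nonneg integral_b1[of t] H_bound[of t] K0 \<Gamma>
    by (intro add_mono mult_left_mono) (auto simp: Q_def)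
  finally show "(LINT x|lborel. \<bar>X t x\<bar>) \<le> (Kg + \<Gamma> * ((1 + M) + (2 + 2 * M\<^sup>2))) * Q" by (simp add: algebra_simps)
qed

lemma X_set_integrable: "set_integrable lborel ({0..T} \<times> UNIV) (\<lambda>p. X (fst p) (snd p))"
proof -
  define C where "C = (Kg + \<Gamma> * ((1 + M) + (2 + 2 * M\<^sup>2))) * Q"
  have C0: "C \<ge> 0" using order_trans[OF _ X_slice(2)[of 0]] T_pos by (simp add: C_def)
  have e: "indicator ({0..T} \<times> UNIV) (t, x) *\<^sub>R X (fst (t, x)) (snd (t, x)) = indicator {0..T} t * X t x" for t x
    by (simp add: indicator_times)
  note Xm[measurable]
  have "integrable (lborel \<Otimes>\<^sub>M lborel) (\<lambda>p. indicator ({0..T} \<times> UNIV) p *\<^sub>R X (fst p) (snd p))"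
  proof (rule lborel_pair.Fubini_integrable)
    have [measurable]: "(\<lambda>p. X (fst p) (snd p)) \<in> borel_measurable (lborel \<Otimes>\<^sub>M lborel)" using Xm by simp
    have [measurable]: "{0..T} \<times> UNIV \<in> sets (lborel \<Otimes>\<^sub>M (lborel :: (real^'d) measure))" by (intro pair_measureI) auto
    show "(\<lambda>p. indicator ({0..T} \<times> UNIV) p *\<^sub>R X (fst p) (snd p)) \<in> borel_measurable (lborel \<Otimes>\<^sub>M lborel)" by measurable
    show "integrable lborel (\<lambda>t. LINT x|lborel. norm (indicator ({0..T} \<times> UNIV) (t, x) *\<^sub>R X (fst (t, x)) (snd (t, x))))"
      unfolding e
    proof (rule Bochner_Integration.integrable_bound[of _ "\<lambda>t. C * indicator {0..T} t"])
      show "integrable lborel (\<lambda>t. C * indicator {0..T} t)"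
        by (intro integrable_mult_right integrable_real_indicator) (auto simp: emeasure_lborel_Icc_eq)
      have "(\<lambda>t. LINT x|lborel. \<bar>indicator {0..T} (fst (t, x)) * X (fst (t, x)) (snd (t, x))\<bar>) \<in> borel_measurable lborel"
        by (rule lborel.borel_measurable_lebesgue_integral[of "\<lambda>t x. \<bar>indicator {0..T} (fst (t, x)) * X (fst (t, x)) (snd (t, x))\<bar>"])
          (simp add: case_prod_beta')
      then show "(\<lambda>t. LINT x|lborel. norm (indicator {0..T} t * X t x)) \<in> borel_measurable lborel" by simp
      show "AE t in lborel. norm (LINT x|lborel. norm (indicator {0..T} t * X t x)) \<le> norm (C * indicator {0..T} t)"
        using X_slice(2) C0 by (intro AE_I2) (auto simp: indicator_def C_def)
    qed
    show "AE t in lborel. integrable lborel (\<lambda>x. indicator ({0..T} \<times> UNIV) (t, x) *\<^sub>R X (fst (t, x)) (snd (t, x)))"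
      unfolding e using X_slice(1) by (intro AE_I2) (auto simp: indicator_def)
  qed
  then show ?thesis by (simp add: set_integrable_def lborel_prod)
qed

text \<open>Two comparisons at each time: \<open>X\<close> with mass times \<open>g\<close>, at the
  cost of \<open>A + H\<close> divided by \<open>wl R\<close>, and then mass times
  \<open>\<phi> * g\<close> with \<open>\<rho>\<close> times \<open>\<phi> * g\<close> by
  \<open>near_continuous\<close>. The product \<open>\<phi> * g\<close> is merely continuous;
  \<open>P\<close> supplies C^1 approximants whose bound \<open>B\<close> is common to all
  times.\<close>

lemma limit_estimate:
  assumes near: "near \<tau> Mm" and c\<phi>: "continuous_on UNIV \<phi>" and s\<phi>: "\<And>t x. norm x > R \<Longrightarrow> \<phi> (t, x) = 0"
    and K\<phi>: "\<And>p. \<bar>\<phi> p\<bar> \<le> K\<phi>"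
    and P: "\<And>t. t \<in> {0..T} \<Longrightarrow> \<exists>\<psi> D1. (\<forall>x. (\<psi> has_derivative D1 x) (at x)) \<and> (\<forall>h. continuous_on UNIV (\<lambda>x. D1 x h)) \<and>
      (\<forall>x. norm x > R \<longrightarrow> \<psi> x = 0) \<and> (\<forall>x. \<bar>\<psi> x\<bar> \<le> B) \<and> (\<forall>x h. \<bar>D1 x h\<bar> \<le> B * norm h) \<and> (\<forall>x. \<bar>\<phi> (t, x) * g t x - \<psi> x\<bar> \<le> e)"
    and Rr: "\<And>t x. t \<in> {0..T} \<Longrightarrow> norm x \<le> R \<Longrightarrow> \<bar>\<rho> t x\<bar> \<le> Rr"
  shows "\<bar>(LINT p:{0..T} \<times> UNIV|lborel. \<phi> p * X (fst p) (snd p)) - (LINT p:{0..T} \<times> UNIV|lborel. \<phi> p * (\<rho> (fst p) (snd p) * g (fst p) (snd p)))\<bar>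
    \<le> (K\<phi> * \<Gamma> / wl R * 2 * \<tau> + slip R B * \<tau> + e * (Mm / wl R + Rr * measure lborel (cball (0::real^'d) R))) * T"
proof (rule set_integral_product_close)
  have K0: "K\<phi> \<ge> 0" using order_trans[OF abs_ge_zero K\<phi>] .
  have m\<phi>: "\<phi> \<in> borel_measurable borel" by (rule borel_measurable_continuous_onI[OF c\<phi>])
  show "set_integrable lborel ({0..T} \<times> UNIV) (\<lambda>p. \<phi> p * X (fst p) (snd p))"
    unfolding set_integrable_def
  proof (rule Bochner_Integration.integrable_bound[OF integrable_mult_right[OF X_set_integrable[unfolded set_integrable_def], of K\<phi>]])
    have "(\<lambda>p. \<phi> p * (indicator ({0..T} \<times> UNIV) p *\<^sub>R X (fst p) (snd p))) \<in> borel_measurable lborel"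
      using m\<phi> borel_measurable_integrable[OF X_set_integrable[unfolded set_integrable_def]] by (intro borel_measurable_times) simp_all
    then show "(\<lambda>p. indicator ({0..T} \<times> UNIV) p *\<^sub>R (\<phi> p * X (fst p) (snd p))) \<in> borel_measurable lborel"
      by (simp add: mult.left_commute)
    show "AE p in lborel. norm (indicator ({0..T} \<times> UNIV) p *\<^sub>R (\<phi> p * X (fst p) (snd p))) \<le> norm (K\<phi> * (indicator ({0..T} \<times> UNIV) p *\<^sub>R X (fst p) (snd p)))"
      using K\<phi> K0 by (intro AE_I2) (auto simp: abs_mult indicator_def intro!: mult_right_mono)
  qed
  have rc: "continuous_on UNIV (\<lambda>p. \<rho> (fst p) (snd p))" using \<rho>_cont by (simp add: case_prod_beta')
  show "set_integrable lborel ({0..T} \<times> UNIV) (\<lambda>p. \<phi> p * (\<rho> (fst p) (snd p) * g (fst p) (snd p)))"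
    by (rule set_integrable_slab[OF continuous_on_mult[OF c\<phi> continuous_on_mult[OF rc gc]], of R]) (simp add: s\<phi>)
  show "T \<ge> 0" using T_pos by simp
  fix t assume t: "t \<in> {0..T}"
  define \<Phi> where "\<Phi> x = \<phi> (t, x) * g t x" for x
  have c\<phi>t: "continuous_on UNIV (\<lambda>x. \<phi> (t, x))"
  proof -
    have "continuous_on UNIV (\<lambda>x::real^'d. (t, x))" by (intro continuous_intros)
    from continuous_on_compose2[OF c\<phi> this subset_UNIV] show ?thesis .
  qed
  have c\<Phi>: "continuous_on UNIV \<Phi>" unfolding \<Phi>_def by (rule continuous_on_mult[OF c\<phi>t g_slice_cont])
  obtain \<psi> D1 where \<psi>: "\<And>x. (\<psi> has_derivative D1 x) (at x)" "\<And>h. continuous_on UNIV (\<lambda>x. D1 x h)"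
      "\<And>x. norm x > R \<Longrightarrow> \<psi> x = 0" "\<And>x h. \<bar>D1 x h\<bar> \<le> B * norm h" "\<And>x. \<bar>\<psi> x\<bar> \<le> B" "\<And>x. \<bar>\<Phi> x - \<psi> x\<bar> \<le> e"
    using P[OF t] unfolding \<Phi>_def by blast
  have s\<Phi>: "\<Phi> x = 0" if "norm x > R" for x using s\<phi>[OF that] by (simp add: \<Phi>_def)
  have 1: "\<bar>(LINT x|lborel. mass_density (F t) x * \<Phi> x) - (LINT x|lborel. \<rho> t x * \<Phi> x)\<bar>
    \<le> slip R B * \<tau> + e * (Mm / wl R + Rr * measure lborel (cball (0::real^'d) R))"
    by (rule near_continuous[OF near c\<Phi> s\<Phi> \<psi> Rr[OF t] t])
  have b\<Phi>: "\<bar>\<Phi> x\<bar> \<le> e + B" for x using \<psi>(5,6)[of x] by linarith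
  have i1: "integrable lborel (\<lambda>x. mass_density (F t) x * \<Phi> x)"
    by (rule ph.integrable_bounded_weight[OF borel_measurable_continuous_onI[OF c\<Phi>] b\<Phi>])
  have i2: "integrable lborel (\<lambda>x. \<phi> (t, x) * X t x)"
  proof (rule Bochner_Integration.integrable_bound[OF integrable_mult_right[OF X_slice(1)[OF t], of K\<phi>]])
    show "(\<lambda>x. \<phi> (t, x) * X t x) \<in> borel_measurable lborel"
      using borel_measurable_continuous_onI[OF c\<phi>t] X_slice_measurable[of t] by (intro borel_measurable_times) simp_all
    show "AE x in lborel. norm (\<phi> (t, x) * X t x) \<le> norm (K\<phi> * X t x)"
      using K\<phi> K0 by (intro AE_I2) (auto simp: abs_mult intro!: mult_right_mono)
  qed
  define G where "G = K\<phi> * \<Gamma> / wl R"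
  have G0: "G \<ge> 0" using K0 \<Gamma> wl_pos[of R] by (simp add: G_def)
  have "\<bar>(LINT x|lborel. \<phi> (t, x) * X t x) - (LINT x|lborel. mass_density (F t) x * \<Phi> x)\<bar> = \<bar>LINT x|lborel. \<phi> (t, x) * X t x - mass_density (F t) x * \<Phi> x\<bar>"
    by (simp only: Bochner_Integration.integral_diff[OF i2 i1])
  also have "\<dots> \<le> (LINT x|lborel. \<bar>\<phi> (t, x) * X t x - mass_density (F t) x * \<Phi> x\<bar>)" by (rule integral_abs_bound)
  \<comment> \<open>Only \<open>b1\<close> carries the weight: weighted, it integrates to
    \<open>A\<close>, whereas \<open>b2\<close> integrates to \<open>H\<close>, small without a
    weight.\<close>
  also have "\<dots> \<le> (LINT x|lborel. G * (wt x * b1 t x + b2 t x))"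
  proof (rule integral_mono_AE)
    show "integrable lborel (\<lambda>x. \<bar>\<phi> (t, x) * X t x - mass_density (F t) x * \<Phi> x\<bar>)"
      by (intro integrable_abs Bochner_Integration.integrable_diff i1 i2)
    show "integrable lborel (\<lambda>x. G * (wt x * b1 t x + b2 t x))"
      by (intro Bochner_Integration.integrable_add integrable_mult_right integrable_wt_b1 integrable_b2)
    show "AE x in lborel. \<bar>\<phi> (t, x) * X t x - mass_density (F t) x * \<Phi> x\<bar> \<le> G * (wt x * b1 t x + b2 t x)"
      using Xe[OF t]
    proof eventually_elim
      case (elim x)
      have n: "wt x * b1 t x + b2 t x \<ge> 0" using b_nonneg[of t x] wt_pos[of x] by simp
      have eq: "\<phi> (t, x) * X t x - mass_density (F t) x * \<Phi> x = \<phi> (t, x) * (X t x - mass_density (F t) x * g t x)"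
        by (simp add: \<Phi>_def algebra_simps)
      show ?case
      proof (cases "norm x > R")
        case True
        then show ?thesis unfolding eq using s\<phi>[OF True] mult_nonneg_nonneg[OF G0 n] by simp
      next
        case False
        then have w: "wl R \<le> wt x" by (intro wt_ge) simp
        have "wl R * (b1 t x + b2 t x) \<le> wt x * b1 t x + b2 t x"
          using mult_right_mono[OF w b_nonneg(1)[of t x]] mult_right_mono[OF order_trans[OF w wt_le_1] b_nonneg(2)[of t x]]
          by (simp add: distrib_left)
        from mult_left_mono[OF this G0]
        have le: "K\<phi> * (\<Gamma> * (b1 t x + b2 t x)) \<le> G * (wt x * b1 t x + b2 t x)"
          using wl_pos[of R] by (simp add: G_def mult.assoc)
        have "\<bar>\<phi> (t, x)\<bar> * \<bar>X t x - mass_density (F t) x * g t x\<bar> \<le> K\<phi> * (\<Gamma> * (b1 t x + b2 t x))"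
          using elim K\<phi> K0 by (intro mult_mono) auto
        then show ?thesis unfolding eq abs_mult using le by linarith
      qed
    qed
  qed
  also have "\<dots> = G * (A t + H t)"
    using integrable_wt_b1[of t] integrable_b2[of t] by (simp add: integral_wt_b1 integral_b2)
  also have "\<dots> \<le> G * (\<tau> + \<tau>)" using near t G0 by (intro mult_left_mono add_mono) (auto simp: near_def)
  finally have 2: "\<bar>(LINT x|lborel. \<phi> (t, x) * X t x) - (LINT x|lborel. mass_density (F t) x * \<Phi> x)\<bar> \<le> K\<phi> * \<Gamma> / wl R * 2 * \<tau>"
    by (simp add: G_def)
  have 3: "(LINT x|lborel. \<phi> (t, x) * (\<rho> (fst (t, x)) (snd (t, x)) * g (fst (t, x)) (snd (t, x)))) = (LINT x|lborel. \<rho> t x * \<Phi> x)"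
    by (simp add: \<Phi>_def mult_ac)
  show "\<bar>(LINT x|lborel. \<phi> (t, x) * X (fst (t, x)) (snd (t, x))) - (LINT x|lborel. \<phi> (t, x) * (\<rho> (fst (t, x)) (snd (t, x)) * g (fst (t, x)) (snd (t, x))))\<bar>
    \<le> K\<phi> * \<Gamma> / wl R * 2 * \<tau> + slip R B * \<tau> + e * (Mm / wl R + Rr * measure lborel (cball (0::real^'d) R))"
    unfolding 3 using 1 2 by simp
qed

end

text \<open>For the first estimate, mass times \<open>U - u\<close> is the integral of
  \<open>F\<close> times \<open>v - u\<close>, and the norm moves inside. The second is Jensen's
  inequality.\<close>

lemma mean_dev:
  assumes x: "ph.good t x"
  shows "mass_density (F t) x * norm (U t x - u t x) \<le> b1 t x"
    and "mass_density (F t) x * (norm (U t x - u t x))\<^sup>2 \<le> b2 t x"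
proof -
  have i: "integrable lborel (\<lambda>v. F t (x, v) *\<^sub>R v)" "integrable lborel (\<lambda>v. F t (x, v))"
    using ph.integrable_momentum_slice[OF x] x by (auto simp: ph.good_def)
  have "mass_density (F t) x *\<^sub>R (U t x - u t x) = (LINT v|lborel. F t (x, v) *\<^sub>R v) - (LINT v|lborel. F t (x, v) *\<^sub>R u t x)"
    using ph.momentum[OF x] i by (simp add: U_def mass_density_def scaleR_right_diff_distrib)
  also have "\<dots> = (LINT v|lborel. F t (x, v) *\<^sub>R v - F t (x, v) *\<^sub>R u t x)"
    using i by (intro Bochner_Integration.integral_diff[symmetric]) auto
  also have "\<dots> = (LINT v|lborel. F t (x, v) *\<^sub>R (v - u t x))" by (simp add: scaleR_right_diff_distrib)
  finally have "norm (mass_density (F t) x *\<^sub>R (U t x - u t x)) \<le> (LINT v|lborel. norm (F t (x, v) *\<^sub>R (v - u t x)))"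
    using integral_norm_bound[of lborel "\<lambda>v. F t (x, v) *\<^sub>R (v - u t x)"] by simp
  then show "mass_density (F t) x * norm (U t x - u t x) \<le> b1 t x"
    using ph.mass_nonneg[of t x] by (simp add: b1_def F_nonneg)
  show "mass_density (F t) x * (norm (U t x - u t x))\<^sup>2 \<le> b2 t x"
    unfolding U_def b2_def by (rule ph.jensen_slice[OF x])
qed

text \<open>The modulus \<open>|v - w| + |v - w|^2\<close> covers Lipschitz functions and the square
  at once; it is asked for only where \<open>|w| \<le> M\<close>, which contains the range of
  \<open>u\<close>.\<close>

lemma velocity_moment_close:
  assumes [measurable]: "h \<in> borel_measurable borel" and b: "\<And>v. \<bar>h v\<bar> \<le> C * (1 + (norm v)\<^sup>2)"
    and K: "\<And>v w. norm w \<le> M \<Longrightarrow> \<bar>h v - h w\<bar> \<le> K * (norm (v - w) + (norm (v - w))\<^sup>2)"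
  shows "AE x in lborel. \<bar>(LINT v|lborel. F t (x, v) * h v) - mass_density (F t) x * h (u t x)\<bar> \<le> K * (b1 t x + b2 t x)"
  using ph.AE_good[of t]
proof eventually_elim
  case (elim x)
  have i: "integrable lborel (\<lambda>v. F t (x, v) * h v)"
    using ph.integrable_slice[OF elim, of h C] b by simp
  have i0: "integrable lborel (\<lambda>v. F t (x, v))" using elim by (simp add: ph.good_def)
  have s2: "integrable lborel (\<lambda>v. F t (x, v) * (norm (v - u t x))\<^sup>2)" by (rule ph.integrable_square_slice[OF elim])
  have s1: "integrable lborel (\<lambda>v. F t (x, v) * norm (v - u t x))"
  proof (rule Bochner_Integration.integrable_bound[OF Bochner_Integration.integrable_add[OF i0 s2]])
    have "(\<lambda>v. F t (x, v)) \<in> borel_measurable lborel" using i0 by auto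
    then show "(\<lambda>v. F t (x, v) * norm (v - u t x)) \<in> borel_measurable lborel" by simp
    show "AE v in lborel. norm (F t (x, v) * norm (v - u t x)) \<le> norm (F t (x, v) + F t (x, v) * (norm (v - u t x))\<^sup>2)"
    proof (rule AE_I2)
      fix v
      show "norm (F t (x, v) * norm (v - u t x)) \<le> norm (F t (x, v) + F t (x, v) * (norm (v - u t x))\<^sup>2)"
        using mult_left_mono[OF ph.norm_le_one_plus_square[of "v - u t x"] F_nonneg[of t "(x, v)"]] F_nonneg[of t "(x, v)"]
        by (simp add: abs_mult distrib_left)
    qed
  qed
  have "(LINT v|lborel. F t (x, v) * h v) - mass_density (F t) x * h (u t x) = (LINT v|lborel. F t (x, v) * h v) - (LINT v|lborel. F t (x, v) * h (u t x))"
    by (simp add: mass_density_def)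
  also have "\<dots> = (LINT v|lborel. F t (x, v) * h v - F t (x, v) * h (u t x))"
    using i i0 by (intro Bochner_Integration.integral_diff[symmetric]) auto
  finally have eq: "(LINT v|lborel. F t (x, v) * h v) - mass_density (F t) x * h (u t x) = (LINT v|lborel. F t (x, v) * h v - F t (x, v) * h (u t x))" .
  have "\<bar>(LINT v|lborel. F t (x, v) * h v) - mass_density (F t) x * h (u t x)\<bar> \<le> (LINT v|lborel. \<bar>F t (x, v) * h v - F t (x, v) * h (u t x)\<bar>)"
    unfolding eq by (rule integral_abs_bound)
  also have "\<dots> \<le> (LINT v|lborel. K * (F t (x, v) * norm (v - u t x) + F t (x, v) * (norm (v - u t x))\<^sup>2))"
  proof (rule integral_mono)
    show "integrable lborel (\<lambda>v. \<bar>F t (x, v) * h v - F t (x, v) * h (u t x)\<bar>)"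
      using i i0 by (intro integrable_abs Bochner_Integration.integrable_diff integrable_mult_left) auto
    show "integrable lborel (\<lambda>v. K * (F t (x, v) * norm (v - u t x) + F t (x, v) * (norm (v - u t x))\<^sup>2))"
      by (intro integrable_mult_right Bochner_Integration.integrable_add s1 s2)
    fix v
    show "\<bar>F t (x, v) * h v - F t (x, v) * h (u t x)\<bar> \<le> K * (F t (x, v) * norm (v - u t x) + F t (x, v) * (norm (v - u t x))\<^sup>2)"
    proof -
      have ab: "\<bar>F t (x, v) * h v - F t (x, v) * h (u t x)\<bar> = F t (x, v) * \<bar>h v - h (u t x)\<bar>"
        using F_nonneg[of t "(x, v)"] by (simp add: right_diff_distrib[symmetric] abs_mult)
      show ?thesis unfolding ab using mult_left_mono[OF K[OF M[of t x], of v] F_nonneg[of t "(x, v)"]]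
        by (simp add: algebra_simps)
    qed
  qed
  also have "\<dots> = K * (b1 t x + b2 t x)" using s1 s2 by (simp add: b1_def b2_def)
  finally show ?case .
qed

lemma velocity_moment_measurable:
  assumes [measurable]: "h \<in> borel_measurable borel"
  shows "(\<lambda>p. LINT v|lborel. F (fst p) (snd p, v) * h v) \<in> borel_measurable (borel \<Otimes>\<^sub>M borel)"
  by measurable

lemma mass_joint_measurable: "(\<lambda>p. mass_density (F (fst p)) (snd p)) \<in> borel_measurable (borel \<Otimes>\<^sub>M borel)"
  unfolding mass_density_def by measurable

end

text \<open>The point is that \<open>B\<close> is independent of \<open>t\<close>: all times are
  mollified with one radius \<open>\<delta>\<close>, taken from uniform continuity on a compact
  slab, and the derivative is bounded through the Lipschitz constant of the bump.\<close>

lemma uniform_C1_approximation: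
  fixes \<Phi> :: "real \<times> 'a::euclidean_space \<Rightarrow> real"
  assumes \<Phi>: "continuous_on UNIV \<Phi>" and s: "\<And>t x. norm x > R \<Longrightarrow> \<Phi> (t, x) = 0" and e: "e > 0"
  shows "\<exists>B. \<forall>t\<in>{0..T}. \<exists>\<psi> D1. (\<forall>x. (\<psi> has_derivative D1 x) (at x)) \<and> (\<forall>h. continuous_on UNIV (\<lambda>x. D1 x h)) \<and>
      (\<forall>x. norm x > R + 1 \<longrightarrow> \<psi> x = 0) \<and> (\<forall>x. \<bar>\<psi> x\<bar> \<le> B) \<and> (\<forall>x h. \<bar>D1 x h\<bar> \<le> B * norm h) \<and> (\<forall>x. \<bar>\<Phi> (t, x) - \<psi> x\<bar> \<le> e)"
proof -
  \<comment> \<open>The margin 3 leaves room for points of norm up to \<open>R + 2\<close> and their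
    neighbours within \<open>\<delta> \<le> 1\<close>; farther out both values vanish.\<close>
  let ?S = "{0..T} \<times> cball (0::'a) (R + 3)"
  have S: "compact ?S" by (intro compact_Times) auto
  have cS: "continuous_on ?S \<Phi>" by (rule continuous_on_subset[OF \<Phi>]) auto
  obtain d where d: "d > 0" "\<And>p p'. p \<in> ?S \<Longrightarrow> p' \<in> ?S \<Longrightarrow> dist p' p < d \<Longrightarrow> dist (\<Phi> p') (\<Phi> p) < e"
    using compact_uniformly_continuous[OF cS S, unfolded uniformly_continuous_on_def, rule_format, OF e] by blast
  have "bounded (\<Phi> ` ?S)" by (rule compact_imp_bounded[OF compact_continuous_image[OF cS S]])
  then obtain K0 where K0: "\<And>p. p \<in> ?S \<Longrightarrow> \<bar>\<Phi> p\<bar> \<le> K0" unfolding bounded_iff by auto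
  define K where "K = \<bar>K0\<bar>"
  have K: "\<bar>\<Phi> (t, x)\<bar> \<le> K" if "t \<in> {0..T}" for t x
  proof (cases "norm x > R")
    case False
    then show ?thesis using K0[of "(t, x)"] that by (simp add: K_def)
  qed (simp add: s K_def)
  define \<delta> where "\<delta> = min 1 (d / 2)"
  have \<delta>: "\<delta> > 0" "\<delta> \<le> 1" "\<delta> < d" using d(1) by (auto simp: \<delta>_def)
  let ?N = "LINT y|lborel. bump \<delta> (y::'a)"
  have N: "?N > 0" by (rule bump_mass_pos[OF \<delta>(1)])
  obtain Lb where Lb: "Lb \<ge> 0" "\<And>x y :: 'a. \<bar>bump \<delta> x - bump \<delta> y\<bar> \<le> Lb * norm (x - y)"
  proof -
    have sm: "smooth (bump \<delta> :: 'a \<Rightarrow> real)" using Ck_bump unfolding smooth_def by blast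
    obtain Lb where Lb: "Lb \<ge> 0" "\<And>z h. \<bar>frechet_derivative (bump \<delta> :: 'a \<Rightarrow> real) (at z) h\<bar> \<le> Lb * norm h"
    proof (rule compact_support_derivative_bounded[OF smooth_derivative_continuous(1)[OF sm] smooth_derivative_continuous(2)[OF sm], of \<delta>])
      show "bump \<delta> z = 0" if "norm z > \<delta>" for z :: 'a using that \<delta>(1) by (auto intro: bump_eq_0)
    next
      fix K assume 1: "K \<ge> 0" and 2: "\<And>z h. \<bar>frechet_derivative (bump \<delta> :: 'a \<Rightarrow> real) (at z) h\<bar> \<le> K * norm h"
      show thesis by (rule that[OF 1 2])
    qed
    have "norm (bump \<delta> x - bump \<delta> y) \<le> Lb * norm (x - y)" for x y :: 'a
      by (rule differentiable_bound[of UNIV _ "\<lambda>z. frechet_derivative (bump \<delta>) (at z)"])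
        (use smooth_derivative_continuous(1)[OF sm] Lb in \<open>auto intro!: onorm_le\<close>)
    then show thesis using that Lb(1) by auto
  qed
  define V where "V = measure lborel (cball (0::'a) R)"
  define B where "B = K + K * Lb * V / ?N"
  have B: "K \<le> B" "K * Lb * V / ?N \<le> B" using Lb(1) N by (simp_all add: B_def K_def V_def)
  show ?thesis
  proof (intro exI[of _ B] ballI)
    fix t assume t: "t \<in> {0..T}"
    define \<Psi> where "\<Psi> x = \<Phi> (t, x)" for x
    define \<psi> where "\<psi> = mollify \<delta> \<Psi>"
    have c: "continuous_on UNIV \<Psi>"
    proof -
      have "continuous_on UNIV (\<lambda>x::'a. (t, x))" by (intro continuous_intros)
      from continuous_on_compose2[OF \<Phi> this subset_UNIV] show ?thesis by (simp add: \<Psi>_def)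
    qed
    have sp: "\<Psi> x = 0" if "norm x > R" for x using s[OF that] by (simp add: \<Psi>_def)
    have bK: "\<bar>\<Psi> x\<bar> \<le> K" for x using K[OF t] by (simp add: \<Psi>_def)
    have sm: "smooth \<psi>" unfolding smooth_def \<psi>_def using Ck_mollify[OF c sp \<delta>(1)] by blast
    note D = smooth_derivative_continuous[OF sm]
    have z: "\<psi> x = 0" if "norm x > R + 1" for x
      unfolding \<psi>_def by (rule mollify_eq_0[OF c sp \<delta>(1)]) (use that \<delta> in auto)
    have bd: "\<bar>\<psi> x\<bar> \<le> B" for x
    proof -
      have "\<bar>mollify \<delta> \<Psi> x - 0\<bar> \<le> K" by (rule mollify_close[OF c sp \<delta>(1)]) (use bK in auto)
      then show ?thesis using B(1) by (simp add: \<psi>_def)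
    qed
    have cl: "\<bar>\<Psi> x - \<psi> x\<bar> \<le> e" for x
    proof -
      have "\<bar>mollify \<delta> \<Psi> x - \<Psi> x\<bar> \<le> e"
      proof (rule mollify_close[OF c sp \<delta>(1)])
        fix y assume y: "norm (x - y) \<le> \<delta>"
        show "\<bar>\<Psi> y - \<Psi> x\<bar> \<le> e"
        proof (cases "norm x > R + 2")
          case True
          then have "norm y > R" using y \<delta>(2) norm_triangle_ineq2[of x y] by linarith
          then show ?thesis using sp[of x] sp[of y] True e by simp
        next
          case False
          then have "norm y \<le> R + 3" using y \<delta>(2) norm_triangle_ineq3[of x y] by linarith
          then have "(t, y) \<in> ?S" "(t, x) \<in> ?S" using False t by auto
          moreover have "dist (t, y) (t, x) < d" using y \<delta>(3) by (simp add: dist_Pair_Pair dist_norm norm_minus_commute)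
          ultimately show ?thesis using d(2)[of "(t, x)" "(t, y)"] by (simp add: \<Psi>_def dist_real_def)
        qed
      qed
      then show ?thesis by (simp add: \<psi>_def abs_minus_commute)
    qed
    have i: "integrable lborel (\<lambda>y. \<Psi> y * bump \<delta> (x - y))" for x by (rule integrable_mollify[OF c sp \<delta>(1)])
    \<comment> \<open>The difference of two shifted kernels is integrated over the ball of radius
      \<open>R\<close>, outside which \<open>\<Psi>\<close> vanishes; this produces the volume
      \<open>V\<close>.\<close>
    have lip: "norm (\<psi> x - \<psi> y) \<le> K * Lb * V / ?N * norm (x - y)" for x y
    proof -
      have "\<bar>(LINT z|lborel. \<Psi> z * bump \<delta> (x - z)) - (LINT z|lborel. \<Psi> z * bump \<delta> (y - z))\<bar> = \<bar>LINT z|lborel. \<Psi> z * bump \<delta> (x - z) - \<Psi> z * bump \<delta> (y - z)\<bar>"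
        by (simp only: Bochner_Integration.integral_diff[OF i i])
      also have "\<dots> \<le> (LINT z|lborel. K * (Lb * norm (x - y)) * indicator (cball (0::'a) R) z)"
      proof (rule order_trans[OF integral_abs_bound], rule integral_mono)
        show "integrable lborel (\<lambda>z. \<bar>\<Psi> z * bump \<delta> (x - z) - \<Psi> z * bump \<delta> (y - z)\<bar>)"
          by (intro integrable_abs Bochner_Integration.integrable_diff i)
        show "integrable lborel (\<lambda>z::'a. K * (Lb * norm (x - y)) * indicator (cball (0::'a) R) z)"
          by (intro integrable_mult_right integrable_real_indicator) (simp, rule emeasure_bounded_finite[OF bounded_cball])
        fix z
        have "\<bar>\<Psi> z\<bar> * \<bar>bump \<delta> (x - z) - bump \<delta> (y - z)\<bar> \<le> K * (Lb * norm (x - y))"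
          using Lb(2)[of "x - z" "y - z"] bK[of z] by (intro mult_mono) (auto simp: K_def)
        then show "\<bar>\<Psi> z * bump \<delta> (x - z) - \<Psi> z * bump \<delta> (y - z)\<bar> \<le> K * (Lb * norm (x - y)) * indicator (cball (0::'a) R) z"
          using sp[of z] by (cases "norm z > R") (auto simp: right_diff_distrib[symmetric] abs_mult indicator_def)
      qed
      also have "\<dots> = K * (Lb * norm (x - y)) * V" by (simp add: V_def)
      finally have "\<bar>(LINT z|lborel. \<Psi> z * bump \<delta> (x - z)) - (LINT z|lborel. \<Psi> z * bump \<delta> (y - z))\<bar> \<le> K * (Lb * norm (x - y)) * V" .
      from divide_right_mono[OF this, of ?N] show ?thesis
        using N by (simp add: \<psi>_def mollify_def diff_divide_distrib[symmetric] abs_divide mult_ac)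
    qed
    have "\<bar>frechet_derivative \<psi> (at x) h\<bar> \<le> B * norm h" for x h
    proof -
      have "norm (frechet_derivative \<psi> (at x) h) \<le> K * Lb * V / ?N * norm h"
        by (rule derivative_norm_le_lipschitz[OF D(1) lip])
      also have "\<dots> \<le> B * norm h" by (intro mult_right_mono B) auto
      finally show ?thesis by simp
    qed
    note fd = this
    show "\<exists>\<psi> D1. (\<forall>x. (\<psi> has_derivative D1 x) (at x)) \<and> (\<forall>h. continuous_on UNIV (\<lambda>x. D1 x h)) \<and>
      (\<forall>x. norm x > R + 1 \<longrightarrow> \<psi> x = 0) \<and> (\<forall>x. \<bar>\<psi> x\<bar> \<le> B) \<and> (\<forall>x h. \<bar>D1 x h\<bar> \<le> B * norm h) \<and> (\<forall>x. \<bar>\<Phi> (t, x) - \<psi> x\<bar> \<le> e)"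
      by (intro exI[of _ \<psi>] exI[of _ "\<lambda>x. frechet_derivative \<psi> (at x)"] conjI allI impI D fd z bd cl[unfolded \<Psi>_def])
  qed
qed

text \<open>\<open>B\<close> may depend on \<open>e\<close>, so \<open>e\<close> is fixed first and
  \<open>\<epsilon>\<close> sent to 0 afterwards. Test functions given only on \<open>[0, T]\<close>
  are extended by clipping the time, which is why the estimate may assume invariance under
  \<open>clip\<close>.\<close>

lemma weakly_converges_if_estimate:
  assumes T: "T > 0" and loc: "\<And>\<epsilon>. \<epsilon> \<in> {0<..1} \<Longrightarrow> loc_integrable T (X \<epsilon>)" and loch: "loc_integrable T h"
    and est: "\<And>\<phi> R e. continuous_on UNIV \<phi> \<Longrightarrow> (\<And>t x. norm x > R \<Longrightarrow> \<phi> (t, x) = 0) \<Longrightarrow> e > 0 \<Longrightarrow>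
      (\<And>t x. \<phi> (t, x) = \<phi> (clip T t, x)) \<Longrightarrow>
      \<exists>B. \<forall>\<epsilon>\<in>{0<..1}. \<bar>(LINT (t, x):{0..T} \<times> UNIV|lborel. \<phi> (t, x) * X \<epsilon> t x) - (LINT (t, x):{0..T} \<times> UNIV|lborel. \<phi> (t, x) * h t x)\<bar>
        \<le> B * sqrt (sqrt \<epsilon>) + e"
  shows "weakly_converges T X (h :: real \<Rightarrow> real^'d \<Rightarrow> real)"
  unfolding weakly_converges_def
proof (intro conjI ballI allI impI loch loc, assumption, elim conjE exE)
  fix \<phi> :: "real \<times> (real^'d) \<Rightarrow> real" and K
  assume c: "continuous_on ({0..T} \<times> UNIV) \<phi>" and K: "compact K" "\<forall>p\<in>{0..T} \<times> UNIV - K. \<phi> p = 0"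
  define \<phi>' where "\<phi>' p = \<phi> (clip T (fst p), snd p)" for p
  have c': "continuous_on UNIV \<phi>'" unfolding \<phi>'_def using continuous_on_clip[OF c] T by simp
  obtain R where R: "\<And>p. p \<in> K \<Longrightarrow> norm p \<le> R" using compact_imp_bounded[OF K(1)] unfolding bounded_iff by blast
  have z: "\<phi>' (t, x) = 0" if "norm x > R" for t x
  proof -
    have "norm x \<le> norm (clip T t, x)" by (rule norm_snd_le)
    then have "(clip T t, x) \<notin> K" using R[of "(clip T t, x)"] that by linarith
    then show ?thesis using K(2) clip_in[of T t] T by (simp add: \<phi>'_def)
  qed
  have cc: "\<phi>' (t, x) = \<phi>' (clip T t, x)" for t x
    using clip_eq[OF clip_in[of T t]] T by (simp add: \<phi>'_def)
  have eq: "(LINT (t, x):{0..T} \<times> UNIV|lborel. \<phi> (t, x) * k t x) = (LINT (t, x):{0..T} \<times> UNIV|lborel. \<phi>' (t, x) * k t x)" for k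
    unfolding set_lebesgue_integral_def
    by (intro Bochner_Integration.integral_cong) (auto simp: indicator_def \<phi>'_def clip_eq)
  show "((\<lambda>\<epsilon>. LINT (t, x):{0..T} \<times> UNIV|lborel. \<phi> (t, x) * X \<epsilon> t x) \<longlongrightarrow>
           (LINT (t, x):{0..T} \<times> UNIV|lborel. \<phi> (t, x) * h t x)) (at_right 0)"
    unfolding eq
  proof (rule tendstoI)
    fix e :: real assume e: "e > 0"
    then have "e / 2 > 0" by simp
    from est[OF c' z this cc] obtain B where B: "\<And>\<epsilon>. \<epsilon> \<in> {0<..1} \<Longrightarrow>
      \<bar>(LINT (t, x):{0..T} \<times> UNIV|lborel. \<phi>' (t, x) * X \<epsilon> t x) - (LINT (t, x):{0..T} \<times> UNIV|lborel. \<phi>' (t, x) * h t x)\<bar>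
        \<le> B * sqrt (sqrt \<epsilon>) + e / 2" by blast
    have "((\<lambda>\<epsilon>. B * sqrt (sqrt \<epsilon>)) \<longlongrightarrow> B * sqrt (sqrt 0)) (at_right 0)" by (intro tendsto_intros)
    then have "((\<lambda>\<epsilon>. B * sqrt (sqrt \<epsilon>)) \<longlongrightarrow> 0) (at_right 0)" by simp
    from order_tendstoD(2)[OF this \<open>e / 2 > 0\<close>]
    have ev: "\<forall>\<^sub>F \<epsilon> in at_right 0. B * sqrt (sqrt \<epsilon>) < e / 2" .
    have "\<forall>\<^sub>F \<epsilon> in at_right (0::real). \<epsilon> \<in> {0<..<1}" by (rule eventually_at_right_real) simp
    with ev show "\<forall>\<^sub>F \<epsilon> in at_right 0. dist (LINT (t, x):{0..T} \<times> UNIV|lborel. \<phi>' (t, x) * X \<epsilon> t x)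
      (LINT (t, x):{0..T} \<times> UNIV|lborel. \<phi>' (t, x) * h t x) < e"
    proof eventually_elim
      case (elim \<epsilon>)
      then show ?case using B[of \<epsilon>] by (simp add: dist_real_def)
    qed
  qed
qed

text \<open>The common form of the five limits. \<open>X\<close> is built from the zero extension
  \<open>kinetic.F\<close>, which is jointly measurable, and \<open>X'\<close> from \<open>f\<close>
  itself; they agree on \<open>[0, T]\<close>, as do \<open>h\<close> and \<open>\<rho>\<close>
  times \<open>g\<close>.\<close>

lemma relative_weak_limit:
  fixes f0 :: "real \<Rightarrow> (real^'d) \<times> (real^'d) \<Rightarrow> real" and f :: "real \<Rightarrow> real \<Rightarrow> (real^'d) \<times> (real^'d) \<Rightarrow> real"
    and X X' :: "real \<Rightarrow> real \<Rightarrow> real^'d \<Rightarrow> real" and g h :: "real \<Rightarrow> real^'d \<Rightarrow> real"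
  assumes rel: "\<And>\<epsilon>. \<epsilon> \<in> {0<..1} \<Longrightarrow> relative lam \<epsilon> (f0 \<epsilon>) (f \<epsilon>) T \<rho> u D\<rho> Du L M"
    and near: "\<And>\<epsilon>. \<epsilon> \<in> {0<..1} \<Longrightarrow> relative.near (f0 \<epsilon>) (f \<epsilon>) T \<rho> u (C * sqrt (sqrt \<epsilon>)) Mm"
    and Xm: "\<And>\<epsilon>. \<epsilon> \<in> {0<..1} \<Longrightarrow> (\<lambda>p. X \<epsilon> (fst p) (snd p)) \<in> borel_measurable (borel \<Otimes>\<^sub>M borel)"
    and Xe: "\<And>\<epsilon> t. \<epsilon> \<in> {0<..1} \<Longrightarrow> t \<in> {0..T} \<Longrightarrow> AE x in lborel. \<bar>X \<epsilon> t x - mass_density (kinetic.F (f \<epsilon>) t) x * g t x\<bar>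
        \<le> \<Gamma> * (relative.b1 (f \<epsilon>) u t x + relative.b2 (f \<epsilon>) u t x)"
    and gc: "continuous_on UNIV (\<lambda>p. g (fst p) (snd p))" and gK: "\<And>t x. \<bar>g t x\<bar> \<le> Kg" and \<Gamma>: "\<Gamma> \<ge> 0"
    and X': "\<And>\<epsilon> t x. \<epsilon> \<in> {0<..1} \<Longrightarrow> t \<in> {0..T} \<Longrightarrow> X' \<epsilon> t x = X \<epsilon> t x"
    and h: "\<And>t x. t \<in> {0..T} \<Longrightarrow> h t x = \<rho> t x * g t x"
  shows "weakly_converges T X' h"
proof -
  have 1: "(1::real) \<in> {0<..1}" by simp
  interpret E: euler_flow lam T \<rho> u D\<rho> Du L M using rel[OF 1] by (rule relative.axioms(2))
  have rc: "continuous_on UNIV (\<lambda>p. \<rho> (fst p) (snd p))" using E.\<rho>_cont by (simp add: case_prod_beta')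
  have Xi: "set_integrable lborel ({0..T} \<times> UNIV) (\<lambda>(t, x). X' \<epsilon> t x)" if \<epsilon>: "\<epsilon> \<in> {0<..1}" for \<epsilon>
  proof -
    have "set_integrable lborel ({0..T} \<times> UNIV) (\<lambda>p. X \<epsilon> (fst p) (snd p))"
      by (rule relative.X_set_integrable[OF rel[OF \<epsilon>] Xm[OF \<epsilon>] Xe[OF \<epsilon>] gc gK \<Gamma>])
    moreover have "(\<lambda>p. indicator ({0..T} \<times> UNIV) p *\<^sub>R X \<epsilon> (fst p) (snd p)) = (\<lambda>p. indicator ({0..T} \<times> UNIV) p *\<^sub>R (case p of (t, x) \<Rightarrow> X' \<epsilon> t x))"
    proof
      fix p show "indicator ({0..T} \<times> UNIV) p *\<^sub>R X \<epsilon> (fst p) (snd p) = indicator ({0..T} \<times> UNIV) p *\<^sub>R (case p of (t, x) \<Rightarrow> X' \<epsilon> t x)"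
        using X'[OF \<epsilon>] by (cases p) (auto simp: indicator_def)
    qed
    ultimately show ?thesis by (simp only: set_integrable_def)
  qed
  show ?thesis
  proof (rule weakly_converges_if_estimate[OF E.T_pos])
    show "loc_integrable T (X' \<epsilon>)" if "\<epsilon> \<in> {0<..1}" for \<epsilon>
      unfolding loc_integrable_def by (auto intro!: set_integrable_subset[OF Xi[OF that]] borel_compact)
    show "loc_integrable T h" unfolding loc_integrable_def
    proof (intro allI impI, elim conjE)
      fix K :: "(real \<times> (real^'d)) set" assume K: "compact K" "K \<subseteq> {0..T} \<times> UNIV"
      have "integrable lborel (\<lambda>p. indicator K p *\<^sub>R (\<rho> (fst p) (snd p) * g (fst p) (snd p)))"
        by (rule borel_integrable_compact[OF K(1) continuous_on_subset[OF continuous_on_mult[OF rc gc] subset_UNIV]])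
      moreover have "(\<lambda>p. indicator K p *\<^sub>R (\<rho> (fst p) (snd p) * g (fst p) (snd p))) = (\<lambda>p. indicator K p *\<^sub>R (case p of (t, x) \<Rightarrow> h t x))"
      proof
        fix p show "indicator K p *\<^sub>R (\<rho> (fst p) (snd p) * g (fst p) (snd p)) = indicator K p *\<^sub>R (case p of (t, x) \<Rightarrow> h t x)"
          using h[of "fst p" "snd p"] K(2) by (cases "p \<in> K") (auto simp: case_prod_beta')
      qed
      ultimately show "set_integrable lborel K (\<lambda>(t, x). h t x)" by (simp only: set_integrable_def)
    qed
  next
    fix \<phi> :: "real \<times> (real^'d) \<Rightarrow> real" and R e :: real
    assume c: "continuous_on UNIV \<phi>" and z: "\<And>t x. norm x > R \<Longrightarrow> \<phi> (t, x) = 0" and e: "e > 0"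
      and cc: "\<And>t x. \<phi> (t, x) = \<phi> (clip T t, x)"
    \<comment> \<open>Mollification enlarges supports by at most 1, hence radius
      \<open>R + 1\<close> throughout.\<close>
    let ?S = "{0..T} \<times> cball (0::real^'d) (R + 1)"
    have S: "compact ?S" by (intro compact_Times) auto
    have bd: "\<exists>K. \<forall>p\<in>?S. \<bar>k p\<bar> \<le> K" if "continuous_on UNIV k" for k :: "real \<times> (real^'d) \<Rightarrow> real"
      using compact_imp_bounded[OF compact_continuous_image[OF continuous_on_subset[OF that subset_UNIV] S]]
      unfolding bounded_iff by auto
    obtain K0 where K0: "\<And>p. p \<in> ?S \<Longrightarrow> \<bar>\<phi> p\<bar> \<le> K0" using bd[OF c] by blast
    define K\<phi> where "K\<phi> = \<bar>K0\<bar>"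
    have K\<phi>: "\<bar>\<phi> p\<bar> \<le> K\<phi>" for p
    proof (cases p)
      case (Pair t x)
      show ?thesis
      proof (cases "norm x > R")
        case True
        then show ?thesis using z by (simp add: Pair K\<phi>_def)
      next
        case False
        then have "(clip T t, x) \<in> ?S" using clip_in[of T t] E.T_pos by auto
        from K0[OF this] show ?thesis unfolding Pair using cc[of t x] by (simp add: K\<phi>_def)
      qed
    qed
    obtain Rr where Rr: "\<And>p. p \<in> ?S \<Longrightarrow> \<bar>\<rho> (fst p) (snd p)\<bar> \<le> Rr" using bd[OF rc] by blast
    define W where "W = Mm / E.wl (R + 1) + Rr * measure lborel (cball (0::real^'d) (R + 1))"
    \<comment> \<open>Makes the approximation error, multiplied by \<open>W\<close> and by the
      length \<open>T\<close>, at most \<open>e\<close>; \<open>|W| + 1\<close> is positive whatever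
      \<open>W\<close> is.\<close>
    define e' where "e' = e / (T * (\<bar>W\<bar> + 1))"
    have e': "e' > 0" using e E.T_pos by (simp add: e'_def add_nonneg_pos)
    have eW: "e' * W * T \<le> e"
    proof -
      have "e' * W * T = e * (W / (\<bar>W\<bar> + 1))" using E.T_pos by (simp add: e'_def)
      also have "\<dots> \<le> e * 1" using e by (intro mult_left_mono) (auto simp: divide_le_eq)
      finally show ?thesis by simp
    qed
    have c\<Phi>: "continuous_on UNIV (\<lambda>p. \<phi> p * g (fst p) (snd p))" by (rule continuous_on_mult[OF c gc])
    have z0: "\<phi> (t, x) * g (fst (t, x)) (snd (t, x)) = 0" if "norm x > R" for t x using z[OF that] by simp
    obtain B where B: "\<forall>t\<in>{0..T}. \<exists>\<psi> D1. (\<forall>x. (\<psi> has_derivative D1 x) (at x)) \<and> (\<forall>h. continuous_on UNIV (\<lambda>x. D1 x h)) \<and>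
      (\<forall>x. norm x > R + 1 \<longrightarrow> \<psi> x = 0) \<and> (\<forall>x. \<bar>\<psi> x\<bar> \<le> B) \<and> (\<forall>x h. \<bar>D1 x h\<bar> \<le> B * norm h) \<and>
      (\<forall>x. \<bar>\<phi> (t, x) * g (fst (t, x)) (snd (t, x)) - \<psi> x\<bar> \<le> e')"
      using uniform_C1_approximation[where \<Phi> = "\<lambda>p. \<phi> p * g (fst p) (snd p)" and R = R and T = T, OF c\<Phi> z0 e'] by blast
    have P: "\<exists>\<psi> D1. (\<forall>x. (\<psi> has_derivative D1 x) (at x)) \<and> (\<forall>h. continuous_on UNIV (\<lambda>x. D1 x h)) \<and>
      (\<forall>x. norm x > R + 1 \<longrightarrow> \<psi> x = 0) \<and> (\<forall>x. \<bar>\<psi> x\<bar> \<le> B) \<and> (\<forall>x h. \<bar>D1 x h\<bar> \<le> B * norm h) \<and> (\<forall>x. \<bar>\<phi> (t, x) * g t x - \<psi> x\<bar> \<le> e')"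
      if "t \<in> {0..T}" for t using B[rule_format, OF that] by simp
    define B' where "B' = (K\<phi> * \<Gamma> / E.wl (R + 1) * 2 * C + E.slip (R + 1) B * C) * T"
    have "\<bar>(LINT (t, x):{0..T} \<times> UNIV|lborel. \<phi> (t, x) * X' \<epsilon> t x) - (LINT (t, x):{0..T} \<times> UNIV|lborel. \<phi> (t, x) * h t x)\<bar>
        \<le> B' * sqrt (sqrt \<epsilon>) + e" if \<epsilon>: "\<epsilon> \<in> {0<..1}" for \<epsilon>
    proof -
      have z': "\<And>t x. norm x > R + 1 \<Longrightarrow> \<phi> (t, x) = 0" using z by simp
      have Rr': "\<And>t x. t \<in> {0..T} \<Longrightarrow> norm x \<le> R + 1 \<Longrightarrow> \<bar>\<rho> t x\<bar> \<le> Rr" using Rr[of "(_, _)"] by auto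
      have "\<bar>(LINT p:{0..T} \<times> UNIV|lborel. \<phi> p * X \<epsilon> (fst p) (snd p)) - (LINT p:{0..T} \<times> UNIV|lborel. \<phi> p * (\<rho> (fst p) (snd p) * g (fst p) (snd p)))\<bar>
        \<le> (K\<phi> * \<Gamma> / E.wl (R + 1) * 2 * (C * sqrt (sqrt \<epsilon>)) + E.slip (R + 1) B * (C * sqrt (sqrt \<epsilon>)) + e' * (Mm / E.wl (R + 1) + Rr * measure lborel (cball (0::real^'d) (R + 1)))) * T"
        by (rule relative.limit_estimate[OF rel[OF \<epsilon>] Xm[OF \<epsilon>] Xe[OF \<epsilon>] gc gK \<Gamma> near[OF \<epsilon>] c z' K\<phi> P Rr'])
      also have "\<dots> = B' * sqrt (sqrt \<epsilon>) + e' * W * T" unfolding W_def[symmetric] by (simp add: B'_def algebra_simps)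
      also have "\<dots> \<le> B' * sqrt (sqrt \<epsilon>) + e" using eW by simp
      also have "(LINT p:{0..T} \<times> UNIV|lborel. \<phi> p * X \<epsilon> (fst p) (snd p)) = (LINT (t, x):{0..T} \<times> UNIV|lborel. \<phi> (t, x) * X' \<epsilon> t x)"
        unfolding set_lebesgue_integral_def using X'[OF \<epsilon>]
        by (intro Bochner_Integration.integral_cong) (auto simp: indicator_def)
      also have "(LINT p:{0..T} \<times> UNIV|lborel. \<phi> p * (\<rho> (fst p) (snd p) * g (fst p) (snd p))) = (LINT (t, x):{0..T} \<times> UNIV|lborel. \<phi> (t, x) * h t x)"
        unfolding set_lebesgue_integral_def using h
        by (intro Bochner_Integration.integral_cong) (auto simp: indicator_def)
      finally show ?thesis .
    qed
    then show "\<exists>B. \<forall>\<epsilon>\<in>{0<..1}. \<bar>(LINT (t, x):{0..T} \<times> UNIV|lborel. \<phi> (t, x) * X' \<epsilon> t x) - (LINT (t, x):{0..T} \<times> UNIV|lborel. \<phi> (t, x) * h t x)\<bar>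
        \<le> B * sqrt (sqrt \<epsilon>) + e" by blast
  qed
qed

context relative
begin

lemma component_measurable: "(\<lambda>p. U (fst p) (snd p) $ i) \<in> borel_measurable (borel \<Otimes>\<^sub>M borel)"
proof -
  have "(\<lambda>p. U (fst p) (snd p) \<bullet> axis i 1) \<in> borel_measurable (borel \<Otimes>\<^sub>M borel)" by measurable
  then show ?thesis by (simp add: inner_axis)
qed

lemma momentum_close:
  "AE x in lborel. \<bar>mass_density (F t) x * U t x $ i - mass_density (F t) x * u t x $ i\<bar> \<le> 1 * (b1 t x + b2 t x)"
  using ph.AE_good[of t]
proof eventually_elim
  case (elim x)
  have "mass_density (F t) x * \<bar>U t x $ i - u t x $ i\<bar> \<le> mass_density (F t) x * norm (U t x - u t x)"
    using component_le_norm_cart[of "U t x - u t x" i] ph.mass_nonneg[of t x] by (intro mult_left_mono) auto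
  moreover have e: "\<bar>mass_density (F t) x * U t x $ i - mass_density (F t) x * u t x $ i\<bar> = mass_density (F t) x * \<bar>U t x $ i - u t x $ i\<bar>"
    using ph.mass_nonneg[of t x] by (simp add: right_diff_distrib[symmetric] abs_mult)
  ultimately have "mass_density (F t) x * \<bar>U t x $ i - u t x $ i\<bar> \<le> b1 t x"
    using order_trans[OF _ mean_dev(1)[OF elim]] by simp
  also have "\<dots> \<le> b1 t x + b2 t x" using b_nonneg(2)[of t x] by simp
  finally show ?case unfolding e by simp
qed

text \<open>The product is expanded about \<open>u\<close>: the term quadratic in
  \<open>U - u\<close> is controlled by \<open>b2\<close>, each of the two linear ones by
  \<open>M * b1\<close>.\<close>

lemma flux_close:
  "AE x in lborel. \<bar>mass_density (F t) x * (U t x $ i * U t x $ j) - mass_density (F t) x * (u t x $ i * u t x $ j)\<bar>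
    \<le> (1 + 2 * M) * (b1 t x + b2 t x)"
  using ph.AE_good[of t]
proof eventually_elim
  case (elim x)
  let ?m = "mass_density (F t) x" and ?n = "norm (U t x - u t x)"
  let ?a = "U t x $ i - u t x $ i" and ?b = "U t x $ j - u t x $ j"
  have m: "?m \<ge> 0" by (rule ph.mass_nonneg)
  have c: "\<bar>?a\<bar> \<le> ?n" "\<bar>?b\<bar> \<le> ?n" "\<bar>u t x $ i\<bar> \<le> M" "\<bar>u t x $ j\<bar> \<le> M"
    using component_le_norm_cart[of "U t x - u t x"] order_trans[OF component_le_norm_cart M] by auto
  have "\<bar>U t x $ i * U t x $ j - u t x $ i * u t x $ j\<bar> = \<bar>?a * ?b + u t x $ i * ?b + ?a * u t x $ j\<bar>" by (simp add: algebra_simps)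
  also have "\<dots> \<le> \<bar>?a * ?b\<bar> + \<bar>u t x $ i * ?b\<bar> + \<bar>?a * u t x $ j\<bar>" by linarith
  also have "\<dots> \<le> ?n * ?n + M * ?n + ?n * M"
    unfolding abs_mult by (intro add_mono mult_mono c) (use M0 in auto)
  finally have d: "\<bar>U t x $ i * U t x $ j - u t x $ i * u t x $ j\<bar> \<le> ?n\<^sup>2 + 2 * M * ?n" by (simp add: power2_eq_square)
  have "\<bar>?m * (U t x $ i * U t x $ j) - ?m * (u t x $ i * u t x $ j)\<bar> = ?m * \<bar>U t x $ i * U t x $ j - u t x $ i * u t x $ j\<bar>"
    using m by (simp add: right_diff_distrib[symmetric] abs_mult)
  also have "\<dots> \<le> ?m * (?n\<^sup>2 + 2 * M * ?n)" by (rule mult_left_mono[OF d m])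
  also have "\<dots> = ?m * ?n\<^sup>2 + 2 * M * (?m * ?n)" by (simp add: algebra_simps)
  also have "\<dots> \<le> b2 t x + 2 * M * b1 t x" using mean_dev[OF elim] M0 by (intro add_mono mult_left_mono) auto
  also have "\<dots> \<le> (1 + 2 * M) * (b1 t x + b2 t x)"
    using b_nonneg[of t x] mult_nonneg_nonneg[OF M0 b_nonneg(2)[of t x]] by (simp add: algebra_simps)
  finally show ?case .
qed

text \<open>The difference of squares is \<open>(v - w) \<bullet> (v + w)\<close>, and
  \<open>v + w\<close> is \<open>v - w\<close> plus \<open>2 *\<^sub>R w\<close>.\<close>

lemma square_lipschitz:
  fixes v w :: "real^'d"
  assumes w: "norm w \<le> M"
  shows "\<bar>(norm v)\<^sup>2 - (norm w)\<^sup>2\<bar> \<le> (1 + 2 * M) * (norm (v - w) + (norm (v - w))\<^sup>2)"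
proof -
  let ?n = "norm (v - w)"
  have "(norm v)\<^sup>2 - (norm w)\<^sup>2 = (v - w) \<bullet> (v + w)" by (simp add: power2_norm_eq_inner inner_diff_left inner_diff_right inner_add_left inner_add_right inner_commute)
  also have "\<bar>\<dots>\<bar> \<le> ?n * norm (v + w)" by (rule Cauchy_Schwarz_ineq2)
  also have "norm (v + w) \<le> ?n + 2 * M"
  proof -
    have "v + w = (v - w) + 2 *\<^sub>R w" by (simp add: scaleR_2)
    then have "norm (v + w) \<le> ?n + norm (2 *\<^sub>R w)" by (metis norm_triangle_ineq)
    then show ?thesis using w by simp
  qed
  finally have "\<bar>(norm v)\<^sup>2 - (norm w)\<^sup>2\<bar> \<le> ?n * (?n + 2 * M)" by (simp add: mult_left_mono)
  also have "\<dots> \<le> (1 + 2 * M) * (?n + ?n\<^sup>2)"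
    using mult_nonneg_nonneg[OF M0 zero_le_power2[of ?n]] norm_ge_zero[of "v - w"] by (simp add: algebra_simps power2_eq_square)
  finally show ?thesis .
qed

end

section \<open>Constants uniform in \<open>\<epsilon>\<close> and the five limits\<close>

theorem theorem2p1:
  fixes lam s T :: real
    and \<rho>0 :: "real^'d \<Rightarrow> real" and u0 :: "real^'d \<Rightarrow> real^'d"
    and \<rho> :: "real \<Rightarrow> real^'d \<Rightarrow> real" and u :: "real \<Rightarrow> real^'d \<Rightarrow> real^'d"
    and f0 :: "real \<Rightarrow> (real^'d) \<times> (real^'d) \<Rightarrow> real"
    and f :: "real \<Rightarrow> real \<Rightarrow> (real^'d) \<times> (real^'d) \<Rightarrow> real"
  assumes lam: "lam \<ge> 0"
    and s: "s > real CARD('d) / 2 + 1"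
    and \<rho>0_pos: "\<And>x. \<rho>0 x > 0"
    and \<rho>0_sobolev: "\<rho>0 \<in> sobolev s"
    and u0_sobolev: "\<And>i. (\<lambda>x. u0 x $ i) \<in> sobolev (s + 1)"
    and f0_nonneg: "\<And>\<epsilon> z. \<epsilon> \<in> {0<..1} \<Longrightarrow> f0 \<epsilon> z \<ge> 0"
    and f0_L1: "\<And>\<epsilon>. \<epsilon> \<in> {0<..1} \<Longrightarrow> integrable lborel (f0 \<epsilon>)"
    and f0_Linf: "\<And>\<epsilon>. \<epsilon> \<in> {0<..1} \<Longrightarrow> \<exists>K. AE z in lborel. \<bar>f0 \<epsilon> z\<bar> \<le> K"
    and f0_energy: "\<And>\<epsilon>. \<epsilon> \<in> {0<..1} \<Longrightarrow> integrable lborel (\<lambda>(x, v). (norm v)\<^sup>2 * f0 \<epsilon> (x, v))"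
    and A1: "\<exists>C. \<forall>\<epsilon>\<in>{0<..1}.
        \<bar>LINT x|lborel. (LINT v|lborel. (norm v)\<^sup>2 / 2 * f0 \<epsilon> (x, v)) - \<rho>0 x * (norm (u0 x))\<^sup>2 / 2\<bar>
          \<le> C * sqrt \<epsilon>"
    and A2: "\<exists>C. \<forall>\<epsilon>\<in>{0<..1}. AE x in lborel.
        \<bar>mass_density (f0 \<epsilon>) x - \<rho>0 x\<bar> \<le> C * sqrt \<epsilon>"
    and A3: "\<exists>C. \<forall>\<epsilon>\<in>{0<..1}. AE x in lborel.
        norm (mean_velocity (f0 \<epsilon>) x - u0 x) \<le> C * sqrt \<epsilon>"
    and f_nonneg: "\<And>\<epsilon> t z. \<epsilon> \<in> {0<..1} \<Longrightarrow> t \<ge> 0 \<Longrightarrow> f \<epsilon> t z \<ge> 0"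
    and f_weak: "\<And>\<epsilon>. \<epsilon> \<in> {0<..1} \<Longrightarrow> weak_solution lam \<epsilon> (f0 \<epsilon>) (f \<epsilon>)"
    and f_init: "\<And>\<epsilon>. \<epsilon> \<in> {0<..1} \<Longrightarrow> AE z in lborel. f \<epsilon> 0 z = f0 \<epsilon> z"
    and f_mass: "\<And>\<epsilon>. \<epsilon> \<in> {0<..1} \<Longrightarrow> conserves_mass (f0 \<epsilon>) (f \<epsilon>)"
    and f_entropy: "\<And>\<epsilon>. \<epsilon> \<in> {0<..1} \<Longrightarrow> entropy_inequality lam \<epsilon> (f0 \<epsilon>) (f \<epsilon>)"
    and T: "T > 0"
    and sol: "classical_solution lam s T \<rho>0 u0 \<rho> u"
  shows "(\<exists>C. \<forall>\<epsilon>\<in>{0<..1}. \<forall>t\<in>{0..T}.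
           integrable lborel
             (\<lambda>x. mass_density (f \<epsilon> t) x * (norm (mean_velocity (f \<epsilon> t) x - u t x))\<^sup>2) \<and>
           (LINT x|lborel. mass_density (f \<epsilon> t) x * (norm (mean_velocity (f \<epsilon> t) x - u t x))\<^sup>2)
             \<le> C * sqrt \<epsilon>)
       \<and> weakly_converges T (\<lambda>\<epsilon> t x. mass_density (f \<epsilon> t) x) \<rho>
       \<and> (\<forall>i. weakly_converges T
               (\<lambda>\<epsilon> t x. mass_density (f \<epsilon> t) x * mean_velocity (f \<epsilon> t) x $ i)
               (\<lambda>t x. \<rho> t x * u t x $ i))
       \<and> (\<forall>i j. weakly_converges T
               (\<lambda>\<epsilon> t x. mass_density (f \<epsilon> t) x *
                  (mean_velocity (f \<epsilon> t) x $ i * mean_velocity (f \<epsilon> t) x $ j))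
               (\<lambda>t x. \<rho> t x * (u t x $ i * u t x $ j)))
       \<and> weakly_converges T (\<lambda>\<epsilon> t x. LINT v|lborel. f \<epsilon> t (x, v) * (norm v)\<^sup>2)
            (\<lambda>t x. \<rho> t x * (norm (u t x))\<^sup>2)
       \<and> (\<forall>\<psi> :: real^'d \<Rightarrow> real.
            C1_on UNIV \<psi> \<and> (\<exists>K. \<forall>y. onorm (frechet_derivative \<psi> (at y)) \<le> K) \<longrightarrow>
            weakly_converges T (\<lambda>\<epsilon> t x. LINT v|lborel. f \<epsilon> t (x, v) * \<psi> v)
              (\<lambda>t x. \<rho> t x * \<psi> (u t x)))"

proof -
  obtain D\<rho> Du L M where E: "euler_flow lam T (\<lambda>t. \<rho> (clip T t)) (\<lambda>t. u (clip T t)) D\<rho> Du L M" and \<rho>M: "\<And>x. \<bar>\<rho> 0 x\<bar> \<le> M"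
  proof (rule classical_solution_euler_flow[OF sol T lam s \<rho>0_pos])
    fix D\<rho> Du L M
    assume 1: "euler_flow lam T (\<lambda>t. \<rho> (clip T t)) (\<lambda>t. u (clip T t)) D\<rho> Du L M" and 2: "\<And>x. \<bar>\<rho> 0 x\<bar> \<le> M"
    show thesis by (rule that[OF 1 2])
  qed
  define r where "r t = \<rho> (clip T t)" for t
  define b where "b t = u (clip T t)" for t
  interpret E: euler_flow lam T r b D\<rho> Du L M using E unfolding r_def b_def .
  have T0: "T \<ge> 0" and z0: "0 \<in> {0..T}" using T by auto
  have ini: "\<rho> 0 x = \<rho>0 x" "u 0 x = u0 x" for x using sol unfolding classical_solution_def by blast+
  have rt: "r t = \<rho> t" "b t = u t" if "t \<in> {0..T}" for t using clip_eq[OF that] by (simp_all add: r_def b_def)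
  have r0: "r 0 = \<rho>0" and b0: "b 0 = u0" using rt[OF z0] ini by (auto simp: fun_eq_iff)
  have bc: "continuous_on UNIV (\<lambda>p. b (fst p) (snd p))" using E.u_cont by (simp add: case_prod_beta')
  have slice: "continuous_on UNIV (\<lambda>x::real^'d. (t, x))" for t :: real by (intro continuous_intros)
  have bsc: "continuous_on UNIV (b t)" and rsc: "continuous_on UNIV (r t)" for t
    using continuous_on_compose2[OF E.u_cont slice subset_UNIV, of t] continuous_on_compose2[OF E.\<rho>_cont slice subset_UNIV, of t] by simp_all
  have bcm: "\<bar>b t x $ i\<bar> \<le> M" for t x i by (rule order_trans[OF component_le_norm_cart E.M])
  have ph: "phase_density (f0 \<epsilon>)" if "\<epsilon> \<in> {0<..1}" for \<epsilon>
    by (rule phase_density.intro[OF f0_nonneg[OF that] f0_L1[OF that] f0_energy[OF that]])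
  have kin: "kinetic lam \<epsilon> (f0 \<epsilon>) (f \<epsilon>)" if "\<epsilon> \<in> {0<..1}" for \<epsilon>
    by (rule kinetic.intro) (use lam that ph[OF that] f_nonneg[OF that] f_weak[OF that] f_init[OF that] f_mass[OF that] f_entropy[OF that] in auto)
  have rel: "relative lam \<epsilon> (f0 \<epsilon>) (f \<epsilon>) T r b D\<rho> Du L M" if "\<epsilon> \<in> {0<..1}" for \<epsilon>
    by (rule relative.intro[OF kin[OF that] E.euler_flow_axioms])
  obtain C1 where C1: "\<And>\<epsilon>. \<epsilon> \<in> {0<..1} \<Longrightarrow> \<bar>LINT x|lborel. (LINT v|lborel. (norm v)\<^sup>2 / 2 * f0 \<epsilon> (x, v)) - \<rho>0 x * (norm (u0 x))\<^sup>2 / 2\<bar> \<le> C1 * sqrt \<epsilon>"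
    using A1 by blast
  obtain C2 where C2: "\<And>\<epsilon>. \<epsilon> \<in> {0<..1} \<Longrightarrow> AE x in lborel. \<bar>mass_density (f0 \<epsilon>) x - \<rho>0 x\<bar> \<le> C2 * sqrt \<epsilon>"
    using A2 by blast
  obtain C3 where C3: "\<And>\<epsilon>. \<epsilon> \<in> {0<..1} \<Longrightarrow> AE x in lborel. norm (mean_velocity (f0 \<epsilon>) x - u0 x) \<le> C3 * sqrt \<epsilon>"
    using A3 by blast
  define c0 where "c0 = max 0 (max C1 (max C2 C3))"
  have c0: "c0 \<ge> 0" "C1 \<le> c0" "C2 \<le> c0" "C3 \<le> c0" by (auto simp: c0_def)
  \<comment> \<open>Measurability and pointwise bounds of the data are read off from the continuous
    solution at time 0.\<close>
  have u0m: "u0 \<in> borel_measurable borel" using borel_measurable_continuous_onI[OF bsc[of 0]] by (simp add: b0)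
  have \<rho>0m: "\<rho>0 \<in> borel_measurable borel" using borel_measurable_continuous_onI[OF rsc[of 0]] by (simp add: r0)
  have u0M: "norm (u0 x) \<le> M" for x using E.M[of 0 x] by (simp add: b0)
  have r2: "integrable lborel (\<lambda>x. (\<rho>0 x)\<^sup>2)"
    using \<rho>0_sobolev by (simp add: sobolev_def is_fourier_transform_def)
  have "integrable lborel (\<lambda>x. \<Sum>i\<in>UNIV. (u0 x $ i)\<^sup>2)"
    using u0_sobolev by (intro Bochner_Integration.integrable_sum) (simp add: sobolev_def is_fourier_transform_def)
  then have b2: "integrable lborel (\<lambda>x. (norm (u0 x))\<^sup>2)"
    by (simp add: norm_vec_def L2_set_def sum_nonneg)
  have rb: "integrable lborel (\<lambda>x. \<rho>0 x * (norm (u0 x))\<^sup>2 / 2)"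
  proof (rule Bochner_Integration.integrable_bound[OF integrable_mult_right[OF b2, of M]])
    show "(\<lambda>x. \<rho>0 x * (norm (u0 x))\<^sup>2 / 2) \<in> borel_measurable lborel" using u0m \<rho>0m by simp
    show "AE x in lborel. norm (\<rho>0 x * (norm (u0 x))\<^sup>2 / 2) \<le> norm (M * (norm (u0 x))\<^sup>2)"
    proof (rule AE_I2)
      fix x
      have "\<rho>0 x * (norm (u0 x))\<^sup>2 \<le> M * (norm (u0 x))\<^sup>2" using \<rho>M[of x] ini(1)[of x] by (intro mult_right_mono) auto
      moreover have "0 \<le> \<rho>0 x * (norm (u0 x))\<^sup>2" using \<rho>0_pos[of x] by simp
      ultimately show "norm (\<rho>0 x * (norm (u0 x))\<^sup>2 / 2) \<le> norm (M * (norm (u0 x))\<^sup>2)" by simp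
    qed
  qed
  define K1 where "K1 = 4 + 2 * (LINT x|lborel. (\<rho>0 x)\<^sup>2) + 8 * (LINT x|lborel. (norm (u0 x))\<^sup>2)"
  have K1: "K1 \<ge> 0" by (simp add: K1_def)
  \<comment> \<open>The initial relative energy is at most \<open>c0 * K1 * sqrt \<epsilon>\<close>;
    the exponential is the Gronwall factor of \<open>H_le\<close>.\<close>
  define KH where "KH = 2 * (c0 * K1) * exp ((2 * (2 * L) + 1) * T)"
  have KH: "KH \<ge> 0" using c0 K1 by (simp add: KH_def)
  define I where "I = (LINT x|lborel. wt (x::real^'d))"
  \<comment> \<open>The bound of \<open>mw_growth\<close>, with
    \<open>sqrt \<epsilon> \<le> 1\<close> used to replace the relative energy by \<open>KH\<close>
    and the initial density error by \<open>c0\<close>.\<close>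
  define Mm where "Mm = 2 * ((M + c0) * I + real CARD('d) * KH * T) * exp ((2 * (real CARD('d) * (M + 1)) + 1) * T)"
  define C where "C = Mm + KH + c0"
  have per: "relative.near (f0 \<epsilon>) (f \<epsilon>) T r b (C * sqrt (sqrt \<epsilon>)) Mm \<and>
      (\<forall>t\<in>{0..T}. integrable lborel (\<lambda>x. mass_density (f \<epsilon> t) x * (norm (mean_velocity (f \<epsilon> t) x - u t x))\<^sup>2) \<and>
        (LINT x|lborel. mass_density (f \<epsilon> t) x * (norm (mean_velocity (f \<epsilon> t) x - u t x))\<^sup>2) \<le> KH * sqrt \<epsilon>)"
    if \<epsilon>: "\<epsilon> \<in> {0<..1}" for \<epsilon>
  proof -
    interpret R: relative lam \<epsilon> "f0 \<epsilon>" "f \<epsilon>" T r b D\<rho> Du L M by (rule rel[OF \<epsilon>])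
    have s: "sqrt \<epsilon> > 0" "sqrt \<epsilon> \<le> 1" using \<epsilon> by auto
    \<comment> \<open>With \<open>H\<close> at most \<open>KH * \<eta>^2\<close> and
      \<open>mw\<close> bounded, this Young parameter balances the two terms of
      \<open>A_le\<close>.\<close>
    define \<eta> where "\<eta> = sqrt (sqrt \<epsilon>)"
    have \<eta>: "\<eta> > 0" "\<eta> \<le> 1" and \<eta>2: "sqrt \<epsilon> = \<eta> * \<eta>" using s \<epsilon> by (auto simp: \<eta>_def)
    define c where "c = c0 * sqrt \<epsilon>"
    have c: "c \<ge> 0" "C1 * sqrt \<epsilon> \<le> c" "C2 * sqrt \<epsilon> \<le> c" "C3 * sqrt \<epsilon> \<le> c" "c \<le> c0"
      using c0 s mult_left_mono[OF s(2) c0(1)] by (auto simp: c_def intro!: mult_right_mono)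
    have mr: "AE x in lborel. \<bar>mass_density (f0 \<epsilon>) x - \<rho>0 x\<bar> \<le> c"
      using C2[OF \<epsilon>] by eventually_elim (use c in linarith)
    have wb: "AE x in lborel. norm (mean_velocity (f0 \<epsilon>) x - u0 x) \<le> c"
      using C3[OF \<epsilon>] by eventually_elim (use c in linarith)
    have A: "(LINT x|lborel. (LINT v|lborel. (norm v)\<^sup>2 / 2 * f0 \<epsilon> (x, v)) - \<rho>0 x * (norm (u0 x))\<^sup>2 / 2) \<le> c"
      using order_trans[OF abs_ge_self C1[OF \<epsilon>]] c(2) by linarith
    have "R.H0 \<le> c * K1"
      using phase_density.initial_relative_energy[OF ph[OF \<epsilon>] u0m u0M r2 b2 rb less_imp_le[OF \<rho>0_pos] c(1) mr wb A]
      by (simp add: R.H0_def b0 K1_def case_prod_beta')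
    then have "2 * R.H0 * exp ((2 * (2 * L) + 1) * T) \<le> 2 * (c * K1) * exp ((2 * (2 * L) + 1) * T)"
      by (intro mult_right_mono mult_left_mono) auto
    also have "\<dots> = KH * sqrt \<epsilon>" by (simp only: KH_def c_def mult_ac)
    finally have k: "2 * R.H0 * exp ((2 * (2 * L) + 1) * T) \<le> KH * sqrt \<epsilon>" .
    have Ht: "R.H t \<le> KH * sqrt \<epsilon>" if "t \<in> {0..T}" for t
      by (rule order_trans[OF R.H_le[OF that] k])
    have HK: "R.H t \<le> KH" if "t \<in> {0..T}" for t
      using Ht[OF that] mult_left_mono[OF s(2) KH] by linarith
    have "R.mw 0 \<le> (M + c) * I"
      using R.mw_initial[of M c] \<rho>M mr ini by (simp add: I_def r0)
    also have "\<dots> \<le> (M + c0) * I"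
      unfolding I_def using c(5) less_imp_le[OF wt_pos] by (intro mult_right_mono Bochner_Integration.integral_nonneg) auto
    finally have mw0: "R.mw 0 \<le> (M + c0) * I" .
    have mw: "R.mw t \<le> Mm" if t: "t \<in> {0..T}" for t
    proof -
      have "2 * (R.mw 0 + real CARD('d) * KH * T) * exp ((2 * (real CARD('d) * (M + 1)) + 1) * T) \<le> Mm"
        unfolding Mm_def using mw0 by (intro mult_right_mono mult_left_mono) auto
      then show ?thesis using R.mw_growth[OF HK t] by linarith
    qed
    have Mm: "Mm \<ge> 0" using mw[OF z0] R.mw_nonneg[of 0] by linarith
    have p: "0 \<le> Mm * \<eta>" "0 \<le> KH * \<eta>" "0 \<le> c0 * \<eta>" using Mm KH c0(1) \<eta>(1) by simp_all
    have Cb: "Mm / 2 * \<eta> + KH / 2 * \<eta> \<le> C * \<eta>" "KH * \<eta> \<le> C * \<eta>" "c0 * \<eta> \<le> C * \<eta>" "C * \<eta> \<ge> 0"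
      using p by (simp_all add: C_def distrib_right)
    have sm: "k * sqrt \<epsilon> \<le> k * \<eta>" if "k \<ge> 0" for k
      unfolding \<eta>2 using mult_left_mono[OF mult_left_le_one_le[of \<eta> \<eta>] that] \<eta> by simp
    have "R.near (C * \<eta>) Mm"
      unfolding R.near_def
    proof (intro conjI ballI)
      show "0 \<le> C * \<eta>" by (rule Cb(4))
      fix t assume t: "t \<in> {0..T}"
      show "R.H t \<le> C * \<eta>" using Ht[OF t] sm[OF KH] Cb(2) by linarith
      show "R.mw t \<le> Mm" by (rule mw[OF t])
      have "R.A t \<le> \<eta> / 2 * R.mw t + 1 / (2 * \<eta>) * R.H t" by (rule R.A_le[OF \<eta>(1)])
      also have "\<dots> \<le> \<eta> / 2 * Mm + 1 / (2 * \<eta>) * (KH * (\<eta> * \<eta>))"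
        using mw[OF t] Ht[OF t, unfolded \<eta>2] \<eta> by (intro add_mono mult_left_mono) auto
      also have "\<dots> = Mm / 2 * \<eta> + KH / 2 * \<eta>" using \<eta> by simp
      finally show "R.A t \<le> C * \<eta>" using Cb(1) by linarith
    next
      show "AE x in lborel. \<bar>mass_density (f0 \<epsilon>) x - r 0 x\<bar> \<le> C * \<eta>"
        using mr
      proof eventually_elim
        case (elim x)
        then show ?case using sm[OF c0(1)] Cb(3) by (simp add: r0 c_def)
      qed
    qed
    moreover have "integrable lborel (\<lambda>x. mass_density (f \<epsilon> t) x * (norm (mean_velocity (f \<epsilon> t) x - u t x))\<^sup>2) \<and>
        (LINT x|lborel. mass_density (f \<epsilon> t) x * (norm (mean_velocity (f \<epsilon> t) x - u t x))\<^sup>2) \<le> KH * sqrt \<epsilon>"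
      if t: "t \<in> {0..T}" for t
    proof -
      have F: "R.F t = f \<epsilon> t" using R.F_eq t by simp
      have bm: "u t \<in> borel_measurable borel" using borel_measurable_continuous_onI[OF bsc[of t]] rt[OF t] by simp
      have i: "integrable lborel (\<lambda>(x, v). f \<epsilon> t (x, v) * (norm (v - u t x))\<^sup>2)"
        using R.integrable_F_sq[of t] by (simp add: R.sq_def F rt[OF t] case_prod_beta')
      have p: "phase_density (f \<epsilon> t)" using R.phase_F[of t] by (simp add: F)
      have "(LINT (x, v)|lborel. f \<epsilon> t (x, v) * (norm (v - u t x))\<^sup>2) = R.H t"
        by (simp add: R.H_def R.sq_def F rt[OF t] case_prod_beta')
      then show ?thesis
        using phase_density.integrable_jensen[OF p bm i] phase_density.integral_jensen[OF p bm i] Ht[OF t] by linarith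
    qed
    ultimately show ?thesis unfolding \<eta>_def by blast
  qed
  note near = per[THEN conjunct1]
  have Fe: "kinetic.F (f \<epsilon>) t = f \<epsilon> t" if "\<epsilon> \<in> {0<..1}" "t \<in> {0..T}" for \<epsilon> t
    using kinetic.F_eq[OF kin[OF that(1)], of t] that(2) by simp
  have Ue: "kinetic.U (f \<epsilon>) t = mean_velocity (f \<epsilon> t)" if "\<epsilon> \<in> {0<..1}" "t \<in> {0..T}" for \<epsilon> t
    using kinetic.U_def[OF kin[OF that(1)], of t] Fe[OF that] by simp
  note mm = relative.mass_joint_measurable[OF rel] and Um = relative.component_measurable[OF rel]
  have M0: "M \<ge> 0" by (rule E.M0)
  have "weakly_converges T (\<lambda>\<epsilon> t x. mass_density (f \<epsilon> t) x) \<rho>"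
  \<comment> \<open>For the density, \<open>X\<close> is exactly mass times 1, so the deviation
    constant is 0.\<close>
  proof (rule relative_weak_limit[where X = "\<lambda>\<epsilon> t x. mass_density (kinetic.F (f \<epsilon>) t) x" and g = "\<lambda>_ _. 1" and \<Gamma> = 0 and Kg = 1, OF rel near mm])
  qed (auto simp: Fe rt)
  moreover have "weakly_converges T (\<lambda>\<epsilon> t x. mass_density (f \<epsilon> t) x * mean_velocity (f \<epsilon> t) x $ i) (\<lambda>t x. \<rho> t x * u t x $ i)" for i
  proof (rule relative_weak_limit[where X = "\<lambda>\<epsilon> t x. mass_density (kinetic.F (f \<epsilon>) t) x * kinetic.U (f \<epsilon>) t x $ i"
        and g = "\<lambda>t x. b t x $ i" and \<Gamma> = 1 and Kg = M, OF rel near borel_measurable_times[OF mm Um] relative.momentum_close[OF rel]])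
    show "continuous_on UNIV (\<lambda>p. b (fst p) (snd p) $ i)" by (rule continuous_on_component[OF bc])
  qed (auto simp: Fe Ue rt bcm)
  moreover have "weakly_converges T (\<lambda>\<epsilon> t x. mass_density (f \<epsilon> t) x * (mean_velocity (f \<epsilon> t) x $ i * mean_velocity (f \<epsilon> t) x $ j))
      (\<lambda>t x. \<rho> t x * (u t x $ i * u t x $ j))" for i j
  proof (rule relative_weak_limit[where X = "\<lambda>\<epsilon> t x. mass_density (kinetic.F (f \<epsilon>) t) x * (kinetic.U (f \<epsilon>) t x $ i * kinetic.U (f \<epsilon>) t x $ j)"
        and g = "\<lambda>t x. b t x $ i * b t x $ j" and \<Gamma> = "1 + 2 * M" and Kg = "M * M",
        OF rel near borel_measurable_times[OF mm borel_measurable_times[OF Um Um]] relative.flux_close[OF rel]])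
    show "continuous_on UNIV (\<lambda>p. b (fst p) (snd p) $ i * b (fst p) (snd p) $ j)"
      by (intro continuous_on_mult continuous_on_component[OF bc])
    show "\<bar>b t x $ i * b t x $ j\<bar> \<le> M * M" for t x unfolding abs_mult by (intro mult_mono bcm) (use M0 in auto)
  qed (use M0 in \<open>auto simp: Fe Ue rt\<close>)
  moreover have "weakly_converges T (\<lambda>\<epsilon> t x. LINT v|lborel. f \<epsilon> t (x, v) * (norm v)\<^sup>2) (\<lambda>t x. \<rho> t x * (norm (u t x))\<^sup>2)"
  proof -
    have hm: "(\<lambda>v::real^'d. (norm v)\<^sup>2) \<in> borel_measurable borel" by measurable
    have hb: "\<bar>(norm v)\<^sup>2\<bar> \<le> 1 * (1 + (norm v)\<^sup>2)" for v :: "real^'d" by simp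
    show ?thesis
    proof (rule relative_weak_limit[where X = "\<lambda>\<epsilon> t x. LINT v|lborel. kinetic.F (f \<epsilon>) t (x, v) * (norm v)\<^sup>2"
          and g = "\<lambda>t x. (norm (b t x))\<^sup>2" and \<Gamma> = "1 + 2 * M" and Kg = "M\<^sup>2",
          OF rel near relative.velocity_moment_measurable[OF rel hm]
            relative.velocity_moment_close[OF rel hm hb relative.square_lipschitz[OF rel]]])
      show "continuous_on UNIV (\<lambda>p. (norm (b (fst p) (snd p)))\<^sup>2)" by (intro continuous_intros bc)
      show "\<bar>(norm (b t x))\<^sup>2\<bar> \<le> M\<^sup>2" for t x using E.M[of t x] by (simp add: power_mono)
    qed (use M0 in \<open>auto simp: Fe rt\<close>)
  qed
  moreover have "weakly_converges T (\<lambda>\<epsilon> t x. LINT v|lborel. f \<epsilon> t (x, v) * \<psi> v) (\<lambda>t x. \<rho> t x * \<psi> (u t x))"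
    if \<psi>: "C1_on UNIV \<psi> \<and> (\<exists>K. \<forall>y. onorm (frechet_derivative \<psi> (at y)) \<le> K)" for \<psi> :: "real^'d \<Rightarrow> real"
  proof -
    obtain K where K: "\<And>y. onorm (frechet_derivative \<psi> (at y)) \<le> K" using \<psi> by blast
    have D: "(\<psi> has_derivative frechet_derivative \<psi> (at y)) (at y)" for y
    proof -
      obtain f' :: "real^'d \<Rightarrow> (real^'d) \<Rightarrow>\<^sub>L real" where "\<And>p. (\<psi> has_derivative blinfun_apply (f' p)) (at p)"
        using \<psi> unfolding C1_on_def by auto
      then have "\<psi> differentiable (at y)" unfolding differentiable_def by blast
      then show ?thesis by (simp add: frechet_derivative_works)
    qed
    have K0: "K \<ge> 0" using order_trans[OF onorm_pos_le[OF has_derivative_bounded_linear[OF D]] K] .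
    have lip: "\<bar>\<psi> v - \<psi> w\<bar> \<le> K * norm (v - w)" for v w
      using differentiable_bound[of UNIV \<psi> "\<lambda>y. frechet_derivative \<psi> (at y)" K v w] D K by simp
    have c\<psi>: "continuous_on UNIV \<psi>" by (rule has_derivative_continuous_on[OF has_derivative_at_withinI[OF D]])
    have hm: "\<psi> \<in> borel_measurable borel" by (rule borel_measurable_continuous_onI[OF c\<psi>])
    \<comment> \<open>Bounded gradient gives linear growth, in particular the quadratic bound under
      which velocity moments are integrable.\<close>
    have hb: "\<bar>\<psi> v\<bar> \<le> (\<bar>\<psi> 0\<bar> + K) * (1 + (norm v)\<^sup>2)" for v
    proof -
      have "norm v \<le> 1 + (norm v)\<^sup>2" using sum_squares_bound[of "norm v" 1] norm_ge_zero[of v] by (simp, linarith)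
      then have "K * norm v \<le> K * (1 + (norm v)\<^sup>2)" using K0 by (rule mult_left_mono)
      moreover have "\<bar>\<psi> 0\<bar> \<le> \<bar>\<psi> 0\<bar> * (1 + (norm v)\<^sup>2)" using mult_left_mono[of 1 "1 + (norm v)\<^sup>2" "\<bar>\<psi> 0\<bar>"] by simp
      ultimately show ?thesis using lip[of v 0] by (simp add: distrib_right)
    qed
    have hl: "\<bar>\<psi> v - \<psi> w\<bar> \<le> K * (norm (v - w) + (norm (v - w))\<^sup>2)" if "norm w \<le> M" for v w
    proof (rule order_trans[OF lip])
      show "K * norm (v - w) \<le> K * (norm (v - w) + (norm (v - w))\<^sup>2)" using K0 by (intro mult_left_mono) auto
    qed
    \<comment> \<open>\<open>\<psi>\<close> itself may be unbounded; the limit involves its values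
      on the range of \<open>u\<close> only.\<close>
    have "bounded (\<psi> ` cball 0 M)"
      by (intro compact_imp_bounded compact_continuous_image continuous_on_subset[OF c\<psi>]) auto
    then obtain Kg where "\<forall>w\<in>cball 0 M. \<bar>\<psi> w\<bar> \<le> Kg" unfolding bounded_iff by auto
    then have Kg: "\<bar>\<psi> w\<bar> \<le> Kg" if "norm w \<le> M" for w using that by simp
    show ?thesis
    proof (rule relative_weak_limit[where X = "\<lambda>\<epsilon> t x. LINT v|lborel. kinetic.F (f \<epsilon>) t (x, v) * \<psi> v"
          and g = "\<lambda>t x. \<psi> (b t x)" and \<Gamma> = K and Kg = Kg,
          OF rel near relative.velocity_moment_measurable[OF rel hm] relative.velocity_moment_close[OF rel hm hb hl]])
      show "continuous_on UNIV (\<lambda>p. \<psi> (b (fst p) (snd p)))" by (rule continuous_on_compose2[OF c\<psi> bc subset_UNIV])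
      show "\<bar>\<psi> (b t x)\<bar> \<le> Kg" for t x by (rule Kg[OF E.M])
    qed (use K0 in \<open>auto simp: Fe rt\<close>)
  qed
  moreover have "\<exists>C. \<forall>\<epsilon>\<in>{0<..1}. \<forall>t\<in>{0..T}.
           integrable lborel (\<lambda>x. mass_density (f \<epsilon> t) x * (norm (mean_velocity (f \<epsilon> t) x - u t x))\<^sup>2) \<and>
           (LINT x|lborel. mass_density (f \<epsilon> t) x * (norm (mean_velocity (f \<epsilon> t) x - u t x))\<^sup>2) \<le> C * sqrt \<epsilon>"
    using per by blast
  ultimately show ?thesis by blast
qed

end
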